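(* Let $p$ be a prime number, let $G=\mathbb{Z}/p\mathbb{Z}$, viewed as an object (concentrated in degree $0$) of the derived category $D(\mathrm{Ab})$ of abelian groups, and let $\underline{C}\subset D(\mathrm{Ab})$ be the full triangulated subcategory compactly generated by $\{G\}$, i.e. the full subcategory with object class $[\{G[i]: i\in\mathbb{Z}\}]^{\mathrm{cl}}$. Then $\{G\}$ is a weakly negative set (i.e. $\underline{C}(G,G[i])=\{0\}$ for all $i>1$) that compactly generates $\underline{C}$ (so $\underline{C}$ is weakly approximable in the sense of Neeman), but $\underline{C}$ is not approximable in the sense of Neeman.
   Context: All coproducts are small. $\underline{C}(X,Y)$ denotes the group of morphisms from $X$ to $Y$. An object $M$ of a triangulated category $\underline{C}$ with small coproducts is compact if $\underline{C}(M,-):\underline{C}\to\mathrm{Ab}$ respects coproducts. A class of objects is extension-closed if it contains $0$ and, for each distinguished triangle $X\to Z\to Y\to X[1]$ with $X,Y$ in the class, $Z$ is in the class. For a class $\mathcal{P}$ of objects, $[\mathcal{P}]^{\mathrm{cl}}$ is the smallest class of objects of the ambient triangulated category that contains $\mathcal{P}$, is extension-closed, and is closed with respect to small coproducts. A class $\mathcal{P}$ compactly generates $\underline{C}$ if all elements of $\mathcal{P}$ are compact and $[\bigcup_{i\in\mathbb{Z}}\mathcal{P}[i]]^{\mathrm{cl}}=\operatorname{Obj}\underline{C}$. For classes $\mathcal{X},\mathcal{Y}$ of objects, $\mathcal{X}\star\mathcal{Y}$ is the class of all $Z$ fitting into a distinguished triangle $X\to Z\to Y\to X[1]$ with $X\in\mathcal{X}$,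 $Y\in\mathcal{Y}$; this operation is associative. $t$-structures are in the cohomological convention: a $t$-structure $t$ is a pair $(\underline{C}^{t\ge 0},\underline{C}^{t\le 0})$ of classes of objects closed under isomorphisms with $\underline{C}^{t\ge 0}\subset\underline{C}^{t\ge 0}[1]$, $\underline{C}^{t\le 0}[1]\subset \underline{C}^{t\le 0}$, no non-zero morphisms from $\underline{C}^{t\le 0}[1]$ to $\underline{C}^{t\ge 0}$, and such that each object $M$ fits into a distinguished triangle $L\to M\to R\to L[1]$ with $L\in\underline{C}^{t\le 0}$ and $R\in\underline{C}^{t\ge 0}[-1]$. Put $\underline{C}^{t\le i}=\underline{C}^{t\le 0}[-i]$. For an object $H$ and an integer $m\ge 0$, let $H[-m,m]$ be the class of all small coproducts of (copies of) objects $H[s]$ with $-m\le s\le m$. For $k\geq 1$ let $\overline{\langle H\rangle}^{[-m,m]}_{k}$ be the class of all retracts (direct summands) in $\underline{C}$ of elements of the $k$-th $\star$-power of $H[-m,m]$, and let $\overline{\langle H\rangle}^{[-m,m]}$ be the class of all retracts of elements of $[\{H[s]:-m\le s\le m\}]^{\mathrm{cl}}$. Definition (Neeman). A triangulated category $\underline{C}$ with small coproducts is weakly approximable if there exist an object $H$ such that $\{H\}$ compactly generates $\underline{C}$, a $t$-structure $t$ on $\underline{C}$, and an integer $m>0$ such that: (i) $H[m]\in\underline{C}^{t\le 0}$ and $\underline{C}(H[-m],X)=\{0\}$ for all $X\in\underline{C}^{t\le 0}$; (ii) for every $F\in\underline{C}^{t\le 0}$ there exists a distinguished triangle $E\to F\to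 D\to E[1]$ with $D\in\underline{C}^{t\le -1}$ and $E\in\overline{\langle H\rangle}^{[-m,m]}$. It is approximable if $H$, $t$, $m$ can be chosen so that (i) holds and in (ii) one can always take $E\in\overline{\langle H\rangle}^{[-m,m]}_{m}$. *)

theory Defs
  imports
    "HOL-Computational_Algebra.Primes"
    "HOL-Algebra.Elementary_Groups"
    "HOL-Algebra.Product_Groups"
    "HOL-Algebra.FiniteProduct"
begin

unbundle cardinal_syntax

section \<open>Small sets\<close>

text \<open>The type \<open>'u\<close> plays the role of the universe: a set is small if it has fewer elements than
  \<open>'u\<close>. If the cardinality of \<open>'u\<close> is strongly inaccessible, these are (up to bijection) the
  elements of a Grothendieck universe. Every family indexed by a small set can be reindexed by a
  small subset of \<open>'u\<close>, so index sets are taken in \<open>'u set\<close>.\<close>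

definition small :: "'u set \<Rightarrow> bool" where
  "small A \<longleftrightarrow> |A| <o |UNIV :: 'u set|"

section \<open>Categories with a shift and distinguished triangles\<close>

text \<open>Groups of morphisms are records of HOL-Algebra, hence written multiplicatively: the zero
  morphism from \<open>X\<close> to \<open>Y\<close> is \<open>\<one>\<^bsub>Hom C X Y\<^esub>\<close>. The composite of \<open>f : X \<rightarrow> Y\<close> and \<open>g : Y \<rightarrow> Z\<close> is
  \<open>Comp C X Y Z g f\<close>.\<close>

record ('o, 'm) preadditive_category =
  Obj :: "'o set"
  Hom :: "'o \<Rightarrow> 'o \<Rightarrow> 'm monoid"
  Comp :: "'o \<Rightarrow> 'o \<Rightarrow> 'o \<Rightarrow> 'm \<Rightarrow> 'm \<Rightarrow> 'm"
  Ident :: "'o \<Rightarrow> 'm"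

text \<open>\<open>Shift C i X\<close> is \<open>X[i]\<close>, and \<open>(X, Y, Z, f, g, h) \<in> Dist C\<close> says that \<open>X \<rightarrow> Y \<rightarrow> Z \<rightarrow> X[1]\<close> with
  the maps \<open>f\<close>, \<open>g\<close>, \<open>h\<close> is a distinguished triangle. The record holds the data of a triangulated
  category only; the effect of the shift on morphisms enters solely through \<open>Dist C\<close>.\<close>

record ('o, 'm) triangulated_category = "('o, 'm) preadditive_category" +
  Shift :: "int \<Rightarrow> 'o \<Rightarrow> 'o"
  Dist :: "('o \<times> 'o \<times> 'o \<times> 'm \<times> 'm \<times> 'm) set"

definition zero_hom :: "('o, 'm, 'z) preadditive_category_scheme \<Rightarrow> 'o \<Rightarrow> 'o \<Rightarrow> bool" where
  "zero_hom C X Y \<longleftrightarrow> carrier (Hom C X Y) = {\<one>\<^bsub>Hom C X Y\<^esub>}"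

definition zero_object :: "('o, 'm, 'z) preadditive_category_scheme \<Rightarrow> 'o \<Rightarrow> bool" where
  "zero_object C X \<longleftrightarrow> X \<in> Obj C \<and> (\<forall>Y\<in>Obj C. zero_hom C X Y \<and> zero_hom C Y X)"

definition isomorphism :: "('o, 'm, 'z) preadditive_category_scheme \<Rightarrow> 'o \<Rightarrow> 'o \<Rightarrow> 'm \<Rightarrow> bool" where
  "isomorphism C X Y f \<longleftrightarrow> f \<in> carrier (Hom C X Y) \<and>
     (\<exists>g\<in>carrier (Hom C Y X). Comp C X Y X g f = Ident C X \<and> Comp C Y X Y f g = Ident C Y)"

definition isomorphic :: "('o, 'm, 'z) preadditive_category_scheme \<Rightarrow> 'o \<Rightarrow> 'o \<Rightarrow> bool" where
  "isomorphic C X Y \<longleftrightarrow> (\<exists>f. isomorphism C X Y f)"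

definition iso_closed :: "('o, 'm, 'z) preadditive_category_scheme \<Rightarrow> 'o set \<Rightarrow> bool" where
  "iso_closed C P \<longleftrightarrow> (\<forall>X\<in>P. \<forall>Y\<in>Obj C. isomorphic C X Y \<longrightarrow> Y \<in> P)"

definition is_coproduct ::
  "('o, 'm, 'z) preadditive_category_scheme \<Rightarrow> 'i set \<Rightarrow> ('i \<Rightarrow> 'o) \<Rightarrow> 'o \<Rightarrow> ('i \<Rightarrow> 'm) \<Rightarrow> bool" where
  "is_coproduct C I X Z \<iota> \<longleftrightarrow>
     (\<forall>i\<in>I. X i \<in> Obj C) \<and> Z \<in> Obj C \<and> (\<forall>i\<in>I. \<iota> i \<in> carrier (Hom C (X i) Z)) \<and>
     (\<forall>Y\<in>Obj C. \<forall>g. (\<forall>i\<in>I. g i \<in> carrier (Hom C (X i) Y)) \<longrightarrow>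
        (\<exists>!h. h \<in> carrier (Hom C Z Y) \<and> (\<forall>i\<in>I. Comp C (X i) Z Y h (\<iota> i) = g i)))"

definition retracts :: "('o, 'm, 'z) preadditive_category_scheme \<Rightarrow> 'o set \<Rightarrow> 'o set" where
  "retracts C P = {X \<in> Obj C. \<exists>Y\<in>P. \<exists>i\<in>carrier (Hom C X Y). \<exists>r\<in>carrier (Hom C Y X).
     Comp C X Y X r i = Ident C X}"

text \<open>The canonical map from the direct sum of the groups \<open>Hom C M (X i)\<close> to \<open>Hom C M Z\<close> has to be an
  isomorphism for all coproducts \<open>Z\<close> of small families \<open>X\<close>.\<close>

definition compact_object ::
  "'u itself \<Rightarrow> ('o, 'm, 'z) preadditive_category_scheme \<Rightarrow> 'o \<Rightarrow> bool" where
  "compact_object U C M \<longleftrightarrow> M \<in> Obj C \<and>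
     (\<forall>(I :: 'u set) X Z \<iota>. small I \<and> is_coproduct C I X Z \<iota> \<longrightarrow>
        (\<lambda>x. finprod (Hom C M Z) (\<lambda>i. Comp C M (X i) Z (\<iota> i) (x i))
               {i \<in> I. x i \<noteq> \<one>\<^bsub>Hom C M (X i)\<^esub>})
        \<in> iso (sum_group I (\<lambda>i. Hom C M (X i))) (Hom C M Z))"

text \<open>\<open>P[i]\<close>, closed under isomorphisms: with this reading \<open>P[i][j] = P[i + j]\<close> holds for \<open>P\<close> closed
  under isomorphisms even if \<open>X[i][j]\<close> is only isomorphic to \<open>X[i + j]\<close>.\<close>

definition shift_class ::
  "('o, 'm, 'z) triangulated_category_scheme \<Rightarrow> 'o set \<Rightarrow> int \<Rightarrow> 'o set" where
  "shift_class C P i = {Y \<in> Obj C. \<exists>X\<in>P. isomorphic C (Shift C i X) Y}"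

definition extension_closed ::
  "('o, 'm, 'z) triangulated_category_scheme \<Rightarrow> 'o set \<Rightarrow> bool" where
  "extension_closed C P \<longleftrightarrow> (\<forall>X. zero_object C X \<longrightarrow> X \<in> P) \<and>
     (\<forall>X Z Y f g h. (X, Z, Y, f, g, h) \<in> Dist C \<and> X \<in> P \<and> Y \<in> P \<longrightarrow> Z \<in> P)"

definition coproduct_closed ::
  "'u itself \<Rightarrow> ('o, 'm, 'z) preadditive_category_scheme \<Rightarrow> 'o set \<Rightarrow> bool" where
  "coproduct_closed U C P \<longleftrightarrow>
     (\<forall>(I :: 'u set) X Z \<iota>. small I \<and> is_coproduct C I X Z \<iota> \<and> (\<forall>i\<in>I. X i \<in> P) \<longrightarrow> Z \<in> P)"

definition closure_cl ::
  "'u itself \<Rightarrow> ('o, 'm, 'z) triangulated_category_scheme \<Rightarrow> 'o set \<Rightarrow> 'o set" where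
  "closure_cl U C P =
     \<Inter> {Q. Q \<subseteq> Obj C \<and> P \<subseteq> Q \<and> extension_closed C Q \<and> coproduct_closed U C Q}"

definition compactly_generates ::
  "'u itself \<Rightarrow> ('o, 'm, 'z) triangulated_category_scheme \<Rightarrow> 'o set \<Rightarrow> bool" where
  "compactly_generates U C P \<longleftrightarrow> (\<forall>M\<in>P. compact_object U C M) \<and>
     closure_cl U C (\<Union>i. shift_class C P i) = Obj C"

definition weakly_negative ::
  "('o, 'm, 'z) triangulated_category_scheme \<Rightarrow> 'o set \<Rightarrow> bool" where
  "weakly_negative C P \<longleftrightarrow> (\<forall>X\<in>P. \<forall>Y\<in>P. \<forall>i>1. zero_hom C X (Shift C i Y))"

definition full_subcategory ::
  "('o, 'm) triangulated_category \<Rightarrow> 'o set \<Rightarrow> ('o, 'm) triangulated_category" where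
  "full_subcategory C P = C\<lparr>Obj := P,
     Dist := {(X, Y, Z, f, g, h). (X, Y, Z, f, g, h) \<in> Dist C \<and> X \<in> P \<and> Y \<in> P \<and> Z \<in> P}\<rparr>"

definition generated_subcategory ::
  "'u itself \<Rightarrow> ('o, 'm) triangulated_category \<Rightarrow> 'o set \<Rightarrow> ('o, 'm) triangulated_category" where
  "generated_subcategory U C P = full_subcategory C (closure_cl U C (\<Union>i. shift_class C P i))"

section \<open>t-structures and approximability\<close>

definition star ::
  "('o, 'm, 'z) triangulated_category_scheme \<Rightarrow> 'o set \<Rightarrow> 'o set \<Rightarrow> 'o set" where
  "star C P Q = {Z. \<exists>X\<in>P. \<exists>Y\<in>Q. \<exists>f g h. (X, Z, Y, f, g, h) \<in> Dist C}"

text \<open>The \<open>k\<close>-th power of \<open>P\<close> with respect to \<^const>\<open>star\<close>, only meant for \<open>k \<ge> 1\<close>.\<close>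

definition star_power ::
  "('o, 'm, 'z) triangulated_category_scheme \<Rightarrow> 'o set \<Rightarrow> nat \<Rightarrow> 'o set" where
  "star_power C P k = (star C P ^^ (k - 1)) P"

definition t_structure ::
  "('o, 'm, 'z) triangulated_category_scheme \<Rightarrow> 'o set \<Rightarrow> 'o set \<Rightarrow> bool" where
  "t_structure C Cge Cle \<longleftrightarrow>
     Cge \<subseteq> Obj C \<and> Cle \<subseteq> Obj C \<and> iso_closed C Cge \<and> iso_closed C Cle \<and>
     Cge \<subseteq> shift_class C Cge 1 \<and> shift_class C Cle 1 \<subseteq> Cle \<and>
     (\<forall>X\<in>shift_class C Cle 1. \<forall>Y\<in>Cge. zero_hom C X Y) \<and>
     (\<forall>M\<in>Obj C. \<exists>L\<in>Cle. \<exists>R\<in>shift_class C Cge (- 1). \<exists>f g h. (L, M, R, f, g, h) \<in> Dist C)"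

definition t_le ::
  "('o, 'm, 'z) triangulated_category_scheme \<Rightarrow> 'o set \<Rightarrow> int \<Rightarrow> 'o set" where
  "t_le C Cle i = shift_class C Cle (- i)"

text \<open>\<open>H[-m,m]\<close>\<close>

definition coproducts_of_shifts ::
  "'u itself \<Rightarrow> ('o, 'm, 'z) triangulated_category_scheme \<Rightarrow> 'o \<Rightarrow> nat \<Rightarrow> 'o set" where
  "coproducts_of_shifts U C H m =
     {Z. \<exists>(I :: 'u set) X \<iota>. small I \<and> is_coproduct C I X Z \<iota> \<and>
           (\<forall>i\<in>I. \<exists>s. - int m \<le> s \<and> s \<le> int m \<and> X i = Shift C s H)}"

text \<open>The class of retracts of elements of the \<open>k\<close>-th star power of \<open>H[-m,m]\<close>.\<close>

definition bounded_gen ::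
  "'u itself \<Rightarrow> ('o, 'm, 'z) triangulated_category_scheme \<Rightarrow> 'o \<Rightarrow> nat \<Rightarrow> nat \<Rightarrow> 'o set" where
  "bounded_gen U C H m k = retracts C (star_power C (coproducts_of_shifts U C H m) k)"

definition unbounded_gen ::
  "'u itself \<Rightarrow> ('o, 'm, 'z) triangulated_category_scheme \<Rightarrow> 'o \<Rightarrow> nat \<Rightarrow> 'o set" where
  "unbounded_gen U C H m =
     retracts C (closure_cl U C {Shift C s H | s. - int m \<le> s \<and> s \<le> int m})"

text \<open>Conditions (i) and (ii) of Neeman's definition; \<open>\<E>\<close> is the class the objects \<open>E\<close> are taken
  from.\<close>

definition approximation_conditions ::
  "('o, 'm, 'z) triangulated_category_scheme \<Rightarrow> 'o \<Rightarrow> 'o set \<Rightarrow> nat \<Rightarrow> 'o set \<Rightarrow> bool" where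
  "approximation_conditions C H Cle m \<E> \<longleftrightarrow>
     Shift C (int m) H \<in> Cle \<and> (\<forall>X\<in>Cle. zero_hom C (Shift C (- int m) H) X) \<and>
     (\<forall>F\<in>Cle. \<exists>E\<in>\<E>. \<exists>D\<in>t_le C Cle (- 1). \<exists>f g h. (E, F, D, f, g, h) \<in> Dist C)"

definition weakly_approximable ::
  "'u itself \<Rightarrow> ('o, 'm, 'z) triangulated_category_scheme \<Rightarrow> bool" where
  "weakly_approximable U C \<longleftrightarrow>
     (\<exists>H\<in>Obj C. \<exists>Cge Cle. \<exists>m>0. compactly_generates U C {H} \<and> t_structure C Cge Cle \<and>
        approximation_conditions C H Cle m (unbounded_gen U C H m))"

definition approximable ::
  "'u itself \<Rightarrow> ('o, 'm, 'z) triangulated_category_scheme \<Rightarrow> bool" where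
  "approximable U C \<longleftrightarrow>
     (\<exists>H\<in>Obj C. \<exists>Cge Cle. \<exists>m>0. compactly_generates U C {H} \<and> t_structure C Cge Cle \<and>
        approximation_conditions C H Cle m (bounded_gen U C H m m))"

section \<open>Complexes of abelian groups\<close>

text \<open>Cohomological grading; \<open>cdiff X n\<close> goes from degree \<open>n\<close> to degree \<open>n + 1\<close>. Abelian groups are
  written multiplicatively. Values of maps outside the carriers are irrelevant.\<close>

record 'a cochain_complex =
  cgrp :: "int \<Rightarrow> 'a monoid"
  cdiff :: "int \<Rightarrow> 'a \<Rightarrow> 'a"

type_synonym ('a, 'b) graded_map = "int \<Rightarrow> 'a \<Rightarrow> 'b"

definition is_complex :: "'a cochain_complex \<Rightarrow> bool" where
  "is_complex X \<longleftrightarrow> (\<forall>n. comm_group (cgrp X n) \<and> cdiff X n \<in> hom (cgrp X n) (cgrp X (n + 1)) \<and>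
     (\<forall>x\<in>carrier (cgrp X n). cdiff X (n + 1) (cdiff X n x) = \<one>\<^bsub>cgrp X (n + 2)\<^esub>))"

definition small_complexes :: "'u cochain_complex set" where
  "small_complexes = {X. is_complex X \<and> (\<forall>n. small (carrier (cgrp X n)))}"

definition chain_map ::
  "'a cochain_complex \<Rightarrow> 'b cochain_complex \<Rightarrow> ('a, 'b) graded_map \<Rightarrow> bool" where
  "chain_map X Y f \<longleftrightarrow> (\<forall>n. f n \<in> hom (cgrp X n) (cgrp Y n) \<and>
     (\<forall>x\<in>carrier (cgrp X n). f (n + 1) (cdiff X n x) = cdiff Y n (f n x)))"

definition comp_map :: "('b, 'c) graded_map \<Rightarrow> ('a, 'b) graded_map \<Rightarrow> ('a, 'c) graded_map" where
  "comp_map g f = (\<lambda>n. g n \<circ> f n)"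

definition id_map :: "('a, 'a) graded_map" where
  "id_map = (\<lambda>n x. x)"

definition zero_map :: "'b cochain_complex \<Rightarrow> ('a, 'b) graded_map" where
  "zero_map Y = (\<lambda>n x. \<one>\<^bsub>cgrp Y n\<^esub>)"

definition add_map ::
  "'b cochain_complex \<Rightarrow> ('a, 'b) graded_map \<Rightarrow> ('a, 'b) graded_map \<Rightarrow> ('a, 'b) graded_map" where
  "add_map Y f g = (\<lambda>n x. f n x \<otimes>\<^bsub>cgrp Y n\<^esub> g n x)"

definition homotopic ::
  "'a cochain_complex \<Rightarrow> 'b cochain_complex \<Rightarrow> ('a, 'b) graded_map \<Rightarrow> ('a, 'b) graded_map \<Rightarrow> bool"
  where
  "homotopic X Y f g \<longleftrightarrow> (\<exists>h. (\<forall>n. h n \<in> hom (cgrp X n) (cgrp Y (n - 1))) \<and>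
     (\<forall>n. \<forall>x\<in>carrier (cgrp X n).
        f n x = g n x \<otimes>\<^bsub>cgrp Y n\<^esub> (cdiff Y (n - 1) (h n x) \<otimes>\<^bsub>cgrp Y n\<^esub> h (n + 1) (cdiff X n x))))"

definition cocycles :: "'a cochain_complex \<Rightarrow> int \<Rightarrow> 'a set" where
  "cocycles X n = kernel (cgrp X n) (cgrp X (n + 1)) (cdiff X n)"

definition coboundaries :: "'a cochain_complex \<Rightarrow> int \<Rightarrow> 'a set" where
  "coboundaries X n = cdiff X (n - 1) ` carrier (cgrp X (n - 1))"

definition cohomology :: "'a cochain_complex \<Rightarrow> int \<Rightarrow> 'a set monoid" where
  "cohomology X n = (cgrp X n\<lparr>carrier := cocycles X n\<rparr>) Mod coboundaries X n"

text \<open>The coset of a cocycle \<open>x\<close> is mapped to the coset of \<open>f n x\<close>.\<close>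

definition cohomology_map ::
  "'b cochain_complex \<Rightarrow> ('a, 'b) graded_map \<Rightarrow> int \<Rightarrow> 'a set \<Rightarrow> 'b set" where
  "cohomology_map Y f n S = coboundaries Y n <#>\<^bsub>cgrp Y n\<^esub> (f n ` S)"

definition quasi_iso ::
  "'a cochain_complex \<Rightarrow> 'b cochain_complex \<Rightarrow> ('a, 'b) graded_map \<Rightarrow> bool" where
  "quasi_iso X Y f \<longleftrightarrow> chain_map X Y f \<and>
     (\<forall>n. cohomology_map Y f n \<in> iso (cohomology X n) (cohomology Y n))"

text \<open>\<open>X[k]\<close> has the differential of \<open>X\<close> multiplied by \<open>(-1)^k\<close>.\<close>

definition shift_complex :: "int \<Rightarrow> 'a cochain_complex \<Rightarrow> 'a cochain_complex" where
  "shift_complex k X = \<lparr>cgrp = (\<lambda>n. cgrp X (n + k)),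
     cdiff = (\<lambda>n x. if even k then cdiff X (n + k) x
                    else inv\<^bsub>cgrp X (n + k + 1)\<^esub> (cdiff X (n + k) x))\<rparr>"

definition shift_map :: "int \<Rightarrow> ('a, 'b) graded_map \<Rightarrow> ('a, 'b) graded_map" where
  "shift_map k f = (\<lambda>n. f (n + k))"

definition cone ::
  "'a cochain_complex \<Rightarrow> 'b cochain_complex \<Rightarrow> ('a, 'b) graded_map \<Rightarrow> ('a \<times> 'b) cochain_complex" where
  "cone X Y f = \<lparr>cgrp = (\<lambda>n. cgrp X (n + 1) \<times>\<times> cgrp Y n),
     cdiff = (\<lambda>n (x, y). (inv\<^bsub>cgrp X (n + 2)\<^esub> (cdiff X (n + 1) x),
                          f (n + 1) x \<otimes>\<^bsub>cgrp Y (n + 1)\<^esub> cdiff Y n y))\<rparr>"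

section \<open>The derived category of abelian groups\<close>

text \<open>The localization of the homotopy category at the quasi-isomorphisms. A morphism from \<open>X\<close> to \<open>Y\<close>
  is an equivalence class of roofs \<open>(W, s, f)\<close>, i.e. of diagrams \<open>X \<leftarrow> W \<rightarrow> Y\<close> with a
  quasi-isomorphism \<open>s : W \<rightarrow> X\<close> and a chain map \<open>f : W \<rightarrow> Y\<close>; it represents \<open>f\<close> composed with the
  inverse of \<open>s\<close>.\<close>

type_synonym 'u roof = "'u cochain_complex \<times> ('u, 'u) graded_map \<times> ('u, 'u) graded_map"

definition roofs :: "'u cochain_complex \<Rightarrow> 'u cochain_complex \<Rightarrow> 'u roof set" where
  "roofs X Y = {(W, s, f). W \<in> small_complexes \<and> quasi_iso W X s \<and> chain_map W Y f}"

definition roof_rel :: "'u cochain_complex \<Rightarrow> 'u cochain_complex \<Rightarrow> ('u roof \<times> 'u roof) set" where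
  "roof_rel X Y = {((W, s, f), (W', s', f')).
     (W, s, f) \<in> roofs X Y \<and> (W', s', f') \<in> roofs X Y \<and>
     (\<exists>(U :: 'u cochain_complex) u u'. U \<in> small_complexes \<and> chain_map U W u \<and> chain_map U W' u' \<and>
        quasi_iso U X (comp_map s u) \<and>
        homotopic U X (comp_map s u) (comp_map s' u') \<and>
        homotopic U Y (comp_map f u) (comp_map f' u'))}"

definition roof_class ::
  "'u cochain_complex \<Rightarrow> 'u cochain_complex \<Rightarrow> 'u roof \<Rightarrow> 'u roof set" where
  "roof_class X Y r = roof_rel X Y `` {r}"

text \<open>The image in the derived category of a chain map \<open>f : X \<rightarrow> Y\<close>.\<close>

definition of_chain_map ::
  "'u cochain_complex \<Rightarrow> 'u cochain_complex \<Rightarrow> ('u, 'u) graded_map \<Rightarrow> 'u roof set" where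
  "of_chain_map X Y f = roof_class X Y (X, id_map, f)"

text \<open>Morphisms are added after passing to representatives with the same denominator. Here, and in
  the composition and the shift below, the union is over all choices of representatives; all of
  them give the same equivalence class.\<close>

definition derived_hom :: "'u cochain_complex \<Rightarrow> 'u cochain_complex \<Rightarrow> 'u roof set monoid" where
  "derived_hom X Y = \<lparr>carrier = roofs X Y // roof_rel X Y,
     monoid.mult = (\<lambda>R S. \<Union> {roof_class X Y (W, s, add_map Y f g) | W s f g.
                               (W, s, f) \<in> R \<and> (W, s, g) \<in> S}),
     one = of_chain_map X Y (zero_map Y)\<rparr>"

text \<open>Roofs \<open>X \<leftarrow> W \<rightarrow> Y\<close> and \<open>Y \<leftarrow> V \<rightarrow> Z\<close> are composed through a square over \<open>Y\<close>
  that commutes up to homotopy.\<close>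

definition derived_comp ::
  "'u cochain_complex \<Rightarrow> 'u cochain_complex \<Rightarrow> 'u cochain_complex \<Rightarrow>
     'u roof set \<Rightarrow> 'u roof set \<Rightarrow> 'u roof set" where
  "derived_comp X Y Z S R = \<Union> {roof_class X Z (U, comp_map s u, comp_map g v) | U u v W s f V t g.
     (W, s, f) \<in> R \<and> (V, t, g) \<in> S \<and> U \<in> small_complexes \<and>
     quasi_iso U W u \<and> chain_map U V v \<and> homotopic U Y (comp_map f u) (comp_map t v)}"

definition derived_shift_mor ::
  "'u cochain_complex \<Rightarrow> 'u cochain_complex \<Rightarrow> 'u roof set \<Rightarrow> 'u roof set" where
  "derived_shift_mor X Y R =
     \<Union> {roof_class (shift_complex 1 X) (shift_complex 1 Y)
          (shift_complex 1 W, shift_map 1 s, shift_map 1 f) | W s f. (W, s, f) \<in> R}"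

definition derived_preadditive :: "('u cochain_complex, 'u roof set) preadditive_category" where
  "derived_preadditive = \<lparr>Obj = small_complexes, Hom = derived_hom, Comp = derived_comp,
     Ident = (\<lambda>X. of_chain_map X X id_map)\<rparr>"

text \<open>The distinguished triangles are those isomorphic to the triangle
  \<open>X \<rightarrow> Y \<rightarrow> cone f \<rightarrow> X[1]\<close> of some chain map \<open>f\<close>. As \<open>cone X Y f\<close> lives on the type
  \<open>'u \<times> 'u\<close>, it is replaced by a complex \<open>Z\<close> on \<open>'u\<close> together with an isomorphism of complexes
  \<open>\<phi>\<close> from \<open>cone X Y f\<close> to \<open>Z\<close>.\<close>

definition cone_triangles ::
  "('u cochain_complex \<times> 'u cochain_complex \<times> 'u cochain_complex \<times>
    'u roof set \<times> 'u roof set \<times> 'u roof set) set" where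
  "cone_triangles = {(X, Y, Z, of_chain_map X Y f,
      of_chain_map Y Z (\<lambda>n y. \<phi> n (\<one>\<^bsub>cgrp X (n + 1)\<^esub>, y)),
      of_chain_map Z (shift_complex 1 X)
        (\<lambda>n z. fst (inv_into (carrier (cgrp (cone X Y f) n)) (\<phi> n) z))) | X Y Z f \<phi>.
     X \<in> small_complexes \<and> Y \<in> small_complexes \<and> Z \<in> small_complexes \<and> chain_map X Y f \<and>
     chain_map (cone X Y f) Z \<phi> \<and> (\<forall>n. \<phi> n \<in> iso (cgrp (cone X Y f) n) (cgrp Z n))}"

definition derived_dist ::
  "('u cochain_complex \<times> 'u cochain_complex \<times> 'u cochain_complex \<times>
    'u roof set \<times> 'u roof set \<times> 'u roof set) set" where
  "derived_dist = {(X, Y, Z, f, g, h).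
     X \<in> small_complexes \<and> Y \<in> small_complexes \<and> Z \<in> small_complexes \<and>
     f \<in> carrier (derived_hom X Y) \<and> g \<in> carrier (derived_hom Y Z) \<and>
     h \<in> carrier (derived_hom Z (shift_complex 1 X)) \<and>
     (\<exists>X' Y' Z' f' g' h' \<alpha> \<beta> \<gamma>. (X', Y', Z', f', g', h') \<in> cone_triangles \<and>
        isomorphism derived_preadditive X X' \<alpha> \<and>
        isomorphism derived_preadditive Y Y' \<beta> \<and>
        isomorphism derived_preadditive Z Z' \<gamma> \<and>
        derived_comp X Y Y' \<beta> f = derived_comp X X' Y' f' \<alpha> \<and>
        derived_comp Y Z Z' \<gamma> g = derived_comp Y Y' Z' g' \<beta> \<and>
        derived_comp Z (shift_complex 1 X) (shift_complex 1 X') (derived_shift_mor X X' \<alpha>) h =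
          derived_comp Z Z' (shift_complex 1 X') h' \<gamma>)}"

definition D_Ab :: "('u cochain_complex, 'u roof set) triangulated_category" where
  "D_Ab = preadditive_category.extend derived_preadditive
            (triangulated_category.fields shift_complex derived_dist)"

definition concentrated_in_degree_0 :: "'a cochain_complex \<Rightarrow> ('b, 'c) monoid_scheme \<Rightarrow> bool" where
  "concentrated_in_degree_0 X A \<longleftrightarrow>
     cgrp X 0 \<cong> A \<and> (\<forall>n. n \<noteq> 0 \<longrightarrow> trivial_group (cgrp X n))"

end

theory Submission
 imports Defs "HOL-Algebra.Ring" "HOL-Algebra.Multiplicative_Group"
begin

text \<open>The category generated by \<open>G = \<int>/p\<close> consists of the complexes with \<open>p\<close>-primary torsion cohomology.
 Embedding a complex into an acyclic divisible one shows that such a complex is isomorphic to a complex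
 \<open>T\<close> of divisible \<open>p\<close>-primary groups; \<open>T\<close> is the telescope of its \<open>p\<^sup>k\<close>-torsion subcomplexes, and these are
 iterated extensions of direct sums of shifts of \<open>G\<close>, in degrees close to the support of the cohomology.
 This yields generation and, for the standard t-structure, weak approximability.

 A compact object \<open>H\<close> has cohomology of bounded exponent. If \<open>H\<close> generates, then some \<open>H\<^sup>l(H)\<close> is nonzero
 and there are nonzero maps from \<open>H\<close> to every torsion complex with cohomology in degree \<open>l\<close>. So condition (i)
 bounds the aisle from above and the coaisle from below; descending induction over condition (ii) then bounds
 the exponent of \<open>H\<^sup>i\<close> on the aisle for every \<open>i\<close>, while truncating a divisible torsion group placed
 in a very negative degree gives an object of the aisle with unbounded exponent.\<close>

text \<open>Morphisms are classes of roofs, so a morphism acts on cohomology through the relation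
  \<open>hrel\<close> between cocycles, and conditions on objects are phrased by
  \<open>tors\<close>: with the sets {1}, the powers of p and {p^N} it expresses acyclicity,
  p-primary torsion and bounded exponent. Such conditions pass to retracts, shifts, middle terms of
  triangles and direct sums. A coproduct in the subcategory, known only by its universal property,
  is therefore compared with a concrete direct sum merely as a retract.

  Bounded exponent of a compact H comes from a morphism from H to a countable sum of copies of H
  with components 1, p, p^2, ...: it exists because every class is killed by a power of p, and
  compactness makes a component vanish. The nonzero morphisms are composites H -> T[p][1] -> G[-l]
  -> X with T a divisible model of H; bounded exponent supplies a class that is not divisible by p.
  Exponents multiply along triangles, so a fixed number m of extensions, for each of finitely many
  degrees, gives one bound for the whole aisle.\<close>

abbreviation dcomp where "dcomp \<equiv> derived_comp"
abbreviation dhom where "dhom \<equiv> derived_hom"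
abbreviation Bd where "Bd \<equiv> coboundaries"
abbreviation Cy where "Cy \<equiv> cocycles"
abbreviation Shf where "Shf \<equiv> shift_complex"
abbreviation dmor where "dmor \<equiv> of_chain_map"
abbreviation idx_mult :: "'a => ('a, 'm) monoid_scheme => 'a => 'a" ("(_ *[_]/ _)" [70, 0, 71] 70) where
 "x *[G] y \<equiv> x \<otimes>\<^bsub>G\<^esub> y"
abbreviation idx_one :: "('a, 'm) monoid_scheme => 'a" ("1[_]") where
 "1[G] \<equiv> \<one>\<^bsub>G\<^esub>"
abbreviation idx_inv :: "('a, 'm) monoid_scheme => 'a => 'a" ("inv[_] _" [0, 81] 80) where
 "inv[G] x \<equiv> inv\<^bsub>G\<^esub> x"
abbreviation idx_pow :: "'a => ('a, 'm) monoid_scheme => 'b::semiring_1 => 'a" ("(_ ^[_]/ _)" [76, 0, 75] 75) where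
 "x ^[G] n \<equiv> x [^]\<^bsub>G\<^esub> n"

section \<open>Commutative groups and maps between their quotients\<close>

lemma (in comm_group) inv_cancel_left:
 "\<lbrakk>x : carrier G; y : carrier G\<rbrakk> \<Longrightarrow> x \<otimes> (inv x \<otimes> y) = y"
 "\<lbrakk>x : carrier G; y : carrier G\<rbrakk> \<Longrightarrow> inv x \<otimes> (x \<otimes> y) = y"
 by (simp_all add: m_assoc [symmetric])

text \<open>This makes the method algebra normalise terms of commutative groups.\<close>

lemmas (in comm_group) comm_group_simprules
 [algebra comm_group "monoid.one G" "monoid.mult G" "m_inv G"] =
 m_closed inv_closed one_closed m_assoc m_comm m_lcomm l_one r_one inv_mult inv_inv inv_one
 r_inv l_inv inv_cancel_left

lemma (in comm_group) pow_mult_distrib_nat: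
 "\<lbrakk>x : carrier G; y : carrier G\<rbrakk> \<Longrightarrow> (x \<otimes> y) [^] (n::nat) = x [^] n \<otimes> y [^] n"
 by (simp add: pow_mult_distrib m_comm)

lemma (in group) r_coset_eq_iff:
 assumes H: "subgroup H G" and x: "x : carrier G" and y: "y : carrier G"
 shows "H #> x = H #> y \<longleftrightarrow> x \<otimes> inv y : H"
proof -
 have "x : H #> y \<longleftrightarrow> x \<otimes> inv y : H" by (rule subgroup.rcos_module[OF H is_group y x])
 moreover have "H #> x = H #> y \<longleftrightarrow> x : H #> y"
  using repr_independence[OF _ y H, of x] rcos_self[OF x H] by auto
 ultimately show ?thesis by simp
qed

text \<open>Injectivity of the coset map is tested on its kernel, since it is a homomorphism, and
  surjectivity on representatives. Isomorphy on cohomology thus becomes two conditions on elements,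
  and \<open>quasi_iso_iff_qis\<close> is the last place where cohomology groups occur as
  quotients.\<close>

lemma comm_group_iso_quotient_iff:
 fixes G :: "('a,'c) monoid_scheme" and H :: "('b,'d) monoid_scheme"
 assumes G: "comm_group G" and H: "comm_group H" and N: "subgroup N G" and M: "subgroup M H"
  and f: "f : hom G H" and fN: "f ` N \<subseteq> M"
 shows "(%S. M <#>\<^bsub>H\<^esub> (f ` S)) : iso (G Mod N) (H Mod M) \<longleftrightarrow>
  (\<forall>x\<in>carrier G. f x : M --> x : N) \<and> (\<forall>y\<in>carrier H. \<exists>x\<in>carrier G. \<exists>m\<in>M. y = f x *[H] m)"
proof -
 interpret G: comm_group G by fact
 interpret H: comm_group H by fact
 interpret N: normal N G by (rule G.subgroup_imp_normal[OF N])
 interpret M: normal M H by (rule H.subgroup_imp_normal[OF M])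
 interpret f: group_hom G H f by unfold_locales (rule f)
 let ?F = "%S. M <#>\<^bsub>H\<^esub> (f ` S)"
 have F: "?F (N #>\<^bsub>G\<^esub> x) = M #>\<^bsub>H\<^esub> f x" if x: "x : carrier G" for x
 proof
  show "?F (N #>\<^bsub>G\<^esub> x) \<subseteq> M #>\<^bsub>H\<^esub> f x"
   using x fN by (force simp: set_mult_def r_coset_def H.m_assoc[symmetric])
  show "M #>\<^bsub>H\<^esub> f x \<subseteq> ?F (N #>\<^bsub>G\<^esub> x)"
  proof
   fix y assume "y : M #>\<^bsub>H\<^esub> f x"
   then obtain m where m: "m : M" "y = m *[H] f x" by (auto simp: r_coset_def)
   have "x : N #>\<^bsub>G\<^esub> x" using x by (rule G.rcos_self[OF _ N])
   then show "y : ?F (N #>\<^bsub>G\<^esub> x)" using m by (auto simp: set_mult_def)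
  qed
 qed
 have eqG: "(N #>\<^bsub>G\<^esub> x = N #>\<^bsub>G\<^esub> y) \<longleftrightarrow> x *[G] inv[G] y : N" if "x : carrier G" "y : carrier G" for x y
  by (rule G.r_coset_eq_iff[OF N that])
 have eqH: "(M #>\<^bsub>H\<^esub> x = M #>\<^bsub>H\<^esub> y) \<longleftrightarrow> x *[H] inv[H] y : M" if "x : carrier H" "y : carrier H" for x y
  by (rule H.r_coset_eq_iff[OF M that])
 have hom: "?F : hom (G Mod N) (H Mod M)"
 proof (rule homI)
  fix S T assume "S : carrier (G Mod N)" "T : carrier (G Mod N)"
  then obtain x y where xy: "x : carrier G" "y : carrier G" "S = N #>\<^bsub>G\<^esub> x" "T = N #>\<^bsub>G\<^esub> y"
   by (auto simp: FactGroup_def RCOSETS_def)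
  show "?F S : carrier (H Mod M)"
   using xy by (simp add: F) (auto simp: FactGroup_def RCOSETS_def)
  show "?F (S *[G Mod N] T) = ?F S *[H Mod M] ?F T"
   using xy by (simp add: FactGroup_def N.rcos_sum F M.rcos_sum)
 qed
 have inj: "inj_on ?F (carrier (G Mod N)) \<longleftrightarrow> (\<forall>x\<in>carrier G. f x : M --> x : N)" (is "?l = ?r")
 proof
  assume ?l
  show ?r
  proof (intro ballI impI)
   fix x assume x: "x : carrier G" "f x : M"
   have "?F (N #>\<^bsub>G\<^esub> x) = ?F (N #>\<^bsub>G\<^esub> 1[G])"
    using x by (simp add: F eqH)
   then have "N #>\<^bsub>G\<^esub> x = N #>\<^bsub>G\<^esub> 1[G]"
    using \<open>?l\<close> x(1) by (auto simp: inj_on_def FactGroup_def RCOSETS_def)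
   then show "x : N" using x(1) eqG[of x "1[G]"] by simp
  qed
 next
  assume r: ?r
  show ?l
  proof (rule inj_onI)
   fix S T assume "S : carrier (G Mod N)" "T : carrier (G Mod N)" and eq: "?F S = ?F T"
   then obtain x y where xy: "x : carrier G" "y : carrier G" "S = N #>\<^bsub>G\<^esub> x" "T = N #>\<^bsub>G\<^esub> y"
    by (auto simp: FactGroup_def RCOSETS_def)
   then have "f (x *[G] inv[G] y) : M" using eq by (simp add: F eqH)
   then show "S = T" using xy r by (simp add: eqG)
  qed
 qed
 have surj: "?F ` carrier (G Mod N) = carrier (H Mod M) \<longleftrightarrow>
  (\<forall>y\<in>carrier H. \<exists>x\<in>carrier G. \<exists>m\<in>M. y = f x *[H] m)" (is "?l = ?r")
 proof
  assume l: ?l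
  show ?r
  proof
   fix y assume y: "y : carrier H"
   then have "M #>\<^bsub>H\<^esub> y : ?F ` carrier (G Mod N)"
    unfolding l by (auto simp: FactGroup_def RCOSETS_def)
   then obtain x where x: "x : carrier G" "M #>\<^bsub>H\<^esub> y = ?F (N #>\<^bsub>G\<^esub> x)"
    by (auto simp: FactGroup_def RCOSETS_def)
   then have "y *[H] inv[H] f x : M" using y by (simp add: F eqH)
   moreover have "y = f x *[H] (y *[H] inv[H] f x)"
    using y x f.hom_closed[OF x(1)] by algebra
   ultimately show "\<exists>x\<in>carrier G. \<exists>m\<in>M. y = f x *[H] m" using x by blast
  qed
 next
  assume r: ?r
  have "carrier (H Mod M) \<subseteq> ?F ` carrier (G Mod N)"
  proof
   fix S assume "S : carrier (H Mod M)"
   then obtain y where y: "y : carrier H" "S = M #>\<^bsub>H\<^esub> y" by (auto simp: FactGroup_def RCOSETS_def)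
   then obtain x m where x: "x : carrier G" "m : M" "y = f x *[H] m" using r by blast
   have mc: "m : carrier H" using x M.subset by blast
   have "y *[H] inv[H] f x = m" using y x(3) mc f.hom_closed[OF x(1)] by algebra
   then have "S = ?F (N #>\<^bsub>G\<^esub> x)" using x y by (simp add: F eqH)
   then show "S : ?F ` carrier (G Mod N)" using x by (auto simp: FactGroup_def RCOSETS_def)
  qed
  moreover have "?F ` carrier (G Mod N) \<subseteq> carrier (H Mod M)" using hom by (auto simp: hom_def)
  ultimately show ?l by blast
 qed
 show ?thesis using hom inj surj by (simp add: iso_def bij_betw_def)
qed

section \<open>Complexes, chain maps, cocycles and coboundaries\<close>

abbreviation Car :: "'a cochain_complex => int => 'a set" where
 "Car X n \<equiv> carrier (cgrp X n)"

lemma comm_group_cgrp: "is_complex X ==> comm_group (cgrp X n)"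
 by (simp add: is_complex_def)

lemma group_cgrp: "is_complex X ==> group (cgrp X n)"
 by (simp add: comm_group_cgrp comm_group.axioms(2))

text \<open>A package of rules to be instantiated at one complex. The premise
  \<open>m = k + 1\<close>, in place of a literal \<open>k + 1\<close>, lets the rules fire in
  degrees such as \<open>n - 1\<close> and \<open>n\<close>, where the equation is left to
  arithmetic.\<close>

lemma cx_simps:
 assumes X: "is_complex X"
 shows "\<lbrakk>x : Car X k; m = k + 1\<rbrakk> \<Longrightarrow> cdiff X k x : Car X m"
  and "\<lbrakk>x : Car X k; y : Car X k\<rbrakk> \<Longrightarrow> cdiff X k (x *[cgrp X k] y) = cdiff X k x *[cgrp X (k + 1)] cdiff X k y"
  and "cdiff X k 1[cgrp X k] = 1[cgrp X (k + 1)]"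
  and "x : Car X k ==> cdiff X k (inv[cgrp X k] x) = inv[cgrp X (k + 1)] (cdiff X k x)"
  and "\<lbrakk>x : Car X k; m = k + 1\<rbrakk> \<Longrightarrow> cdiff X m (cdiff X k x) = 1[cgrp X (m + 1)]"
  and "\<lbrakk>x : Car X k; y : Car X k\<rbrakk> \<Longrightarrow> x *[cgrp X k] y : Car X k"
  and "1[cgrp X k] : Car X k"
  and "x : Car X k ==> inv[cgrp X k] x : Car X k"
  and "x : Car X k ==> 1[cgrp X k] *[cgrp X k] x = x"
  and "x : Car X k ==> x *[cgrp X k] 1[cgrp X k] = x"
  and "inv[cgrp X k] 1[cgrp X k] = 1[cgrp X k]"
  and "x : Car X k ==> inv[cgrp X k] (inv[cgrp X k] x) = x"
  and "x : Car X k ==> x *[cgrp X k] inv[cgrp X k] x = 1[cgrp X k]"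
  and "x : Car X k ==> inv[cgrp X k] x *[cgrp X k] x = 1[cgrp X k]"
  and "x : Car X k ==> x ^[cgrp X k] (i::nat) : Car X k"
  and "x : Car X k ==> x ^[cgrp X k] (j::int) : Car X k"
  and "x : Car X k ==> cdiff X k (x ^[cgrp X k] (i::nat)) = cdiff X k x ^[cgrp X (k + 1)] i"
  and "x : Car X k ==> cdiff X k (x ^[cgrp X k] (j::int)) = cdiff X k x ^[cgrp X (k + 1)] j"
  and "1[cgrp X k] ^[cgrp X k] (i::nat) = 1[cgrp X k]"
  and "1[cgrp X k] ^[cgrp X k] (j::int) = 1[cgrp X k]"
proof -
 interpret K: comm_group "cgrp X k" for k using X by (rule comm_group_cgrp)
 interpret d: group_hom "cgrp X k" "cgrp X (k + 1)" "cdiff X k" for k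
  using X by unfold_locales (simp add: is_complex_def)
 show "\<lbrakk>x : Car X k; m = k + 1\<rbrakk> \<Longrightarrow> cdiff X k x : Car X m" by simp
 show "\<lbrakk>x : Car X k; m = k + 1\<rbrakk> \<Longrightarrow> cdiff X m (cdiff X k x) = 1[cgrp X (m + 1)]"
  using X by (simp add: is_complex_def add.assoc)
qed (simp_all add: assms group_cgrp group_hom.hom_nat_pow group_hom.hom_int_pow group_hom_def group_hom_axioms_def
   is_complex_def[THEN iffD1, rule_format, THEN conjunct2, THEN conjunct1] group.inv_closed
   group.is_monoid monoid.m_closed monoid.one_closed monoid.l_one monoid.r_one monoid.inv_one
   group.inv_inv group.r_inv group.l_inv monoid.nat_pow_closed group.int_pow_closed monoid.nat_pow_one
   group.int_pow_one group_hom.hom_mult group_hom.hom_one group_hom.hom_inv)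

text \<open>Both complexes are part of the condition, so that a single fact yields the algebraic
  rules of the source, of the target and of the map.\<close>

definition cmap :: "'a cochain_complex => 'b cochain_complex => ('a, 'b) graded_map => bool" where
 "cmap X Y f \<longleftrightarrow> is_complex X \<and> is_complex Y \<and> chain_map X Y f"

lemma cmapD: "cmap X Y f ==> is_complex X" "cmap X Y f ==> is_complex Y" "cmap X Y f ==> chain_map X Y f"
 by (simp_all add: cmap_def)

lemma cmap_simps:
 assumes f: "cmap X Y f"
 shows "x : Car X k ==> f k x : Car Y k"
  and "\<lbrakk>x : Car X k; y : Car X k\<rbrakk> \<Longrightarrow> f k (x *[cgrp X k] y) = f k x *[cgrp Y k] f k y"
  and "f k 1[cgrp X k] = 1[cgrp Y k]"
  and "x : Car X k ==> f k (inv[cgrp X k] x) = inv[cgrp Y k] (f k x)"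
  and "\<lbrakk>x : Car X k; m = k + 1\<rbrakk> \<Longrightarrow> f m (cdiff X k x) = cdiff Y k (f k x)"
  and "x : Car X k ==> f k (x ^[cgrp X k] (i::nat)) = f k x ^[cgrp Y k] i"
  and "x : Car X k ==> f k (x ^[cgrp X k] (j::int)) = f k x ^[cgrp Y k] j"
proof -
 interpret f: group_hom "cgrp X k" "cgrp Y k" "f k" for k
  using f by (auto simp: cmap_def chain_map_def group_hom_def group_hom_axioms_def group_cgrp)
 show "x : Car X k ==> f k x : Car Y k" by simp
 show "\<lbrakk>x : Car X k; m = k + 1\<rbrakk> \<Longrightarrow> f m (cdiff X k x) = cdiff Y k (f k x)"
  using f by (simp add: cmap_def chain_map_def)
qed (use f in \<open>simp_all add: cmap_def chain_map_def group_hom_def group_hom_axioms_def group_cgrp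
 group_hom.hom_mult group_hom.hom_one group_hom.hom_inv group_hom.hom_nat_pow group_hom.hom_int_pow group_hom.hom_closed\<close>)

lemma cmapI:
 assumes "is_complex X" "is_complex Y"
  and "!!n x. x : Car X n ==> f n x : Car Y n"
  and "!!n x y. x : Car X n ==> y : Car X n ==> f n (x *[cgrp X n] y) = f n x *[cgrp Y n] f n y"
  and "!!n x. x : Car X n ==> f (n + 1) (cdiff X n x) = cdiff Y n (f n x)"
 shows "cmap X Y f"
 using assms by (auto simp: cmap_def chain_map_def hom_def)

lemma is_complexI:
 assumes "!!n. comm_group (cgrp X n)"
  and "!!n x. x : Car X n ==> cdiff X n x : Car X (n + 1)"
  and "!!n x y. x : Car X n ==> y : Car X n ==> cdiff X n (x *[cgrp X n] y) = cdiff X n x *[cgrp X (n + 1)] cdiff X n y"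
  and "!!n x. x : Car X n ==> cdiff X (n + 1) (cdiff X n x) = 1[cgrp X (n + 2)]"
 shows "is_complex X"
 using assms by (auto simp: is_complex_def hom_def)

lemma cocycles_iff: "x : Cy X n \<longleftrightarrow> x : Car X n \<and> cdiff X n x = 1[cgrp X (n + 1)]"
 by (simp add: cocycles_def kernel_def)

lemma coboundaries_iff: "x : Bd X n \<longleftrightarrow> (\<exists>z\<in>Car X (n - 1). x = cdiff X (n - 1) z)"
 by (auto simp: coboundaries_def)

lemma group_hom_cdiff:
 assumes "is_complex X" shows "group_hom (cgrp X n) (cgrp X (n + 1)) (cdiff X n)"
 using assms by (simp add: group_hom_def group_hom_axioms_def group_cgrp) (simp add: is_complex_def)

lemma cocycles_subgroup:
 assumes X: "is_complex X" shows "subgroup (Cy X n) (cgrp X n)"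
 unfolding cocycles_def by (rule group_hom.subgroup_kernel[OF group_hom_cdiff[OF X]])

lemma coboundaries_subgroup:
 assumes X: "is_complex X" shows "subgroup (Bd X n) (cgrp X n)"
 using group_hom.img_is_subgroup[OF group_hom_cdiff[OF X, of "n - 1"]] by (simp add: coboundaries_def)

lemma coboundaries_subset_cocycles: "is_complex X ==> Bd X n \<subseteq> Cy X n"
 by (auto simp: coboundaries_iff cocycles_iff cx_simps)

section \<open>Quasi-isomorphisms in terms of elements\<close>

lemma (in comm_group) comm_group_restrict: "subgroup H G ==> comm_group (G\<lparr>carrier := H\<rparr>)"
 by (rule group.group_comm_groupI)
  (auto simp: subgroup.subgroup_is_group subgroup.mem_carrier m_comm)

lemma comm_group_DirProd: "\<lbrakk>comm_group G; comm_group H\<rbrakk> \<Longrightarrow> comm_group (G \<times>\<times> H)"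
 by (rule group.group_comm_groupI)
  (auto simp: DirProd_group comm_group.axioms(2) comm_monoid.m_comm comm_group.axioms(1))

text \<open>The form of \<open>quasi_iso\<close> without cosets: the first clause is injectivity on
  cohomology, the second surjectivity up to a coboundary.\<close>

definition qis :: "'a cochain_complex => 'b cochain_complex => ('a, 'b) graded_map => bool" where
 "qis X Y f \<longleftrightarrow> cmap X Y f \<and>
  (\<forall>n. (\<forall>x\<in>Cy X n. f n x : Bd Y n --> x : Bd X n) \<and>
     (\<forall>y\<in>Cy Y n. \<exists>x\<in>Cy X n. \<exists>z\<in>Car Y (n - 1). y = f n x *[cgrp Y n] cdiff Y (n - 1) z))"

lemma qis_cmap: "qis X Y f ==> cmap X Y f" by (simp add: qis_def)

lemma cmap_cocycle: "\<lbrakk>cmap X Y f; x : Cy X n\<rbrakk> \<Longrightarrow> f n x : Cy Y n"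
 using cmap_simps(5)[of X Y f x n "n + 1"] by (auto simp: cocycles_iff cmap_simps)

lemma cmap_coboundary: "\<lbrakk>cmap X Y f; x : Bd X n\<rbrakk> \<Longrightarrow> f n x : Bd Y n"
 by (auto simp: coboundaries_iff cmap_simps)

lemma quasi_iso_iff_qis:
 assumes X: "is_complex X" and Y: "is_complex Y"
 shows "quasi_iso X Y f \<longleftrightarrow> qis X Y f"
proof (cases "chain_map X Y f")
 case True
 then have f: "cmap X Y f" using X Y by (simp add: cmap_def)
 have "cohomology_map Y f n : iso (cohomology X n) (cohomology Y n) \<longleftrightarrow>
  (\<forall>x\<in>Cy X n. f n x : Bd Y n --> x : Bd X n) \<and>
  (\<forall>y\<in>Cy Y n. \<exists>x\<in>Cy X n. \<exists>z\<in>Car Y (n - 1). y = f n x *[cgrp Y n] cdiff Y (n - 1) z)" for n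
 proof -
  let ?G = "cgrp X n\<lparr>carrier := Cy X n\<rparr>" and ?H = "cgrp Y n\<lparr>carrier := Cy Y n\<rparr>"
  have 1: "comm_group ?G" "comm_group ?H"
   using X Y by (auto intro!: comm_group.comm_group_restrict comm_group_cgrp cocycles_subgroup)
  have 2: "subgroup (Bd X n) ?G" "subgroup (Bd Y n) ?H"
   using X Y by (auto intro!: group.subgroup_incl group_cgrp coboundaries_subgroup
     cocycles_subgroup coboundaries_subset_cocycles[THEN subsetD])
  have 3: "f n : hom ?G ?H"
   by (auto simp: hom_def cmap_cocycle[OF f] cmap_simps[OF f] cocycles_iff)
    (use cmap_cocycle[OF f] in \<open>auto simp: cocycles_iff\<close>)
  have 4: "f n ` Bd X n \<subseteq> Bd Y n"
   using cmap_coboundary[OF f] by blast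
  have 5: "cohomology_map Y f n = (%S. Bd Y n <#>\<^bsub>?H\<^esub> (f n ` S))"
   by (rule ext) (simp add: cohomology_map_def set_mult_def)
  show ?thesis
   unfolding 5 cohomology_def comm_group_iso_quotient_iff[OF 1 2 3 4]
   by (simp add: coboundaries_iff Bex_def) blast
 qed
 then show ?thesis using f True by (simp add: quasi_iso_def qis_def)
next
 case False
 then show ?thesis by (simp add: quasi_iso_def qis_def cmap_def)
qed

section \<open>Homotopies and cohomologous elements\<close>

definition htp ::
 "'a cochain_complex => 'b cochain_complex => ('a, 'b) graded_map => ('a, 'b) graded_map => bool" where
 "htp X Y f g \<longleftrightarrow> cmap X Y f \<and> cmap X Y g \<and> homotopic X Y f g"

lemma htpD: "htp X Y f g ==> cmap X Y f" "htp X Y f g ==> cmap X Y g"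
 by (simp_all add: htp_def)

lemma htpE:
 assumes "htp X Y f g"
 obtains h where
  "!!k m x. \<lbrakk>x : Car X k; m = k - 1\<rbrakk> \<Longrightarrow> h k x : Car Y m"
  "!!k x y. \<lbrakk>x : Car X k; y : Car X k\<rbrakk> \<Longrightarrow> h k (x *[cgrp X k] y) = h k x *[cgrp Y (k - 1)] h k y"
  "!!n x. x : Car X n ==> f n x = g n x *[cgrp Y n] (cdiff Y (n - 1) (h n x) *[cgrp Y n] h (n + 1) (cdiff X n x))"
proof -
 from assms obtain h where "\<forall>n. h n : hom (cgrp X n) (cgrp Y (n - 1))"
  and e: "\<forall>n. \<forall>x\<in>Car X n. f n x = g n x *[cgrp Y n] (cdiff Y (n - 1) (h n x) *[cgrp Y n] h (n + 1) (cdiff X n x))"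
  by (auto simp: htp_def homotopic_def)
 then show thesis by (intro that[of h]) (auto simp: hom_def)
qed

lemma htpI:
 assumes "cmap X Y f" "cmap X Y g"
  "!!k x. x : Car X k ==> h k x : Car Y (k - 1)"
  "!!k x y. \<lbrakk>x : Car X k; y : Car X k\<rbrakk> \<Longrightarrow> h k (x *[cgrp X k] y) = h k x *[cgrp Y (k - 1)] h k y"
  "!!n x. x : Car X n ==> f n x = g n x *[cgrp Y n] (cdiff Y (n - 1) (h n x) *[cgrp Y n] h (n + 1) (cdiff X n x))"
 shows "htp X Y f g"
 using assms by (auto simp: htp_def homotopic_def hom_def intro!: exI[of _ h])

lemma htp_of_eq:
 assumes f: "cmap X Y f" and g: "cmap X Y g" and eq: "!!n x. x : Car X n ==> f n x = g n x"
 shows "htp X Y f g"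
proof -
 note [simp] = cx_simps[OF cmapD(1)[OF f]] cx_simps[OF cmapD(2)[OF f]] cmap_simps[OF f] cmap_simps[OF g]
 show ?thesis
  by (rule htpI[OF f g, of "%n x. 1[cgrp Y (n - 1)]"]) (simp_all add: eq)
qed

lemma htp_refl: "cmap X Y f ==> htp X Y f f"
 by (rule htp_of_eq) simp_all

lemma htp_sym:
 assumes "htp X Y f g" shows "htp X Y g f"
proof -
 from assms obtain h where h:
  "!!k m x. \<lbrakk>x : Car X k; m = k - 1\<rbrakk> \<Longrightarrow> h k x : Car Y m"
  "!!k x y. \<lbrakk>x : Car X k; y : Car X k\<rbrakk> \<Longrightarrow> h k (x *[cgrp X k] y) = h k x *[cgrp Y (k - 1)] h k y"
  "!!n x. x : Car X n ==> f n x = g n x *[cgrp Y n] (cdiff Y (n - 1) (h n x) *[cgrp Y n] h (n + 1) (cdiff X n x))"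
  by (rule htpE) blast
 note f = htpD(1)[OF assms] and g = htpD(2)[OF assms]
 note [simp] = cx_simps[OF cmapD(1)[OF f]] cx_simps[OF cmapD(2)[OF f]] cmap_simps[OF f] cmap_simps[OF g] h(1,2)
 interpret Y: comm_group "cgrp Y i" for i using cmapD(2)[OF f] by (rule comm_group_cgrp)
 show ?thesis
 proof (rule htpI[OF g f, of "%n x. inv[cgrp Y (n - 1)] h n x"])
  fix n x assume x: "x : Car X n"
  have c: "g n x : Car Y n" "cdiff Y (n - 1) (h n x) : Car Y n" "h (n + 1) (cdiff X n x) : Car Y n"
   using x by simp_all
  show "g n x = f n x *[cgrp Y n] (cdiff Y (n - 1) (inv[cgrp Y (n - 1)] h n x) *[cgrp Y n] inv[cgrp Y (n + 1 - 1)] h (n + 1) (cdiff X n x))"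
   using x by (simp add: h(3)) (use c in algebra)
 qed (simp_all add: Y.inv_mult)
qed

lemma htp_trans:
 assumes "htp X Y f g" "htp X Y g k" shows "htp X Y f k"
proof -
 from assms(1) obtain h where h:
  "!!k m x. \<lbrakk>x : Car X k; m = k - 1\<rbrakk> \<Longrightarrow> h k x : Car Y m"
  "!!k x y. \<lbrakk>x : Car X k; y : Car X k\<rbrakk> \<Longrightarrow> h k (x *[cgrp X k] y) = h k x *[cgrp Y (k - 1)] h k y"
  "!!n x. x : Car X n ==> f n x = g n x *[cgrp Y n] (cdiff Y (n - 1) (h n x) *[cgrp Y n] h (n + 1) (cdiff X n x))"
  by (rule htpE) blast
 from assms(2) obtain h' where h':
  "!!k m x. \<lbrakk>x : Car X k; m = k - 1\<rbrakk> \<Longrightarrow> h' k x : Car Y m"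
  "!!k x y. \<lbrakk>x : Car X k; y : Car X k\<rbrakk> \<Longrightarrow> h' k (x *[cgrp X k] y) = h' k x *[cgrp Y (k - 1)] h' k y"
  "!!n x. x : Car X n ==> g n x = k n x *[cgrp Y n] (cdiff Y (n - 1) (h' n x) *[cgrp Y n] h' (n + 1) (cdiff X n x))"
  by (rule htpE) blast
 note f = htpD(1)[OF assms(1)] and k = htpD(2)[OF assms(2)]
 note [simp] = cx_simps[OF cmapD(1)[OF f]] cx_simps[OF cmapD(2)[OF f]] cmap_simps[OF k] h(1,2) h'(1,2)
 interpret Y: comm_group "cgrp Y i" for i using cmapD(2)[OF f] by (rule comm_group_cgrp)
 show ?thesis
 proof (rule htpI[OF f k, of "%n x. h n x *[cgrp Y (n - 1)] h' n x"])
  fix n x assume x: "x : Car X n"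
  have c: "k n x : Car Y n" "cdiff Y (n - 1) (h n x) : Car Y n" "h (n + 1) (cdiff X n x) : Car Y n"
   "cdiff Y (n - 1) (h' n x) : Car Y n" "h' (n + 1) (cdiff X n x) : Car Y n"
   using x by simp_all
  show "f n x = k n x *[cgrp Y n] (cdiff Y (n - 1) (h n x *[cgrp Y (n - 1)] h' n x) *[cgrp Y n]
   (h (n + 1) (cdiff X n x) *[cgrp Y (n + 1 - 1)] h' (n + 1) (cdiff X n x)))"
   using x by (simp add: h(3) h'(3)) (use c in algebra)
 next
  fix i x y assume "x : Car X i" "y : Car X i"
  then have "h i x : Car Y (i - 1)" "h i y : Car Y (i - 1)" "h' i x : Car Y (i - 1)" "h' i y : Car Y (i - 1)"
   "h i (x *[cgrp X i] y) = h i x *[cgrp Y (i - 1)] h i y" "h' i (x *[cgrp X i] y) = h' i x *[cgrp Y (i - 1)] h' i y" by simp_all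
  then show "h i (x *[cgrp X i] y) *[cgrp Y (i - 1)] h' i (x *[cgrp X i] y) =
   h i x *[cgrp Y (i - 1)] h' i x *[cgrp Y (i - 1)] (h i y *[cgrp Y (i - 1)] h' i y)"
   by algebra
 qed simp_all
qed

lemma comp_map_apply [simp]: "comp_map g f n x = g n (f n x)"
 by (simp add: comp_map_def)

lemma id_map_apply [simp]: "id_map n x = x"
 by (simp add: id_map_def)

lemma comp_map_assoc: "comp_map (comp_map h g) f = comp_map h (comp_map g f)"
 by (simp add: comp_map_def o_assoc)

lemma comp_map_id [simp]: "comp_map f id_map = f" "comp_map id_map f = f"
 by (auto simp: comp_map_def id_map_def o_def)

lemma cmap_comp: "\<lbrakk>cmap X Y f; cmap Y Z g\<rbrakk> \<Longrightarrow> cmap X Z (comp_map g f)"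
 by (rule cmapI) (auto simp: cmapD cmap_simps)

lemma cmap_id: "is_complex X ==> cmap X X id_map"
 by (rule cmapI) auto

lemma cmap_zero: "\<lbrakk>is_complex X; is_complex Y\<rbrakk> \<Longrightarrow> cmap X Y (zero_map Y)"
 by (rule cmapI) (auto simp: cx_simps zero_map_def)

lemma cmap_add:
 assumes f: "cmap X Y f" and g: "cmap X Y g" shows "cmap X Y (add_map Y f g)"
proof -
 interpret Y: comm_group "cgrp Y i" for i using cmapD(2)[OF f] by (rule comm_group_cgrp)
 note [simp] = cx_simps[OF cmapD(1)[OF f]] cx_simps[OF cmapD(2)[OF f]] cmap_simps[OF f] cmap_simps[OF g]
 show ?thesis
 proof (rule cmapI[OF cmapD(1,2)[OF f]])
  fix n x y assume "x : Car X n" "y : Car X n"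
  then have "f n x : Car Y n" "g n x : Car Y n" "f n y : Car Y n" "g n y : Car Y n"
   "f n (x *[cgrp X n] y) = f n x *[cgrp Y n] f n y" "g n (x *[cgrp X n] y) = g n x *[cgrp Y n] g n y" by simp_all
  then show "add_map Y f g n (x *[cgrp X n] y) = add_map Y f g n x *[cgrp Y n] add_map Y f g n y"
   unfolding add_map_def by algebra
 qed (simp_all add: add_map_def)
qed

lemma htp_comp_left:
 assumes "htp X Y f f'" and g: "cmap Y Z g"
 shows "htp X Z (comp_map g f) (comp_map g f')"
proof -
 from assms(1) obtain h where h:
  "!!k m x. \<lbrakk>x : Car X k; m = k - 1\<rbrakk> \<Longrightarrow> h k x : Car Y m"
  "!!k x y. \<lbrakk>x : Car X k; y : Car X k\<rbrakk> \<Longrightarrow> h k (x *[cgrp X k] y) = h k x *[cgrp Y (k - 1)] h k y"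
  "!!n x. x : Car X n ==> f n x = f' n x *[cgrp Y n] (cdiff Y (n - 1) (h n x) *[cgrp Y n] h (n + 1) (cdiff X n x))"
  by (rule htpE) blast
 note f = htpD(1)[OF assms(1)] and f' = htpD(2)[OF assms(1)]
 note [simp] = cx_simps[OF cmapD(1)[OF f]] cx_simps[OF cmapD(2)[OF f]] cmap_simps[OF g] cmap_simps[OF f'] h(1,2)
 show ?thesis
  by (rule htpI[OF cmap_comp[OF f g] cmap_comp[OF f' g], of "%n x. g (n - 1) (h n x)"]) (simp_all add: h(3))
qed

lemma htp_comp_right:
 assumes "htp Y Z g g'" and f: "cmap X Y f"
 shows "htp X Z (comp_map g f) (comp_map g' f)"
proof -
 from assms(1) obtain h where h:
  "!!k m x. \<lbrakk>x : Car Y k; m = k - 1\<rbrakk> \<Longrightarrow> h k x : Car Z m"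
  "!!k x y. \<lbrakk>x : Car Y k; y : Car Y k\<rbrakk> \<Longrightarrow> h k (x *[cgrp Y k] y) = h k x *[cgrp Z (k - 1)] h k y"
  "!!n x. x : Car Y n ==> g n x = g' n x *[cgrp Z n] (cdiff Z (n - 1) (h n x) *[cgrp Z n] h (n + 1) (cdiff Y n x))"
  by (rule htpE) blast
 note g = htpD(1)[OF assms(1)] and g' = htpD(2)[OF assms(1)]
 note [simp] = cmap_simps[OF f] h(1,2)
 show ?thesis
  by (rule htpI[OF cmap_comp[OF f g] cmap_comp[OF f g'], of "%n x. h n (f n x)"]) (simp_all add: h(3))
qed

lemma htp_add:
 assumes 1: "htp X Y f f'" and 2: "htp X Y g g'"
 shows "htp X Y (add_map Y f g) (add_map Y f' g')"
proof -
 from 1 obtain h where h: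
  "!!k m x. \<lbrakk>x : Car X k; m = k - 1\<rbrakk> \<Longrightarrow> h k x : Car Y m"
  "!!k x y. \<lbrakk>x : Car X k; y : Car X k\<rbrakk> \<Longrightarrow> h k (x *[cgrp X k] y) = h k x *[cgrp Y (k - 1)] h k y"
  "!!n x. x : Car X n ==> f n x = f' n x *[cgrp Y n] (cdiff Y (n - 1) (h n x) *[cgrp Y n] h (n + 1) (cdiff X n x))"
  by (rule htpE) blast
 from 2 obtain h' where h':
  "!!k m x. \<lbrakk>x : Car X k; m = k - 1\<rbrakk> \<Longrightarrow> h' k x : Car Y m"
  "!!k x y. \<lbrakk>x : Car X k; y : Car X k\<rbrakk> \<Longrightarrow> h' k (x *[cgrp X k] y) = h' k x *[cgrp Y (k - 1)] h' k y"
  "!!n x. x : Car X n ==> g n x = g' n x *[cgrp Y n] (cdiff Y (n - 1) (h' n x) *[cgrp Y n] h' (n + 1) (cdiff X n x))"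
  by (rule htpE) blast
 note f = htpD(1)[OF 1] htpD(2)[OF 1] and g = htpD(1)[OF 2] htpD(2)[OF 2]
 note [simp] = cx_simps[OF cmapD(1)[OF f(1)]] cx_simps[OF cmapD(2)[OF f(1)]] cmap_simps[OF f(2)] cmap_simps[OF g(2)] h(1,2) h'(1,2)
 interpret Y: comm_group "cgrp Y i" for i using cmapD(2)[OF f(1)] by (rule comm_group_cgrp)
 show ?thesis
 proof (rule htpI[of _ _ _ _ "%n x. h n x *[cgrp Y (n - 1)] h' n x"])
  fix n x assume x: "x : Car X n"
  have c: "f' n x : Car Y n" "g' n x : Car Y n" "cdiff Y (n - 1) (h n x) : Car Y n" "h (n + 1) (cdiff X n x) : Car Y n"
   "cdiff Y (n - 1) (h' n x) : Car Y n" "h' (n + 1) (cdiff X n x) : Car Y n"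
   using x by simp_all
  show "add_map Y f g n x = add_map Y f' g' n x *[cgrp Y n] (cdiff Y (n - 1) (h n x *[cgrp Y (n - 1)] h' n x) *[cgrp Y n]
   (h (n + 1) (cdiff X n x) *[cgrp Y (n + 1 - 1)] h' (n + 1) (cdiff X n x)))"
   using x by (simp add: h(3) h'(3) add_map_def) (use c in algebra)
 next
  fix i x y assume "x : Car X i" "y : Car X i"
  then have "h i x : Car Y (i - 1)" "h i y : Car Y (i - 1)" "h' i x : Car Y (i - 1)" "h' i y : Car Y (i - 1)"
   "h i (x *[cgrp X i] y) = h i x *[cgrp Y (i - 1)] h i y" "h' i (x *[cgrp X i] y) = h' i x *[cgrp Y (i - 1)] h' i y" by simp_all
  then show "h i (x *[cgrp X i] y) *[cgrp Y (i - 1)] h' i (x *[cgrp X i] y) =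
   h i x *[cgrp Y (i - 1)] h' i x *[cgrp Y (i - 1)] (h i y *[cgrp Y (i - 1)] h' i y)"
   by algebra
 qed (simp_all add: f g cmap_add)
qed

definition cohom :: "'a cochain_complex => int => 'a => 'a => bool" where
 "cohom X n x y \<longleftrightarrow> (\<exists>z\<in>Car X (n - 1). x = y *[cgrp X n] cdiff X (n - 1) z)"

lemma cohom_iff:
 assumes X: "is_complex X" and y: "y : Car X n"
 shows "cohom X n x y \<longleftrightarrow> x : Car X n \<and> x *[cgrp X n] inv[cgrp X n] y : Bd X n"
proof -
 interpret K: comm_group "cgrp X n" using X by (rule comm_group_cgrp)
 note [simp] = cx_simps[OF X]
 show ?thesis
 proof
  assume "cohom X n x y"
  then obtain z where z: "z : Car X (n - 1)" "x = y *[cgrp X n] cdiff X (n - 1) z" by (auto simp: cohom_def)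
  have c: "cdiff X (n - 1) z : Car X n" using z by simp
  have "x *[cgrp X n] inv[cgrp X n] y = cdiff X (n - 1) z" unfolding z(2) using y c by algebra
  then show "x : Car X n \<and> x *[cgrp X n] inv[cgrp X n] y : Bd X n"
   using z y by (auto simp: coboundaries_iff)
 next
  assume "x : Car X n \<and> x *[cgrp X n] inv[cgrp X n] y : Bd X n"
  then obtain z where z: "x : Car X n" "z : Car X (n - 1)" "x *[cgrp X n] inv[cgrp X n] y = cdiff X (n - 1) z"
   by (auto simp: coboundaries_iff)
  then have "x = y *[cgrp X n] cdiff X (n - 1) z" unfolding z(3)[symmetric] using y z(1) by algebra
  then show "cohom X n x y" using z by (auto simp: cohom_def)
 qed
qed

lemma cohom_refl: "\<lbrakk>is_complex X; x : Car X n\<rbrakk> \<Longrightarrow> cohom X n x x"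
 by (simp add: cohom_iff cx_simps subgroup.one_closed[OF coboundaries_subgroup])

lemma cohom_sym:
 assumes X: "is_complex X" and y: "y : Car X n" and "cohom X n x y" shows "cohom X n y x"
proof -
 interpret K: comm_group "cgrp X n" using X by (rule comm_group_cgrp)
 have x: "x : Car X n" and b: "x *[cgrp X n] inv[cgrp X n] y : Bd X n"
  using assms by (auto simp: cohom_iff)
 have "inv[cgrp X n] (x *[cgrp X n] inv[cgrp X n] y) : Bd X n"
  using b by (rule subgroup.m_inv_closed[OF coboundaries_subgroup[OF X]])
 moreover have "inv[cgrp X n] (x *[cgrp X n] inv[cgrp X n] y) = y *[cgrp X n] inv[cgrp X n] x"
  using x y by algebra
 ultimately show ?thesis using X x y by (simp add: cohom_iff)
qed

lemma cohom_trans: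
 assumes X: "is_complex X" and z: "z : Car X n" and "cohom X n x y" "cohom X n y z" shows "cohom X n x z"
proof -
 interpret K: comm_group "cgrp X n" using X by (rule comm_group_cgrp)
 have y: "y : Car X n" and b: "y *[cgrp X n] inv[cgrp X n] z : Bd X n"
  using assms by (auto simp: cohom_iff)
 have x: "x : Car X n" and a: "x *[cgrp X n] inv[cgrp X n] y : Bd X n"
  using assms y by (auto simp: cohom_iff)
 have "(x *[cgrp X n] inv[cgrp X n] y) *[cgrp X n] (y *[cgrp X n] inv[cgrp X n] z) : Bd X n"
  by (rule subgroup.m_closed[OF coboundaries_subgroup[OF X] a b])
 moreover have "(x *[cgrp X n] inv[cgrp X n] y) *[cgrp X n] (y *[cgrp X n] inv[cgrp X n] z) = x *[cgrp X n] inv[cgrp X n] z"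
  using x y z by algebra
 ultimately show ?thesis using X x z by (simp add: cohom_iff)
qed

lemma cohom_one_iff: "is_complex X ==> cohom X n x 1[cgrp X n] \<longleftrightarrow> x : Bd X n"
 by (auto simp: cohom_def coboundaries_iff cx_simps)

lemma cohom_coboundary:
 assumes X: "is_complex X" and "cohom X n x y" "y : Bd X n" shows "x : Bd X n"
 using cohom_trans[OF X _ assms(2), of "1[cgrp X n]"] assms(3)
 by (simp add: cohom_one_iff[OF X] cx_simps[OF X])

lemma cohom_pow:
 assumes X: "is_complex X" and y: "y : Car X n" and "cohom X n x y"
 shows "cohom X n (x ^[cgrp X n] (k::nat)) (y ^[cgrp X n] k)"
proof -
 interpret K: comm_group "cgrp X n" using X by (rule comm_group_cgrp)
 note [simp] = cx_simps[OF X]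
 obtain z where z: "z : Car X (n - 1)" "x = y *[cgrp X n] cdiff X (n - 1) z"
  using assms by (auto simp: cohom_def)
 have "x ^[cgrp X n] k = y ^[cgrp X n] k *[cgrp X n] cdiff X (n - 1) (z ^[cgrp X (n - 1)] k)"
  using z y by (simp add: K.pow_mult_distrib_nat)
 then show ?thesis unfolding cohom_def using z(1) by (blast intro: cx_simps(15)[OF X])
qed

lemma cohom_cmap:
 assumes f: "cmap X Y f" and y: "y : Car X n" and "cohom X n x y" shows "cohom Y n (f n x) (f n y)"
proof -
 note [simp] = cx_simps[OF cmapD(1)[OF f]] cmap_simps[OF f]
 obtain z where z: "z : Car X (n - 1)" "x = y *[cgrp X n] cdiff X (n - 1) z"
  using assms by (auto simp: cohom_def)
 then have "f n x = f n y *[cgrp Y n] cdiff Y (n - 1) (f (n - 1) z)" using y by simp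
 then show ?thesis unfolding cohom_def using z(1) by (blast intro: cmap_simps(1)[OF f])
qed

lemma htp_cohom:
 assumes "htp X Y f g" and x: "x : Cy X n" shows "cohom Y n (f n x) (g n x)"
proof -
 from assms(1) obtain h where h:
  "!!k m x. \<lbrakk>x : Car X k; m = k - 1\<rbrakk> \<Longrightarrow> h k x : Car Y m"
  "!!k x y. \<lbrakk>x : Car X k; y : Car X k\<rbrakk> \<Longrightarrow> h k (x *[cgrp X k] y) = h k x *[cgrp Y (k - 1)] h k y"
  "!!n x. x : Car X n ==> f n x = g n x *[cgrp Y n] (cdiff Y (n - 1) (h n x) *[cgrp Y n] h (n + 1) (cdiff X n x))"
  by (rule htpE) blast
 note f = htpD(1)[OF assms(1)]
 note [simp] = cx_simps[OF cmapD(1)[OF f]] cx_simps[OF cmapD(2)[OF f]] cmap_simps[OF htpD(2)[OF assms(1)]] h(1)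
 interpret Y: comm_group "cgrp Y i" for i using cmapD(2)[OF f] by (rule comm_group_cgrp)
 \<comment> \<open>Only multiplicativity of \<open>h\<close> is available; cancellation gives its
   value at the unit, and so the term with \<open>cdiff X n x\<close> disappears on
   cocycles.\<close>
 have "h (n + 1) 1[cgrp X (n + 1)] *[cgrp Y n] h (n + 1) 1[cgrp X (n + 1)] = h (n + 1) 1[cgrp X (n + 1)]"
  using h(2)[of "1[cgrp X (n + 1)]" "n + 1" "1[cgrp X (n + 1)]"] by simp
 then have e: "h (n + 1) 1[cgrp X (n + 1)] = 1[cgrp Y n]"
  using Y.l_cancel_one[of "h (n + 1) 1[cgrp X (n + 1)]" n "h (n + 1) 1[cgrp X (n + 1)]"] by simp
 have x': "x : Car X n" "cdiff X n x = 1[cgrp X (n + 1)]" using x by (auto simp: cocycles_iff)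
 have "f n x = g n x *[cgrp Y n] cdiff Y (n - 1) (h n x)" unfolding h(3)[OF x'(1)] x'(2) e using x'(1) by simp
 then show ?thesis using x unfolding cohom_def by (auto simp: cocycles_iff)
qed

lemma qis_iff_cohom:
 "qis X Y f \<longleftrightarrow> cmap X Y f \<and> (\<forall>n. (\<forall>x\<in>Cy X n. f n x : Bd Y n --> x : Bd X n) \<and>
  (\<forall>y\<in>Cy Y n. \<exists>x\<in>Cy X n. cohom Y n y (f n x)))"
 by (simp add: qis_def cohom_def)

lemma qis_inj: "\<lbrakk>qis X Y f; x : Cy X n; f n x : Bd Y n\<rbrakk> \<Longrightarrow> x : Bd X n"
 by (auto simp: qis_def)

lemma qis_surj: "\<lbrakk>qis X Y f; y : Cy Y n\<rbrakk> \<Longrightarrow> \<exists>x\<in>Cy X n. cohom Y n y (f n x)"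
 by (simp add: qis_iff_cohom)

lemma qis_htp:
 assumes "htp X Y f g" "qis X Y f" shows "qis X Y g"
 unfolding qis_iff_cohom
proof (intro conjI allI ballI impI)
 note f = htpD(1)[OF assms(1)]
 note Y = cmapD(2)[OF f]
 show g: "cmap X Y g" by (rule htpD(2)[OF assms(1)])
 fix n
 { fix x assume x: "x : Cy X n" "g n x : Bd Y n"
  then show "x : Bd X n"
   using assms(2) cohom_coboundary[OF Y htp_cohom[OF assms(1) x(1)]] by (auto simp: qis_def) }
 { fix y assume y: "y : Cy Y n"
  then obtain x where x: "x : Cy X n" "cohom Y n y (f n x)" using qis_surj[OF assms(2)] by blast
  then show "\<exists>x\<in>Cy X n. cohom Y n y (g n x)"
   using cohom_trans[OF Y _ x(2) htp_cohom[OF assms(1) x(1)]] cmap_cocycle[OF g x(1)] by (auto simp: cocycles_iff) }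
qed

lemma qis_comp:
 assumes f: "qis X Y f" and g: "qis Y Z g" shows "qis X Z (comp_map g f)"
 unfolding qis_iff_cohom
proof (intro conjI allI ballI impI)
 note fc = qis_cmap[OF f] and gc = qis_cmap[OF g]
 note Z = cmapD(2)[OF gc]
 show gf: "cmap X Z (comp_map g f)" by (rule cmap_comp[OF fc gc])
 fix n
 { fix x assume x: "x : Cy X n" "comp_map g f n x : Bd Z n"
  then show "x : Bd X n"
   using f g cmap_cocycle[OF fc x(1)] by (auto simp: qis_iff_cohom) }
 { fix z assume "z : Cy Z n"
  then obtain y where y: "y : Cy Y n" "cohom Z n z (g n y)" using qis_surj[OF g] by blast
  then obtain x where x: "x : Cy X n" "cohom Y n y (f n x)" using qis_surj[OF f] by blast
  then have "cohom Z n (g n y) (g n (f n x))" using cohom_cmap[OF gc _ x(2)] cmap_cocycle[OF fc x(1)] by (auto simp: cocycles_iff)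
  then show "\<exists>x\<in>Cy X n. cohom Z n z (comp_map g f n x)"
   using cohom_trans[OF Z _ y(2)] x(1) cmap_cocycle[OF gf x(1)] by (intro bexI[OF _ x(1)]) (auto simp: cocycles_iff) }
qed

text \<open>The case of two-out-of-three that is needed for the diagonal of a homotopy pullback. For
  surjectivity, y is compared with the class obtained by lifting its image in Z: the difference is
  killed by g, hence a coboundary.\<close>

lemma qis_cancel_left:
 assumes gf: "qis X Z (comp_map g f)" and g: "qis Y Z g" and fc: "cmap X Y f" shows "qis X Y f"
 unfolding qis_iff_cohom
proof (intro conjI allI ballI impI)
 note gc = qis_cmap[OF g]
 note Y = cmapD(1)[OF gc] and Z = cmapD(2)[OF gc]
 show "cmap X Y f" by fact
 fix n
 { fix x assume x: "x : Cy X n" "f n x : Bd Y n"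
  then show "x : Bd X n"
   using gf cmap_coboundary[OF gc x(2)] by (auto simp: qis_iff_cohom) }
 { fix y assume y: "y : Cy Y n"
  then have gy: "g n y : Cy Z n" by (rule cmap_cocycle[OF gc])
  then obtain x where x: "x : Cy X n" "cohom Z n (g n y) (g n (f n x))" using qis_surj[OF gf gy] by auto
  note fx = cmap_cocycle[OF fc x(1)]
  have car: "y : Car Y n" "f n x : Car Y n" "g n (f n x) : Car Z n"
   using y fx cmap_cocycle[OF gc fx] by (auto simp: cocycles_iff)
  have "y *[cgrp Y n] inv[cgrp Y n] f n x : Cy Y n"
   using y fx subgroup.m_closed[OF cocycles_subgroup[OF Y]] subgroup.m_inv_closed[OF cocycles_subgroup[OF Y]] by blast
  moreover have "g n (y *[cgrp Y n] inv[cgrp Y n] f n x) : Bd Z n"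
   using x(2) car by (simp add: cohom_iff[OF Z] cmap_simps[OF gc] cx_simps[OF Y])
  ultimately have "cohom Y n y (f n x)"
   using g car by (auto simp: qis_def cohom_iff[OF Y])
  then show "\<exists>x\<in>Cy X n. cohom Y n y (f n x)" using x by blast }
qed

lemma cmap_inverse:
 assumes f: "cmap X Y f" and b: "!!n. bij_betw (f n) (Car X n) (Car Y n)"
 shows "cmap Y X (%n. inv_into (Car X n) (f n))"
proof -
 let ?g = "%n. inv_into (Car X n) (f n)"
 have g: "!!n y. y : Car Y n ==> ?g n y : Car X n" "!!n y. y : Car Y n ==> f n (?g n y) = y"
  "!!n x. x : Car X n ==> ?g n (f n x) = x"
  using b by (auto simp: bij_betw_def f_inv_into_f inv_into_into)
 note [simp] = cmap_simps[OF f] cx_simps[OF cmapD(1)[OF f]]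
 show ?thesis
 proof (rule cmapI[OF cmapD(2,1)[OF f]])
  fix n x y assume "x : Car Y n" "y : Car Y n"
  then show "?g n (x *[cgrp Y n] y) = ?g n x *[cgrp X n] ?g n y"
   using g(3)[of "?g n x *[cgrp X n] ?g n y" n] by (simp add: g)
 next
  fix n x assume x: "x : Car Y n"
  have "?g (n + 1) (f (n + 1) (cdiff X n (?g n x))) = cdiff X n (?g n x)" using x by (intro g(3)) (simp add: g)
  then show "?g (n + 1) (cdiff Y n x) = cdiff X n (?g n x)" using x by (simp add: g)
 qed (simp add: g)
qed

lemma qis_of_inverse:
 assumes f: "cmap X Y f" and g: "cmap Y X g"
  and gf: "!!n x. x : Car X n ==> g n (f n x) = x" and fg: "!!n y. y : Car Y n ==> f n (g n y) = y"
 shows "qis X Y f"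
 unfolding qis_iff_cohom
proof (intro conjI allI ballI impI)
 fix n
 { fix x assume x: "x : Cy X n" "f n x : Bd Y n"
  show "x : Bd X n" using cmap_coboundary[OF g x(2)] x(1) by (simp add: gf cocycles_iff) }
 { fix y assume "y : Cy Y n"
  then show "\<exists>x\<in>Cy X n. cohom Y n y (f n x)"
   using cmap_cocycle[OF g] by (intro bexI[of _ "g n y"]) (auto simp: fg cocycles_iff intro: cohom_refl cmapD(2)[OF f]) }
qed fact

lemma qis_id: "is_complex X ==> qis X X id_map"
 by (rule qis_of_inverse[OF cmap_id cmap_id]) simp_all

lemma qis_bij:
 assumes f: "cmap X Y f" and b: "!!n. bij_betw (f n) (Car X n) (Car Y n)"
 shows "qis X Y f" and "qis Y X (%n. inv_into (Car X n) (f n))"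
 using b by (auto intro!: qis_of_inverse f cmap_inverse simp: bij_betw_def f_inv_into_f inv_into_into)

text \<open>The homotopy pullback: up to signs, the cone of the difference of \<open>f\<close> and
  \<open>t\<close> on the sum of W and V, shifted by -1. A chain map into it is a pair of maps to W
  and V together with a homotopy, which is kept in the third component.\<close>

definition hpull ::
 "'a cochain_complex => 'b cochain_complex => 'c cochain_complex => ('a, 'c) graded_map => ('b, 'c) graded_map =>
  ('a \<times> 'b \<times> 'c) cochain_complex" where
 "hpull W V Y f t = \<lparr>cgrp = (%n. cgrp W n \<times>\<times> (cgrp V n \<times>\<times> cgrp Y (n - 1))),
  cdiff = (%n (w, v, y). (cdiff W n w, cdiff V n v,
    f n w *[cgrp Y n] (inv[cgrp Y n] (t n v) *[cgrp Y n] inv[cgrp Y n] (cdiff Y (n - 1) y))))\<rparr>"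

lemma hpull_simps [simp]:
 "cgrp (hpull W V Y f t) n = cgrp W n \<times>\<times> (cgrp V n \<times>\<times> cgrp Y (n - 1))"
 "cdiff (hpull W V Y f t) n (w, v, y) = (cdiff W n w, cdiff V n v,
    f n w *[cgrp Y n] (inv[cgrp Y n] (t n v) *[cgrp Y n] inv[cgrp Y n] (cdiff Y (n - 1) y)))"
 by (simp_all add: hpull_def)

lemma is_complex_hpull:
 assumes f: "cmap W Y f" and t: "cmap V Y t" shows "is_complex (hpull W V Y f t)"
proof -
 note W = cmapD(1)[OF f] and V = cmapD(1)[OF t] and Y = cmapD(2)[OF t]
 note [simp] = cx_simps[OF W] cx_simps[OF V] cx_simps[OF Y] cmap_simps[OF f] cmap_simps[OF t]
 interpret Y: comm_group "cgrp Y i" for i using Y by (rule comm_group_cgrp)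
 show ?thesis
 proof (rule is_complexI)
  fix n x y assume xy: "x : Car (hpull W V Y f t) n" "y : Car (hpull W V Y f t) n"
  obtain a b c a' b' c' where e: "x = (a, b, c)" "y = (a', b', c')" by (cases x, cases y) auto
  have c: "f n a : Car Y n" "f n a' : Car Y n" "t n b : Car Y n" "t n b' : Car Y n"
   "cdiff Y (n - 1) c : Car Y n" "cdiff Y (n - 1) c' : Car Y n" using xy e by simp_all
  show "cdiff (hpull W V Y f t) n (x *[cgrp (hpull W V Y f t) n] y) =
   cdiff (hpull W V Y f t) n x *[cgrp (hpull W V Y f t) (n + 1)] cdiff (hpull W V Y f t) n y"
   using xy e by simp (use c in algebra)
 next
  fix n x assume x: "x : Car (hpull W V Y f t) n"
  obtain a b c where e: "x = (a, b, c)" by (cases x) auto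
  have c: "cdiff Y n (f n a) : Car Y (1 + n)" "cdiff Y n (t n b) : Car Y (1 + n)" using x e by (simp_all add: add.commute)
  show "cdiff (hpull W V Y f t) (n + 1) (cdiff (hpull W V Y f t) n x) = 1[cgrp (hpull W V Y f t) (n + 2)]"
   using x e by (simp add: add.commute) (use c in algebra)
 qed (auto simp: comm_group_DirProd comm_group_cgrp W V Y)
qed

lemma hpull_proj:
 assumes f: "cmap W Y f" and t: "cmap V Y t"
 shows "cmap (hpull W V Y f t) W (%n (w, v, y). w)" "cmap (hpull W V Y f t) V (%n (w, v, y). v)"
  and "htp (hpull W V Y f t) Y (comp_map f (%n (w, v, y). w)) (comp_map t (%n (w, v, y). v))"
proof -
 note W = cmapD(1)[OF f] and V = cmapD(1)[OF t] and Y = cmapD(2)[OF t]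
 note [simp] = cx_simps[OF W] cx_simps[OF V] cx_simps[OF Y] cmap_simps[OF f] cmap_simps[OF t]
 interpret Y: comm_group "cgrp Y i" for i using Y by (rule comm_group_cgrp)
 show 1: "cmap (hpull W V Y f t) W (%n (w, v, y). w)"
  by (rule cmapI) (auto simp: is_complex_hpull[OF f t] W)
 show 2: "cmap (hpull W V Y f t) V (%n (w, v, y). v)"
  by (rule cmapI) (auto simp: is_complex_hpull[OF f t] V)
 show "htp (hpull W V Y f t) Y (comp_map f (%n (w, v, y). w)) (comp_map t (%n (w, v, y). v))"
 proof (rule htpI[OF cmap_comp[OF 1 f] cmap_comp[OF 2 t], of "%n (w, v, y). y"])
  fix n x assume x: "x : Car (hpull W V Y f t) n"
  obtain a b c where e: "x = (a, b, c)" by (cases x) auto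
  have c: "f n a : Car Y n" "t n b : Car Y n" "cdiff Y (n - 1) c : Car Y n" using x e by simp_all
  show "comp_map f (%n (w, v, y). w) n x = comp_map t (%n (w, v, y). v) n x *[cgrp Y n]
   (cdiff Y (n - 1) (case x of (w, v, y) => y) *[cgrp Y n] (case cdiff (hpull W V Y f t) n x of (w, v, y) => y))"
   using e by simp (use c in algebra)
 qed auto
qed

text \<open>The kernel of the projection is a shifted cone of \<open>t\<close>, hence acyclic; the
  proof spells this out on elements. Surjectivity lifts the image of a cocycle of W along
  \<open>t\<close>, injectivity uses \<open>t\<close> in the two degrees n and n - 1.\<close>

lemma hpull_proj_qis:
 assumes f: "cmap W Y f" and tq: "qis V Y t"
 shows "qis (hpull W V Y f t) W (%n (w, v, y). w)"
 unfolding qis_iff_cohom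
proof (intro conjI allI ballI impI)
 note t = qis_cmap[OF tq]
 note W = cmapD(1)[OF f] and V = cmapD(1)[OF t] and Y = cmapD(2)[OF t]
 note [simp] = cx_simps[OF W] cx_simps[OF V] cx_simps[OF Y] cmap_simps[OF f] cmap_simps[OF t]
 interpret Y: comm_group "cgrp Y i" for i using Y by (rule comm_group_cgrp)
 interpret V: comm_group "cgrp V i" for i using V by (rule comm_group_cgrp)
 let ?E = "hpull W V Y f t"
 show "cmap ?E W (%n (w, v, y). w)" by (rule hpull_proj[OF f t])
 fix n
 { fix w assume w: "w : Cy W n"
  then have "f n w : Cy Y n" by (rule cmap_cocycle[OF f])
  then obtain v where v: "v : Cy V n" "cohom Y n (f n w) (t n v)" using qis_surj[OF tq] by blast
  then obtain z where z: "z : Car Y (n - 1)" "f n w = t n v *[cgrp Y n] cdiff Y (n - 1) z" by (auto simp: cohom_def)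
  have c: "t n v : Car Y n" "cdiff Y (n - 1) z : Car Y n" using v z by (auto simp: cocycles_iff)
  have "f n w *[cgrp Y n] (inv[cgrp Y n] (t n v) *[cgrp Y n] inv[cgrp Y n] (cdiff Y (n - 1) z)) = 1[cgrp Y n]"
   unfolding z(2) using c by algebra
  then have "(w, v, z) : Cy ?E n" using w v z by (auto simp: cocycles_iff)
  then show "\<exists>x\<in>Cy ?E n. cohom W n w (case x of (w, v, y) => w)"
   using w by (intro bexI[of _ "(w, v, z)"]) (auto simp: cocycles_iff intro: cohom_refl[OF W]) }
 { fix x assume x: "x : Cy ?E n" "(case x of (w, v, y) => w) : Bd W n"
  obtain w v y where e: "x = (w, v, y)" by (cases x) auto
  from x e obtain w' where w': "w' : Car W (n - 1)" "w = cdiff W (n - 1) w'" by (auto simp: coboundaries_iff)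
  have v: "v : Car V n" "cdiff V n v = 1[cgrp V (n + 1)]" and y: "y : Car Y (n - 1)"
   and eq: "f n w *[cgrp Y n] (inv[cgrp Y n] (t n v) *[cgrp Y n] inv[cgrp Y n] (cdiff Y (n - 1) y)) = 1[cgrp Y n]"
   using x e by (auto simp: cocycles_iff)
  have fw: "f n w = cdiff Y (n - 1) (f (n - 1) w')" unfolding w'(2) using w'(1) by simp
  have cw: "cdiff Y (n - 1) (f (n - 1) w') : Car Y n" "t n v : Car Y n" "cdiff Y (n - 1) y : Car Y n"
   using w' v y by simp_all
  have "t n v = (f n w *[cgrp Y n] inv[cgrp Y n] (cdiff Y (n - 1) y)) *[cgrp Y n]
   inv[cgrp Y n] (f n w *[cgrp Y n] (inv[cgrp Y n] (t n v) *[cgrp Y n] inv[cgrp Y n] (cdiff Y (n - 1) y)))"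
   using cw unfolding fw by algebra
  also have "\<dots> = cdiff Y (n - 1) (f (n - 1) w' *[cgrp Y (n - 1)] inv[cgrp Y (n - 1)] y)"
   unfolding eq using w' y cw by (simp add: fw)
  finally have tv: "t n v = cdiff Y (n - 1) (f (n - 1) w' *[cgrp Y (n - 1)] inv[cgrp Y (n - 1)] y)" .
  have "t n v : Bd Y n" unfolding tv coboundaries_def using w' y by (intro imageI) simp
  then have "v : Bd V n" using v by (intro qis_inj[OF tq]) (auto simp: cocycles_iff)
  then obtain v' where v': "v' : Car V (n - 1)" "v = cdiff V (n - 1) v'" by (auto simp: coboundaries_iff)
  \<comment> \<open>The elements \<open>w'\<close> and \<open>v'\<close> bound w and v but need not
    account for \<open>y\<close>; the defect \<open>y'\<close> is a cocycle. Surjectivity of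
    \<open>t\<close> in degree n - 1 writes it as the image of \<open>v2\<close> times a coboundary,
    and correcting \<open>v'\<close> by \<open>v2\<close> removes it.\<close>
  define y' where "y' = f (n - 1) w' *[cgrp Y (n - 1)] (inv[cgrp Y (n - 1)] (t (n - 1) v') *[cgrp Y (n - 1)] inv[cgrp Y (n - 1)] y)"
  have y'c: "y' : Car Y (n - 1)" using w' v' y by (simp add: y'_def)
  have tv': "t n v = cdiff Y (n - 1) (t (n - 1) v')" unfolding v'(2) using v'(1) by simp
  have "cdiff Y (n - 1) y' = cdiff Y (n - 1) (f (n - 1) w') *[cgrp Y n]
   (inv[cgrp Y n] (cdiff Y (n - 1) (t (n - 1) v')) *[cgrp Y n] inv[cgrp Y n] (cdiff Y (n - 1) y))"
   using w' v' y by (simp add: y'_def)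
  also have "\<dots> = 1[cgrp Y n]" by (rule eq[unfolded fw tv'])
  finally have "y' : Cy Y (n - 1)" using y'c by (simp add: cocycles_iff)
  then obtain v2 where v2: "v2 : Cy V (n - 1)" "cohom Y (n - 1) y' (t (n - 1) v2)" using qis_surj[OF tq] by blast
  then obtain y2 where y2: "y2 : Car Y (n - 2)" "y' = t (n - 1) v2 *[cgrp Y (n - 1)] cdiff Y (n - 2) y2"
   by (auto simp: cohom_def)
  have v2c: "v2 : Car V (n - 1)" "cdiff V (n - 1) v2 = 1[cgrp V n]" using v2 by (auto simp: cocycles_iff)
  let ?p = "(w', v' *[cgrp V (n - 1)] v2, y2)"
  have c: "f (n - 1) w' : Car Y (n - 1)" "t (n - 1) v' : Car Y (n - 1)" "t (n - 1) v2 : Car Y (n - 1)"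
    "cdiff Y (n - 2) y2 : Car Y (n - 1)"
   using w' v' v2c y2(1) by simp_all
  have "y = f (n - 1) w' *[cgrp Y (n - 1)] (inv[cgrp Y (n - 1)] (t (n - 1) v') *[cgrp Y (n - 1)] inv[cgrp Y (n - 1)] y')"
   unfolding y'_def using c y by algebra
  also have "\<dots> = f (n - 1) w' *[cgrp Y (n - 1)] (inv[cgrp Y (n - 1)] (t (n - 1) (v' *[cgrp V (n - 1)] v2)) *[cgrp Y (n - 1)] inv[cgrp Y (n - 1)] cdiff Y (n - 2) y2)"
   unfolding y2(2) using v' v2c by (simp) (use c in algebra)
  finally have "x = cdiff ?E (n - 1) ?p"
   unfolding e using w' v' v2c by simp
  moreover have "?p : Car ?E (n - 1)" using w' v' v2c y2(1) by simp
  ultimately show "x : Bd ?E n" unfolding coboundaries_iff by blast }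
qed

lemma hpull_univ:
 assumes f: "cmap W Y f" and t: "cmap V Y t" and a: "cmap N W a" and b: "cmap N V b"
  and h: "htp N Y (comp_map f a) (comp_map t b)"
 shows "\<exists>k. cmap N (hpull W V Y f t) k \<and> (\<forall>n x. fst (k n x) = a n x \<and> fst (snd (k n x)) = b n x)"
proof -
 from h obtain h where h:
  "!!k m x. \<lbrakk>x : Car N k; m = k - 1\<rbrakk> \<Longrightarrow> h k x : Car Y m"
  "!!k x y. \<lbrakk>x : Car N k; y : Car N k\<rbrakk> \<Longrightarrow> h k (x *[cgrp N k] y) = h k x *[cgrp Y (k - 1)] h k y"
  "!!n x. x : Car N n ==> comp_map f a n x = comp_map t b n x *[cgrp Y n] (cdiff Y (n - 1) (h n x) *[cgrp Y n] h (n + 1) (cdiff N n x))"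
  by (rule htpE) blast
 note N = cmapD(1)[OF a] and W = cmapD(1)[OF f] and V = cmapD(1)[OF t] and Y = cmapD(2)[OF t]
 note [simp] = cx_simps[OF W] cx_simps[OF V] cx_simps[OF Y] cx_simps[OF N] cmap_simps[OF f] cmap_simps[OF t]
  cmap_simps[OF a] cmap_simps[OF b] h(1,2)
 interpret Y: comm_group "cgrp Y i" for i using Y by (rule comm_group_cgrp)
 have "cmap N (hpull W V Y f t) (%n x. (a n x, b n x, h n x))"
 proof (rule cmapI[OF N is_complex_hpull[OF f t]])
  fix n x assume x: "x : Car N n"
  have e: "f n (a n x) = t n (b n x) *[cgrp Y n] (cdiff Y (n - 1) (h n x) *[cgrp Y n] h (n + 1) (cdiff N n x))"
   using h(3)[OF x] by simp
  have c: "t n (b n x) : Car Y n" "cdiff Y (n - 1) (h n x) : Car Y n" "h (n + 1) (cdiff N n x) : Car Y n"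
   using x by simp_all
  show "(a (n + 1) (cdiff N n x), b (n + 1) (cdiff N n x), h (n + 1) (cdiff N n x)) =
    cdiff (hpull W V Y f t) n (a n x, b n x, h n x)"
   using x unfolding hpull_simps e by simp (use c in algebra)
 qed auto
 then show ?thesis by (intro exI[of _ "%n x. (a n x, b n x, h n x)"]) simp
qed

section \<open>Subcomplexes, shifts, cones and transport into the universe\<close>

definition subcx :: "'a cochain_complex => (int => 'a set) => 'a cochain_complex" where
 "subcx X S = \<lparr>cgrp = (%n. (cgrp X n)\<lparr>carrier := S n\<rparr>), cdiff = cdiff X\<rparr>"

lemma subcx_simps [simp]:
 "cgrp (subcx X S) n = (cgrp X n)\<lparr>carrier := S n\<rparr>" "cdiff (subcx X S) = cdiff X"
 by (simp_all add: subcx_def)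

lemma is_complex_subcx:
 assumes X: "is_complex X" and S: "!!n. subgroup (S n) (cgrp X n)"
  and d: "!!n x. x : S n ==> cdiff X n x : S (n + 1)"
 shows "is_complex (subcx X S)" and "cmap (subcx X S) X id_map"
proof -
 note [simp] = cx_simps[OF X] subgroup.mem_carrier[OF S]
 show 1: "is_complex (subcx X S)"
  by (rule is_complexI) (auto simp: comm_group.comm_group_restrict[OF comm_group_cgrp[OF X] S] d add.assoc)
 show "cmap (subcx X S) X id_map"
  by (rule cmapI[OF 1 X]) simp_all
qed

definition zerocx :: "'a cochain_complex" where
 "zerocx = \<lparr>cgrp = (%n. \<lparr>carrier = {undefined}, monoid.mult = (%x y. undefined), one = undefined\<rparr>),
  cdiff = (%n x. undefined)\<rparr>"

lemma zerocx_simps [simp]: "Car zerocx n = {undefined}" "1[cgrp zerocx n] = undefined"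
 "x *[cgrp zerocx n] y = undefined" "cdiff zerocx n x = undefined"
 by (simp_all add: zerocx_def)

lemma is_complex_zerocx: "is_complex zerocx"
 by (rule is_complexI) (auto intro!: comm_groupI simp: zerocx_def)

lemma shift_complex_simps [simp]:
 "cgrp (Shf k X) n = cgrp X (n + k)"
 "cdiff (Shf k X) n x = (if even k then cdiff X (n + k) x else inv[cgrp X (n + k + 1)] (cdiff X (n + k) x))"
 by (simp_all add: shift_complex_def)

lemma is_complex_shift:
 assumes X: "is_complex X" shows "is_complex (Shf k X)"
proof -
 note [simp] = cx_simps[OF X]
 interpret X: comm_group "cgrp X i" for i using X by (rule comm_group_cgrp)
 have [simp]: "i + 1 + k = i + k + 1" "i + 2 + k = i + k + 2" for i by simp_all
 show ?thesis
  by (rule is_complexI) (auto simp: comm_group_cgrp[OF X] X.inv_mult add.commute[of 2])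
qed

lemma cmap_shift:
 assumes f: "cmap X Y f" shows "cmap (Shf k X) (Shf k Y) (shift_map k f)"
proof -
 note [simp] = cx_simps[OF cmapD(1)[OF f]] cx_simps[OF cmapD(2)[OF f]] cmap_simps[OF f]
 have [simp]: "i + 1 + k = i + k + 1" for i by simp
 show ?thesis
  by (rule cmapI) (auto simp: is_complex_shift cmapD[OF f] shift_map_def)
qed

lemma cocycles_shift:
 assumes X: "is_complex X" shows "Cy (Shf k X) n = Cy X (n + k)"
proof -
 note [simp] = cx_simps[OF X]
 interpret X: comm_group "cgrp X i" for i using X by (rule comm_group_cgrp)
 have [simp]: "i + 1 + k = i + k + 1" for i by simp
 show ?thesis by (cases "even k") (auto simp: cocycles_iff X.inv_eq_1_iff)
qed

lemma coboundaries_shift: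
 assumes X: "is_complex X" shows "Bd (Shf k X) n = Bd X (n + k)"
proof -
 note [simp] = cx_simps[OF X]
 have i: "n - 1 + k = n + k - 1" "n - 1 + k + 1 = n + k" by simp_all
 show ?thesis
 proof (cases "even k")
  case True then show ?thesis by (simp add: coboundaries_def i)
 next
  case False
  have "(%x. inv[cgrp X (n + k)] (cdiff X (n + k - 1) x)) ` Car X (n + k - 1) = cdiff X (n + k - 1) ` Car X (n + k - 1)"
   (is "?A = ?B")
  proof -
   have e: "inv[cgrp X (n + k)] (cdiff X (n + k - 1) x) = cdiff X (n + k - 1) (inv[cgrp X (n + k - 1)] x)"
    if "x : Car X (n + k - 1)" for x using that by simp
   have "?A = (%x. cdiff X (n + k - 1) (inv[cgrp X (n + k - 1)] x)) ` Car X (n + k - 1)"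
    using e by (intro image_cong) auto
   also have "\<dots> = cdiff X (n + k - 1) ` ((%x. inv[cgrp X (n + k - 1)] x) ` Car X (n + k - 1))" by (simp add: image_image)
   also have "(%x. inv[cgrp X (n + k - 1)] x) ` Car X (n + k - 1) = Car X (n + k - 1)"
   proof (intro equalityI subsetI)
    fix x assume "x : Car X (n + k - 1)"
    then show "x : (%x. inv[cgrp X (n + k - 1)] x) ` Car X (n + k - 1)"
     by (intro image_eqI[of _ _ "inv[cgrp X (n + k - 1)] x"]) auto
   qed auto
   finally show ?thesis .
  qed
  then show ?thesis using False by (simp add: coboundaries_def i)
 qed
qed

lemma htp_shift:
 assumes h: "htp X Y f g" shows "htp (Shf 1 X) (Shf 1 Y) (shift_map 1 f) (shift_map 1 g)"
proof -
 from h obtain h where h: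
  "!!k m x. \<lbrakk>x : Car X k; m = k - 1\<rbrakk> \<Longrightarrow> h k x : Car Y m"
  "!!k x y. \<lbrakk>x : Car X k; y : Car X k\<rbrakk> \<Longrightarrow> h k (x *[cgrp X k] y) = h k x *[cgrp Y (k - 1)] h k y"
  "!!n x. x : Car X n ==> f n x = g n x *[cgrp Y n] (cdiff Y (n - 1) (h n x) *[cgrp Y n] h (n + 1) (cdiff X n x))"
  by (rule htpE) blast
 note f = htpD(1)[OF assms] and g = htpD(2)[OF assms]
 note X = cmapD(1)[OF f] and Y = cmapD(2)[OF f]
 interpret Y: comm_group "cgrp Y i" for i using Y by (rule comm_group_cgrp)
 interpret h: group_hom "cgrp X k" "cgrp Y (k - 1)" "h k" for k
  using h X Y by (auto simp: group_hom_def group_hom_axioms_def group_cgrp hom_def)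
 note [simp] = cx_simps[OF X] cx_simps[OF Y] cmap_simps[OF f] cmap_simps[OF g] h(1,2)
 show ?thesis
 \<comment> \<open>The differentials of \<open>Shf 1\<close> are inverted, so the homotopy has to be
   inverted as well.\<close>
 proof (rule htpI[OF cmap_shift[OF f] cmap_shift[OF g], where h = "%n x. inv[cgrp Y n] h (n + 1) x"])
  fix n x assume x: "x : Car (Shf 1 X) n"
  have [simp]: "1 + n = n + 1" "2 + n = n + 2" by simp_all
  have "h (n + 2) (inv[cgrp X (n + 2)] cdiff X (n + 1) x) = inv[cgrp Y (n + 1)] h (n + 2) (cdiff X (n + 1) x)"
   using h.hom_inv[of "cdiff X (n + 1) x" "n + 2"] x by simp
  then show "shift_map 1 f n x = shift_map 1 g n x *[cgrp (Shf 1 Y) n]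
   (cdiff (Shf 1 Y) (n - 1) (inv[cgrp Y n] h (n + 1) x) *[cgrp (Shf 1 Y) n]
    inv[cgrp Y (n + 1)] h (n + 1 + 1) (cdiff (Shf 1 X) n x))"
   using x h(3)[of x "n + 1"] by (simp add: shift_map_def)
 qed (auto simp: Y.inv_mult)
qed

lemma qis_shift:
 assumes f: "qis X Y f" shows "qis (Shf k X) (Shf k Y) (shift_map k f)"
proof -
 note fc = qis_cmap[OF f]
 note X = cmapD(1)[OF fc] and Y = cmapD(2)[OF fc]
 have c: "cohom (Shf k Y) n x y \<longleftrightarrow> cohom Y (n + k) x y" if "y : Car Y (n + k)" for n x y
  using that by (simp add: cohom_iff Y is_complex_shift coboundaries_shift)
 show ?thesis
  unfolding qis_iff_cohom cocycles_shift[OF X] cocycles_shift[OF Y] coboundaries_shift[OF X] coboundaries_shift[OF Y]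
 proof (intro conjI allI ballI impI)
  show "cmap (Shf k X) (Shf k Y) (shift_map k f)" by (rule cmap_shift[OF fc])
  fix n
  { fix x assume "x : Cy X (n + k)" "shift_map k f n x : Bd Y (n + k)"
   then show "x : Bd X (n + k)" using qis_inj[OF f] by (simp add: shift_map_def) }
  { fix y assume "y : Cy Y (n + k)"
   then obtain x where x: "x : Cy X (n + k)" "cohom Y (n + k) y (f (n + k) x)" using qis_surj[OF f] by blast
   then have "f (n + k) x : Car Y (n + k)" using cmap_cocycle[OF fc] by (auto simp: cocycles_iff)
   then show "\<exists>x\<in>Cy X (n + k). cohom (Shf k Y) n y (shift_map k f n x)"
    using x c by (auto simp: shift_map_def) }
 qed
qed

lemma shift_shift_cmap:
 assumes X: "is_complex X" shows "cmap (Shf j (Shf k X)) (Shf (j + k) X) id_map"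
  "cmap (Shf (j + k) X) (Shf j (Shf k X)) id_map"
proof -
 note [simp] = cx_simps[OF X]
 show "cmap (Shf j (Shf k X)) (Shf (j + k) X) id_map"
  by (rule cmapI) (auto simp: is_complex_shift X ac_simps)
 show "cmap (Shf (j + k) X) (Shf j (Shf k X)) id_map"
  by (rule cmapI) (auto simp: is_complex_shift X ac_simps)
qed

lemma qis_shift_shift: "is_complex X ==> qis (Shf j (Shf k X)) (Shf (j + k) X) id_map"
 by (rule qis_of_inverse[OF shift_shift_cmap]) auto

lemma qis_shift_0:
 assumes X: "is_complex X" shows "qis (Shf 0 X) X id_map"
proof -
 have "cmap (Shf 0 X) X id_map" "cmap X (Shf 0 X) id_map"
  by (auto intro!: cmapI X is_complex_shift)
 then show ?thesis by (rule qis_of_inverse) auto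
qed

lemma cone_simps [simp]:
 "cgrp (cone X Y f) n = cgrp X (n + 1) \<times>\<times> cgrp Y n"
 "cdiff (cone X Y f) n (x, y) = (inv[cgrp X (n + 2)] (cdiff X (n + 1) x), f (n + 1) x *[cgrp Y (n + 1)] cdiff Y n y)"
 by (simp_all add: cone_def)

lemma is_complex_cone:
 assumes f: "cmap X Y f" shows "is_complex (cone X Y f)"
proof -
 note X = cmapD(1)[OF f] and Y = cmapD(2)[OF f]
 note [simp] = cx_simps[OF X] cx_simps[OF Y] cmap_simps[OF f]
 have [simp]: "2 + i = i + 2" "3 + i = i + 3" for i :: int by simp_all
 interpret Y: comm_group "cgrp Y i" for i using Y by (rule comm_group_cgrp)
 interpret X: comm_group "cgrp X i" for i using X by (rule comm_group_cgrp)
 show ?thesis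
 proof (rule is_complexI)
  fix n :: int and p q assume xy: "p : Car (cone X Y f) n" "q : Car (cone X Y f) n"
  obtain a b a' b' where e: "p = (a, b)" "q = (a', b')" by (cases p, cases q) auto
  have c: "f (n + 1) a : Car Y (n + 1)" "f (n + 1) a' : Car Y (n + 1)" "cdiff Y n b : Car Y (n + 1)" "cdiff Y n b' : Car Y (n + 1)"
   using xy e by simp_all
  show "cdiff (cone X Y f) n (p *[cgrp (cone X Y f) n] q) = cdiff (cone X Y f) n p *[cgrp (cone X Y f) (n + 1)] cdiff (cone X Y f) n q"
   using xy e by (simp add: X.inv_mult) (use c in algebra)
 next
  fix n :: int and p assume x: "p : Car (cone X Y f) n"
  show "cdiff (cone X Y f) (n + 1) (cdiff (cone X Y f) n p) = 1[cgrp (cone X Y f) (n + 2)]"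
   using x by (cases p) simp
 qed (auto simp: comm_group_DirProd comm_group_cgrp X Y)
qed

text \<open>Cones, homotopy pullbacks, direct sums and quotients are formed on other types.
  Smallness of the carriers gives injections into the universe, along which the whole structure is
  carried over.\<close>

lemma transport_complex:
 fixes X :: "'b cochain_complex"
 assumes X: "is_complex X" and s: "!!n. |Car X n| <o |UNIV :: 'u set|"
 shows "\<exists>(X' :: 'u cochain_complex) \<phi>. X' : small_complexes \<and> cmap X X' \<phi> \<and> (\<forall>n. bij_betw (\<phi> n) (Car X n) (Car X' n))"
proof -
 have "\<forall>n. \<exists>\<phi> :: 'b => 'u. inj_on \<phi> (Car X n)"
  using s[THEN ordLess_imp_ordLeq] by (auto simp: card_of_ordLeq[symmetric])
 then obtain \<phi> :: "int => 'b => 'u" where \<phi>: "!!n. inj_on (\<phi> n) (Car X n)" by metis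
 let ?i = "%n. inv_into (Car X n) (\<phi> n)"
 define X' where "X' = \<lparr>cgrp = (%n. \<lparr>carrier = \<phi> n ` Car X n, monoid.mult = (%x y. \<phi> n (?i n x *[cgrp X n] ?i n y)),
  one = \<phi> n 1[cgrp X n]\<rparr>), cdiff = (%n x. \<phi> (n + 1) (cdiff X n (?i n x)))\<rparr>"
 note [simp] = cx_simps[OF X] inv_into_f_f[OF \<phi>]
 interpret X: comm_group "cgrp X i" for i using X by (rule comm_group_cgrp)
 have cg: "comm_group (cgrp X' n)" for n
 proof (rule comm_groupI)
  fix x assume "x : carrier (cgrp X' n)"
  then obtain a where "a : Car X n" "x = \<phi> n a" by (auto simp: X'_def)
  then show "\<exists>y\<in>Car X' n. y *[cgrp X' n] x = 1[cgrp X' n]"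
   by (auto simp: X'_def intro!: bexI[of _ "inv[cgrp X n] a"])
 qed (auto simp: X'_def X.m_assoc X.m_comm X.m_lcomm)
 have X': "is_complex X'"
  by (rule is_complexI[OF cg]) (auto simp: X'_def add.assoc)
 have "cmap X X' \<phi>"
  by (rule cmapI[OF X X']) (auto simp: X'_def)
 moreover have "X' : small_complexes"
  using X' s by (auto simp: small_complexes_def small_def X'_def intro: ordLeq_ordLess_trans[OF card_of_image])
 moreover have "bij_betw (\<phi> n) (Car X n) (Car X' n)" for n
  using \<phi> by (auto simp: bij_betw_def X'_def)
 ultimately show ?thesis by blast
qed

section \<open>The Ore conditions and the equivalence of roofs\<close>

notation comp_map (infixr "\<cdot>" 75)

lemma sm_image: "|A| <o r ==> |f ` A| <o r"
 by (rule ordLeq_ordLess_trans[OF card_of_image])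

lemma sm_subset: "\<lbrakk>|B| <o r; A \<subseteq> B\<rbrakk> \<Longrightarrow> |A| <o r"
 by (rule ordLeq_ordLess_trans[OF card_of_mono1])

lemma sm_inj_on: "\<lbrakk>inj_on f A; |f ` A| <o r\<rbrakk> \<Longrightarrow> |A| <o r"
 by (rule ordIso_ordLess_trans[OF card_of_ordIsoI]) (auto simp: bij_betw_def)

lemma small_complex: "X : small_complexes ==> is_complex X" "X : small_complexes ==> |Car X n| <o |UNIV :: 'u set|"
 for X :: "'u cochain_complex"
 by (auto simp: small_complexes_def small_def)

text \<open>Regularity keeps small unions of small sets small; uncountability makes countable index
  sets small, as the telescope and the countable sums of copies of one object require.\<close>

locale universe =
 fixes U :: "'u itself"
 assumes regular: "regularCard |UNIV :: 'u set|" and uncountable: "natLeq <o |UNIV :: 'u set|"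
begin

abbreviation Sm :: "'u cochain_complex set" where "Sm \<equiv> small_complexes"

lemma infinite_univ: "infinite (UNIV :: 'u set)"
 using uncountable by (metis card_of_nat card_of_ordLess2 finite_iff_ordLess_natLeq infinite_UNIV_nat
  natLeq_Card_order not_ordLess_ordLeq ordLess_imp_ordLeq ordLess_irreflexive ordLess_transitive)

lemma sm_Sigma: "\<lbrakk>|A| <o |UNIV :: 'u set|; !!a. a : A ==> |F a| <o |UNIV :: 'u set|\<rbrakk> \<Longrightarrow> |Sigma A F| <o |UNIV :: 'u set|"
 using regularCard_stable[OF card_of_Card_order _ regular] infinite_univ
 by (intro stable_elim) (simp_all add: Field_card_of)

lemma sm_Times: "\<lbrakk>|A| <o |UNIV :: 'u set|; |B| <o |UNIV :: 'u set|\<rbrakk> \<Longrightarrow> |A \<times> B| <o |UNIV :: 'u set|"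
 by (rule sm_Sigma)

lemma sm_nat: "|UNIV :: nat set| <o |UNIV :: 'u set|"
 using uncountable card_of_nat ordIso_ordLess_trans by blast

lemma sm_countable: "countable A ==> |A| <o |UNIV :: 'u set|"
 by (rule sm_inj_on[of "to_nat_on A"]) (auto intro: sm_subset[OF sm_nat])

text \<open>The homotopy pullback of \<open>f\<close> and \<open>t\<close> supplies the square: its
  projection to W is a quasi-isomorphism because \<open>t\<close> is one.\<close>

lemma ore:
 assumes W: "W : Sm" and V: "V : Sm" and Y: "Y : Sm" and f: "cmap W Y f" and t: "qis V Y t"
 shows "\<exists>N\<in>Sm. \<exists>u v. qis N W u \<and> cmap N V v \<and> htp N Y (f \<cdot> u) (t \<cdot> v)"
proof -
 note tc = qis_cmap[OF t]
 let ?E = "hpull W V Y f t"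
 have "|Car ?E n| <o |UNIV :: 'u set|" for n
  by (simp add: sm_Times small_complex W V Y)
 then obtain N :: "'u cochain_complex" and \<phi> where N: "N : Sm" "cmap ?E N \<phi>" "\<forall>n. bij_betw (\<phi> n) (Car ?E n) (Car N n)"
  using transport_complex[OF is_complex_hpull[OF f tc]] by blast
 let ?i = "%n. inv_into (Car ?E n) (\<phi> n)"
 have i: "qis N ?E ?i" by (rule qis_bij(2)[OF N(2)]) (use N(3) in blast)
 note ic = qis_cmap[OF i]
 show ?thesis
 proof (intro bexI exI conjI)
  show "qis N W ((%n (w, v, y). w) \<cdot> ?i)" by (rule qis_comp[OF i hpull_proj_qis[OF f t]])
  show "cmap N V ((%n (w, v, y). v) \<cdot> ?i)" by (rule cmap_comp[OF ic hpull_proj(2)[OF f tc]])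
  show "htp N Y (f \<cdot> (%n (w, v, y). w) \<cdot> ?i) (t \<cdot> (%n (w, v, y). v) \<cdot> ?i)"
   using htp_comp_right[OF hpull_proj(3)[OF f tc] ic] by (simp add: comp_map_assoc)
 qed fact
qed

text \<open>The two maps factor through the homotopy pullback of \<open>t\<close> along itself, whose diagonal is a
 quasi-isomorphism; the Ore condition for the diagonal equalises them.\<close>

lemma ore_cancel:
 assumes N: "N : Sm" and V: "V : Sm" and Y: "Y : Sm" and t: "qis V Y t"
  and a: "cmap N V a" and b: "cmap N V b" and h: "htp N Y (t \<cdot> a) (t \<cdot> b)"
 shows "\<exists>M\<in>Sm. \<exists>c. qis M N c \<and> htp M V (a \<cdot> c) (b \<cdot> c)"
proof -
 note tc = qis_cmap[OF t]
 let ?E = "hpull V V Y t t"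
 let ?p = "%n (w, v, y). w" and ?q = "%n (w, v, y). v"
 have "|Car ?E n| <o |UNIV :: 'u set|" for n
  by (simp add: sm_Times small_complex V Y)
 then obtain E :: "'u cochain_complex" and \<phi> where E: "E : Sm" "cmap ?E E \<phi>" "\<forall>n. bij_betw (\<phi> n) (Car ?E n) (Car E n)"
  using transport_complex[OF is_complex_hpull[OF tc tc]] by blast
 let ?i = "%n. inv_into (Car ?E n) (\<phi> n)"
 have i: "qis E ?E ?i" and \<phi>: "qis ?E E \<phi>" using qis_bij[OF E(2)] E(3) by blast+
 note ic = qis_cmap[OF i]
 have i\<phi>: "?i n (\<phi> n x) = x" if "x : Car ?E n" for n x
  using E(3) that by (metis bij_betw_inv_into_left)
 have id: "cmap V V id_map" by (rule cmap_id[OF small_complex(1)[OF V]])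
 obtain \<Delta> where \<Delta>: "cmap V ?E \<Delta>" "\<forall>n x. fst (\<Delta> n x) = x \<and> fst (snd (\<Delta> n x)) = x"
  using hpull_univ[OF tc tc id id] htp_refl[OF tc] by auto
 obtain k where k: "cmap N ?E k" "\<forall>n x. fst (k n x) = a n x \<and> fst (snd (k n x)) = b n x"
  using hpull_univ[OF tc tc a b h] by auto
 have p\<Delta>: "?p \<cdot> \<Delta> = id_map" "?q \<cdot> \<Delta> = id_map"
  using \<Delta>(2) by (simp_all add: fun_eq_iff case_prod_beta)
 have pk: "?p \<cdot> k = a" "?q \<cdot> k = b"
  using k(2) by (simp_all add: fun_eq_iff case_prod_beta)
 have "qis V ?E \<Delta>"
  by (rule qis_cancel_left[OF _ hpull_proj_qis[OF tc t] \<Delta>(1)]) (simp add: p\<Delta> qis_id small_complex(1)[OF V])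
 then have \<phi>\<Delta>: "qis V E (\<phi> \<cdot> \<Delta>)" using qis_comp[OF _ \<phi>] by blast
 obtain M c v where M: "M : Sm" "qis M N c" "cmap M V v" "htp M E ((\<phi> \<cdot> k) \<cdot> c) ((\<phi> \<cdot> \<Delta>) \<cdot> v)"
  using ore[OF N V E(1) cmap_comp[OF k(1) E(2)] \<phi>\<Delta>] by blast
 note cc = qis_cmap[OF M(2)]
 have 1: "htp M ?E (k \<cdot> c) (?i \<cdot> (\<phi> \<cdot> k) \<cdot> c)"
  by (rule htp_of_eq) (auto intro!: cmap_comp cc k ic E simp: i\<phi> cmap_simps[OF k(1)] cmap_simps[OF cc] simp del: hpull_simps)
 have 2: "htp M ?E (?i \<cdot> (\<phi> \<cdot> \<Delta>) \<cdot> v) (\<Delta> \<cdot> v)"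
  by (rule htp_of_eq) (auto intro!: cmap_comp M(3) \<Delta> ic E simp: i\<phi> cmap_simps[OF \<Delta>(1)] cmap_simps[OF M(3)] simp del: hpull_simps)
 have 3: "htp M ?E (k \<cdot> c) (\<Delta> \<cdot> v)"
  by (rule htp_trans[OF htp_trans[OF 1 htp_comp_left[OF M(4) ic]] 2])
 have "htp M V (?p \<cdot> k \<cdot> c) (?p \<cdot> \<Delta> \<cdot> v)" "htp M V (?q \<cdot> k \<cdot> c) (?q \<cdot> \<Delta> \<cdot> v)"
  by (rule htp_comp_left[OF 3 hpull_proj(1)[OF tc tc]], rule htp_comp_left[OF 3 hpull_proj(2)[OF tc tc]])
 then have "htp M V (a \<cdot> c) v" "htp M V (b \<cdot> c) v"
  by (simp_all add: comp_map_assoc[symmetric] pk p\<Delta>)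
 then have "htp M V (a \<cdot> c) (b \<cdot> c)" using htp_sym htp_trans by blast
 then show ?thesis using M by blast
qed

definition is_roof :: "'u cochain_complex => 'u cochain_complex => 'u cochain_complex => ('u, 'u) graded_map => ('u, 'u) graded_map => bool" where
 "is_roof X Y W s f \<longleftrightarrow> W : Sm \<and> X : Sm \<and> Y : Sm \<and> qis W X s \<and> cmap W Y f"

lemma is_roofD: "is_roof X Y W s f ==> W : Sm" "is_roof X Y W s f ==> qis W X s" "is_roof X Y W s f ==> cmap W Y f"
 "is_roof X Y W s f ==> cmap W X s" "is_roof X Y W s f ==> X : Sm" "is_roof X Y W s f ==> Y : Sm"
 by (auto simp: is_roof_def qis_cmap)

lemma roofs_iff: "\<lbrakk>X : Sm; Y : Sm\<rbrakk> \<Longrightarrow> (W, s, f) : roofs X Y \<longleftrightarrow> is_roof X Y W s f"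
 by (auto simp: roofs_def is_roof_def cmap_def small_complex quasi_iso_iff_qis)

lemma roof_rel_iff:
 assumes X: "X : Sm" and Y: "Y : Sm"
 shows "((W, s, f), (W', s', f')) : roof_rel X Y \<longleftrightarrow> is_roof X Y W s f \<and> is_roof X Y W' s' f' \<and>
  (\<exists>N\<in>Sm. \<exists>u u'. cmap N W u \<and> cmap N W' u' \<and> qis N X (s \<cdot> u) \<and> htp N X (s \<cdot> u) (s' \<cdot> u') \<and> htp N Y (f \<cdot> u) (f' \<cdot> u'))"
proof (cases "is_roof X Y W s f \<and> is_roof X Y W' s' f'")
 case True
 then have r: "is_roof X Y W s f" "is_roof X Y W' s' f'" by auto
 have "(chain_map N W u \<and> chain_map N W' u' \<and> quasi_iso N X (s \<cdot> u) \<and> homotopic N X (s \<cdot> u) (s' \<cdot> u') \<and> homotopic N Y (f \<cdot> u) (f' \<cdot> u')) \<longleftrightarrow>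
  (cmap N W u \<and> cmap N W' u' \<and> qis N X (s \<cdot> u) \<and> htp N X (s \<cdot> u) (s' \<cdot> u') \<and> htp N Y (f \<cdot> u) (f' \<cdot> u'))" (is "?l \<longleftrightarrow> ?r")
  if N: "N : Sm" for N u u'
 proof -
  have c: "cmap N W u \<longleftrightarrow> chain_map N W u" "cmap N W' u' \<longleftrightarrow> chain_map N W' u'"
   using N r by (simp_all add: cmap_def small_complex is_roofD)
  have "htp N X (s \<cdot> u) (s' \<cdot> u') \<longleftrightarrow> homotopic N X (s \<cdot> u) (s' \<cdot> u')"
   "htp N Y (f \<cdot> u) (f' \<cdot> u') \<longleftrightarrow> homotopic N Y (f \<cdot> u) (f' \<cdot> u')" if "cmap N W u" "cmap N W' u'"
   using cmap_comp[OF that(1) is_roofD(4)[OF r(1)]] cmap_comp[OF that(2) is_roofD(4)[OF r(2)]]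
    cmap_comp[OF that(1) is_roofD(3)[OF r(1)]] cmap_comp[OF that(2) is_roofD(3)[OF r(2)]]
   by (auto simp: htp_def)
  then show ?thesis
   unfolding c[symmetric] using N X by (auto simp: quasi_iso_iff_qis small_complex)
 qed
 then have "(\<exists>N\<in>Sm. \<exists>u u'. chain_map N W u \<and> chain_map N W' u' \<and> quasi_iso N X (s \<cdot> u) \<and> homotopic N X (s \<cdot> u) (s' \<cdot> u') \<and> homotopic N Y (f \<cdot> u) (f' \<cdot> u')) \<longleftrightarrow>
  (\<exists>N\<in>Sm. \<exists>u u'. cmap N W u \<and> cmap N W' u' \<and> qis N X (s \<cdot> u) \<and> htp N X (s \<cdot> u) (s' \<cdot> u') \<and> htp N Y (f \<cdot> u) (f' \<cdot> u'))"
  by (intro bex_cong ex_cong1 refl)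
 then show ?thesis
  using r X Y unfolding roof_rel_def by (auto simp: roofs_iff)
next
 case False
 then show ?thesis using X Y by (auto simp: roof_rel_def roofs_iff)
qed

lemma roof_relD:
 assumes "((W, s, f), (W', s', f')) : roof_rel X Y" "X : Sm" "Y : Sm"
 shows "is_roof X Y W s f" "is_roof X Y W' s' f'"
 using assms roof_rel_iff by blast+

lemma roof_relI:
 assumes "is_roof X Y W s f" "is_roof X Y W' s' f'" "N : Sm" "cmap N W u" "cmap N W' u'" "qis N X (s \<cdot> u)"
  "htp N X (s \<cdot> u) (s' \<cdot> u')" "htp N Y (f \<cdot> u) (f' \<cdot> u')"
 shows "((W, s, f), (W', s', f')) : roof_rel X Y"
 using assms roof_rel_iff is_roofD(5,6) by blast

text \<open>The source of all independence of representatives: related roofs turn lifts of homotopic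
  maps into maps that agree after a further quasi-isomorphism. Both lifts are compared with the
  complex \<open>U1\<close> that witnesses the relation, and the denominators \<open>t\<close> and
  \<open>t'\<close> are cancelled one after the other by \<open>ore_cancel\<close>.\<close>

lemma roof_rel_agree:
 assumes Y: "Y : Sm" and Z: "Z : Sm" and rel: "((V, t, g), (V', t', g')) : roof_rel Y Z" and N: "N : Sm"
  and v: "cmap N V v" and v': "cmap N V' v'" and h: "htp N Y (t \<cdot> v) (t' \<cdot> v')"
 shows "\<exists>M\<in>Sm. \<exists>c. qis M N c \<and> htp M Z (g \<cdot> v \<cdot> c) (g' \<cdot> v' \<cdot> c)"
proof -
 from rel Y Z obtain U1 u u' where r: "is_roof Y Z V t g" "is_roof Y Z V' t' g'" and
  U1: "U1 : Sm" "cmap U1 V u" "cmap U1 V' u'" "qis U1 Y (t \<cdot> u)" "htp U1 Y (t \<cdot> u) (t' \<cdot> u')" "htp U1 Z (g \<cdot> u) (g' \<cdot> u')"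
  by (auto simp: roof_rel_iff)
 note r1 = is_roofD[OF r(1)] and r2 = is_roofD[OF r(2)]
 obtain N2 a b where N2: "N2 : Sm" "qis N2 N a" "cmap N2 U1 b" "htp N2 Y ((t \<cdot> v) \<cdot> a) ((t \<cdot> u) \<cdot> b)"
  using ore[OF N U1(1) Y cmap_comp[OF v r1(4)] U1(4)] by blast
 note ac = qis_cmap[OF N2(2)]
 have h1: "htp N2 Y (t \<cdot> v \<cdot> a) (t \<cdot> u \<cdot> b)" using N2(4) by (simp add: comp_map_assoc)
 obtain N3 c1 where N3: "N3 : Sm" "qis N3 N2 c1" "htp N3 V ((v \<cdot> a) \<cdot> c1) ((u \<cdot> b) \<cdot> c1)"
  using ore_cancel[OF N2(1) r1(1) Y r1(2) cmap_comp[OF ac v] cmap_comp[OF N2(3) U1(2)] h1] by blast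
 note c1 = qis_cmap[OF N3(2)]
 have "htp N2 Y (t' \<cdot> v' \<cdot> a) (t \<cdot> v \<cdot> a)"
  using htp_comp_right[OF htp_sym[OF h] ac] by (simp add: comp_map_assoc)
 moreover have "htp N2 Y (t \<cdot> u \<cdot> b) (t' \<cdot> u' \<cdot> b)"
  using htp_comp_right[OF U1(5) N2(3)] by (simp add: comp_map_assoc)
 ultimately have "htp N2 Y (t' \<cdot> v' \<cdot> a) (t' \<cdot> u' \<cdot> b)" using h1 htp_trans by blast
 from htp_comp_right[OF this c1] have h2: "htp N3 Y (t' \<cdot> v' \<cdot> a \<cdot> c1) (t' \<cdot> u' \<cdot> b \<cdot> c1)" by (simp add: comp_map_assoc)
 obtain N4 c2 where N4: "N4 : Sm" "qis N4 N3 c2" "htp N4 V' ((v' \<cdot> a \<cdot> c1) \<cdot> c2) ((u' \<cdot> b \<cdot> c1) \<cdot> c2)"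
  using ore_cancel[OF N3(1) r2(1) Y r2(2) _ _ h2]
   cmap_comp[OF cmap_comp[OF c1 ac] v'] cmap_comp[OF cmap_comp[OF c1 N2(3)] U1(3)] by blast
 note c2 = qis_cmap[OF N4(2)]
 have "htp N4 Z (g \<cdot> v \<cdot> a \<cdot> c1 \<cdot> c2) (g \<cdot> u \<cdot> b \<cdot> c1 \<cdot> c2)"
  using htp_comp_left[OF htp_comp_right[OF N3(3) c2] r1(3)] by (simp add: comp_map_assoc)
 moreover have "htp N4 Z (g \<cdot> u \<cdot> b \<cdot> c1 \<cdot> c2) (g' \<cdot> u' \<cdot> b \<cdot> c1 \<cdot> c2)"
  using htp_comp_right[OF U1(6) cmap_comp[OF c2 cmap_comp[OF c1 N2(3)]]] by (simp add: comp_map_assoc)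
 moreover have "htp N4 Z (g' \<cdot> u' \<cdot> b \<cdot> c1 \<cdot> c2) (g' \<cdot> v' \<cdot> a \<cdot> c1 \<cdot> c2)"
  using htp_sym[OF htp_comp_left[OF N4(3) r2(3)]] by (simp add: comp_map_assoc)
 ultimately have "htp N4 Z (g \<cdot> v \<cdot> (a \<cdot> c1 \<cdot> c2)) (g' \<cdot> v' \<cdot> (a \<cdot> c1 \<cdot> c2))"
  using htp_trans by blast
 moreover have "qis N4 N (a \<cdot> c1 \<cdot> c2)" by (rule qis_comp[OF qis_comp[OF N4(2) N3(2)] N2(2)])
 ultimately show ?thesis using N4(1) by blast
qed

lemma roof_rel_refl: "is_roof X Y W s f ==> ((W, s, f), (W, s, f)) : roof_rel X Y"
 by (rule roof_relI[where N = W and u = id_map and u' = id_map]) (auto simp: is_roofD cmap_id small_complex intro: htp_refl is_roofD)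

lemma roof_rel_sym:
 assumes "((W, s, f), (W', s', f')) : roof_rel X Y" "X : Sm" "Y : Sm"
 shows "((W', s', f'), (W, s, f)) : roof_rel X Y"
 using assms by (auto simp: roof_rel_iff intro: htp_sym qis_htp)

lemma roof_rel_trans:
 assumes 1: "((W1, s1, f1), (W2, s2, f2)) : roof_rel X Y" and 2: "((W2, s2, f2), (W3, s3, f3)) : roof_rel X Y"
  and X: "X : Sm" and Y: "Y : Sm"
 shows "((W1, s1, f1), (W3, s3, f3)) : roof_rel X Y"
proof -
 from 1 X Y obtain N u1 u2 where r: "is_roof X Y W1 s1 f1" "is_roof X Y W2 s2 f2" and
  N: "N : Sm" "cmap N W1 u1" "cmap N W2 u2" "qis N X (s1 \<cdot> u1)" "htp N X (s1 \<cdot> u1) (s2 \<cdot> u2)" "htp N Y (f1 \<cdot> u1) (f2 \<cdot> u2)"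
  by (auto simp: roof_rel_iff)
 note r3 = roof_relD(2)[OF 2 X Y]
 obtain M a b where M: "M : Sm" "qis M N a" "cmap M W3 b" "htp M X ((s2 \<cdot> u2) \<cdot> a) (s3 \<cdot> b)"
  using ore[OF N(1) is_roofD(1)[OF r3] X cmap_comp[OF N(3) is_roofD(4)[OF r(2)]] is_roofD(2)[OF r3]] by blast
 note a = qis_cmap[OF M(2)]
 obtain L c where L: "L : Sm" "qis L M c" "htp L Y (f2 \<cdot> (u2 \<cdot> a) \<cdot> c) (f3 \<cdot> b \<cdot> c)"
  using roof_rel_agree[OF X Y 2 M(1) cmap_comp[OF a N(3)] M(3)] M(4) by (auto simp: comp_map_assoc)
 note c = qis_cmap[OF L(2)]
 show ?thesis
 proof (rule roof_relI[OF r(1) r3 L(1), where u = "u1 \<cdot> a \<cdot> c" and u' = "b \<cdot> c"])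
  show "cmap L W1 (u1 \<cdot> a \<cdot> c)" by (rule cmap_comp[OF cmap_comp[OF c a] N(2)])
  show "cmap L W3 (b \<cdot> c)" by (rule cmap_comp[OF c M(3)])
  show "qis L X (s1 \<cdot> u1 \<cdot> a \<cdot> c)"
   using qis_comp[OF qis_comp[OF L(2) M(2)] N(4)] by (simp add: comp_map_assoc)
  have "htp L X ((s1 \<cdot> u1) \<cdot> a \<cdot> c) ((s2 \<cdot> u2) \<cdot> a \<cdot> c)" by (rule htp_comp_right[OF N(5) cmap_comp[OF c a]])
  moreover have "htp L X (((s2 \<cdot> u2) \<cdot> a) \<cdot> c) ((s3 \<cdot> b) \<cdot> c)" by (rule htp_comp_right[OF M(4) c])
  ultimately show "htp L X (s1 \<cdot> u1 \<cdot> a \<cdot> c) (s3 \<cdot> b \<cdot> c)"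
   by (simp add: comp_map_assoc) (rule htp_trans)
  have "htp L Y ((f1 \<cdot> u1) \<cdot> a \<cdot> c) ((f2 \<cdot> u2) \<cdot> a \<cdot> c)" by (rule htp_comp_right[OF N(6) cmap_comp[OF c a]])
  then show "htp L Y (f1 \<cdot> u1 \<cdot> a \<cdot> c) (f3 \<cdot> b \<cdot> c)"
   using L(3) by (simp add: comp_map_assoc) (rule htp_trans)
 qed
qed

lemma equiv_roof_rel:
 assumes X: "X : Sm" and Y: "Y : Sm" shows "equiv (roofs X Y) (roof_rel X Y)"
proof (rule equivI)
 show "roof_rel X Y \<subseteq> roofs X Y \<times> roofs X Y" by (auto simp: roof_rel_def)
 show "refl_on (roofs X Y) (roof_rel X Y)"
  by (auto simp: refl_on_def roofs_iff X Y roof_rel_refl)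
 show "sym (roof_rel X Y)" using roof_rel_sym[OF _ X Y] by (auto intro!: symI)
 show "trans (roof_rel X Y)"
 proof (rule transI)
  fix a b c assume "(a, b) : roof_rel X Y" "(b, c) : roof_rel X Y"
  then show "(a, c) : roof_rel X Y"
   by (cases a, cases b, cases c) (auto intro: roof_rel_trans[OF _ _ X Y])
 qed
qed

lemma roof_class_eq_iff:
 assumes "is_roof X Y W s f" "is_roof X Y W' s' f'"
 shows "roof_class X Y (W, s, f) = roof_class X Y (W', s', f') \<longleftrightarrow> ((W, s, f), (W', s', f')) : roof_rel X Y"
 unfolding roof_class_def
 using eq_equiv_class_iff[OF equiv_roof_rel[OF is_roofD(5,6)[OF assms(1)]]] assms roofs_iff[OF is_roofD(5,6)[OF assms(1)]] by blast

lemma mem_roof_class: "(W', s', f') : roof_class X Y (W, s, f) \<longleftrightarrow> ((W, s, f), (W', s', f')) : roof_rel X Y"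
 by (simp add: roof_class_def)

lemma derived_hom_carrier:
 assumes X: "X : Sm" and Y: "Y : Sm"
 shows "R : carrier (dhom X Y) \<longleftrightarrow> (\<exists>W s f. is_roof X Y W s f \<and> R = roof_class X Y (W, s, f))"
proof -
 have "R : carrier (dhom X Y) \<longleftrightarrow> (\<exists>r\<in>roofs X Y. R = roof_class X Y r)"
  by (auto simp: derived_hom_def quotient_def roof_class_def)
 then show ?thesis by (simp add: Bex_def roofs_iff X Y)
qed

lemma roof_classE:
 assumes "X : Sm" "Y : Sm" "R : carrier (dhom X Y)"
 obtains W s f where "is_roof X Y W s f" "R = roof_class X Y (W, s, f)"
 using assms(3) unfolding derived_hom_carrier[OF assms(1,2)] by (elim exE conjE) (rule that)

lemma roof_class_closed: "is_roof X Y W s f ==> roof_class X Y (W, s, f) : carrier (dhom X Y)"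
 by (subst derived_hom_carrier) (auto dest: is_roofD(5,6))

text \<open>Together with \<open>roof_class_htp\<close> this gives the two moves by which
  representatives are changed below: refining the denominator, and replacing both maps up to
  homotopy.\<close>

lemma roof_class_refine:
 assumes r: "is_roof X Y W s f" and N: "N : Sm" and u: "cmap N W u" and q: "qis N X (s \<cdot> u)"
 shows "is_roof X Y N (s \<cdot> u) (f \<cdot> u)" "roof_class X Y (W, s, f) = roof_class X Y (N, s \<cdot> u, f \<cdot> u)"
proof -
 show r': "is_roof X Y N (s \<cdot> u) (f \<cdot> u)" using assms by (auto simp: is_roof_def intro: cmap_comp)
 show "roof_class X Y (W, s, f) = roof_class X Y (N, s \<cdot> u, f \<cdot> u)"
  unfolding roof_class_eq_iff[OF r r']
  by (rule roof_relI[OF r r' N u cmap_id]) (auto simp: small_complex N q intro: htp_refl qis_cmap is_roofD[OF r'])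
qed

lemma roof_class_htp:
 assumes r: "is_roof X Y W s f" and s: "htp W X s s'" and f: "htp W Y f f'"
 shows "is_roof X Y W s' f'" "roof_class X Y (W, s, f) = roof_class X Y (W, s', f')"
proof -
 show r': "is_roof X Y W s' f'" using assms qis_htp[OF s] htpD[OF f] by (auto simp: is_roof_def)
 show "roof_class X Y (W, s, f) = roof_class X Y (W, s', f')"
  unfolding roof_class_eq_iff[OF r r']
  by (rule roof_relI[OF r r' is_roofD(1)[OF r] cmap_id cmap_id]) (auto simp: small_complex is_roofD[OF r] s f)
qed

lemma common_denominator:
 assumes r1: "is_roof X Y W s f" and r2: "is_roof X Z V t g"
 shows "\<exists>N r a b. is_roof X Y N r a \<and> is_roof X Z N r b \<and>
  roof_class X Y (W, s, f) = roof_class X Y (N, r, a) \<and> roof_class X Z (V, t, g) = roof_class X Z (N, r, b)"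
proof -
 note d1 = is_roofD[OF r1] and d2 = is_roofD[OF r2]
 obtain N u v where N: "N : Sm" "qis N W u" "cmap N V v" "htp N X (s \<cdot> u) (t \<cdot> v)"
  using ore[OF d1(1) d2(1) d1(5) d1(4) d2(2)] by blast
 have q: "qis N X (s \<cdot> u)" by (rule qis_comp[OF N(2) d1(2)])
 have q': "qis N X (t \<cdot> v)" by (rule qis_htp[OF N(4) q])
 note a = roof_class_refine[OF r1 N(1) qis_cmap[OF N(2)] q] and b = roof_class_refine[OF r2 N(1) N(3) q']
 note b' = roof_class_htp[OF b(1) htp_sym[OF N(4)] htp_refl[OF is_roofD(3)[OF b(1)]]]
 show ?thesis using a b' b(2) by metis
qed

end

section \<open>Composition, isomorphisms and addition in the derived category\<close>

context universe
begin

text \<open>A composite is independent of the representatives and of the square.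
  \<open>roof_rel_agree\<close> for \<open>rel1\<close> makes the two maps to Y agree on a
  refinement; there \<open>v\<close> and \<open>v'\<close> are lifts of homotopic maps, so
  \<open>roof_rel_agree\<close> for \<open>rel2\<close> applies.\<close>

lemma square_refine:
 assumes rel1: "((W, s, f), (W', s', f')) : roof_rel X Y" and rel2: "((V, t, g), (V', t', g')) : roof_rel Y Z"
  and X: "X : Sm" and Y: "Y : Sm" and Z: "Z : Sm"
  and N: "N : Sm" "qis N W u" "cmap N V v" "htp N Y (f \<cdot> u) (t \<cdot> v)"
  and N': "N' : Sm" "qis N' W' u'" "cmap N' V' v'" "htp N' Y (f' \<cdot> u') (t' \<cdot> v')"
 shows "((N, s \<cdot> u, g \<cdot> v), (N', s' \<cdot> u', g' \<cdot> v')) : roof_rel X Z"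
proof -
 note r1 = roof_relD[OF rel1 X Y] and r2 = roof_relD[OF rel2 Y Z]
 note u = qis_cmap[OF N(2)] and u' = qis_cmap[OF N'(2)]
 have su: "qis N X (s \<cdot> u)" by (rule qis_comp[OF N(2) is_roofD(2)[OF r1(1)]])
 have su': "qis N' X (s' \<cdot> u')" by (rule qis_comp[OF N'(2) is_roofD(2)[OF r1(2)]])
 obtain M a b where M: "M : Sm" "qis M N a" "cmap M N' b" "htp M X ((s \<cdot> u) \<cdot> a) ((s' \<cdot> u') \<cdot> b)"
  using ore[OF N(1) N'(1) X qis_cmap[OF su] su'] by blast
 note a = qis_cmap[OF M(2)]
 obtain L c where L: "L : Sm" "qis L M c" "htp L Y (f \<cdot> (u \<cdot> a) \<cdot> c) (f' \<cdot> (u' \<cdot> b) \<cdot> c)"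
  using roof_rel_agree[OF X Y rel1 M(1) cmap_comp[OF a u] cmap_comp[OF M(3) u']] M(4) by (auto simp: comp_map_assoc)
 note c = qis_cmap[OF L(2)]
 have "htp L Y ((f \<cdot> u) \<cdot> a \<cdot> c) ((t \<cdot> v) \<cdot> a \<cdot> c)" by (rule htp_comp_right[OF N(4) cmap_comp[OF c a]])
 then have 1: "htp L Y (t \<cdot> v \<cdot> a \<cdot> c) (f \<cdot> (u \<cdot> a) \<cdot> c)"
  unfolding comp_map_assoc by (rule htp_sym)
 have "htp L Y ((f' \<cdot> u') \<cdot> b \<cdot> c) ((t' \<cdot> v') \<cdot> b \<cdot> c)" by (rule htp_comp_right[OF N'(4) cmap_comp[OF c M(3)]])
 then have "htp L Y (f' \<cdot> (u' \<cdot> b) \<cdot> c) (t' \<cdot> v' \<cdot> b \<cdot> c)" unfolding comp_map_assoc .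
 then have h: "htp L Y (t \<cdot> v \<cdot> a \<cdot> c) (t' \<cdot> v' \<cdot> b \<cdot> c)"
  by (rule htp_trans[OF htp_trans[OF 1 L(3)]])
 obtain K e where K: "K : Sm" "qis K L e" "htp K Z (g \<cdot> (v \<cdot> a \<cdot> c) \<cdot> e) (g' \<cdot> (v' \<cdot> b \<cdot> c) \<cdot> e)"
  using roof_rel_agree[OF Y Z rel2 L(1) cmap_comp[OF cmap_comp[OF c a] N(3)] cmap_comp[OF cmap_comp[OF c M(3)] N'(3)] h] by blast
 note e = qis_cmap[OF K(2)]
 have ace: "qis K N (a \<cdot> c \<cdot> e)" by (rule qis_comp[OF qis_comp[OF K(2) L(2)] M(2)])
 show ?thesis
 proof (rule roof_relI[OF _ _ K(1), where u = "a \<cdot> c \<cdot> e" and u' = "b \<cdot> c \<cdot> e"])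
  show "is_roof X Z N (s \<cdot> u) (g \<cdot> v)"
   using su X Z N(1) cmap_comp[OF N(3) is_roofD(3)[OF r2(1)]] by (simp add: is_roof_def)
  show "is_roof X Z N' (s' \<cdot> u') (g' \<cdot> v')"
   using su' X Z N'(1) cmap_comp[OF N'(3) is_roofD(3)[OF r2(2)]] by (simp add: is_roof_def)
  show "cmap K N (a \<cdot> c \<cdot> e)" by (rule qis_cmap[OF ace])
  show "cmap K N' (b \<cdot> c \<cdot> e)" by (rule cmap_comp[OF cmap_comp[OF e c] M(3)])
  show "qis K X ((s \<cdot> u) \<cdot> a \<cdot> c \<cdot> e)" by (rule qis_comp[OF ace su])
  show "htp K X ((s \<cdot> u) \<cdot> a \<cdot> c \<cdot> e) ((s' \<cdot> u') \<cdot> b \<cdot> c \<cdot> e)"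
   using htp_comp_right[OF M(4) cmap_comp[OF e c]] by (simp add: comp_map_assoc)
  show "htp K Z ((g \<cdot> v) \<cdot> a \<cdot> c \<cdot> e) ((g' \<cdot> v') \<cdot> b \<cdot> c \<cdot> e)"
   using K(3) by (simp add: comp_map_assoc)
 qed
qed

lemma derived_comp_roof:
 assumes r1: "is_roof X Y W s f" and r2: "is_roof Y Z V t g"
  and N: "N : Sm" "qis N W u" "cmap N V v" "htp N Y (f \<cdot> u) (t \<cdot> v)"
 shows "is_roof X Z N (s \<cdot> u) (g \<cdot> v)"
  and "dcomp X Y Z (roof_class Y Z (V, t, g)) (roof_class X Y (W, s, f)) = roof_class X Z (N, s \<cdot> u, g \<cdot> v)"
proof -
 note X = is_roofD(5)[OF r1] and Y = is_roofD(6)[OF r1] and Z = is_roofD(6)[OF r2]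
 show r: "is_roof X Z N (s \<cdot> u) (g \<cdot> v)"
  using X Z N(1) qis_comp[OF N(2) is_roofD(2)[OF r1]] cmap_comp[OF N(3) is_roofD(3)[OF r2]] by (simp add: is_roof_def)
 \<comment> \<open>The family whose union defines the composite. It turns out to be a singleton, so
   that any one square computes the composite.\<close>
 define A where "A = {roof_class X Z (N, s' \<cdot> u, g' \<cdot> v) | N u v W' s' f' V' t' g'.
  (W', s', f') : roof_class X Y (W, s, f) \<and> (V', t', g') : roof_class Y Z (V, t, g) \<and> N : Sm \<and>
  quasi_iso N W' u \<and> chain_map N V' v \<and> homotopic N Y (f' \<cdot> u) (t' \<cdot> v)}"
 have 1: "B = roof_class X Z (N, s \<cdot> u, g \<cdot> v)" if BA: "B : A" for B
 proof -
  from BA obtain N' u' v' W' s' f' V' t' g' where B: "B = roof_class X Z (N', s' \<cdot> u', g' \<cdot> v')"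
   and m: "((W, s, f), (W', s', f')) : roof_rel X Y" "((V, t, g), (V', t', g')) : roof_rel Y Z"
   and N': "N' : Sm" "quasi_iso N' W' u'" "chain_map N' V' v'" "homotopic N' Y (f' \<cdot> u') (t' \<cdot> v')"
   unfolding A_def mem_roof_class mem_Collect_eq by (elim exE conjE) (rule that)
  note r1' = roof_relD(2)[OF m(1) X Y] and r2' = roof_relD(2)[OF m(2) Y Z]
  note cx = small_complex(1)[OF N'(1)] small_complex(1)[OF is_roofD(1)[OF r1']] small_complex(1)[OF is_roofD(1)[OF r2']]
  have q: "qis N' W' u'" using N'(2) unfolding quasi_iso_iff_qis[OF cx(1,2)] .
  have v': "cmap N' V' v'" using N'(3) cx(1,3) by (simp add: cmap_def)
  have h: "htp N' Y (f' \<cdot> u') (t' \<cdot> v')"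
   unfolding htp_def using N'(4) cmap_comp[OF qis_cmap[OF q] is_roofD(3)[OF r1']] cmap_comp[OF v' is_roofD(4)[OF r2']] by blast
  note rel = square_refine[OF m X Y Z N N'(1) q v' h]
  show ?thesis using roof_class_eq_iff[OF roof_relD[OF rel X Z]] rel B by simp
 qed
 have 2: "roof_class X Z (N, s \<cdot> u, g \<cdot> v) : A"
  unfolding A_def mem_Collect_eq mem_roof_class
 proof (intro exI conjI)
  show "quasi_iso N W u" using N(2) cmapD[OF qis_cmap[OF N(2)]] by (simp add: quasi_iso_iff_qis)
  show "homotopic N Y (f \<cdot> u) (t \<cdot> v)" using N(4) by (simp add: htp_def)
 qed (rule refl roof_rel_refl[OF r1] roof_rel_refl[OF r2] N(1) cmapD(3)[OF N(3)])+
 have "A = {roof_class X Z (N, s \<cdot> u, g \<cdot> v)}"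
  by (rule equalityI) (simp_all add: subset_iff 1 2)
 moreover have "dcomp X Y Z (roof_class Y Z (V, t, g)) (roof_class X Y (W, s, f)) = \<Union> A"
  unfolding derived_comp_def A_def by (rule refl)
 ultimately show "dcomp X Y Z (roof_class Y Z (V, t, g)) (roof_class X Y (W, s, f)) = roof_class X Z (N, s \<cdot> u, g \<cdot> v)"
  by simp
qed

lemma derived_comp_square:
 assumes r1: "is_roof X Y W s f" and r2: "is_roof Y Z V t g"
 obtains N u v where "N : Sm" "qis N W u" "cmap N V v" "htp N Y (f \<cdot> u) (t \<cdot> v)"
  "is_roof X Z N (s \<cdot> u) (g \<cdot> v)"
  "dcomp X Y Z (roof_class Y Z (V, t, g)) (roof_class X Y (W, s, f)) = roof_class X Z (N, s \<cdot> u, g \<cdot> v)"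
 using ore[OF is_roofD(1)[OF r1] is_roofD(1)[OF r2] is_roofD(5)[OF r2] is_roofD(3)[OF r1] is_roofD(2)[OF r2]]
  derived_comp_roof[OF r1 r2] by blast

lemma derived_comp_closed:
 assumes "X : Sm" "Y : Sm" "Z : Sm" "R : carrier (dhom X Y)" "S : carrier (dhom Y Z)"
 shows "dcomp X Y Z S R : carrier (dhom X Z)"
proof -
 obtain W s f where 1: "is_roof X Y W s f" "R = roof_class X Y (W, s, f)" by (rule roof_classE[OF assms(1,2,4)])
 obtain V t g where 2: "is_roof Y Z V t g" "S = roof_class Y Z (V, t, g)" by (rule roof_classE[OF assms(2,3,5)])
 show ?thesis by (rule derived_comp_square[OF 1(1) 2(1)]) (simp add: 1 2 roof_class_closed)
qed

lemma derived_comp_assoc: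
 assumes X: "X1 : Sm" "X2 : Sm" "X3 : Sm" "X4 : Sm"
  and R: "R : carrier (dhom X1 X2)" and S: "S : carrier (dhom X2 X3)" and T: "T : carrier (dhom X3 X4)"
 shows "dcomp X1 X2 X4 (dcomp X2 X3 X4 T S) R = dcomp X1 X3 X4 T (dcomp X1 X2 X3 S R)"
proof -
 obtain W s f where 1: "is_roof X1 X2 W s f" "R = roof_class X1 X2 (W, s, f)" by (rule roof_classE[OF X(1,2) R])
 obtain V t g where 2: "is_roof X2 X3 V t g" "S = roof_class X2 X3 (V, t, g)" by (rule roof_classE[OF X(2,3) S])
 obtain P r k where 3: "is_roof X3 X4 P r k" "T = roof_class X3 X4 (P, r, k)" by (rule roof_classE[OF X(3,4) T])
 obtain M c d where M: "M : Sm" "qis M V c" "cmap M P d" "htp M X3 (g \<cdot> c) (r \<cdot> d)" "is_roof X2 X4 M (t \<cdot> c) (k \<cdot> d)"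
  and TS: "dcomp X2 X3 X4 T S = roof_class X2 X4 (M, t \<cdot> c, k \<cdot> d)"
  unfolding 2 3 by (rule derived_comp_square[OF 2(1) 3(1)])
 obtain L e l where L: "L : Sm" "qis L W e" "cmap L M l" "htp L X2 (f \<cdot> e) ((t \<cdot> c) \<cdot> l)"
  and TSR: "dcomp X1 X2 X4 (dcomp X2 X3 X4 T S) R = roof_class X1 X4 (L, s \<cdot> e, (k \<cdot> d) \<cdot> l)"
  unfolding 1 TS by (rule derived_comp_square[OF 1(1) M(5)])
 have "htp L X2 (f \<cdot> e) (t \<cdot> c \<cdot> l)" using L(4) by (simp add: comp_map_assoc)
 note SR = derived_comp_roof[OF 1(1) 2(1) L(1,2) cmap_comp[OF L(3) qis_cmap[OF M(2)]] this]
 have "htp L X3 ((g \<cdot> c \<cdot> l) \<cdot> id_map) (r \<cdot> d \<cdot> l)"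
  using htp_comp_right[OF M(4) L(3)] by (simp add: comp_map_assoc)
 note TSR' = derived_comp_roof(2)[OF SR(1) 3(1) L(1) qis_id[OF small_complex(1)[OF L(1)]] cmap_comp[OF L(3) M(3)] this]
 show ?thesis unfolding TSR unfolding 1 2 3 SR(2) TSR' by (simp add: comp_map_assoc)
qed

lemma is_roof_of_chain_map: "\<lbrakk>X : Sm; Y : Sm; cmap X Y f\<rbrakk> \<Longrightarrow> is_roof X Y X id_map f"
 by (simp add: is_roof_def qis_id small_complex)

lemma of_chain_map_closed: "\<lbrakk>X : Sm; Y : Sm; cmap X Y f\<rbrakk> \<Longrightarrow> dmor X Y f : carrier (dhom X Y)"
 unfolding of_chain_map_def by (rule roof_class_closed[OF is_roof_of_chain_map])

lemma of_chain_map_cong: "\<lbrakk>X : Sm; Y : Sm; htp X Y f g\<rbrakk> \<Longrightarrow> dmor X Y f = dmor X Y g"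
 unfolding of_chain_map_def
 by (rule roof_class_htp(2)[OF is_roof_of_chain_map]) (auto intro: htp_refl cmap_id small_complex htpD)

lemma comp_of_chain_map:
 assumes r: "is_roof X Y W s f" and Z: "Z : Sm" and g: "cmap Y Z g"
 shows "dcomp X Y Z (dmor Y Z g) (roof_class X Y (W, s, f)) = roof_class X Z (W, s, g \<cdot> f)"
 unfolding of_chain_map_def
 using derived_comp_roof(2)[OF r is_roof_of_chain_map[OF is_roofD(6)[OF r] Z g] is_roofD(1)[OF r] qis_id is_roofD(3)[OF r]]
 by (simp add: small_complex is_roofD[OF r] htp_refl)

lemma of_chain_map_comp:
 assumes "X : Sm" "Y : Sm" "Z : Sm" "cmap X Y f" "cmap Y Z g"
 shows "dcomp X Y Z (dmor Y Z g) (dmor X Y f) = dmor X Z (g \<cdot> f)"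
 using comp_of_chain_map[OF is_roof_of_chain_map[OF assms(1,2,4)] assms(3,5)] by (simp add: of_chain_map_def)

lemma derived_comp_id_left:
 assumes "X : Sm" "Y : Sm" "R : carrier (dhom X Y)"
 shows "dcomp X Y Y (dmor Y Y id_map) R = R"
proof -
 obtain W s f where 1: "is_roof X Y W s f" "R = roof_class X Y (W, s, f)" by (rule roof_classE[OF assms])
 show ?thesis unfolding 1 using comp_of_chain_map[OF 1(1) assms(2) cmap_id] assms by (simp add: small_complex)
qed

lemma derived_comp_id_right:
 assumes "X : Sm" "Y : Sm" "R : carrier (dhom X Y)"
 shows "dcomp X X Y R (dmor X X id_map) = R"
proof -
 obtain W s f where 1: "is_roof X Y W s f" "R = roof_class X Y (W, s, f)" by (rule roof_classE[OF assms])
 have i: "is_roof X X X id_map id_map" by (rule is_roof_of_chain_map) (simp_all add: assms cmap_id small_complex)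
 show ?thesis unfolding 1 of_chain_map_def
  using derived_comp_roof(2)[OF i 1(1) is_roofD(1)[OF 1(1)] is_roofD(2)[OF 1(1)] cmap_id]
  by (simp add: is_roofD[OF 1(1)] small_complex htp_refl)
qed

lemma D_Ab_simps [simp]: "Obj D_Ab = small_complexes" "Hom D_Ab = dhom" "Comp D_Ab = dcomp"
 "Ident D_Ab X = dmor X X id_map" "Shift D_Ab = Shf" "Dist D_Ab = derived_dist"
 by (simp_all add: D_Ab_def preadditive_category.defs triangulated_category.defs derived_preadditive_def)

lemma derived_preadditive_simps [simp]: "Obj derived_preadditive = small_complexes" "Hom derived_preadditive = dhom"
 "Comp derived_preadditive = dcomp" "Ident derived_preadditive X = dmor X X id_map"
 by (simp_all add: derived_preadditive_def)

lemma isomorphism_D: "isomorphism derived_preadditive X Y f \<longleftrightarrow> isomorphism D_Ab X Y f"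
 by (simp add: isomorphism_def)

text \<open>The inverse is the roof with denominator \<open>f\<close> and numerator the
  identity.\<close>

lemma isomorphism_qis:
 assumes X: "X : Sm" and Y: "Y : Sm" and f: "qis X Y f"
 shows "isomorphism D_Ab X Y (dmor X Y f)"
proof -
 note fc = qis_cmap[OF f]
 have r: "is_roof Y X X f id_map" by (simp add: is_roof_def X Y f cmap_id small_complex)
 have r': "is_roof X Y X id_map f" by (rule is_roof_of_chain_map[OF X Y fc])
 have i: "qis X X id_map" by (simp add: qis_id small_complex X)
 have 1: "dcomp Y X Y (dmor X Y f) (roof_class Y X (X, f, id_map)) = dmor Y Y id_map"
  using comp_of_chain_map[OF r Y fc] roof_class_refine(2)[OF is_roof_of_chain_map[OF Y Y cmap_id] X fc] f Y
  by (simp add: of_chain_map_def small_complex)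
 have 2: "dcomp X Y X (roof_class Y X (X, f, id_map)) (dmor X Y f) = dmor X X id_map"
  using derived_comp_roof(2)[OF r' r X i qis_cmap[OF i]] htp_refl[OF fc] by (simp add: of_chain_map_def)
 show ?thesis
  using 1 2 roof_class_closed[OF r] of_chain_map_closed[OF X Y fc] by (auto simp: isomorphism_def)
qed

abbreviation isoD :: "'u cochain_complex => 'u cochain_complex => bool" where
 "isoD X Y \<equiv> isomorphic D_Ab X Y"

lemma isoD_qis: "\<lbrakk>X : Sm; Y : Sm; qis X Y f\<rbrakk> \<Longrightarrow> isoD X Y"
 using isomorphism_qis by (auto simp: isomorphic_def)

lemma isoD_sym: "isoD X Y ==> isoD Y X"
 by (auto simp: isomorphic_def isomorphism_def)

lemma isoD_refl: "X : Sm ==> isoD X X"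
 using isoD_qis qis_id small_complex(1) by blast

lemma isoD_trans:
 assumes X: "X : Sm" "Y : Sm" "Z : Sm" and "isoD X Y" "isoD Y Z" shows "isoD X Z"
proof -
 obtain a b where a: "a : carrier (dhom X Y)" "b : carrier (dhom Y X)"
  "dcomp X Y X b a = dmor X X id_map" "dcomp Y X Y a b = dmor Y Y id_map"
  using assms(4) by (auto simp: isomorphic_def isomorphism_def)
 obtain c d where c: "c : carrier (dhom Y Z)" "d : carrier (dhom Z Y)"
  "dcomp Y Z Y d c = dmor Y Y id_map" "dcomp Z Y Z c d = dmor Z Z id_map"
  using assms(5) by (auto simp: isomorphic_def isomorphism_def)
 note cl = derived_comp_closed
 have ca: "dcomp X Y Z c a : carrier (dhom X Z)" and bd: "dcomp Z Y X b d : carrier (dhom Z X)"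
  using X a c by (auto intro: cl)
 have "dcomp X Z Y d (dcomp X Y Z c a) = a"
  using derived_comp_assoc[OF X(1,2,3,2) a(1) c(1,2)] c(3) derived_comp_id_left[OF X(1,2) a(1)] by simp
 then have 1: "dcomp X Z X (dcomp Z Y X b d) (dcomp X Y Z c a) = dmor X X id_map"
  using derived_comp_assoc[OF X(1,3,2,1) ca c(2) a(2)] a(3) by simp
 have "dcomp Z X Y a (dcomp Z Y X b d) = d"
  using derived_comp_assoc[OF X(3,2,1,2) c(2) a(2,1)] a(4) derived_comp_id_left[OF X(3,2) c(2)] by simp
 then have 2: "dcomp Z X Z (dcomp X Y Z c a) (dcomp Z Y X b d) = dmor Z Z id_map"
  using derived_comp_assoc[OF X(3,1,2,3) bd a(1) c(1)] c(4) by simp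
 show ?thesis using 1 2 ca bd by (auto simp: isomorphic_def isomorphism_def)
qed

lemma add_map_comp: "add_map Y f g \<cdot> u = add_map Y (f \<cdot> u) (g \<cdot> u)"
 by (simp add: add_map_def comp_map_def fun_eq_iff)

lemma zero_map_comp: "zero_map Y \<cdot> u = zero_map Y"
 by (simp add: zero_map_def comp_map_def fun_eq_iff)

lemma is_roof_add: "\<lbrakk>is_roof X Y W s f; is_roof X Y W s g\<rbrakk> \<Longrightarrow> is_roof X Y W s (add_map Y f g)"
 by (simp add: is_roof_def cmap_add)

text \<open>The union over representatives again collapses to one class. Both summands have to agree
  on the same refinement, so the second use of \<open>roof_rel_agree\<close> starts from the complex
  produced by the first.\<close>

lemma derived_add:
 assumes r1: "is_roof X Y W s f" and r2: "is_roof X Y W s g"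
 shows "roof_class X Y (W, s, f) *[dhom X Y] roof_class X Y (W, s, g) = roof_class X Y (W, s, add_map Y f g)"
proof -
 note X = is_roofD(5)[OF r1] and Y = is_roofD(6)[OF r1]
 define A where "A = {roof_class X Y (W', s', add_map Y f' g') | W' s' f' g'.
  (W', s', f') : roof_class X Y (W, s, f) \<and> (W', s', g') : roof_class X Y (W, s, g)}"
 have 1: "B = roof_class X Y (W, s, add_map Y f g)" if BA: "B : A" for B
 proof -
  from BA obtain W' s' f' g' where B: "B = roof_class X Y (W', s', add_map Y f' g')"
   and m: "((W, s, f), (W', s', f')) : roof_rel X Y" "((W, s, g), (W', s', g')) : roof_rel X Y"
   unfolding A_def mem_roof_class mem_Collect_eq by (elim exE conjE) (rule that)
  note r1' = roof_relD(2)[OF m(1) X Y] and r2' = roof_relD(2)[OF m(2) X Y]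
  obtain N u v where N: "N : Sm" "qis N W u" "cmap N W' v" "htp N X (s \<cdot> u) (s' \<cdot> v)"
   using ore[OF is_roofD(1)[OF r1] is_roofD(1)[OF r1'] X is_roofD(4)[OF r1] is_roofD(2)[OF r1']] by blast
  note u = qis_cmap[OF N(2)]
  obtain M c where M: "M : Sm" "qis M N c" "htp M Y (f \<cdot> u \<cdot> c) (f' \<cdot> v \<cdot> c)"
   using roof_rel_agree[OF X Y m(1) N(1) u N(3,4)] by blast
  note c = qis_cmap[OF M(2)]
  have h: "htp M X (s \<cdot> u \<cdot> c) (s' \<cdot> v \<cdot> c)" using htp_comp_right[OF N(4) c] by (simp add: comp_map_assoc)
  obtain L e where L: "L : Sm" "qis L M e" "htp L Y (g \<cdot> (u \<cdot> c) \<cdot> e) (g' \<cdot> (v \<cdot> c) \<cdot> e)"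
   using roof_rel_agree[OF X Y m(2) M(1) cmap_comp[OF c u] cmap_comp[OF c N(3)] h] by blast
  note e = qis_cmap[OF L(2)]
  have uce: "qis L W (u \<cdot> c \<cdot> e)" by (rule qis_comp[OF qis_comp[OF L(2) M(2)] N(2)])
  have hf: "htp L Y (f \<cdot> u \<cdot> c \<cdot> e) (f' \<cdot> v \<cdot> c \<cdot> e)" using htp_comp_right[OF M(3) e] by (simp add: comp_map_assoc)
  have hg: "htp L Y (g \<cdot> u \<cdot> c \<cdot> e) (g' \<cdot> v \<cdot> c \<cdot> e)" using L(3) by (simp add: comp_map_assoc)
  note rr = is_roof_add[OF r1 r2] is_roof_add[OF r1' r2']
  have "((W, s, add_map Y f g), (W', s', add_map Y f' g')) : roof_rel X Y"
  proof (rule roof_relI[OF rr L(1), where u = "u \<cdot> c \<cdot> e" and u' = "v \<cdot> c \<cdot> e"])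
   show "cmap L W (u \<cdot> c \<cdot> e)" by (rule qis_cmap[OF uce])
   show "cmap L W' (v \<cdot> c \<cdot> e)" by (rule cmap_comp[OF cmap_comp[OF e c] N(3)])
   show "qis L X (s \<cdot> u \<cdot> c \<cdot> e)" by (rule qis_comp[OF uce is_roofD(2)[OF r1]])
   show "htp L X (s \<cdot> u \<cdot> c \<cdot> e) (s' \<cdot> v \<cdot> c \<cdot> e)" using htp_comp_right[OF h e] by (simp add: comp_map_assoc)
   show "htp L Y (add_map Y f g \<cdot> u \<cdot> c \<cdot> e) (add_map Y f' g' \<cdot> v \<cdot> c \<cdot> e)"
    unfolding add_map_comp by (rule htp_add[OF hf hg])
  qed
  then show ?thesis using B roof_class_eq_iff[OF rr] by simp
 qed
 have 2: "roof_class X Y (W, s, add_map Y f g) : A"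
  unfolding A_def mem_Collect_eq mem_roof_class
  using roof_rel_refl[OF r1] roof_rel_refl[OF r2] by blast
 have "A = {roof_class X Y (W, s, add_map Y f g)}"
  by (rule equalityI) (simp_all add: subset_iff 1 2)
 moreover have "roof_class X Y (W, s, f) *[dhom X Y] roof_class X Y (W, s, g) = \<Union> A"
  unfolding derived_hom_def A_def monoid.simps by (rule refl)
 ultimately show ?thesis by simp
qed

lemma derived_zero:
 assumes X: "X : Sm" and Y: "Y : Sm" and W: "W : Sm" and s: "qis W X s"
 shows "roof_class X Y (W, s, zero_map Y) = 1[dhom X Y]" "is_roof X Y W s (zero_map Y)"
proof -
 have c: "cmap V Y (zero_map Y)" if "V : Sm" for V :: "'u cochain_complex"
  using that by (simp add: cmap_zero small_complex Y)
 have r: "is_roof X Y X id_map (zero_map Y)" by (rule is_roof_of_chain_map[OF X Y c[OF X]])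
 have "roof_class X Y (X, id_map, zero_map Y) = roof_class X Y (W, s, zero_map Y)"
  using roof_class_refine(2)[OF r W qis_cmap[OF s]] s by (simp add: zero_map_comp)
 then show "roof_class X Y (W, s, zero_map Y) = 1[dhom X Y]" by (simp add: derived_hom_def of_chain_map_def)
 show "is_roof X Y W s (zero_map Y)" using c[OF W] W X Y s by (simp add: is_roof_def)
qed

lemma common_denominator3:
 assumes r1: "is_roof X Y W s f" and r2: "is_roof X Y V t g" and r3: "is_roof X Y P r k"
 shows "\<exists>N q a b c. is_roof X Y N q a \<and> is_roof X Y N q b \<and> is_roof X Y N q c \<and>
  roof_class X Y (W, s, f) = roof_class X Y (N, q, a) \<and> roof_class X Y (V, t, g) = roof_class X Y (N, q, b) \<and>
  roof_class X Y (P, r, k) = roof_class X Y (N, q, c)"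
proof -
 obtain N q a b where N: "is_roof X Y N q a" "is_roof X Y N q b"
  "roof_class X Y (W, s, f) = roof_class X Y (N, q, a)" "roof_class X Y (V, t, g) = roof_class X Y (N, q, b)"
  using common_denominator[OF r1 r2] by blast
 note d1 = is_roofD[OF N(1)] and d3 = is_roofD[OF r3]
 obtain M u v where M: "M : Sm" "qis M N u" "cmap M P v" "htp M X (q \<cdot> u) (r \<cdot> v)"
  using ore[OF d1(1) d3(1) d1(5) d1(4) d3(2)] by blast
 have q: "qis M X (q \<cdot> u)" by (rule qis_comp[OF M(2) d1(2)])
 have q': "qis M X (r \<cdot> v)" by (rule qis_htp[OF M(4) q])
 note A = roof_class_refine[OF N(1) M(1) qis_cmap[OF M(2)] q] and B = roof_class_refine[OF N(2) M(1) qis_cmap[OF M(2)] q]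
  and C = roof_class_refine[OF r3 M(1) M(3) q']
 note C' = roof_class_htp[OF C(1) htp_sym[OF M(4)] htp_refl[OF is_roofD(3)[OF C(1)]]]
 show ?thesis using A B C(2) C' N(3,4) by metis
qed

lemma comm_group_derived_hom:
 assumes X: "X : Sm" and Y: "Y : Sm" shows "comm_group (dhom X Y)"
proof -
 interpret Y: comm_group "cgrp Y i" for i using Y by (simp add: comm_group_cgrp small_complex)
 show ?thesis
 proof (rule comm_groupI)
  fix R S assume RS: "R : carrier (dhom X Y)" "S : carrier (dhom X Y)"
  obtain W s f where 1: "is_roof X Y W s f" "R = roof_class X Y (W, s, f)" by (rule roof_classE[OF X Y RS(1)])
  obtain V t g where 2: "is_roof X Y V t g" "S = roof_class X Y (V, t, g)" by (rule roof_classE[OF X Y RS(2)])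
  obtain N q a b where N: "is_roof X Y N q a" "is_roof X Y N q b" "R = roof_class X Y (N, q, a)" "S = roof_class X Y (N, q, b)"
   using common_denominator[OF 1(1) 2(1)] 1(2) 2(2) by metis
  show "R *[dhom X Y] S : carrier (dhom X Y)"
   unfolding N derived_add[OF N(1,2)] by (rule roof_class_closed[OF is_roof_add[OF N(1,2)]])
  have "htp N Y (add_map Y a b) (add_map Y b a)"
   using is_roofD(3)[OF N(1)] is_roofD(3)[OF N(2)]
   by (intro htp_of_eq cmap_add) (auto simp: add_map_def Y.m_comm cmap_simps)
  then show "R *[dhom X Y] S = S *[dhom X Y] R"
   unfolding N derived_add[OF N(1,2)] derived_add[OF N(2,1)]
   by (rule roof_class_htp(2)[OF is_roof_add[OF N(1,2)] htp_refl[OF is_roofD(4)[OF N(1)]]])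
  fix T assume T: "T : carrier (dhom X Y)"
  obtain P r k where 3: "is_roof X Y P r k" "T = roof_class X Y (P, r, k)" by (rule roof_classE[OF X Y T])
  obtain M q a b c where M: "is_roof X Y M q a" "is_roof X Y M q b" "is_roof X Y M q c"
   "R = roof_class X Y (M, q, a)" "S = roof_class X Y (M, q, b)" "T = roof_class X Y (M, q, c)"
   using common_denominator3[OF 1(1) 2(1) 3(1)] 1(2) 2(2) 3(2) by metis
  note ab = is_roof_add[OF M(1,2)] and bc = is_roof_add[OF M(2,3)]
  have "htp M Y (add_map Y (add_map Y a b) c) (add_map Y a (add_map Y b c))"
   using is_roofD(3)[OF M(1)] is_roofD(3)[OF M(2)] is_roofD(3)[OF M(3)]
   by (intro htp_of_eq cmap_add) (auto simp: add_map_def Y.m_assoc cmap_simps)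
  then show "R *[dhom X Y] S *[dhom X Y] T = R *[dhom X Y] (S *[dhom X Y] T)"
   unfolding M derived_add[OF M(1,2)] derived_add[OF M(2,3)] derived_add[OF ab M(3)] derived_add[OF M(1) bc]
   by (rule roof_class_htp(2)[OF is_roof_add[OF ab M(3)] htp_refl[OF is_roofD(4)[OF M(1)]]])
 next
  show "1[dhom X Y] : carrier (dhom X Y)"
   using of_chain_map_closed[OF X Y cmap_zero] X Y by (simp add: derived_hom_def small_complex)
 next
  fix R assume R: "R : carrier (dhom X Y)"
  obtain W s f where 1: "is_roof X Y W s f" "R = roof_class X Y (W, s, f)" by (rule roof_classE[OF X Y R])
  note z = derived_zero[OF X Y is_roofD(1,2)[OF 1(1)]] and f = is_roofD(3)[OF 1(1)]
  have "htp W Y (add_map Y (zero_map Y) f) f"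
   using f is_roofD(3)[OF z(2)] by (intro htp_of_eq cmap_add) (auto simp: add_map_def zero_map_def cmap_simps)
  then show "1[dhom X Y] *[dhom X Y] R = R"
   unfolding 1 z(1)[symmetric] derived_add[OF z(2) 1(1)]
   by (rule roof_class_htp(2)[OF is_roof_add[OF z(2) 1(1)] htp_refl[OF is_roofD(4)[OF 1(1)]]])
  let ?g = "%n x. inv[cgrp Y n] (f n x)"
  have g: "cmap W Y ?g"
   by (rule cmapI) (auto simp: cmapD[OF f] cmap_simps[OF f] cx_simps[OF cmapD(2)[OF f]] Y.inv_mult)
  then have r: "is_roof X Y W s ?g" using 1(1) by (simp add: is_roof_def)
  have "htp W Y (add_map Y ?g f) (zero_map Y)"
   using f g is_roofD(3)[OF z(2)] by (intro htp_of_eq cmap_add) (auto simp: add_map_def zero_map_def cmap_simps)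
  then have "roof_class X Y (W, s, ?g) *[dhom X Y] R = 1[dhom X Y]"
   unfolding 1 z(1)[symmetric] derived_add[OF r 1(1)]
   by (rule roof_class_htp(2)[OF is_roof_add[OF r 1(1)] htp_refl[OF is_roofD(4)[OF 1(1)]]])
  then show "\<exists>S\<in>carrier (dhom X Y). S *[dhom X Y] R = 1[dhom X Y]"
   using roof_class_closed[OF r] by blast
 qed
qed

lemma derived_comp_hom:
 assumes X: "X : Sm" and Y: "Y : Sm" and Z: "Z : Sm" and T: "T : carrier (dhom Y Z)"
 shows "dcomp X Y Z T : hom (dhom X Y) (dhom X Z)"
proof (rule homI)
 fix R S assume RS: "R : carrier (dhom X Y)" "S : carrier (dhom X Y)"
 show "dcomp X Y Z T R : carrier (dhom X Z)" by (rule derived_comp_closed[OF X Y Z RS(1) T])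
 obtain W s f where 1: "is_roof X Y W s f" "R = roof_class X Y (W, s, f)" by (rule roof_classE[OF X Y RS(1)])
 obtain V t g where 2: "is_roof X Y V t g" "S = roof_class X Y (V, t, g)" by (rule roof_classE[OF X Y RS(2)])
 obtain N q a b where N: "is_roof X Y N q a" "is_roof X Y N q b" "R = roof_class X Y (N, q, a)" "S = roof_class X Y (N, q, b)"
  using common_denominator[OF 1(1) 2(1)] 1(2) 2(2) by metis
 obtain P r k where 3: "is_roof Y Z P r k" "T = roof_class Y Z (P, r, k)" by (rule roof_classE[OF Y Z T])
 note a = is_roofD[OF N(1)] and b = is_roofD[OF N(2)] and c = is_roofD[OF 3(1)]
 obtain M u v where M: "M : Sm" "qis M N u" "cmap M P v" "htp M Y (a \<cdot> u) (r \<cdot> v)"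
  using ore[OF a(1) c(1) Y a(3) c(2)] by blast
 \<comment> \<open>The second square is formed over the first refinement, so that both composites
   acquire the same denominator and can be added.\<close>
 obtain L u' w where L: "L : Sm" "qis L M u'" "cmap L P w" "htp L Y ((b \<cdot> u) \<cdot> u') (r \<cdot> w)"
  using ore[OF M(1) c(1) Y cmap_comp[OF qis_cmap[OF M(2)] b(3)] c(2)] by blast
 have uu: "qis L N (u \<cdot> u')" by (rule qis_comp[OF L(2) M(2)])
 have vu: "cmap L P (v \<cdot> u')" by (rule cmap_comp[OF qis_cmap[OF L(2)] M(3)])
 have h1: "htp L Y (a \<cdot> u \<cdot> u') (r \<cdot> v \<cdot> u')"
  using htp_comp_right[OF M(4) qis_cmap[OF L(2)]] by (simp add: comp_map_assoc)
 have h2: "htp L Y (b \<cdot> u \<cdot> u') (r \<cdot> w)" using L(4) by (simp add: comp_map_assoc)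
 note vw = cmap_add[OF vu L(3)]
 have "htp L Y (add_map Y (r \<cdot> v \<cdot> u') (r \<cdot> w)) (r \<cdot> add_map P (v \<cdot> u') w)"
  using htpD[OF h1] htpD[OF h2] by (intro htp_of_eq cmap_add cmap_comp[OF vw c(4)])
   (auto simp: add_map_def cmap_simps[OF c(4)] cmap_simps[OF vu, simplified] cmap_simps[OF L(3)])
 then have h3: "htp L Y (add_map Y a b \<cdot> u \<cdot> u') (r \<cdot> add_map P (v \<cdot> u') w)"
  unfolding add_map_comp using htp_trans[OF htp_add[OF h1 h2]] by blast
 note A = derived_comp_roof[OF N(1) 3(1) L(1) uu vu h1] and B = derived_comp_roof[OF N(2) 3(1) L(1) uu L(3) h2]
  and C = derived_comp_roof[OF is_roof_add[OF N(1,2)] 3(1) L(1) uu vw h3]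
 have "htp L Z (k \<cdot> add_map P (v \<cdot> u') w) (add_map Z (k \<cdot> v \<cdot> u') (k \<cdot> w))"
  using is_roofD(3)[OF A(1)] is_roofD(3)[OF B(1)] by (intro htp_of_eq cmap_add cmap_comp[OF vw c(3)])
   (auto simp: add_map_def cmap_simps[OF c(3)] cmap_simps[OF vu, simplified] cmap_simps[OF L(3)])
 then show "dcomp X Y Z T (R *[dhom X Y] S) = dcomp X Y Z T R *[dhom X Z] dcomp X Y Z T S"
  unfolding N derived_add[OF N(1,2)] 3(2) A(2) B(2) C(2) derived_add[OF A(1) B(1)]
  by (rule roof_class_htp(2)[OF C(1) htp_refl[OF is_roofD(4)[OF C(1)]]])
qed

end

section \<open>Equality of cohomology classes and torsion conditions\<close>

definition ceq :: "'a cochain_complex => int => 'a => 'a => bool" where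
 "ceq X n x y \<longleftrightarrow> is_complex X \<and> x : Cy X n \<and> y : Cy X n \<and> cohom X n x y"

lemma ceqD: "ceq X n x y ==> x : Cy X n" "ceq X n x y ==> y : Cy X n" "ceq X n x y ==> is_complex X"
 by (simp_all add: ceq_def)

lemma ceq_refl: "\<lbrakk>is_complex X; x : Cy X n\<rbrakk> \<Longrightarrow> ceq X n x x"
 by (simp add: ceq_def cohom_refl cocycles_iff)

lemma ceq_sym: "ceq X n x y ==> ceq X n y x"
 unfolding ceq_def by (intro conjI; elim conjE) (auto intro!: cohom_sym[of X y n x] simp: cocycles_iff)

lemma ceq_trans: "\<lbrakk>ceq X n x y; ceq X n y z\<rbrakk> \<Longrightarrow> ceq X n x z"
 unfolding ceq_def by (intro conjI; elim conjE) (auto intro: cohom_trans[of X z n x y] simp: cocycles_iff)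

lemma ceq_cmap:
 assumes f: "cmap X Y f" and "ceq X n x y" shows "ceq Y n (f n x) (f n y)"
 using assms(2) cmap_cocycle[OF f] cohom_cmap[OF f, of y n x] cmapD(2)[OF f] by (simp add: ceq_def cocycles_iff)

lemma ceq_htp:
 assumes h: "htp X Y f g" and x: "x : Cy X n" shows "ceq Y n (f n x) (g n x)"
 using htp_cohom[OF h x] cmap_cocycle[OF htpD(1)[OF h] x] cmap_cocycle[OF htpD(2)[OF h] x] cmapD(2)[OF htpD(1)[OF h]]
 by (simp add: ceq_def)

lemma ceq_one_iff:
 assumes X: "is_complex X" shows "ceq X n x 1[cgrp X n] \<longleftrightarrow> x : Bd X n"
 using coboundaries_subset_cocycles[OF X, of n] subgroup.one_closed[OF cocycles_subgroup[OF X]]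
 by (auto simp: ceq_def cohom_one_iff[OF X] X)

lemma ceq_coboundary: "\<lbrakk>ceq X n x y; y : Bd X n\<rbrakk> \<Longrightarrow> x : Bd X n"
 by (metis ceq_def cohom_coboundary)

lemma ceq_iff:
 assumes X: "is_complex X" and x: "x : Cy X n" and y: "y : Cy X n"
 shows "ceq X n x y \<longleftrightarrow> x *[cgrp X n] inv[cgrp X n] y : Bd X n"
 using cohom_iff[OF X, of y n x] assms by (auto simp: ceq_def cocycles_iff)

lemma ceq_qis_inj:
 assumes f: "qis X Y f" and x: "x : Cy X n" and y: "y : Cy X n" and e: "ceq Y n (f n x) (f n y)"
 shows "ceq X n x y"
proof -
 note fc = qis_cmap[OF f]
 note X = cmapD(1)[OF fc] and Y = cmapD(2)[OF fc]
 have "x *[cgrp X n] inv[cgrp X n] y : Cy X n"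
  using x y subgroup.m_closed[OF cocycles_subgroup[OF X]] subgroup.m_inv_closed[OF cocycles_subgroup[OF X]] by blast
 moreover have "f n (x *[cgrp X n] inv[cgrp X n] y) : Bd Y n"
  using e x y unfolding ceq_iff[OF Y ceqD(1)[OF e] ceqD(2)[OF e]]
  by (simp add: cmap_simps[OF fc] cx_simps[OF X] cocycles_iff)
 ultimately show ?thesis unfolding ceq_iff[OF X x y] by (rule qis_inj[OF f])
qed

lemma ceq_qis_surj:
 assumes f: "qis X Y f" and y: "y : Cy Y n"
 shows "\<exists>x\<in>Cy X n. ceq Y n y (f n x)"
 using qis_surj[OF f y] cmap_cocycle[OF qis_cmap[OF f]] y cmapD(2)[OF qis_cmap[OF f]] by (auto simp: ceq_def)

lemma cocycles_pow:
 assumes X: "is_complex X" and x: "x : Cy X n" shows "x ^[cgrp X n] (k::nat) : Cy X n"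
 using x by (simp add: cocycles_iff cx_simps[OF X])

lemma coboundaries_pow:
 assumes X: "is_complex X" and x: "x : Bd X n" shows "x ^[cgrp X n] (k::nat) : Bd X n"
proof -
 obtain z where z: "z : Car X (n - 1)" "x = cdiff X (n - 1) z" using x by (auto simp: coboundaries_iff)
 then have "x ^[cgrp X n] k = cdiff X (n - 1) (z ^[cgrp X (n - 1)] k)" by (simp add: cx_simps[OF X])
 then show ?thesis unfolding coboundaries_iff using cx_simps(15)[OF X z(1)] by blast
qed

lemma ceq_pow: "ceq X n x y ==> ceq X n (x ^[cgrp X n] (k::nat)) (y ^[cgrp X n] k)"
 unfolding ceq_def by (elim conjE) (intro conjI cohom_pow cocycles_pow, auto simp: cocycles_iff)

text \<open>One predicate for all conditions on cohomology: for S = {1} the group vanishes, for S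
  the powers of p it is p-primary torsion, for S = {p^N} it is killed by p^N. The exponent may
  depend on the class.\<close>

definition tors :: "'a cochain_complex => int => nat set => bool" where
 "tors X n S \<longleftrightarrow> (\<forall>x\<in>Cy X n. \<exists>k\<in>S. x ^[cgrp X n] k : Bd X n)"

abbreviation acyclic_at :: "'a cochain_complex => int => bool" where
 "acyclic_at X n \<equiv> tors X n {1}"

lemma acyclic_at_iff: "is_complex X ==> acyclic_at X n \<longleftrightarrow> Cy X n \<subseteq> Bd X n"
 by (auto simp: tors_def group.is_monoid[OF group_cgrp] monoid.nat_pow_Suc monoid.nat_pow_0 monoid.l_one cocycles_iff subset_iff)

lemma tors_qis:
 assumes f: "qis X Y f" shows "tors X n S \<longleftrightarrow> tors Y n S"
proof
 note fc = qis_cmap[OF f]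
 note X = cmapD(1)[OF fc] and Y = cmapD(2)[OF fc]
 assume t: "tors X n S"
 show "tors Y n S" unfolding tors_def
 proof
  fix y assume "y : Cy Y n"
  then obtain x where x: "x : Cy X n" "ceq Y n y (f n x)" using ceq_qis_surj[OF f] by blast
  then obtain k where k: "k : S" "x ^[cgrp X n] k : Bd X n" using t by (auto simp: tors_def)
  have "f n x ^[cgrp Y n] k : Bd Y n"
   using cmap_coboundary[OF fc k(2)] x(1) by (simp add: cmap_simps[OF fc] cocycles_iff)
  then show "\<exists>k\<in>S. y ^[cgrp Y n] k : Bd Y n" using k(1) ceq_coboundary[OF ceq_pow[OF x(2)]] by blast
 qed
next
 note fc = qis_cmap[OF f]
 note X = cmapD(1)[OF fc]
 assume t: "tors Y n S"
 show "tors X n S" unfolding tors_def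
 proof
  fix x assume x: "x : Cy X n"
  then obtain k where k: "k : S" "f n x ^[cgrp Y n] k : Bd Y n"
   using t cmap_cocycle[OF fc x] by (auto simp: tors_def)
  then have "f n (x ^[cgrp X n] k) : Bd Y n" using x by (simp add: cmap_simps[OF fc] cocycles_iff)
  then show "\<exists>k\<in>S. x ^[cgrp X n] k : Bd X n"
   using k(1) qis_inj[OF f cocycles_pow[OF X x]] by blast
 qed
qed

lemma tors_shift: "is_complex X ==> tors (Shf k X) n S \<longleftrightarrow> tors X (n + k) S"
 by (simp add: tors_def cocycles_shift coboundaries_shift)

lemma tors_mono: "\<lbrakk>tors X n S; S \<subseteq> S'\<rbrakk> \<Longrightarrow> tors X n S'"
 unfolding tors_def by blast

lemma qis_zerocx:
 assumes Y: "is_complex Y" and a: "!!n. acyclic_at Y n" shows "qis zerocx Y (zero_map Y)"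
 unfolding qis_iff_cohom
proof (intro conjI allI ballI impI)
 show "cmap zerocx Y (zero_map Y)" by (rule cmap_zero[OF is_complex_zerocx Y])
 fix n
 show "x : Bd zerocx n" if "x : Cy zerocx n" for x
  using that by (auto simp: cocycles_iff coboundaries_iff)
 show "\<exists>x\<in>Cy zerocx n. cohom Y n y (zero_map Y n x)" if "y : Cy Y n" for y
  using subsetD[OF a[unfolded acyclic_at_iff[OF Y]] that]
  by (intro bexI[of _ undefined]) (auto simp: zero_map_def cohom_one_iff[OF Y] cocycles_iff)
qed

lemma shift_map_comp: "shift_map k (g \<cdot> f) = shift_map k g \<cdot> shift_map k f"
 by (simp add: shift_map_def comp_map_def fun_eq_iff)

lemma shift_map_id: "shift_map k id_map = id_map"
 by (simp add: shift_map_def id_map_def)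

section \<open>The action of morphisms on cohomology, and triangles\<close>

context universe
begin

text \<open>The induced map on cohomology as a relation between cocycles: x is lifted along the
  denominator and the lift is mapped by the numerator. By \<open>hrel_ex\<close> and
  \<open>hrel_uniq\<close> this is a map on classes.\<close>

definition hrel :: "'u cochain_complex => 'u cochain_complex => 'u roof set => int => 'u => 'u => bool" where
 "hrel X Y R n x y \<longleftrightarrow> (\<exists>W s f w. (W, s, f) : R \<and> w : Cy W n \<and> ceq X n (s n w) x \<and> ceq Y n (f n w) y)"

lemma hrelD: "hrel X Y R n x y ==> x : Cy X n" "hrel X Y R n x y ==> y : Cy Y n"
 by (auto simp: hrel_def dest: ceqD)

lemma roof_class_mem:
 assumes X: "X : Sm" "Y : Sm" and R: "R : carrier (dhom X Y)" and m: "(W, s, f) : R"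
 shows "is_roof X Y W s f" "R = roof_class X Y (W, s, f)"
proof -
 obtain W' s' f' where 1: "is_roof X Y W' s' f'" "R = roof_class X Y (W', s', f')" by (rule roof_classE[OF X R])
 have rel: "((W', s', f'), (W, s, f)) : roof_rel X Y" using m unfolding 1(2) mem_roof_class .
 show r: "is_roof X Y W s f" by (rule roof_relD(2)[OF rel X])
 show "R = roof_class X Y (W, s, f)" unfolding 1(2) using rel roof_class_eq_iff[OF 1(1) r] by simp
qed

lemma mem_roof_class_self: "is_roof X Y W s f ==> (W, s, f) : roof_class X Y (W, s, f)"
 unfolding mem_roof_class by (rule roof_rel_refl)

lemma hrel_uniq:
 assumes X: "X : Sm" "Y : Sm" and R: "R : carrier (dhom X Y)"
  and "hrel X Y R n x y" "hrel X Y R n x' y'" "ceq X n x x'"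
 shows "ceq Y n y y'"
proof -
 obtain W s f w where 1: "(W, s, f) : R" "w : Cy W n" "ceq X n (s n w) x" "ceq Y n (f n w) y"
  using assms(4) by (auto simp: hrel_def)
 obtain W' s' f' w' where 2: "(W', s', f') : R" "w' : Cy W' n" "ceq X n (s' n w') x'" "ceq Y n (f' n w') y'"
  using assms(5) by (auto simp: hrel_def)
 note r1 = roof_class_mem[OF X R 1(1)] and r2 = roof_class_mem[OF X R 2(1)]
 have "((W, s, f), (W', s', f')) : roof_rel X Y" using roof_class_eq_iff[OF r1(1) r2(1)] r1(2) r2(2) by simp
 then obtain N u u' where N: "N : Sm" "cmap N W u" "cmap N W' u'" "qis N X (s \<cdot> u)" "htp N X (s \<cdot> u) (s' \<cdot> u')" "htp N Y (f \<cdot> u) (f' \<cdot> u')"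
  using X by (auto simp: roof_rel_iff)
 obtain m where m: "m : Cy N n" "ceq X n x (s n (u n m))"
  using ceq_qis_surj[OF N(4) ceqD(2)[OF 1(3)]] by auto
 note um = cmap_cocycle[OF N(2) m(1)] and um' = cmap_cocycle[OF N(3) m(1)]
 have a: "ceq W n w (u n m)"
  by (rule ceq_qis_inj[OF is_roofD(2)[OF r1(1)] 1(2) um ceq_trans[OF 1(3) m(2)]])
 have hs: "ceq X n (s n (u n m)) (s' n (u' n m))" using ceq_htp[OF N(5) m(1)] by simp
 have hf: "ceq Y n (f n (u n m)) (f' n (u' n m))" using ceq_htp[OF N(6) m(1)] by simp
 have "ceq X n (s' n w') (s' n (u' n m))"
  by (rule ceq_trans[OF 2(3) ceq_trans[OF ceq_sym[OF assms(6)] ceq_trans[OF m(2) hs]]])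
 then have b: "ceq W' n w' (u' n m)" by (rule ceq_qis_inj[OF is_roofD(2)[OF r2(1)] 2(2) um'])
 show ?thesis
  using ceq_trans[OF ceq_sym[OF 1(4)] ceq_trans[OF ceq_cmap[OF is_roofD(3)[OF r1(1)] a]
   ceq_trans[OF hf ceq_trans[OF ceq_sym[OF ceq_cmap[OF is_roofD(3)[OF r2(1)] b]] 2(4)]]]] .
qed

lemma hrel_ex:
 assumes X: "X : Sm" "Y : Sm" and R: "R : carrier (dhom X Y)" and x: "x : Cy X n"
 shows "\<exists>y. hrel X Y R n x y"
proof -
 obtain W s f where 1: "is_roof X Y W s f" "R = roof_class X Y (W, s, f)" by (rule roof_classE[OF X R])
 obtain w where w: "w : Cy W n" "ceq X n x (s n w)" using ceq_qis_surj[OF is_roofD(2)[OF 1(1)] x] by blast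
 have "ceq Y n (f n w) (f n w)"
  using cmap_cocycle[OF is_roofD(3)[OF 1(1)] w(1)] by (rule ceq_refl[OF small_complex(1)[OF X(2)]])
 then show ?thesis unfolding hrel_def using mem_roof_class_self[OF 1(1)] 1(2) w ceq_sym by metis
qed

lemma hrel_comp:
 assumes X: "X : Sm" "Y : Sm" "Z : Sm" and R: "R : carrier (dhom X Y)" and S: "S : carrier (dhom Y Z)"
  and "hrel X Y R n x y" "hrel Y Z S n y z"
 shows "hrel X Z (dcomp X Y Z S R) n x z"
proof -
 obtain W s f w where 1: "(W, s, f) : R" "w : Cy W n" "ceq X n (s n w) x" "ceq Y n (f n w) y"
  using assms(6) by (auto simp: hrel_def)
 obtain V t g v where 2: "(V, t, g) : S" "v : Cy V n" "ceq Y n (t n v) y" "ceq Z n (g n v) z"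
  using assms(7) by (auto simp: hrel_def)
 note r1 = roof_class_mem[OF X(1,2) R 1(1)] and r2 = roof_class_mem[OF X(2,3) S 2(1)]
 obtain N u v' where N: "N : Sm" "qis N W u" "cmap N V v'" "htp N Y (f \<cdot> u) (t \<cdot> v')"
  "is_roof X Z N (s \<cdot> u) (g \<cdot> v')"
  and c: "dcomp X Y Z S R = roof_class X Z (N, s \<cdot> u, g \<cdot> v')"
  unfolding r1(2) r2(2) by (rule derived_comp_square[OF r1(1) r2(1)])
 obtain m where m: "m : Cy N n" "ceq W n w (u n m)" using ceq_qis_surj[OF N(2) 1(2)] by blast
 have a: "ceq X n (s n (u n m)) x" by (rule ceq_trans[OF ceq_sym[OF ceq_cmap[OF is_roofD(4)[OF r1(1)] m(2)]] 1(3)])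
 have h: "ceq Y n (f n (u n m)) (t n (v' n m))" using ceq_htp[OF N(4) m(1)] by simp
 have "ceq Y n (t n (v' n m)) (t n v)"
  by (rule ceq_trans[OF ceq_sym[OF h] ceq_trans[OF ceq_sym[OF ceq_cmap[OF is_roofD(3)[OF r1(1)] m(2)]] ceq_trans[OF 1(4) ceq_sym[OF 2(3)]]]])
 then have b: "ceq V n (v' n m) v" by (rule ceq_qis_inj[OF is_roofD(2)[OF r2(1)] cmap_cocycle[OF N(3) m(1)] 2(2)])
 have "ceq Z n (g n (v' n m)) z" by (rule ceq_trans[OF ceq_cmap[OF is_roofD(3)[OF r2(1)] b] 2(4)])
 then show ?thesis unfolding hrel_def c using mem_roof_class_self[OF N(5)] m(1) a by fastforce
qed

lemma hrel_of_chain_map: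
 assumes X: "X : Sm" "Y : Sm" and f: "cmap X Y f" and x: "x : Cy X n"
 shows "hrel X Y (dmor X Y f) n x (f n x)"
 unfolding hrel_def of_chain_map_def
 using mem_roof_class_self[OF is_roof_of_chain_map[OF X f]] x
  ceq_refl[OF small_complex(1)[OF X(1)] x] ceq_refl[OF small_complex(1)[OF X(2)] cmap_cocycle[OF f x]]
 by (metis id_map_apply)

lemma hrel_pow:
 assumes X: "X : Sm" "Y : Sm" and R: "R : carrier (dhom X Y)" and h: "hrel X Y R n x y"
 shows "hrel X Y R n (x ^[cgrp X n] (k::nat)) (y ^[cgrp Y n] k)"
proof -
 obtain W s f w where 1: "(W, s, f) : R" "w : Cy W n" "ceq X n (s n w) x" "ceq Y n (f n w) y"
  using h by (auto simp: hrel_def)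
 note r = roof_class_mem(1)[OF X R 1(1)]
 have w: "w : Car W n" using 1(2) by (simp add: cocycles_iff)
 have "ceq X n (s n (w ^[cgrp W n] k)) (x ^[cgrp X n] k)" "ceq Y n (f n (w ^[cgrp W n] k)) (y ^[cgrp Y n] k)"
  using ceq_pow[OF 1(3)] ceq_pow[OF 1(4)] cmap_simps(6)[OF is_roofD(4)[OF r] w] cmap_simps(6)[OF is_roofD(3)[OF r] w] by simp_all
 then show ?thesis unfolding hrel_def using 1(1) cocycles_pow[OF small_complex(1)[OF is_roofD(1)[OF r]] 1(2)] by blast
qed

lemma hrel_coboundary:
 assumes X: "X : Sm" "Y : Sm" and R: "R : carrier (dhom X Y)" and h: "hrel X Y R n x y" and x: "x : Bd X n"
 shows "y : Bd Y n"
proof -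
 obtain W s f w where 1: "(W, s, f) : R" "w : Cy W n" "ceq X n (s n w) x" "ceq Y n (f n w) y"
  using h by (auto simp: hrel_def)
 note r = roof_class_mem(1)[OF X R 1(1)]
 have "w : Bd W n" by (rule qis_inj[OF is_roofD(2)[OF r] 1(2) ceq_coboundary[OF 1(3) x]])
 then show ?thesis using ceq_coboundary[OF ceq_sym[OF 1(4)]] cmap_coboundary[OF is_roofD(3)[OF r]] by blast
qed

lemma hrel_retract_coboundary:
 assumes X: "X : Sm" "Y : Sm" and i: "i : carrier (dhom X Y)" and r: "r : carrier (dhom Y X)"
  and ri: "dcomp X Y X r i = dmor X X id_map" and h: "hrel X Y i n x y" and y: "y : Bd Y n"
 shows "x : Bd X n"
proof -
 obtain z where z: "hrel Y X r n y z" using hrel_ex[OF X(2,1) r hrelD(2)[OF h]] by blast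
 have "hrel X X (dmor X X id_map) n x z" using hrel_comp[OF X X(1) i r h z] ri by simp
 moreover have "hrel X X (dmor X X id_map) n x x"
  using hrel_of_chain_map[OF X(1) X(1) cmap_id hrelD(1)[OF h]] X by (simp add: small_complex)
 moreover have "dmor X X id_map : carrier (dhom X X)"
  using X by (simp add: of_chain_map_closed cmap_id small_complex)
 ultimately have "ceq X n x z" using hrel_uniq[OF X(1) X(1)] ceq_refl[OF small_complex(1)[OF X(1)] hrelD(1)[OF h]] by blast
 then show ?thesis using hrel_coboundary[OF X(2,1) r z y] by (rule ceq_coboundary)
qed

lemma tors_retract:
 assumes X: "X : Sm" "Y : Sm" and i: "i : carrier (dhom X Y)" and r: "r : carrier (dhom Y X)"
  and ri: "dcomp X Y X r i = dmor X X id_map" and t: "tors Y n S"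
 shows "tors X n S"
 unfolding tors_def
proof
 fix x assume "x : Cy X n"
 then obtain y where y: "hrel X Y i n x y" using hrel_ex[OF X i] by blast
 then obtain k where k: "k : S" "y ^[cgrp Y n] k : Bd Y n" using t hrelD(2)[OF y] by (auto simp: tors_def)
 then show "\<exists>k\<in>S. x ^[cgrp X n] k : Bd X n"
  using hrel_retract_coboundary[OF X i r ri hrel_pow[OF X i y]] by blast
qed

lemma tors_isoD: "\<lbrakk>X : Sm; Y : Sm; isoD X Y\<rbrakk> \<Longrightarrow> tors X n S \<longleftrightarrow> tors Y n S"
 using tors_retract by (auto simp: isomorphic_def isomorphism_def)

lemma shift_Sm: "X : Sm ==> Shf k X : Sm"
 using is_complex_shift by (auto simp: small_complexes_def)

lemma zerocx_Sm: "zerocx : Sm"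
 using is_complex_zerocx sm_countable[of "{undefined :: 'u}"] by (simp add: small_complexes_def small_def)

lemma roof_rel_shift:
 assumes X: "X : Sm" "Y : Sm" and rel: "((W, s, f), (W', s', f')) : roof_rel X Y"
 shows "((Shf 1 W, shift_map 1 s, shift_map 1 f), (Shf 1 W', shift_map 1 s', shift_map 1 f')) \<in>
  roof_rel (Shf 1 X) (Shf 1 Y)"
proof -
 obtain N u u' where r: "is_roof X Y W s f" "is_roof X Y W' s' f'" and
  N: "N : Sm" "cmap N W u" "cmap N W' u'" "qis N X (s \<cdot> u)" "htp N X (s \<cdot> u) (s' \<cdot> u')" "htp N Y (f \<cdot> u) (f' \<cdot> u')"
  using rel X by (auto simp: roof_rel_iff)
 have "is_roof (Shf 1 X) (Shf 1 Y) (Shf 1 W) (shift_map 1 s) (shift_map 1 f)" if "is_roof X Y W s f" for W s f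
  using that by (simp add: is_roof_def shift_Sm qis_shift cmap_shift)
 note r' = this[OF r(1)] this[OF r(2)]
 show ?thesis
  by (rule roof_relI[OF r' shift_Sm[OF N(1)] cmap_shift[OF N(2)] cmap_shift[OF N(3)]])
   (simp_all add: shift_map_comp[symmetric] qis_shift htp_shift N)
qed

lemma derived_shift_mor_id:
 assumes X: "X : Sm"
 shows "derived_shift_mor X X (dmor X X id_map) = dmor (Shf 1 X) (Shf 1 X) id_map"
proof -
 have i: "is_roof X X X id_map id_map" by (rule is_roof_of_chain_map) (simp_all add: X cmap_id small_complex)
 let ?X = "Shf 1 X"
 note X' = shift_Sm[OF X, of 1]
 define A where "A = {roof_class ?X ?X (Shf 1 W, shift_map 1 s, shift_map 1 f) | W s f. (W, s, f) : dmor X X id_map}"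
 have 1: "B = dmor ?X ?X id_map" if BA: "B : A" for B
 proof -
  from BA obtain W s f where B: "B = roof_class ?X ?X (Shf 1 W, shift_map 1 s, shift_map 1 f)"
   and m: "((X, id_map, id_map), (W, s, f)) : roof_rel X X"
   unfolding A_def of_chain_map_def mem_roof_class mem_Collect_eq by (elim exE conjE) (rule that)
  note rel = roof_rel_shift[OF X X m]
  show ?thesis using roof_class_eq_iff[OF roof_relD[OF rel X' X']] rel B by (simp add: of_chain_map_def shift_map_id)
 qed
 have 2: "dmor ?X ?X id_map : A"
  unfolding A_def mem_Collect_eq
  using mem_roof_class_self[OF i] by (intro exI[of _ X] exI[of _ id_map]) (simp add: of_chain_map_def shift_map_id)
 have "A = {dmor ?X ?X id_map}" by (rule equalityI) (simp_all add: subset_iff 1 2)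
 then show ?thesis unfolding derived_shift_mor_def A_def[symmetric] by simp
qed

text \<open>Only the second and the third vertex of the cone triangle are replaced by isomorphic
  objects. The comparison on X is then an identity, and of the shift on morphisms nothing beyond
  \<open>derived_shift_mor_id\<close> enters.\<close>

lemma derived_dist_cone:
 assumes X: "X : Sm" and Y: "Y : Sm" and Y': "Y' : Sm" and Z: "Z : Sm" and V: "V : Sm" and f: "cmap X Y' f"
  and \<phi>: "cmap (cone X Y' f) V \<phi>" "!!n. bij_betw (\<phi> n) (Car (cone X Y' f) n) (Car V n)"
  and iY: "isoD Y Y'" and iZ: "isoD Z V"
 shows "\<exists>a b c. (X, Y, Z, a, b, c) : derived_dist"
proof -
 obtain \<beta> \<beta>' where \<beta>: "\<beta> : carrier (dhom Y Y')" "\<beta>' : carrier (dhom Y' Y)"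
  "dcomp Y Y' Y \<beta>' \<beta> = dmor Y Y id_map" "dcomp Y' Y Y' \<beta> \<beta>' = dmor Y' Y' id_map"
  using iY by (auto simp: isomorphic_def isomorphism_def)
 obtain \<gamma> \<gamma>' where \<gamma>: "\<gamma> : carrier (dhom Z V)" "\<gamma>' : carrier (dhom V Z)"
  "dcomp Z V Z \<gamma>' \<gamma> = dmor Z Z id_map" "dcomp V Z V \<gamma> \<gamma>' = dmor V V id_map"
  using iZ by (auto simp: isomorphic_def isomorphism_def)
 let ?X1 = "Shf 1 X"
 note X1 = shift_Sm[OF X, of 1]
 let ?f = "dmor X Y' f"
 let ?g = "dmor Y' V (%n y. \<phi> n (1[cgrp X (n + 1)], y))"
 let ?hm = "%n z. fst (inv_into (Car (cone X Y' f) n) (\<phi> n) z)"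
 let ?h = "dmor V ?X1 ?hm"
 note cX = small_complex(1)[OF X] and cY = small_complex(1)[OF Y']
 have ci: "cmap Y' (cone X Y' f) (%n y. (1[cgrp X (n + 1)], y))"
 proof -
  have [simp]: "2 + i = i + 2" for i :: int by simp
  show ?thesis by (rule cmapI) (auto simp: is_complex_cone[OF f] cY cx_simps[OF cX] cx_simps[OF cY] cmap_simps[OF f])
 qed
 have cp: "cmap (cone X Y' f) ?X1 (%n z. fst z)"
  by (rule cmapI) (auto simp: is_complex_cone[OF f] is_complex_shift cX cx_simps[OF cX] add.commute)
 have g: "cmap Y' V (%n y. \<phi> n (1[cgrp X (n + 1)], y))"
  using cmap_comp[OF ci \<phi>(1)] by (simp add: comp_map_def o_def)
 have h: "cmap V ?X1 ?hm" using cmap_comp[OF cmap_inverse[OF \<phi>] cp] unfolding comp_map_def o_def .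
 have tri: "(X, Y', V, ?f, ?g, ?h) : cone_triangles"
  unfolding cone_triangles_def mem_Collect_eq
 proof (intro exI conjI)
  show "\<forall>n. \<phi> n : iso (cgrp (cone X Y' f) n) (cgrp V n)"
   using \<phi> by (auto simp: iso_def cmap_def chain_map_def)
 qed (rule refl X Y' V cmapD(3)[OF f] cmapD(3)[OF \<phi>(1)])+
 have fc: "?f : carrier (dhom X Y')" and gc: "?g : carrier (dhom Y' V)" and hc: "?h : carrier (dhom V ?X1)"
  by (rule of_chain_map_closed[OF X Y' f], rule of_chain_map_closed[OF Y' V g], rule of_chain_map_closed[OF V X1 h])
 have idX: "dmor X X id_map : carrier (dhom X X)" using X by (simp add: of_chain_map_closed cmap_id cX)
 define a where "a = dcomp X Y' Y \<beta>' ?f"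
 define b where "b = dcomp Y Y' Z (dcomp Y' V Z \<gamma>' ?g) \<beta>"
 define c where "c = dcomp Z V ?X1 ?h \<gamma>"
 have \<gamma>g: "dcomp Y' V Z \<gamma>' ?g : carrier (dhom Y' Z)" by (rule derived_comp_closed[OF Y' V Z gc \<gamma>(2)])
 have ac: "a : carrier (dhom X Y)" unfolding a_def by (rule derived_comp_closed[OF X Y' Y fc \<beta>(2)])
 have bc: "b : carrier (dhom Y Z)" unfolding b_def by (rule derived_comp_closed[OF Y Y' Z \<beta>(1) \<gamma>g])
 have cc: "c : carrier (dhom Z ?X1)" unfolding c_def by (rule derived_comp_closed[OF Z V X1 \<gamma>(1) hc])
 have 1: "dcomp X Y Y' \<beta> a = dcomp X X Y' ?f (dmor X X id_map)"
  unfolding a_def using derived_comp_assoc[OF X Y' Y Y' fc \<beta>(2,1)] \<beta>(4) derived_comp_id_left[OF X Y' fc]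
   derived_comp_id_right[OF X Y' fc] by simp
 have 2: "dcomp Y Z V \<gamma> b = dcomp Y Y' V ?g \<beta>"
  unfolding b_def using derived_comp_assoc[OF Y Y' Z V \<beta>(1) \<gamma>g \<gamma>(1)] derived_comp_assoc[OF Y' V Z V gc \<gamma>(2,1)] \<gamma>(4)
   derived_comp_id_left[OF Y' V gc] by simp
 have 3: "dcomp Z ?X1 ?X1 (derived_shift_mor X X (dmor X X id_map)) c = dcomp Z V ?X1 ?h \<gamma>"
  unfolding derived_shift_mor_id[OF X] using derived_comp_id_left[OF Z X1 cc] c_def by simp
 have iX: "isomorphism derived_preadditive X X (dmor X X id_map)"
  using isomorphism_qis[OF X X qis_id] cX by (simp add: isomorphism_D)
 have iso: "isomorphism derived_preadditive Y Y' \<beta>" "isomorphism derived_preadditive Z V \<gamma>"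
  using \<beta> \<gamma> by (auto simp: isomorphism_def)
 show ?thesis
  unfolding derived_dist_def mem_Collect_eq prod.case
  using X Y Z ac bc cc tri iX iso 1 2 3 by blast
qed

lemma transport_cone:
 assumes X: "X : Sm" and Y: "Y : Sm" and f: "cmap X Y f"
 shows "\<exists>V \<phi>. V : Sm \<and> cmap (cone X Y f) V \<phi> \<and> (\<forall>n. bij_betw (\<phi> n) (Car (cone X Y f) n) (Car V n))"
 by (rule transport_complex[OF is_complex_cone[OF f]]) (simp add: sm_Times small_complex X Y)

lemma derived_dist_cone_qis:
 assumes X: "X : Sm" and Y: "Y : Sm" and Z: "Z : Sm" and f: "cmap X Y f"
  and q: "(\<exists>k. qis (cone X Y f) Z k) \<or> (\<exists>k. qis Z (cone X Y f) k)"
 shows "\<exists>a b c. (X, Y, Z, a, b, c) : derived_dist"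
proof -
 obtain V \<phi> where V: "V : Sm" "cmap (cone X Y f) V \<phi>" "!!n. bij_betw (\<phi> n) (Car (cone X Y f) n) (Car V n)"
  using transport_cone[OF X Y f] by blast
 have "isoD Z V" using q
 proof
  assume "\<exists>k. qis (cone X Y f) Z k"
  then show ?thesis using isoD_sym[OF isoD_qis[OF V(1) Z qis_comp[OF qis_bij(2)[OF V(2,3)]]]] by blast
 next
  assume "\<exists>k. qis Z (cone X Y f) k"
  then show ?thesis using isoD_qis[OF Z V(1) qis_comp[OF _ qis_bij(1)[OF V(2,3)]]] by blast
 qed
 then show ?thesis by (rule derived_dist_cone[OF X Y Y Z V(1) f V(2,3) isoD_refl[OF Y]])
qed

text \<open>By exactness at the middle vertex: an exponent l from S' kills the image of a class of Y
  in Z, so the l-th power comes from X, where some k from S kills it. The argument takes place in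
  the cone triangle to which the given triangle is isomorphic.\<close>

lemma tors_extension:
 assumes d: "(X :: 'u cochain_complex, Y, Z, f, g, h) : derived_dist" and tX: "tors X n S" and tZ: "tors Z n S'"
 shows "tors Y n {k * l | k l. k : S \<and> l : S'}"
proof -
 from d obtain X' Y' Z' f' g' h' \<alpha> \<beta> \<gamma> where S: "X : Sm" "Y : Sm" "Z : Sm" "g : carrier (dhom Y Z)"
  and t: "(X', Y', Z', f', g', h') : cone_triangles" and iso: "isomorphism D_Ab X X' \<alpha>" "isomorphism D_Ab Y Y' \<beta>" "isomorphism D_Ab Z Z' \<gamma>"
  and sq: "dcomp Y Z Z' \<gamma> g = dcomp Y Y' Z' g' \<beta>"
  unfolding derived_dist_def isomorphism_D by blast
 from t obtain a \<phi> where S': "X' : Sm" "Y' : Sm" "Z' : Sm" and a: "chain_map X' Y' a"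
  and \<phi>: "chain_map (cone X' Y' a) Z' \<phi>" "\<forall>n. \<phi> n : iso (cgrp (cone X' Y' a) n) (cgrp Z' n)"
  and g': "g' = dmor Y' Z' (%n y. \<phi> n (1[cgrp X' (n + 1)], y))"
  unfolding cone_triangles_def by blast
 note cX = small_complex(1)[OF S'(1)] and cY = small_complex(1)[OF S'(2)] and cZ = small_complex(1)[OF S'(3)]
 have ac: "cmap X' Y' a" using a cX cY by (simp add: cmap_def)
 have \<phi>c: "cmap (cone X' Y' a) Z' \<phi>" using \<phi> cZ is_complex_cone[OF ac] by (simp add: cmap_def)
 have b: "bij_betw (\<phi> n) (Car (cone X' Y' a) n) (Car Z' n)" for n using \<phi>(2) by (simp add: iso_def)
 have ci: "cmap Y' (cone X' Y' a) (%n y. (1[cgrp X' (n + 1)], y))"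
 proof -
  have [simp]: "2 + i = i + 2" for i :: int by simp
  show ?thesis by (rule cmapI) (auto simp: is_complex_cone[OF ac] cY cx_simps[OF cX] cx_simps[OF cY] cmap_simps[OF ac])
 qed
 have gm: "cmap Y' Z' (%n y. \<phi> n (1[cgrp X' (n + 1)], y))"
  using cmap_comp[OF ci \<phi>c] by (simp add: comp_map_def o_def)
 have gc: "g' : carrier (dhom Y' Z')" unfolding g' by (rule of_chain_map_closed[OF S'(2,3) gm])
 have \<beta>c: "\<beta> : carrier (dhom Y Y')" and \<gamma>c: "\<gamma> : carrier (dhom Z Z')" using iso by (auto simp: isomorphism_def)
 have tX': "tors X' n S" using tX tors_isoD[OF S(1) S'(1)] iso(1) by (auto simp: isomorphic_def)
 show ?thesis unfolding tors_def
 proof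
  fix z assume z: "z : Cy Y n"
  obtain z' where z': "hrel Y Y' \<beta> n z z'" using hrel_ex[OF S(2) S'(2) \<beta>c z] by blast
  obtain w where w: "hrel Y Z g n z w" using hrel_ex[OF S(2,3,4) z] by blast
  obtain w' where w': "hrel Z Z' \<gamma> n w w'" using hrel_ex[OF S(3) S'(3) \<gamma>c hrelD(2)[OF w]] by blast
  obtain l where l: "l : S'" "w ^[cgrp Z n] l : Bd Z n" using tZ hrelD(2)[OF w] by (auto simp: tors_def)
  have wl: "w' ^[cgrp Z' n] l : Bd Z' n"
   by (rule hrel_coboundary[OF S(3) S'(3) \<gamma>c hrel_pow[OF S(3) S'(3) \<gamma>c w'] l(2)])
  note zc = hrelD(2)[OF z']
  have 1: "hrel Y' Z' g' n z' (\<phi> n (1[cgrp X' (n + 1)], z'))" unfolding g' by (rule hrel_of_chain_map[OF S'(2,3) gm zc])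
  have "ceq Z' n (\<phi> n (1[cgrp X' (n + 1)], z')) w'"
   using hrel_uniq[OF S(2) S'(3) derived_comp_closed[OF S(2) S'(2,3) \<beta>c gc] hrel_comp[OF S(2) S'(2,3) \<beta>c gc z' 1]
    _ ceq_refl[OF small_complex(1)[OF S(2)] z]] hrel_comp[OF S(2,3) S'(3) S(4) \<gamma>c w w'] sq by simp
  then have "\<phi> n (1[cgrp X' (n + 1)], z') ^[cgrp Z' n] l : Bd Z' n"
   using ceq_coboundary[OF ceq_pow wl] by blast
  moreover have "\<phi> n (1[cgrp X' (n + 1)], z') ^[cgrp Z' n] l = \<phi> n (1[cgrp X' (n + 1)], z' ^[cgrp Y' n] l)"
   using cmap_simps(6)[OF gm, of z' n l] zc by (simp add: cocycles_iff)
  ultimately have "\<phi> n (1[cgrp X' (n + 1)], z' ^[cgrp Y' n] l) : Bd Z' n" by simp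
  then have "(1[cgrp X' (n + 1)], z' ^[cgrp Y' n] l) : Bd (cone X' Y' a) n"
   by (rule qis_inj[OF qis_bij(1)[OF \<phi>c b] cmap_cocycle[OF ci cocycles_pow[OF cY zc]]])
  \<comment> \<open>A bounding pair in the cone: its first equation says that \<open>x\<close> is a
    cocycle, its second that the power of \<open>z'\<close> is cohomologous to the image of
    \<open>x\<close>.\<close>
  then obtain x y where xy: "x : Car X' n" "y : Car Y' (n - 1)"
   "1[cgrp X' (n + 1)] = inv[cgrp X' (n + 1)] (cdiff X' n x)" "z' ^[cgrp Y' n] l = a n x *[cgrp Y' n] cdiff Y' (n - 1) y"
   unfolding coboundaries_iff by (force simp: add.commute)
  have "cdiff X' n x = 1[cgrp X' (n + 1)]"
   using xy(1) arg_cong[OF xy(3), of "m_inv (cgrp X' (n + 1))"] by (simp add: cx_simps[OF cX])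
  then have xz: "x : Cy X' n" using xy(1) by (simp add: cocycles_iff)
  then obtain k where k: "k : S" "x ^[cgrp X' n] k : Bd X' n" using tX' by (auto simp: tors_def)
  have "ceq Y' n (z' ^[cgrp Y' n] l) (a n x)"
   using xy cocycles_pow[OF cY zc, of l] cmap_cocycle[OF ac xz] by (auto simp: ceq_def cY cohom_def)
  from ceq_pow[OF this, of k] have "(z' ^[cgrp Y' n] l) ^[cgrp Y' n] k : Bd Y' n"
   using ceq_coboundary cmap_coboundary[OF ac k(2)] xy(1) by (simp add: cmap_simps[OF ac])
  then have "z' ^[cgrp Y' n] (k * l) : Bd Y' n"
   using zc by (simp add: monoid.nat_pow_pow group.is_monoid[OF group_cgrp[OF cY]] cocycles_iff mult.commute)
  moreover obtain \<beta>' where "\<beta>' : carrier (dhom Y' Y)" "dcomp Y Y' Y \<beta>' \<beta> = dmor Y Y id_map"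
   using iso(2) by (auto simp: isomorphism_def)
  ultimately have "z ^[cgrp Y n] (k * l) : Bd Y n"
   using hrel_retract_coboundary[OF S(2) S'(2) \<beta>c _ _ hrel_pow[OF S(2) S'(2) \<beta>c z']] by blast
  then show "\<exists>k\<in>{k * l |k l. k : S \<and> l : S'}. z ^[cgrp Y n] k : Bd Y n" using k l by blast
 qed
qed

text \<open>Every denominator over an acyclic source is acyclic itself, so the zero complex refines
  it and the numerator becomes zero.\<close>

lemma zero_hom_acyclic_source:
 assumes X: "X : Sm" "Y : Sm" and a: "!!n. acyclic_at X n" shows "zero_hom D_Ab X Y"
proof -
 have "R = 1[dhom X Y]" if R: "R : carrier (dhom X Y)" for R
 proof -
  obtain W s f where 1: "is_roof X Y W s f" "R = roof_class X Y (W, s, f)" by (rule roof_classE[OF X R])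
  note W = small_complex(1)[OF is_roofD(1)[OF 1(1)]]
  have z: "qis (zerocx :: 'u cochain_complex) W (zero_map W)"
   using a tors_qis[OF is_roofD(2)[OF 1(1)]] by (intro qis_zerocx W) blast
  note q = qis_comp[OF z is_roofD(2)[OF 1(1)]]
  note r = roof_class_refine[OF 1(1) zerocx_Sm qis_cmap[OF z] q]
  note zr = derived_zero[OF X zerocx_Sm q]
  have "htp (zerocx :: 'u cochain_complex) Y (f \<cdot> zero_map W) (zero_map Y)"
   using is_roofD(3)[OF r(1)] is_roofD(3)[OF zr(2)]
   by (rule htp_of_eq) (simp add: zero_map_def cmap_simps[OF is_roofD(3)[OF 1(1)]])
  then show ?thesis
   using roof_class_htp(2)[OF r(1) htp_refl[OF is_roofD(4)[OF r(1)]]] 1(2) r(2) zr(1) by simp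
 qed
 then show ?thesis
  using comm_group_derived_hom[OF X] by (auto simp: zero_hom_def monoid.one_closed comm_group_def comm_monoid_def)
qed

text \<open>The zero complex maps to the acyclic V by a quasi-isomorphism; the Ore square for this
  map refines the roof until its numerator is null-homotopic.\<close>

lemma factor_acyclic:
 assumes r: "is_roof X Y W s f" and V: "V : Sm" and a: "!!n. acyclic_at V n" and g: "cmap W V g" and k: "cmap V Y k"
  and f: "htp W Y f (k \<cdot> g)"
 shows "roof_class X Y (W, s, f) = 1[dhom X Y]"
proof -
 have z: "qis (zerocx :: 'u cochain_complex) V (zero_map V)" by (rule qis_zerocx[OF small_complex(1)[OF V] a])
 obtain N u v where N: "N : Sm" "qis N W u" "cmap N (zerocx :: 'u cochain_complex) v" "htp N V (g \<cdot> u) (zero_map V \<cdot> v)"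
  using ore[OF is_roofD(1)[OF r] zerocx_Sm V g z] by blast
 note q = qis_comp[OF N(2) is_roofD(2)[OF r]]
 note r' = roof_class_refine[OF r N(1) qis_cmap[OF N(2)] q]
 note zr = derived_zero[OF is_roofD(5,6)[OF r] N(1) q]
 have "htp N Y (f \<cdot> u) (k \<cdot> g \<cdot> u)" using htp_comp_right[OF f qis_cmap[OF N(2)]] by (simp add: comp_map_assoc)
 moreover have "htp N Y (k \<cdot> g \<cdot> u) (k \<cdot> zero_map V)" using htp_comp_left[OF N(4) k] by (simp add: zero_map_comp)
 moreover have "htp N Y (k \<cdot> zero_map V) (zero_map Y)"
  using htpD(2)[OF calculation(2)] is_roofD(3)[OF zr(2)]
  by (rule htp_of_eq) (simp add: zero_map_def cmap_simps[OF k])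
 ultimately have "htp N Y (f \<cdot> u) (zero_map Y)" using htp_trans by blast
 then show ?thesis
  using roof_class_htp(2)[OF r'(1) htp_refl[OF is_roofD(4)[OF r'(1)]]] r'(2) zr(1) by simp
qed

lemma zero_hom_acyclic_target:
 assumes X: "X : Sm" "Y : Sm" and a: "!!n. acyclic_at Y n" shows "zero_hom D_Ab X Y"
proof -
 have "R = 1[dhom X Y]" if R: "R : carrier (dhom X Y)" for R
 proof -
  obtain W s f where 1: "is_roof X Y W s f" "R = roof_class X Y (W, s, f)" by (rule roof_classE[OF X R])
  show ?thesis unfolding 1(2)
   by (rule factor_acyclic[OF 1(1) X(2) a is_roofD(3)[OF 1(1)] cmap_id[OF small_complex(1)[OF X(2)]]])
    (simp add: htp_refl is_roofD[OF 1(1)])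
 qed
 then show ?thesis
  using comm_group_derived_hom[OF X] by (auto simp: zero_hom_def monoid.one_closed comm_group_def comm_monoid_def)
qed

lemma zero_object_acyclic: "\<lbrakk>X : Sm; !!n. acyclic_at X n\<rbrakk> \<Longrightarrow> zero_object D_Ab X"
 by (simp add: zero_object_def zero_hom_acyclic_source zero_hom_acyclic_target)

lemma acyclic_of_zero_hom:
 assumes X: "X : Sm" and z: "zero_hom D_Ab X X" shows "acyclic_at X n"
 unfolding acyclic_at_iff[OF small_complex(1)[OF X]]
proof
 fix x assume x: "x : Cy X n"
 note cX = small_complex(1)[OF X]
 have c: "dmor X X id_map : carrier (dhom X X)" using X by (simp add: of_chain_map_closed cmap_id cX)
 then have e: "dmor X X id_map = dmor X X (zero_map X)" using z by (simp add: zero_hom_def derived_hom_def)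
 have "hrel X X (dmor X X id_map) n x (zero_map X n x)"
  unfolding e by (rule hrel_of_chain_map[OF X X cmap_zero[OF cX cX] x])
 moreover have "hrel X X (dmor X X id_map) n x x" using hrel_of_chain_map[OF X X cmap_id[OF cX] x] by simp
 ultimately have "ceq X n x 1[cgrp X n]"
  using hrel_uniq[OF X X c] ceq_refl[OF cX x] by (simp add: zero_map_def)
 then show "x : Bd X n" by (simp add: ceq_one_iff[OF cX])
qed

text \<open>\<open>closure_cl\<close> is an intersection of classes of this kind, so generation
  statements are proved for an arbitrary such class that contains the generators.\<close>

definition closedQ :: "'u cochain_complex set => bool" where
 "closedQ Q \<longleftrightarrow> Q \<subseteq> Sm \<and> extension_closed D_Ab Q \<and> coproduct_closed U D_Ab Q"

lemma closedQ_zero: "\<lbrakk>closedQ Q; X : Sm; !!n. acyclic_at X n\<rbrakk> \<Longrightarrow> X : Q"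
 using zero_object_acyclic by (auto simp: closedQ_def extension_closed_def)

lemma closedQ_dist: "\<lbrakk>closedQ Q; (X, Y, Z, a, b, c) : derived_dist; X : Q; Z : Q\<rbrakk> \<Longrightarrow> Y : Q"
 unfolding closedQ_def extension_closed_def D_Ab_simps by blast

lemma acyclic_cone_id:
 assumes X: "is_complex X" shows "acyclic_at (cone X X id_map) n"
 unfolding acyclic_at_iff[OF is_complex_cone[OF cmap_id[OF X]]]
proof
 note [simp] = cx_simps[OF X]
 interpret X: comm_group "cgrp X i" for i using X by (rule comm_group_cgrp)
 fix p assume p: "p : Cy (cone X X id_map) n"
 obtain x y where e: "p = (x, y)" by (cases p) auto
 have x: "x : Car X (n + 1)" and y: "y : Car X n" and eq: "x *[cgrp X (n + 1)] cdiff X n y = 1[cgrp X (n + 1)]"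
  using p e by (auto simp: cocycles_iff)
 have "x = inv[cgrp X (n + 1)] (cdiff X n y)" using X.inv_equality[OF eq] x y by simp
 then have "p = cdiff (cone X X id_map) (n - 1) (y, 1[cgrp X (n - 1)])" using y e by (simp add: add.commute)
 then show "p : Bd (cone X X id_map) n"
  unfolding coboundaries_iff using y by (intro bexI[of _ "(y, 1[cgrp X (n - 1)])"]) simp_all
qed

text \<open>Closure under isomorphisms follows from closure under extensions: the cone of the
  identity of X is acyclic, and the middle vertex of its triangle may be replaced by Y.\<close>

lemma closedQ_iso:
 assumes Q: "closedQ Q" and X: "X : Q" and Y: "Y : Sm" and i: "isoD X Y" shows "Y : Q"
proof -
 have XS: "X : Sm" using Q X by (auto simp: closedQ_def)
 note id = cmap_id[OF small_complex(1)[OF XS]]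
 obtain V \<phi> where V: "V : Sm" "cmap (cone X X id_map) V \<phi>" "!!n. bij_betw (\<phi> n) (Car (cone X X id_map) n) (Car V n)"
  using transport_cone[OF XS XS id] by blast
 have "acyclic_at V n" for n
  using tors_qis[OF qis_bij(1)[OF V(2,3)]] acyclic_cone_id[OF small_complex(1)[OF XS]] by blast
 then have "V : Q" by (rule closedQ_zero[OF Q V(1)])
 moreover obtain a b c where "(X, Y, V, a, b, c) : derived_dist"
  using derived_dist_cone[OF XS Y XS V(1) V(1) id V(2,3) isoD_sym[OF i] isoD_refl[OF V(1)]] by blast
 ultimately show ?thesis using closedQ_dist[OF Q _ X] by blast
qed

lemma closedQ_cone:
 assumes Q: "closedQ Q" and X: "X : Q" and Z: "Z : Q" and Y: "Y : Sm" and f: "cmap X Y f"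
  and q: "(\<exists>k. qis (cone X Y f) Z k) \<or> (\<exists>k. qis Z (cone X Y f) k)"
 shows "Y : Q"
proof -
 have "X : Sm" "Z : Sm" using Q X Z by (auto simp: closedQ_def)
 then obtain a b c where "(X, Y, Z, a, b, c) : derived_dist" using derived_dist_cone_qis[OF _ Y _ f q] by blast
 then show ?thesis using closedQ_dist[OF Q _ X Z] by blast
qed

end

section \<open>Direct sums of groups and of complexes\<close>

lemma finprod_hom:
 assumes G: "comm_group G" and H: "comm_group H" and h: "h : hom G H" and F: "finite F" and f: "f : F \<rightarrow> carrier G"
 shows "h (finprod G f F) = finprod H (%i. h (f i)) F"
proof -
 interpret G: comm_group G by fact
 interpret H: comm_group H by fact
 interpret h: group_hom G H h by unfold_locales (rule h)
 show ?thesis using F f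
 proof (induction F rule: finite_induct)
  case (insert i F)
  then have "f : F \<rightarrow> carrier G" "f i : carrier G" "(%i. h (f i)) : F \<rightarrow> carrier H" by (auto simp: Pi_iff)
  then show ?case using insert by simp
 qed simp
qed

text \<open>The direct sum described by injections and projections rather than by a carrier of
  functions, so that the description survives transport into the universe, reindexing and shifts.
  The last two clauses give finite support and the detection of elements by their
  components.\<close>

definition gsum :: "'i set => ('i => 'a monoid) => 'b monoid => ('i => 'a => 'b) => ('i => 'b => 'a) => bool" where
 "gsum I A Z j p \<longleftrightarrow> comm_group Z \<and>
  (\<forall>i\<in>I. comm_group (A i) \<and> j i : hom (A i) Z \<and> p i : hom Z (A i) \<and>
    (\<forall>x\<in>carrier (A i). p i (j i x) = x \<and> (\<forall>k\<in>I. k \<noteq> i --> p k (j i x) = 1[A k]))) \<and>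
  (\<forall>z\<in>carrier Z. finite {i\<in>I. p i z \<noteq> 1[A i]}) \<and>
  (\<forall>z\<in>carrier Z. (\<forall>i\<in>I. p i z = 1[A i]) --> z = 1[Z])"

lemma gsumD:
 assumes "gsum I A Z j p"
 shows "comm_group Z" "i : I ==> comm_group (A i)" "i : I ==> j i : hom (A i) Z" "i : I ==> p i : hom Z (A i)"
  "\<lbrakk>i : I; x : carrier (A i)\<rbrakk> \<Longrightarrow> p i (j i x) = x"
  "\<lbrakk>i : I; x : carrier (A i); k : I; k \<noteq> i\<rbrakk> \<Longrightarrow> p k (j i x) = 1[A k]"
  "z : carrier Z ==> finite {i\<in>I. p i z \<noteq> 1[A i]}"
  "\<lbrakk>z : carrier Z; !!i. i : I ==> p i z = 1[A i]\<rbrakk> \<Longrightarrow> z = 1[Z]"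
  "\<lbrakk>i : I; x : carrier (A i)\<rbrakk> \<Longrightarrow> j i x : carrier Z"
  "\<lbrakk>i : I; z : carrier Z\<rbrakk> \<Longrightarrow> p i z : carrier (A i)"
 using assms by (auto simp: gsum_def hom_def)

lemma gsum_proj_finprod:
 assumes g: "gsum I A Z j p" and F: "finite F" "F \<subseteq> I" and y: "!!i. i : F ==> y i : carrier (A i)" and k: "k : I"
 shows "p k (finprod Z (%i. j i (y i)) F) = (if k : F then y k else 1[A k])"
proof -
 note D = gsumD[OF g]
 interpret Ak: comm_group "A k" using D(2) k .
 have c: "(%i. j i (y i)) : F \<rightarrow> carrier Z" using F y D(9) by auto
 have "p k (finprod Z (%i. j i (y i)) F) = finprod (A k) (%i. p k (j i (y i))) F"
  by (rule finprod_hom[OF D(1) D(2)[OF k] D(4)[OF k] F(1) c])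
 also have "\<dots> = finprod (A k) (%i. if k = i then y i else 1[A k]) F"
  by (rule Ak.finprod_cong') (use F y D(5,6) k in auto)
 also have "\<dots> = (if k : F then y k else 1[A k])"
 proof (cases "k : F")
  case True
  define y' where "y' = (%i. if i = k then y k else 1[A k])"
  have "finprod (A k) (%i. if k = i then y i else 1[A k]) F = finprod (A k) (%i. if k = i then y' i else 1[A k]) F"
   by (rule Ak.finprod_cong') (use y[OF True] in \<open>auto simp: y'_def\<close>)
  also have "\<dots> = y' k" using True F y[OF True] by (intro Ak.finprod_singleton) (auto simp: y'_def)
  finally show ?thesis using True by (simp add: y'_def)
 next
  case False
  have "finprod (A k) (%i. if k = i then y i else 1[A k]) F = 1[A k]"
   by (rule Ak.finprod_one_eqI) (use False in auto)
  then show ?thesis using False by simp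
 qed
 finally show ?thesis .
qed

lemma gsum_eqI:
 assumes g: "gsum I A Z j p" and z: "z : carrier Z" "w : carrier Z" and e: "!!i. i : I ==> p i z = p i w"
 shows "z = w"
proof -
 note D = gsumD[OF g]
 interpret Z: comm_group Z using D(1) .
 have "p i (z *[Z] inv[Z] w) = 1[A i]" if i: "i : I" for i
 proof -
  interpret Ai: comm_group "A i" using D(2) i .
  interpret h: group_hom Z "A i" "p i" by unfold_locales (rule D(4)[OF i])
  show ?thesis using z e[OF i] by simp
 qed
 then have "z *[Z] inv[Z] w = 1[Z]" using z by (intro D(8)) auto
 then show ?thesis using z by (metis Z.inv_closed Z.inv_equality Z.inv_inv)
qed

lemma gsum_decomp:
 assumes g: "gsum I A Z j p" and z: "z : carrier Z" and F: "finite F" "F \<subseteq> I" "{i\<in>I. p i z \<noteq> 1[A i]} \<subseteq> F"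
 shows "finprod Z (%i. j i (p i z)) F = z"
proof (rule gsum_eqI[OF g _ z])
 note D = gsumD[OF g]
 interpret Z: comm_group Z using D(1) .
 show "finprod Z (%i. j i (p i z)) F : carrier Z" using F D(9,10) z by (auto intro!: Z.finprod_closed)
 fix k assume k: "k : I"
 show "p k (finprod Z (%i. j i (p i z)) F) = p k z"
 proof (cases "k : F")
  case True then show ?thesis using gsum_proj_finprod[OF g F(1,2) _ k, of "%i. p i z"] F(2) z D(10) by auto
 next
  case False
  then have "p k z = 1[A k]" using F(3) k by blast
  then show ?thesis using False gsum_proj_finprod[OF g F(1,2) _ k, of "%i. p i z"] F(2) z D(10) by auto
 qed
qed

lemma gsum_build:
 assumes g: "gsum I A Z j p" and y: "!!i. i : I ==> y i : carrier (A i)" and f: "finite {i\<in>I. y i \<noteq> 1[A i]}"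
 shows "\<exists>z\<in>carrier Z. \<forall>i\<in>I. p i z = y i"
proof -
 note D = gsumD[OF g]
 interpret Z: comm_group Z using D(1) .
 let ?F = "{i\<in>I. y i \<noteq> 1[A i]}"
 have "finprod Z (%i. j i (y i)) ?F : carrier Z" using D(9) y by (auto intro!: Z.finprod_closed)
 moreover have "p i (finprod Z (%i. j i (y i)) ?F) = y i" if "i : I" for i
  using gsum_proj_finprod[OF g f _ _ that, of y] y that by auto
 ultimately show ?thesis by blast
qed

lemma gsum_hom_ext:
 assumes g: "gsum I A Z j p" and B: "comm_group B" and f: "f : hom Z B" and h: "h : hom Z B"
  and e: "!!i x. i : I ==> x : carrier (A i) ==> f (j i x) = h (j i x)" and z: "z : carrier Z"
 shows "f z = h z"
proof -
 note D = gsumD[OF g]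
 interpret B: comm_group B using B .
 let ?F = "{i\<in>I. p i z \<noteq> 1[A i]}"
 have F: "finite ?F" "?F \<subseteq> I" using D(7)[OF z] by auto
 have c: "(%i. j i (p i z)) : ?F \<rightarrow> carrier Z" using D(9,10) z by auto
 have "f (finprod Z (%i. j i (p i z)) ?F) = h (finprod Z (%i. j i (p i z)) ?F)"
  unfolding finprod_hom[OF D(1) B f F(1) c] finprod_hom[OF D(1) B h F(1) c]
  by (rule B.finprod_cong') (use e D(9,10) z h in \<open>auto simp: hom_def\<close>)
 then show ?thesis using gsum_decomp[OF g z F] by simp
qed

lemma gsum_lift:
 assumes g: "gsum I A Z j p" and B: "comm_group B" and f: "!!i. i : I ==> f i : hom (A i) B"
 shows "\<exists>h. h : hom Z B \<and> (\<forall>i\<in>I. \<forall>x\<in>carrier (A i). h (j i x) = f i x)"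
proof -
 note D = gsumD[OF g]
 interpret B: comm_group B using B .
 interpret Z: comm_group Z using D(1) .
 have f1: "f i 1[A i] = 1[B]" if "i : I" for i
  using f[OF that] D(2)[OF that] B by (intro hom_one) (auto simp: comm_group_def)
 have fc: "f i x : carrier B" if "i : I" "x : carrier (A i)" for i x using f[OF that(1)] that(2) by (auto simp: hom_def)
 define h where "h = (%z. finprod B (%i. f i (p i z)) {i\<in>I. p i z \<noteq> 1[A i]})"
 have h: "h z = finprod B (%i. f i (p i z)) F" if "z : carrier Z" "finite F" "F \<subseteq> I" "{i\<in>I. p i z \<noteq> 1[A i]} \<subseteq> F" for z F
  unfolding h_def by (rule B.finprod_mono_neutral_cong_left) (use that f1 fc D(10) in \<open>auto simp: simp_implies_def\<close>)
 have "h : hom Z B"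
 proof (rule homI)
  fix z assume z: "z : carrier Z"
  show "h z : carrier B" unfolding h_def using z fc D(10) by (auto intro!: B.finprod_closed)
  fix w assume w: "w : carrier Z"
  let ?F = "{i\<in>I. p i z \<noteq> 1[A i]} \<union> {i\<in>I. p i w \<noteq> 1[A i]}"
  have F: "finite ?F" "?F \<subseteq> I" using D(7) z w by auto
  have pzw: "p i (z *[Z] w) = p i z *[A i] p i w" if "i : I" for i using D(4)[OF that] z w by (auto simp: hom_def)
  have "{i\<in>I. p i (z *[Z] w) \<noteq> 1[A i]} \<subseteq> ?F"
  proof -
   have "p i (z *[Z] w) = 1[A i]" if "i : I" "p i z = 1[A i]" "p i w = 1[A i]" for i
    using that D(2)[OF that(1)] by (simp add: pzw comm_group_def comm_monoid_def monoid.l_one monoid.one_closed)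
   then show ?thesis by blast
  qed
  then have "h (z *[Z] w) = finprod B (%i. f i (p i (z *[Z] w))) ?F" using z w F by (intro h) auto
  also have "\<dots> = finprod B (%i. f i (p i z) *[B] f i (p i w)) ?F"
   by (rule B.finprod_cong') (use f D(10) z w fc in \<open>auto simp: hom_def pzw\<close>)
  also have "\<dots> = finprod B (%i. f i (p i z)) ?F *[B] finprod B (%i. f i (p i w)) ?F"
   using fc D(10) z w by (intro B.finprod_multf) auto
  also have "\<dots> = h z *[B] h w" using z w F h[of z ?F] h[of w ?F] by auto
  finally show "h (z *[Z] w) = h z *[B] h w" .
 qed
 moreover have "h (j i x) = f i x" if i: "i : I" and x: "x : carrier (A i)" for i x
 proof -
  have "h (j i x) = finprod B (%k. f k (p k (j i x))) {i}"
   by (intro h D(9)[OF i x]) (use i D(6)[OF i x] in auto)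
  also have "\<dots> = f i x" using i x fc D(5) by simp
  finally show ?thesis .
 qed
 ultimately show ?thesis by blast
qed

definition dsum :: "'i set => ('i => 'a cochain_complex) => 'b cochain_complex =>
  ('i => ('a, 'b) graded_map) => ('i => ('b, 'a) graded_map) => bool" where
 "dsum I X Z j p \<longleftrightarrow> is_complex Z \<and> (\<forall>i\<in>I. cmap (X i) Z (j i) \<and> cmap Z (X i) (p i)) \<and>
  (\<forall>n. gsum I (%i. cgrp (X i) n) (cgrp Z n) (%i. j i n) (%i. p i n))"

lemma dsumD:
 assumes "dsum I X Z j p"
 shows "is_complex Z" "i : I ==> cmap (X i) Z (j i)" "i : I ==> cmap Z (X i) (p i)"
  "gsum I (%i. cgrp (X i) n) (cgrp Z n) (%i. j i n) (%i. p i n)"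
  "i : I ==> is_complex (X i)"
 using assms by (auto simp: dsum_def dest: cmapD)

lemma dsum_lift:
 assumes d: "dsum I X Z j p" and Y: "is_complex Y" and f: "!!i. i : I ==> cmap (X i) Y (f i)"
 shows "\<exists>h. cmap Z Y h \<and> (\<forall>i\<in>I. \<forall>n. \<forall>x\<in>Car (X i) n. h n (j i n x) = f i n x)"
proof -
 note D = dsumD[OF d]
 have "\<exists>h. h : hom (cgrp Z n) (cgrp Y n) \<and> (\<forall>i\<in>I. \<forall>x\<in>Car (X i) n. h (j i n x) = f i n x)" for n
  by (rule gsum_lift[OF D(4) comm_group_cgrp[OF Y]]) (use f in \<open>auto simp: cmap_def chain_map_def\<close>)
 then obtain h where h: "!!n. h n : hom (cgrp Z n) (cgrp Y n)" "!!i n x. \<lbrakk>i : I; x : Car (X i) n\<rbrakk> \<Longrightarrow> h n (j i n x) = f i n x"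
  by metis
 have "h (n + 1) (cdiff Z n z) = cdiff Y n (h n z)" if z: "z : Car Z n" for n z
 proof -
  have dZ: "cdiff Z n : hom (cgrp Z n) (cgrp Z (n + 1))" and dY: "cdiff Y n : hom (cgrp Y n) (cgrp Y (n + 1))"
   using D(1) Y by (auto simp: is_complex_def)
  have "(h (n + 1) \<circ> cdiff Z n) z = (cdiff Y n \<circ> h n) z"
  proof (rule gsum_hom_ext[OF D(4) comm_group_cgrp[OF Y] _ _ _ z])
   show "h (n + 1) \<circ> cdiff Z n : hom (cgrp Z n) (cgrp Y (n + 1))" by (rule Group.hom_compose[OF dZ h(1)])
   show "cdiff Y n \<circ> h n : hom (cgrp Z n) (cgrp Y (n + 1))" by (rule Group.hom_compose[OF h(1) dY])
   fix i x assume i: "i : I" and x: "x : Car (X i) n"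
   show "(h (n + 1) \<circ> cdiff Z n) (j i n x) = (cdiff Y n \<circ> h n) (j i n x)"
    using cmap_simps(5)[OF D(2)[OF i] x, symmetric] cmap_simps(5)[OF f[OF i] x] h(2)[OF i x]
     h(2)[OF i, of "cdiff (X i) n x" "n + 1"] cx_simps(1)[OF D(5)[OF i] x] by simp
  qed
  then show ?thesis by simp
 qed
 then have "cmap Z Y h" using D(1) Y h(1) by (auto simp: cmap_def chain_map_def)
 then show ?thesis using h(2) by blast
qed

lemma dsum_ext:
 assumes d: "dsum I X Z j p" and f: "cmap Z Y f" and g: "cmap Z Y g"
  and e: "!!i n x. \<lbrakk>i : I; x : Car (X i) n\<rbrakk> \<Longrightarrow> f n (j i n x) = g n (j i n x)" and z: "z : Car Z n"
 shows "f n z = g n z"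
 by (rule gsum_hom_ext[OF dsumD(4)[OF d] comm_group_cgrp[OF cmapD(2)[OF f]] _ _ _ z])
  (use f g e in \<open>auto simp: cmap_def chain_map_def\<close>)

text \<open>The homotopies on the summands are homomorphisms out of the summands, so they glue by
  \<open>gsum_lift\<close> in each degree; the homotopy equation is then checked on the
  injections.\<close>

lemma dsum_htp:
 assumes d: "dsum I X Z j p" and f: "cmap Z Y f" and g: "cmap Z Y g"
  and h: "!!i. i : I ==> htp (X i) Y (f \<cdot> j i) (g \<cdot> j i)"
 shows "htp Z Y f g"
proof -
 note D = dsumD[OF d]
 note Y = cmapD(2)[OF f]
 have "\<forall>i\<in>I. \<exists>h. (\<forall>n. h n : hom (cgrp (X i) n) (cgrp Y (n - 1))) \<and>
  (\<forall>n. \<forall>x\<in>Car (X i) n. f n (j i n x) = g n (j i n x) *[cgrp Y n] (cdiff Y (n - 1) (h n x) *[cgrp Y n] h (n + 1) (cdiff (X i) n x)))"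
  using h by (simp add: htp_def homotopic_def)
 then obtain k where k: "!!i n. i : I ==> k i n : hom (cgrp (X i) n) (cgrp Y (n - 1))"
  "!!i n x. \<lbrakk>i : I; x : Car (X i) n\<rbrakk> \<Longrightarrow> f n (j i n x) = g n (j i n x) *[cgrp Y n] (cdiff Y (n - 1) (k i n x) *[cgrp Y n] k i (n + 1) (cdiff (X i) n x))"
  by metis
 have "\<exists>h. h : hom (cgrp Z n) (cgrp Y (n - 1)) \<and> (\<forall>i\<in>I. \<forall>x\<in>Car (X i) n. h (j i n x) = k i n x)" for n
  by (rule gsum_lift[OF D(4) comm_group_cgrp[OF Y]]) (rule k(1))
 then obtain h where h: "!!n. h n : hom (cgrp Z n) (cgrp Y (n - 1))" "!!i n x. \<lbrakk>i : I; x : Car (X i) n\<rbrakk> \<Longrightarrow> h n (j i n x) = k i n x"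
  by metis
 have hc: "x : Car Z k ==> m = k - 1 ==> h k x : Car Y m" for x k m using h(1)[of k] by (auto simp: hom_def)
 have hm: "x : Car Z k ==> y : Car Z k ==> h k (x *[cgrp Z k] y) = h k x *[cgrp Y (k - 1)] h k y" for x y k
  using h(1)[of k] by (auto simp: hom_def)
 note [simp] = cx_simps[OF D(1)] cx_simps[OF Y] cmap_simps[OF f] cmap_simps[OF g] hc hm
 show ?thesis
 proof (rule htpI[OF f g, of h])
  fix n z assume z: "z : Car Z n"
  interpret Y: comm_group "cgrp Y n" by (rule comm_group_cgrp[OF Y])
  show "f n z = g n z *[cgrp Y n] (cdiff Y (n - 1) (h n z) *[cgrp Y n] h (n + 1) (cdiff Z n z))"
  proof (rule gsum_hom_ext[OF D(4) comm_group_cgrp[OF Y] _ _ _ z])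
   show "f n : hom (cgrp Z n) (cgrp Y n)" by (rule homI) simp_all
   show "(%z. g n z *[cgrp Y n] (cdiff Y (n - 1) (h n z) *[cgrp Y n] h (n + 1) (cdiff Z n z))) : hom (cgrp Z n) (cgrp Y n)"
   proof (rule homI)
    fix x y assume xy: "x : Car Z n" "y : Car Z n"
    have c: "g n x : Car Y n" "g n y : Car Y n" "cdiff Y (n - 1) (h n x) : Car Y n" "cdiff Y (n - 1) (h n y) : Car Y n"
     "h (n + 1) (cdiff Z n x) : Car Y n" "h (n + 1) (cdiff Z n y) : Car Y n" using xy by simp_all
    show "g n (x *[cgrp Z n] y) *[cgrp Y n] (cdiff Y (n - 1) (h n (x *[cgrp Z n] y)) *[cgrp Y n] h (n + 1) (cdiff Z n (x *[cgrp Z n] y))) =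
     g n x *[cgrp Y n] (cdiff Y (n - 1) (h n x) *[cgrp Y n] h (n + 1) (cdiff Z n x)) *[cgrp Y n]
     (g n y *[cgrp Y n] (cdiff Y (n - 1) (h n y) *[cgrp Y n] h (n + 1) (cdiff Z n y)))"
     using xy by simp (use c in algebra)
   qed simp
   fix i x assume i: "i : I" and x: "x : Car (X i) n"
   show "f n (j i n x) = g n (j i n x) *[cgrp Y n] (cdiff Y (n - 1) (h n (j i n x)) *[cgrp Y n] h (n + 1) (cdiff Z n (j i n x)))"
    using k(2)[OF i x] h(2)[OF i x] h(2)[OF i, of "cdiff (X i) n x" "n + 1"] cx_simps(1)[OF D(5)[OF i] x]
     cmap_simps(5)[OF D(2)[OF i] x, symmetric] by simp
  qed
 qed simp_all
qed

lemma dsum_cocycles: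
 assumes d: "dsum I X Z j p"
 shows "z : Cy Z n \<longleftrightarrow> z : Car Z n \<and> (\<forall>i\<in>I. p i n z : Cy (X i) n)"
proof -
 note D = dsumD[OF d]
 have "cdiff Z n z = 1[cgrp Z (n + 1)]" if z: "z : Car Z n" and "\<forall>i\<in>I. p i n z : Cy (X i) n"
 proof (rule gsumD(8)[OF D(4)])
  show "cdiff Z n z : Car Z (n + 1)" using z by (simp add: cx_simps[OF D(1)])
  show "p i (n + 1) (cdiff Z n z) = 1[cgrp (X i) (n + 1)]" if "i : I" for i
   using cmap_simps(5)[OF D(3)[OF that] z] \<open>\<forall>i\<in>I. p i n z : Cy (X i) n\<close> that by (simp add: cocycles_iff)
 qed
 then show ?thesis using cmap_cocycle[OF D(3)] by (auto simp: cocycles_iff)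
qed

lemma dsum_coboundaries:
 assumes d: "dsum I X Z j p" and z: "z : Car Z n" and b: "!!i. i : I ==> p i n z : Bd (X i) n"
 shows "z : Bd Z n"
proof -
 note D = dsumD[OF d]
 \<comment> \<open>A trivial component gets a trivial preimage. This keeps the family finitely
   supported, so that \<open>gsum_build\<close> can assemble it.\<close>
 have "\<forall>i\<in>I. \<exists>y\<in>Car (X i) (n - 1). p i n z = cdiff (X i) (n - 1) y \<and> (p i n z = 1[cgrp (X i) n] --> y = 1[cgrp (X i) (n - 1)])"
 proof
  fix i assume i: "i : I"
  show "\<exists>y\<in>Car (X i) (n - 1). p i n z = cdiff (X i) (n - 1) y \<and> (p i n z = 1[cgrp (X i) n] --> y = 1[cgrp (X i) (n - 1)])"
  proof (cases "p i n z = 1[cgrp (X i) n]")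
   case True
   then show ?thesis by (intro bexI[of _ "1[cgrp (X i) (n - 1)]"]) (simp_all add: cx_simps[OF D(5)[OF i]])
  next
   case False
   then show ?thesis using b[OF i] by (auto simp: coboundaries_iff)
  qed
 qed
 then obtain y where y: "!!i. i : I ==> y i : Car (X i) (n - 1)" "!!i. i : I ==> p i n z = cdiff (X i) (n - 1) (y i)"
  "!!i. i : I ==> p i n z = 1[cgrp (X i) n] ==> y i = 1[cgrp (X i) (n - 1)]" by metis
 have "finite {i\<in>I. y i \<noteq> 1[cgrp (X i) (n - 1)]}"
  by (rule finite_subset[OF _ gsumD(7)[OF D(4) z]]) (use y(3) in auto)
 then obtain w where w: "w : Car Z (n - 1)" "!!i. i : I ==> p i (n - 1) w = y i"
  using gsum_build[OF D(4)[of "n - 1"], of y] y(1) by blast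
 have "z = cdiff Z (n - 1) w"
 proof (rule gsum_eqI[OF D(4) z])
  show "cdiff Z (n - 1) w : Car Z n" using w by (simp add: cx_simps[OF D(1)])
  show "p i n z = p i n (cdiff Z (n - 1) w)" if i: "i : I" for i
   using cmap_simps(5)[OF D(3)[OF i] w(1), of n] w(2)[OF i] y(2)[OF i] by simp
 qed
 then show ?thesis using w by (auto simp: coboundaries_iff)
qed

lemma dsum_qis:
 assumes d: "dsum I X Z j p" and d': "dsum I W N j' p'" and q: "!!i. i : I ==> qis (W i) (X i) (s i)"
  and s: "cmap N Z t" "!!i n x. \<lbrakk>i : I; x : Car (W i) n\<rbrakk> \<Longrightarrow> t n (j' i n x) = j i n (s i n x)"
 shows "qis N Z t"
proof -
 note D = dsumD[OF d] and D' = dsumD[OF d']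
 have ps: "p i n (t n w) = s i n (p' i n w)" if i: "i : I" and w: "w : Car N n" for i n w
 proof -
  have "(p i \<cdot> t) n w = (s i \<cdot> p' i) n w"
  proof (rule dsum_ext[OF d' cmap_comp[OF s(1) D(3)[OF i]] cmap_comp[OF D'(3)[OF i] qis_cmap[OF q[OF i]]] _ w])
   fix k n x assume k: "k : I" and x: "x : Car (W k) n"
   have sx: "s k n x : Car (X k) n" using cmap_simps(1)[OF qis_cmap[OF q[OF k]] x] .
   show "(p i \<cdot> t) n (j' k n x) = (s i \<cdot> p' i) n (j' k n x)"
    using gsumD(5)[OF D(4) k sx] gsumD(6)[OF D(4) k sx i] gsumD(5)[OF D'(4) k x] gsumD(6)[OF D'(4) k x i]
     s(2)[OF k x] cmap_simps(3)[OF qis_cmap[OF q[OF i]]] by (cases "i = k") auto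
  qed
  then show ?thesis by simp
 qed
 show ?thesis unfolding qis_iff_cohom
 proof (intro conjI allI ballI impI)
  show "cmap N Z t" by (rule s(1))
  fix n
  { fix w assume w: "w : Cy N n" "t n w : Bd Z n"
   have wc: "w : Car N n" using w by (simp add: cocycles_iff)
   show "w : Bd N n"
   proof (rule dsum_coboundaries[OF d' wc])
    fix i assume i: "i : I"
    have "s i n (p' i n w) : Bd (X i) n" using cmap_coboundary[OF D(3)[OF i] w(2)] ps[OF i wc] by simp
    then show "p' i n w : Bd (W i) n" by (rule qis_inj[OF q[OF i] cmap_cocycle[OF D'(3)[OF i] w(1)]])
   qed }
  { fix z assume z: "z : Cy Z n"
   then have zc: "z : Car Z n" by (simp add: cocycles_iff)
   \<comment> \<open>As in \<open>dsum_coboundaries\<close>, trivial components are lifted trivially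
     to retain finite support.\<close>
   have "\<forall>i\<in>I. \<exists>x\<in>Cy (W i) n. ceq (X i) n (p i n z) (s i n x) \<and> (p i n z = 1[cgrp (X i) n] --> x = 1[cgrp (W i) n])"
   proof
    fix i assume i: "i : I"
    note pz = cmap_cocycle[OF D(3)[OF i] z]
    show "\<exists>x\<in>Cy (W i) n. ceq (X i) n (p i n z) (s i n x) \<and> (p i n z = 1[cgrp (X i) n] --> x = 1[cgrp (W i) n])"
    proof (cases "p i n z = 1[cgrp (X i) n]")
     case True
     then show ?thesis
      using subgroup.one_closed[OF cocycles_subgroup[OF D'(5)[OF i]]] ceq_refl[OF D(5)[OF i] pz] cmap_simps(3)[OF qis_cmap[OF q[OF i]]]
      by (intro bexI[of _ "1[cgrp (W i) n]"]) auto
    next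
     case False
     then show ?thesis using ceq_qis_surj[OF q[OF i] pz] by auto
    qed
   qed
   then obtain x where x: "!!i. i : I ==> x i : Cy (W i) n" "!!i. i : I ==> ceq (X i) n (p i n z) (s i n (x i))"
    "!!i. i : I ==> p i n z = 1[cgrp (X i) n] ==> x i = 1[cgrp (W i) n]" by metis
   have "finite {i\<in>I. x i \<noteq> 1[cgrp (W i) n]}"
    by (rule finite_subset[OF _ gsumD(7)[OF D(4) zc]]) (use x(3) in auto)
   then obtain w where w: "w : Car N n" "!!i. i : I ==> p' i n w = x i"
    using gsum_build[OF D'(4)[of n], of x] x(1) by (auto simp: cocycles_iff)
   have wz: "w : Cy N n" using w x(1) by (simp add: dsum_cocycles[OF d'])
   have twc: "t n w : Car Z n" using cmap_simps(1)[OF s(1) w(1)] .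
   have "z *[cgrp Z n] inv[cgrp Z n] t n w : Bd Z n"
   proof (rule dsum_coboundaries[OF d])
    show "z *[cgrp Z n] inv[cgrp Z n] t n w : Car Z n" using zc twc by (simp add: cx_simps[OF D(1)])
    fix i assume i: "i : I"
    have "p i n (z *[cgrp Z n] inv[cgrp Z n] t n w) = p i n z *[cgrp (X i) n] inv[cgrp (X i) n] s i n (x i)"
     using zc twc w by (simp add: cmap_simps[OF D(3)[OF i]] cx_simps[OF D(1)] ps[OF i w(1)] i)
    then show "p i n (z *[cgrp Z n] inv[cgrp Z n] t n w) : Bd (X i) n"
     using ceq_iff[OF D(5)[OF i] ceqD(1)[OF x(2)[OF i]] ceqD(2)[OF x(2)[OF i]]] x(2)[OF i] by simp
   qed
   then have "cohom Z n z (t n w)" using zc twc by (simp add: cohom_iff[OF D(1)])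
   then show "\<exists>x\<in>Cy N n. cohom Z n z (t n x)" using wz by blast }
 qed
qed

text \<open>An element has finitely many nontrivial components, each with its own exponent; since S
  is directed under divisibility, one exponent serves them all.\<close>

lemma dsum_tors:
 assumes d: "dsum I X Z j p" and t: "!!i. i : I ==> tors (X i) n S"
  and S: "S \<noteq> {}" "!!a b. \<lbrakk>a : S; b : S\<rbrakk> \<Longrightarrow> \<exists>c\<in>S. a dvd c \<and> b dvd c"
 shows "tors Z n S"
 unfolding tors_def
proof
 note D = dsumD[OF d]
 have dir: "\<exists>c\<in>S. \<forall>a\<in>F. a dvd c" if "finite F" "F \<subseteq> S" for F
  using that
 proof (induction F rule: finite_induct)
  case empty then show ?case using S(1) by auto
 next
  case (insert a F)
  then obtain c where "c : S" "\<forall>a\<in>F. a dvd c" by auto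
  moreover then obtain e where "e : S" "a dvd e" "c dvd e" using S(2)[of a c] insert by auto
  ultimately show ?case by (intro bexI[of _ e]) (auto intro: dvd_trans)
 qed
 fix z assume z: "z : Cy Z n"
 then have zc: "z : Car Z n" by (simp add: cocycles_iff)
 let ?F = "{i\<in>I. p i n z \<noteq> 1[cgrp (X i) n]}"
 have "\<forall>i\<in>I. \<exists>k\<in>S. p i n z ^[cgrp (X i) n] k : Bd (X i) n"
  using t cmap_cocycle[OF D(3) z] by (auto simp: tors_def)
 then obtain k where k: "!!i. i : I ==> k i : S" "!!i. i : I ==> p i n z ^[cgrp (X i) n] k i : Bd (X i) n" by metis
 obtain c where c: "c : S" "\<forall>a\<in>k ` ?F. a dvd c" using dir[of "k ` ?F"] gsumD(7)[OF D(4) zc] k(1) by auto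
 have "z ^[cgrp Z n] c : Bd Z n"
 proof (rule dsum_coboundaries[OF d])
  show "z ^[cgrp Z n] c : Car Z n" using zc by (simp add: cx_simps[OF D(1)])
  fix i assume i: "i : I"
  have e: "p i n (z ^[cgrp Z n] c) = p i n z ^[cgrp (X i) n] c" using zc by (simp add: cmap_simps[OF D(3)[OF i]])
  have pz: "p i n z : Car (X i) n" using cmap_simps(1)[OF D(3)[OF i] zc] .
  show "p i n (z ^[cgrp Z n] c) : Bd (X i) n"
  proof (cases "i : ?F")
   case True
   then obtain l where "c = k i * l" using c(2) by auto
   then have "p i n z ^[cgrp (X i) n] c = (p i n z ^[cgrp (X i) n] k i) ^[cgrp (X i) n] l"
    using pz by (simp add: monoid.nat_pow_pow group.is_monoid[OF group_cgrp[OF D(5)[OF i]]])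
   then show ?thesis using e coboundaries_pow[OF D(5)[OF i] k(2)[OF i]] by simp
  next
   case False
   then show ?thesis using e i subgroup.one_closed[OF coboundaries_subgroup[OF D(5)[OF i]]] by (simp add: cx_simps[OF D(5)[OF i]])
  qed
 qed
 then show "\<exists>k\<in>S. z ^[cgrp Z n] k : Bd Z n" using c(1) by blast
qed

lemma dsum_shift:
 assumes d: "dsum I X Z j p"
 shows "dsum I (%i. Shf k (X i)) (Shf k Z) (%i. shift_map k (j i)) (%i. shift_map k (p i))"
 using dsumD(1-4)[OF d] by (auto simp: dsum_def is_complex_shift cmap_shift) (simp add: shift_map_def)

lemma dsum_transport:
 assumes d: "dsum I X Z j p" and f: "cmap Z Z' f" and b: "!!n. bij_betw (f n) (Car Z n) (Car Z' n)"
 shows "dsum I X Z' (%i. f \<cdot> j i) (%i. p i \<cdot> (%n. inv_into (Car Z n) (f n)))"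
proof -
 note D = dsumD[OF d]
 let ?g = "%n. inv_into (Car Z n) (f n)"
 note g = cmap_inverse[OF f b]
 have gf: "?g n (f n z) = z" if "z : Car Z n" for n z using b that by (metis bij_betw_inv_into_left)
 have fg: "f n (?g n z) = z" if "z : Car Z' n" for n z using b that by (metis bij_betw_inv_into_right)
 have "gsum I (%i. cgrp (X i) n) (cgrp Z' n) (%i. (f \<cdot> j i) n) (%i. (p i \<cdot> ?g) n)" for n
  unfolding gsum_def
 proof (intro conjI ballI impI)
  note G = gsumD[OF D(4)[of n]]
  show "comm_group (cgrp Z' n)" by (rule comm_group_cgrp[OF cmapD(2)[OF f]])
  { fix i assume i: "i : I"
   show "comm_group (cgrp (X i) n)" by (rule G(2)[OF i])
   show "(f \<cdot> j i) n : hom (cgrp (X i) n) (cgrp Z' n)" using cmap_comp[OF D(2)[OF i] f] by (simp add: cmap_def chain_map_def)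
   show "(p i \<cdot> ?g) n : hom (cgrp Z' n) (cgrp (X i) n)" using cmap_comp[OF g D(3)[OF i]] by (simp add: cmap_def chain_map_def)
   fix x assume x: "x : Car (X i) n"
   show "(p i \<cdot> ?g) n ((f \<cdot> j i) n x) = x" using G(5)[OF i x] gf[OF G(9)[OF i x]] by simp
   show "(p k \<cdot> ?g) n ((f \<cdot> j i) n x) = 1[cgrp (X k) n]" if "k : I" "k \<noteq> i" for k
    using G(6)[OF i x that] gf[OF G(9)[OF i x]] by simp }
  fix z assume z: "z : Car Z' n"
  have gz: "?g n z : Car Z n" by (rule cmap_simps(1)[OF g z])
  show "finite {i : I. (p i \<cdot> ?g) n z \<noteq> 1[cgrp (X i) n]}" using G(7)[OF gz] by simp
  assume "\<forall>i\<in>I. (p i \<cdot> ?g) n z = 1[cgrp (X i) n]"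
  then have "?g n z = 1[cgrp Z n]" using G(8)[OF gz] by simp
  then show "z = 1[cgrp Z' n]" using fg[OF z] cmap_simps(3)[OF f] by simp
 qed
 then show ?thesis unfolding dsum_def using cmap_comp[OF D(2) f] cmap_comp[OF g D(3)] cmapD(2)[OF f] by blast
qed

definition sumcx :: "'i set => ('i => 'a cochain_complex) => ('i => 'a) cochain_complex" where
 "sumcx I X = \<lparr>cgrp = (%n. sum_group I (%i. cgrp (X i) n)), cdiff = (%n z. \<lambda>i\<in>I. cdiff (X i) n (z i))\<rparr>"

lemma sumcx_dsum:
 assumes X: "!!i. i : I ==> is_complex (X i)"
 shows "dsum I X (sumcx I X) (%i n x. \<lambda>k\<in>I. if k = i then x else 1[cgrp (X k) n]) (%i n z. z i)"
proof -
 have g: "i : I ==> group (cgrp (X i) n)" for i n using X group_cgrp by blast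
 have car: "Car (sumcx I X) n = {x : \<Pi>\<^sub>E i\<in>I. Car (X i) n. finite {i : I. x i \<noteq> 1[cgrp (X i) n]}}" for n
  by (simp add: sumcx_def carrier_sum_group g)
 have [simp]: "x *[cgrp (sumcx I X) n] y = (\<lambda>i\<in>I. x i *[cgrp (X i) n] y i)" "1[cgrp (sumcx I X) n] = (\<lambda>i\<in>I. 1[cgrp (X i) n])"
  "cdiff (sumcx I X) n z = (\<lambda>i\<in>I. cdiff (X i) n (z i))" for x y z n
  by (simp_all add: sumcx_def)
 have mem: "z i : Car (X i) n" if "z : Car (sumcx I X) n" "i : I" for z i n using that by (auto simp: car)
 note [simp] = cx_simps[OF X]
 have cg: "comm_group (cgrp (sumcx I X) n)" for n
 proof (rule group.group_comm_groupI)
  show "group (cgrp (sumcx I X) n)" using g by (simp add: sumcx_def)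
  show "x *[cgrp (sumcx I X) n] y = y *[cgrp (sumcx I X) n] x" if "x : Car (sumcx I X) n" "y : Car (sumcx I X) n" for x y
   using mem[OF that(1)] mem[OF that(2)] X by (auto intro!: restrict_ext simp: comm_monoid.m_comm comm_group.axioms(1) comm_group_cgrp)
 qed
 have cx: "is_complex (sumcx I X)"
 proof (rule is_complexI[OF cg])
  fix n x assume x: "x : Car (sumcx I X) n"
  have "{i\<in>I. cdiff (X i) n (x i) \<noteq> 1[cgrp (X i) (n + 1)]} \<subseteq> {i : I. x i \<noteq> 1[cgrp (X i) n]}" by auto
  then have "finite {i\<in>I. cdiff (X i) n (x i) \<noteq> 1[cgrp (X i) (n + 1)]}" using x car finite_subset by auto
  moreover have "{i\<in>I. (\<lambda>i\<in>I. cdiff (X i) n (x i)) i \<noteq> 1[cgrp (X i) (n + 1)]} = {i\<in>I. cdiff (X i) n (x i) \<noteq> 1[cgrp (X i) (n + 1)]}" by auto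
  ultimately show "cdiff (sumcx I X) n x : Car (sumcx I X) (n + 1)"
   using mem[OF x] unfolding car by simp
  show "cdiff (sumcx I X) (n + 1) (cdiff (sumcx I X) n x) = 1[cgrp (sumcx I X) (n + 2)]"
   using mem[OF x] by (auto intro!: restrict_ext simp: add.commute)
  fix y assume y: "y : Car (sumcx I X) n"
  show "cdiff (sumcx I X) n (x *[cgrp (sumcx I X) n] y) = cdiff (sumcx I X) n x *[cgrp (sumcx I X) (n + 1)] cdiff (sumcx I X) n y"
   using mem[OF x] mem[OF y] by (auto intro!: restrict_ext)
 qed
 have jc: "(\<lambda>k\<in>I. if k = i then x else 1[cgrp (X k) n]) : Car (sumcx I X) n" if "i : I" "x : Car (X i) n" for i x n
 proof -
  have "{k\<in>I. (\<lambda>k\<in>I. if k = i then x else 1[cgrp (X k) n]) k \<noteq> 1[cgrp (X k) n]} \<subseteq> {i}" by auto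
  then have "finite {k\<in>I. (\<lambda>k\<in>I. if k = i then x else 1[cgrp (X k) n]) k \<noteq> 1[cgrp (X k) n]}" by (rule finite_subset) simp
  then show ?thesis using that unfolding car by auto
 qed
 have j: "cmap (X i) (sumcx I X) (%n x. \<lambda>k\<in>I. if k = i then x else 1[cgrp (X k) n])" if i: "i : I" for i
  by (rule cmapI[OF X[OF i] cx jc[OF i]]) (auto intro!: restrict_ext simp: i)
 have p: "cmap (sumcx I X) (X i) (%n z. z i)" if i: "i : I" for i
  by (rule cmapI[OF cx X[OF i]]) (simp_all add: mem i)
 have "gsum I (%i. cgrp (X i) n) (cgrp (sumcx I X) n) (%i x. \<lambda>k\<in>I. if k = i then x else 1[cgrp (X k) n]) (%i z. z i)" for n
  unfolding gsum_def
 proof (intro conjI ballI impI cg)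
  { fix i assume i: "i : I"
   show "comm_group (cgrp (X i) n)" using X[OF i] by (rule comm_group_cgrp)
   show "(%x. \<lambda>k\<in>I. if k = i then x else 1[cgrp (X k) n]) : hom (cgrp (X i) n) (cgrp (sumcx I X) n)" using j[OF i] by (simp add: cmap_def chain_map_def)
   show "(%z. z i) : hom (cgrp (sumcx I X) n) (cgrp (X i) n)" using p[OF i] by (simp add: cmap_def chain_map_def)
   fix x assume "x : Car (X i) n"
   show "(\<lambda>k\<in>I. if k = i then x else 1[cgrp (X k) n]) i = x" using i by simp
   show "(\<lambda>k\<in>I. if k = i then x else 1[cgrp (X k) n]) k = 1[cgrp (X k) n]" if "k : I" "k \<noteq> i" for k using that by simp }
  fix z assume z: "z : Car (sumcx I X) n"
  show "finite {i : I. z i \<noteq> 1[cgrp (X i) n]}" using z by (simp add: car)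
  assume "\<forall>i\<in>I. z i = 1[cgrp (X i) n]"
  then show "z = 1[cgrp (sumcx I X) n]" using z by (auto simp: car intro!: PiE_ext[of z I "%i. Car (X i) n"])
 qed
 then show ?thesis using cx j p by (simp add: dsum_def)
qed

lemma dsum_reindex:
 assumes d: "dsum I X Z j p" and e: "inj_on e I"
 shows "dsum (e ` I) (%i. X (inv_into I e i)) Z (%i. j (inv_into I e i)) (%i. p (inv_into I e i))"
proof -
 note D = dsumD[OF d]
 have i: "inv_into I e k : I" if "k : e ` I" for k using that by (rule inv_into_into)
 have ne: "inv_into I e k \<noteq> inv_into I e l" if "k : e ` I" "l : e ` I" "k \<noteq> l" for k l
  using that by (metis f_inv_into_f)
 have ie: "inv_into I e (e k) = k" if "k : I" for k using e that by simp
 have "gsum (e ` I) (%i. cgrp (X (inv_into I e i)) n) (cgrp Z n) (%i. j (inv_into I e i) n) (%i. p (inv_into I e i) n)" for n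
 proof -
  note G = gsumD[OF D(4)[of n]]
  have fin: "finite {i : e ` I. p (inv_into I e i) n z \<noteq> 1[cgrp (X (inv_into I e i)) n]}" if "z : Car Z n" for z
   by (rule finite_subset[OF _ finite_imageI[OF G(7)[OF that], of e]]) (auto simp: ie)
  have sep: "z = 1[cgrp Z n]" if "z : Car Z n" "\<forall>i\<in>e ` I. p (inv_into I e i) n z = 1[cgrp (X (inv_into I e i)) n]" for z
   by (rule G(8)[OF that(1)]) (use that(2) ie in auto)
  show ?thesis
   unfolding gsum_def
  proof (intro conjI ballI impI)
   show "comm_group (cgrp Z n)" by (rule G(1))
   show "comm_group (cgrp (X (inv_into I e k)) n)" "j (inv_into I e k) n : hom (cgrp (X (inv_into I e k)) n) (cgrp Z n)"
    "p (inv_into I e k) n : hom (cgrp Z n) (cgrp (X (inv_into I e k)) n)" if "k : e ` I" for k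
    using G(2,3,4)[OF i[OF that]] .
   show "p (inv_into I e k) n (j (inv_into I e k) n x) = x" if "k : e ` I" "x : Car (X (inv_into I e k)) n" for k x
    by (rule G(5)[OF i[OF that(1)] that(2)])
   show "p (inv_into I e l) n (j (inv_into I e k) n x) = 1[cgrp (X (inv_into I e l)) n]"
    if "k : e ` I" "x : Car (X (inv_into I e k)) n" "l : e ` I" "l \<noteq> k" for k x l
    by (rule G(6)[OF i[OF that(1)] that(2) i[OF that(3)] ne[OF that(3,1,4)]])
  qed (rule fin sep, assumption+)+
 qed
 then show ?thesis unfolding dsum_def using D(1,2,3) i by blast
qed

lemma full_subcategory_simps [simp]:
 "Obj (full_subcategory D_Ab P) = P" "Hom (full_subcategory D_Ab P) = dhom" "Comp (full_subcategory D_Ab P) = dcomp"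
 "Ident (full_subcategory D_Ab P) X = dmor X X id_map" "Shift (full_subcategory D_Ab P) = Shf"
 "Dist (full_subcategory D_Ab P) = {(X, Y, Z, f, g, h). (X, Y, Z, f, g, h) : derived_dist \<and> X : P \<and> Y : P \<and> Z : P}"
 by (simp_all add: full_subcategory_def D_Ab_def preadditive_category.defs triangulated_category.defs derived_preadditive_def)

section \<open>Smallness of direct sums, and direct sums as coproducts\<close>

context universe
begin

lemma sm_lists:
 assumes S: "|S| <o |UNIV :: 'u set|" shows "|lists S| <o |UNIV :: 'u set|"
proof -
 let ?L = "%n. {xs : lists S. length xs = n}"
 have L: "|?L n| <o |UNIV :: 'u set|" for n
 proof (induction n)
  case 0
  show ?case by (rule sm_subset[OF sm_countable[of "{[]}"]]) auto
 next
  case (Suc n)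
  have "?L (Suc n) \<subseteq> (%(x, xs). x # xs) ` (S \<times> ?L n)"
  proof
   fix xs assume "xs : ?L (Suc n)"
   then show "xs : (%(x, xs). x # xs) ` (S \<times> ?L n)" by (cases xs) auto
  qed
  then show ?case by (rule sm_subset[OF sm_image[OF sm_Times[OF S Suc]]])
 qed
 have "|snd ` Sigma (UNIV :: nat set) ?L| <o |UNIV :: 'u set|" by (rule sm_image[OF sm_Sigma[OF sm_nat L]])
 moreover have "lists S \<subseteq> snd ` Sigma (UNIV :: nat set) ?L"
 proof
  fix xs assume "xs : lists S"
  then show "xs : snd ` Sigma (UNIV :: nat set) ?L" by (intro image_eqI[of _ _ "(length xs, xs)"]) auto
 qed
 ultimately show ?thesis by (rule sm_subset)
qed

lemma sm_finite_subsets: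
 assumes S: "|S| <o |UNIV :: 'u set|" shows "|{F. finite F \<and> F \<subseteq> S}| <o |UNIV :: 'u set|"
proof -
 have "{F. finite F \<and> F \<subseteq> S} \<subseteq> set ` lists S"
 proof
  fix F assume F: "F : {F. finite F \<and> F \<subseteq> S}"
  then obtain xs where "set xs = F" using finite_list by auto
  then show "F : set ` lists S" using F by (intro image_eqI[of _ _ xs]) auto
 qed
 then show ?thesis by (rule sm_subset[OF sm_image[OF sm_lists[OF S]]])
qed

text \<open>A finitely supported function is determined by the finite set of its nontrivial
  argument-value pairs, and the finite subsets of a small set form a small set.\<close>

lemma sm_finite_support:
 assumes I: "|I| <o |UNIV :: 'u set|" and A: "!!i. i : I ==> |A i| <o |UNIV :: 'u set|"
 shows "|{z : \<Pi>\<^sub>E i\<in>I. A i. finite {i\<in>I. z i \<noteq> c i}}| <o |UNIV :: 'u set|" (is "|?P| <o _")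
proof -
 let ?g = "%z. {(i, z i) | i. i : I \<and> z i \<noteq> c i}"
 have inj: "inj_on ?g ?P"
 proof (rule inj_onI)
  fix z w assume z: "z : ?P" and w: "w : ?P" and e: "?g z = ?g w"
  have "z i = w i" if "i : I" for i
  proof -
   have "(i, z i) : ?g z \<longleftrightarrow> (i, z i) : ?g w" "(i, w i) : ?g z \<longleftrightarrow> (i, w i) : ?g w" using e by simp_all
   then show ?thesis using that by auto
  qed
  then show "z = w" using z w by (intro PiE_ext[of z I A w]) auto
 qed
 have "?g ` ?P \<subseteq> {F. finite F \<and> F \<subseteq> Sigma I A}"
 proof
  fix F assume "F : ?g ` ?P"
  then obtain z where z: "z : ?P" "F = ?g z" by blast
  have "F = (%i. (i, z i)) ` {i\<in>I. z i \<noteq> c i}" using z(2) by auto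
  then show "F : {F. finite F \<and> F \<subseteq> Sigma I A}" using z(1) by auto
 qed
 then show ?thesis by (intro sm_inj_on[OF inj] sm_subset[OF sm_finite_subsets[OF sm_Sigma[OF I A]]])
qed

lemma dsum_exists:
 fixes X :: "'i => 'u cochain_complex"
 assumes I: "|I| <o |UNIV :: 'u set|" and X: "!!i. i : I ==> X i : Sm"
 shows "\<exists>Z\<in>Sm. \<exists>j p. dsum I X Z j p"
proof -
 have cx: "is_complex (X i)" if "i : I" for i using X[OF that] by (rule small_complex)
 note d = sumcx_dsum[of I X, OF cx]
 have car: "Car (sumcx I X) n = {x : \<Pi>\<^sub>E i\<in>I. Car (X i) n. finite {i : I. x i \<noteq> 1[cgrp (X i) n]}}" for n
  using cx by (simp add: sumcx_def carrier_sum_group group_cgrp)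
 have "|Car (sumcx I X) n| <o |UNIV :: 'u set|" for n
  unfolding car by (rule sm_finite_support[OF I small_complex(2)[OF X]])
 then obtain Z :: "'u cochain_complex" and \<phi> where "Z : Sm" "cmap (sumcx I X) Z \<phi>" "\<forall>n. bij_betw (\<phi> n) (Car (sumcx I X) n) (Car Z n)"
  using transport_complex[OF dsumD(1)[OF d]] by blast
 then show ?thesis using dsum_transport[OF d] by blast
qed

text \<open>Roofs on the summands are added up: by \<open>dsum_qis\<close> the direct sum of the
  denominators is a denominator again.\<close>

lemma dsum_coproduct_exists:
 assumes d: "dsum I X Z j p" and I: "|I| <o |UNIV :: 'u set|" and X: "!!i. i : I ==> X i : Sm" and Z: "Z : Sm" and Y: "Y : Sm"
  and g: "!!i. i : I ==> g i : carrier (dhom (X i) Y)"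
 shows "\<exists>h\<in>carrier (dhom Z Y). \<forall>i\<in>I. dcomp (X i) Z Y h (dmor (X i) Z (j i)) = g i"
proof -
 note D = dsumD[OF d]
 have "\<forall>i\<in>I. \<exists>W s f. is_roof (X i) Y W s f \<and> g i = roof_class (X i) Y (W, s, f)"
  using g X derived_hom_carrier[OF _ Y] by blast
 then obtain W s f where r: "!!i. i : I ==> is_roof (X i) Y (W i) (s i) (f i)" "!!i. i : I ==> g i = roof_class (X i) Y (W i, s i, f i)"
  by metis
 obtain N j' p' where N: "N : Sm" "dsum I W N j' p'" using dsum_exists[OF I, of W] is_roofD(1)[OF r(1)] by blast
 note D' = dsumD[OF N(2)]
 obtain t where t: "cmap N Z t" "!!i n x. \<lbrakk>i : I; x : Car (W i) n\<rbrakk> \<Longrightarrow> t n (j' i n x) = (j i \<cdot> s i) n x"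
  using dsum_lift[OF N(2) D(1), of "%i. j i \<cdot> s i"] cmap_comp[OF is_roofD(4)[OF r(1)] D(2)] by blast
 have tq: "qis N Z t" by (rule dsum_qis[OF d N(2) is_roofD(2)[OF r(1)] t(1)]) (use t(2) in auto)
 obtain k where k: "cmap N Y k" "!!i n x. \<lbrakk>i : I; x : Car (W i) n\<rbrakk> \<Longrightarrow> k n (j' i n x) = f i n x"
  using dsum_lift[OF N(2) small_complex(1)[OF Y], of f] is_roofD(3)[OF r(1)] by blast
 have rh: "is_roof Z Y N t k" using N(1) Z Y tq k(1) by (simp add: is_roof_def)
 have "dcomp (X i) Z Y (roof_class Z Y (N, t, k)) (dmor (X i) Z (j i)) = g i" if i: "i : I" for i
 proof -
  note ri = is_roofD[OF r(1)[OF i]]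
  have ji: "is_roof (X i) Z (X i) id_map (j i)" by (rule is_roof_of_chain_map[OF X[OF i] Z D(2)[OF i]])
  have h: "htp (W i) Z (j i \<cdot> s i) (t \<cdot> j' i)"
   using t(2)[OF i] by (intro htp_of_eq cmap_comp[OF ri(4) D(2)[OF i]] cmap_comp[OF D'(2)[OF i] t(1)]) auto
  note c = derived_comp_roof[OF ji rh ri(1) ri(2) D'(2)[OF i] h]
  have "htp (W i) Y (k \<cdot> j' i) (f i)" using k(2)[OF i] by (intro htp_of_eq cmap_comp[OF D'(2)[OF i] k(1)] ri(3)) auto
  then show ?thesis
   unfolding of_chain_map_def c(2) r(2)[OF i]
   using roof_class_htp(2)[OF c(1) htp_refl[OF is_roofD(4)[OF c(1)]]] by simp
 qed
 then show ?thesis using roof_class_closed[OF rh] by blast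
qed

text \<open>Equality of the restrictions gives, for each index separately, a refinement over which
  the two numerators agree up to homotopy. The direct sum of these refinements is one refinement for
  the whole, and the homotopies glue.\<close>

lemma dsum_coproduct_unique:
 assumes d: "dsum I X Z j p" and I: "|I| <o |UNIV :: 'u set|" and X: "!!i. i : I ==> X i : Sm" and Z: "Z : Sm" and Y: "Y : Sm"
  and h: "h1 : carrier (dhom Z Y)" "h2 : carrier (dhom Z Y)"
  and e: "!!i. i : I ==> dcomp (X i) Z Y h1 (dmor (X i) Z (j i)) = dcomp (X i) Z Y h2 (dmor (X i) Z (j i))"
 shows "h1 = h2"
proof -
 note D = dsumD[OF d]
 obtain W1 s1 f1 where 1: "is_roof Z Y W1 s1 f1" "h1 = roof_class Z Y (W1, s1, f1)" by (rule roof_classE[OF Z Y h(1)])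
 obtain W2 s2 f2 where 2: "is_roof Z Y W2 s2 f2" "h2 = roof_class Z Y (W2, s2, f2)" by (rule roof_classE[OF Z Y h(2)])
 obtain W s a b where W: "is_roof Z Y W s a" "is_roof Z Y W s b" "h1 = roof_class Z Y (W, s, a)" "h2 = roof_class Z Y (W, s, b)"
  using common_denominator[OF 1(1) 2(1)] 1(2) 2(2) by metis
 note Wd = is_roofD[OF W(1)]
 have "\<exists>M c v. M : Sm \<and> qis M (X i) c \<and> cmap M W v \<and> htp M Z (j i \<cdot> c) (s \<cdot> v) \<and> htp M Y (a \<cdot> v) (b \<cdot> v)" if i: "i : I" for i
 proof -
  have ji: "is_roof (X i) Z (X i) id_map (j i)" by (rule is_roof_of_chain_map[OF X[OF i] Z D(2)[OF i]])
  obtain N u v where N: "N : Sm" "qis N (X i) u" "cmap N W v" "htp N Z (j i \<cdot> u) (s \<cdot> v)"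
   using ore[OF X[OF i] Wd(1) Z D(2)[OF i] Wd(2)] by blast
  note A = derived_comp_roof[OF ji W(1) N] and B = derived_comp_roof[OF ji W(2) N]
  have "((N, u, a \<cdot> v), (N, u, b \<cdot> v)) : roof_rel (X i) Y"
   using roof_class_eq_iff[OF A(1) B(1)] e[OF i] A(2) B(2) W(3,4) by (simp add: of_chain_map_def)
  from roof_rel_agree[OF X[OF i] Y this N(1) cmap_id cmap_id] N(1) obtain M c where
   M: "M : Sm" "qis M N c" "htp M Y ((a \<cdot> v) \<cdot> c) ((b \<cdot> v) \<cdot> c)"
   using htp_refl[OF qis_cmap[OF N(2)]] by (auto simp: small_complex)
  have "htp M Z (j i \<cdot> u \<cdot> c) (s \<cdot> v \<cdot> c)" using htp_comp_right[OF N(4) qis_cmap[OF M(2)]] by (simp add: comp_map_assoc)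
  moreover have "htp M Y (a \<cdot> v \<cdot> c) (b \<cdot> v \<cdot> c)" using M(3) by (simp add: comp_map_assoc)
  moreover note qis_comp[OF M(2) N(2)] cmap_comp[OF qis_cmap[OF M(2)] N(3)]
  ultimately show ?thesis using M(1) by blast
 qed
 then obtain M c v where M: "!!i. i : I ==> M i : Sm" "!!i. i : I ==> qis (M i) (X i) (c i)" "!!i. i : I ==> cmap (M i) W (v i)"
  "!!i. i : I ==> htp (M i) Z (j i \<cdot> c i) (s \<cdot> v i)" "!!i. i : I ==> htp (M i) Y (a \<cdot> v i) (b \<cdot> v i)"
  by metis
 obtain N j' p' where N: "N : Sm" "dsum I M N j' p'" using dsum_exists[OF I, of M] M(1) by blast
 note D' = dsumD[OF N(2)]
 obtain t where t: "cmap N Z t" "!!i n x. \<lbrakk>i : I; x : Car (M i) n\<rbrakk> \<Longrightarrow> t n (j' i n x) = (j i \<cdot> c i) n x"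
  using dsum_lift[OF N(2) D(1), of "%i. j i \<cdot> c i"] cmap_comp[OF qis_cmap[OF M(2)] D(2)] by blast
 have tq: "qis N Z t" by (rule dsum_qis[OF d N(2) M(2) t(1)]) (use t(2) in auto)
 obtain w where w: "cmap N W w" "!!i n x. \<lbrakk>i : I; x : Car (M i) n\<rbrakk> \<Longrightarrow> w n (j' i n x) = v i n x"
  using dsum_lift[OF N(2) small_complex(1)[OF Wd(1)], of v] M(3) by blast
 have jw: "htp (M i) W (v i) (w \<cdot> j' i)" if "i : I" for i
  using w(2)[OF that] by (intro htp_of_eq M(3)[OF that] cmap_comp[OF D'(2)[OF that] w(1)]) auto
 have st: "htp N Z t (s \<cdot> w)"
 proof (rule dsum_htp[OF N(2) t(1) cmap_comp[OF w(1) Wd(4)]])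
  fix i assume i: "i : I"
  have "htp (M i) Z (t \<cdot> j' i) (j i \<cdot> c i)"
   using t(2)[OF i] by (intro htp_of_eq cmap_comp[OF D'(2)[OF i] t(1)] cmap_comp[OF qis_cmap[OF M(2)[OF i]] D(2)[OF i]]) auto
  from htp_trans[OF htp_trans[OF this M(4)[OF i]] htp_comp_left[OF jw[OF i] Wd(4)]]
  show "htp (M i) Z (t \<cdot> j' i) ((s \<cdot> w) \<cdot> j' i)" by (simp add: comp_map_assoc)
 qed
 have ab: "htp N Y (a \<cdot> w) (b \<cdot> w)"
 proof (rule dsum_htp[OF N(2) cmap_comp[OF w(1) Wd(3)] cmap_comp[OF w(1) is_roofD(3)[OF W(2)]]])
  fix i assume i: "i : I"
  from htp_trans[OF htp_trans[OF htp_sym[OF htp_comp_left[OF jw[OF i] Wd(3)]] M(5)[OF i]] htp_comp_left[OF jw[OF i] is_roofD(3)[OF W(2)]]]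
  show "htp (M i) Y ((a \<cdot> w) \<cdot> j' i) ((b \<cdot> w) \<cdot> j' i)" by (simp add: comp_map_assoc)
 qed
 have "((W, s, a), (W, s, b)) : roof_rel Z Y"
  by (rule roof_relI[OF W(1,2) N(1) w(1) w(1) qis_htp[OF st tq] htp_refl[OF htpD(2)[OF st]] ab])
 then show ?thesis using roof_class_eq_iff[OF W(1,2)] W(3,4) by simp
qed

lemma dsum_coproduct:
 assumes d: "dsum I X Z j p" and I: "|I| <o |UNIV :: 'u set|" and X: "!!i. i : I ==> X i : Sm" and Z: "Z : Sm"
 shows "is_coproduct D_Ab I X Z (%i. dmor (X i) Z (j i))"
proof -
 have "\<exists>!h. h : carrier (dhom Z Y) \<and> (\<forall>i\<in>I. dcomp (X i) Z Y h (dmor (X i) Z (j i)) = g i)"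
  if Y: "Y : Sm" and g: "\<forall>i\<in>I. g i : carrier (dhom (X i) Y)" for Y g
 proof -
  obtain h where "h : carrier (dhom Z Y)" "\<forall>i\<in>I. dcomp (X i) Z Y h (dmor (X i) Z (j i)) = g i"
   using dsum_coproduct_exists[OF d I X Z Y, of g] g by blast
  then show ?thesis using dsum_coproduct_unique[OF d I X Z Y] by (intro ex1I[of _ h]) auto
 qed
 then show ?thesis unfolding is_coproduct_def
  using X Z of_chain_map_closed[OF X Z dsumD(2)[OF d]] by simp
qed

lemma closedQ_dsum:
 assumes Q: "closedQ Q" and d: "dsum I X Z j p" and I: "|I| <o |UNIV :: 'u set|" and X: "!!i. i : I ==> X i : Q" and Z: "Z : Sm"
 shows "Z : Q"
proof -
 \<comment> \<open>\<open>coproduct_closed\<close> speaks of index sets inside the universe, so the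
   family is reindexed along an injection.\<close>
 obtain e :: "_ => 'u" where e: "inj_on e I" using I[THEN ordLess_imp_ordLeq] by (auto simp: card_of_ordLeq[symmetric])
 have s: "small (e ` I)" unfolding small_def by (rule sm_image[OF I])
 have X': "X (inv_into I e i) : Q" if "i : e ` I" for i using X[OF inv_into_into[OF that]] .
 have "is_coproduct D_Ab (e ` I) (%i. X (inv_into I e i)) Z (%i. dmor (X (inv_into I e i)) Z (j (inv_into I e i)))"
  by (rule dsum_coproduct[OF dsum_reindex[OF d e] _ _ Z]) (use s X' Q in \<open>auto simp: small_def closedQ_def\<close>)
 then show ?thesis using Q s X' unfolding closedQ_def coproduct_closed_def by blast
qed

text \<open>Only the universal property inside the subcategory is known for Z. If a concrete direct
  sum Z' lies in the subcategory, the two universal properties give maps both ways, and uniqueness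
  for Z makes it a retract of Z'. Torsion bounds and compactness need no more.\<close>

lemma coproduct_retract:
 assumes P: "P \<subseteq> Sm" and c: "is_coproduct (full_subcategory D_Ab P) I X Z \<iota>" and I: "|I| <o |UNIV :: 'u set|"
  and d: "dsum I X Z' j p" and Z': "Z' : P"
 shows "\<exists>h k. h : carrier (dhom Z Z') \<and> k : carrier (dhom Z' Z) \<and> dcomp Z Z' Z k h = dmor Z Z id_map \<and>
  (\<forall>i\<in>I. dcomp (X i) Z Z' h (\<iota> i) = dmor (X i) Z' (j i)) \<and>
  (\<forall>i\<in>I. dcomp (X i) Z' Z k (dmor (X i) Z' (j i)) = \<iota> i)"
proof -
 note D = dsumD[OF d]
 have X: "i : I ==> X i : Sm" and Z: "Z : Sm" "Z : P" and \<iota>: "i : I ==> \<iota> i : carrier (dhom (X i) Z)" for i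
  using c P by (auto simp: is_coproduct_def)
 have Zs: "Z' : Sm" using Z' P by blast
 have univ: "\<exists>!h. h : carrier (dhom Z Y) \<and> (\<forall>i\<in>I. dcomp (X i) Z Y h (\<iota> i) = g i)"
  if "Y : P" "\<forall>i\<in>I. g i : carrier (dhom (X i) Y)" for Y g
  using c that by (simp add: is_coproduct_def)
 have jc: "dmor (X i) Z' (j i) : carrier (dhom (X i) Z')" if "i : I" for i
  by (rule of_chain_map_closed[OF X[OF that] Zs D(2)[OF that]])
 obtain h where h: "h : carrier (dhom Z Z')" "\<forall>i\<in>I. dcomp (X i) Z Z' h (\<iota> i) = dmor (X i) Z' (j i)"
  using univ[OF Z', of "%i. dmor (X i) Z' (j i)"] jc by blast
 obtain k where k: "k : carrier (dhom Z' Z)" "\<forall>i\<in>I. dcomp (X i) Z' Z k (dmor (X i) Z' (j i)) = \<iota> i"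
  using dsum_coproduct_exists[OF d I X Zs Z(1), of \<iota>] \<iota> by blast
 have idc: "dmor Z Z id_map : carrier (dhom Z Z)" using Z by (simp add: of_chain_map_closed cmap_id small_complex)
 have kh: "dcomp Z Z' Z k h : carrier (dhom Z Z)" by (rule derived_comp_closed[OF Z(1) Zs Z(1) h(1) k(1)])
 have 1: "dcomp (X i) Z Z (dcomp Z Z' Z k h) (\<iota> i) = \<iota> i" if i: "i : I" for i
  using derived_comp_assoc[OF X[OF i] Z(1) Zs Z(1) \<iota>[OF i] h(1) k(1)] h(2) k(2) i by simp
 have 2: "dcomp (X i) Z Z (dmor Z Z id_map) (\<iota> i) = \<iota> i" if i: "i : I" for i
  by (rule derived_comp_id_left[OF X[OF i] Z(1) \<iota>[OF i]])
 have "dcomp Z Z' Z k h = dmor Z Z id_map"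
 proof -
  have "\<exists>!f. f : carrier (dhom Z Z) \<and> (\<forall>i\<in>I. dcomp (X i) Z Z f (\<iota> i) = \<iota> i)" using univ[OF Z(2), of \<iota>] \<iota> by blast
  moreover have "dcomp Z Z' Z k h : carrier (dhom Z Z) \<and> (\<forall>i\<in>I. dcomp (X i) Z Z (dcomp Z Z' Z k h) (\<iota> i) = \<iota> i)"
   using kh 1 by blast
  moreover have "dmor Z Z id_map : carrier (dhom Z Z) \<and> (\<forall>i\<in>I. dcomp (X i) Z Z (dmor Z Z id_map) (\<iota> i) = \<iota> i)"
   using idc 2 by blast
  ultimately show ?thesis unfolding Ex1_def by (elim exE conjE) (metis (no_types, lifting))
 qed
 then show ?thesis using h k by blast
qed

end

section \<open>The two-term free resolution of G and the morphisms out of shifts of G\<close>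

lemma acyclic_atE:
 assumes "is_complex X" "acyclic_at X n" "x : Cy X n"
 obtains z where "z : Car X (n - 1)" "x = cdiff X (n - 1) z"
 using subsetD[OF assms(2)[unfolded acyclic_at_iff[OF assms(1)]] assms(3)] that by (auto simp: coboundaries_iff)

text \<open>The free resolution of Z/p, placed so that its cohomology sits in degree
  \<open>l\<close>: multiplication by p from the integers in degree l - 1 to the integers in degree
  l.\<close>

definition Pcx :: "nat => int => int cochain_complex" where
 "Pcx p l = \<lparr>cgrp = (%n. if n = l \<or> n = l - 1 then integer_group else integer_group\<lparr>carrier := {0}\<rparr>),
  cdiff = (%n k. if n = l - 1 then int p * k else 0)\<rparr>"

lemma Pcx_simps [simp]:
 "Car (Pcx p l) n = (if n = l \<or> n = l - 1 then UNIV else {0})" "x *[cgrp (Pcx p l) n] y = x + y" "1[cgrp (Pcx p l) n] = 0"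
 "cdiff (Pcx p l) n k = (if n = l - 1 then int p * k else 0)"
 by (auto simp: Pcx_def integer_group_def)

lemma is_complex_Pcx: "is_complex (Pcx p l)"
proof (rule is_complexI)
 fix n
 have "subgroup {0} integer_group" by (rule group.triv_subgroup[OF group_integer_group, simplified])
 then show "comm_group (cgrp (Pcx p l) n)"
  using comm_group.comm_group_restrict[OF abelian_integer_group] abelian_integer_group by (simp add: Pcx_def)
qed (auto simp: algebra_simps)

text \<open>The candidate chain map on the resolution that sends the generators in degrees l and l -
  1 to \<open>x\<close> and \<open>w\<close>. It commutes with the differentials when
  \<open>w\<close> bounds the p-th power of the cocycle \<open>x\<close>, and every chain map has
  this shape by \<open>cmap_Pcx_eq_pmap\<close>.\<close>

definition pmap :: "'a cochain_complex => int => 'a => 'a => (int, 'a) graded_map" where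
 "pmap X l x w = (%n k. if n = l then x ^[cgrp X l] k else if n = l - 1 then w ^[cgrp X (l - 1)] k else 1[cgrp X n])"

lemma cmap_pmap:
 assumes X: "is_complex X" and x: "x : Cy X l" and w: "w : Car X (l - 1)" "cdiff X (l - 1) w = x ^[cgrp X l] p"
 shows "cmap (Pcx p l) X (pmap X l x w)"
proof -
 note [simp] = cx_simps[OF X]
 have xc: "x : Car X l" "cdiff X l x = 1[cgrp X (l + 1)]" using x by (auto simp: cocycles_iff)
 have g: "group (cgrp X n)" for n by (rule group_cgrp[OF X])
 show ?thesis
 proof (rule cmapI[OF is_complex_Pcx X])
  fix n :: int and k :: int assume "k : Car (Pcx p l) n"
  have [simp]: "1 + n = n + 1" by simp
  have "(x ^[cgrp X l] p) ^[cgrp X l] k = x ^[cgrp X l] (int p * k)"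
   using group.int_pow_pow[OF g xc(1), of "int p" k] by (simp add: int_pow_int)
  then show "pmap X l x w (n + 1) (cdiff (Pcx p l) n k) = cdiff X n (pmap X l x w n k)"
   using xc w by (auto simp: pmap_def int_pow_0 split: if_splits)
 qed (use xc w in \<open>auto simp: pmap_def group.int_pow_mult[OF g] split: if_splits\<close>)
qed

lemma cmap_Pcx_eq_pmap:
 assumes f: "cmap (Pcx p l) X f" and k: "k : Car (Pcx p l) n"
 shows "f n k = pmap X l (f l 1) (f (l - 1) 1) n k"
proof -
 have "f n k = f n 1 ^[cgrp X n] k" if "n = l \<or> n = l - 1"
 proof -
  have "f n (1 ^[cgrp (Pcx p l) n] k) = f n 1 ^[cgrp X n] k" using that by (intro cmap_simps(7)[OF f]) simp
  moreover have "1 ^[cgrp (Pcx p l) n] k = k" using that by (simp add: Pcx_def)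
  ultimately show ?thesis by simp
 qed
 moreover have "f n k = 1[cgrp X n]" if "\<not> (n = l \<or> n = l - 1)"
  using k that cmap_simps(3)[OF f, of n] by simp
 ultimately show ?thesis by (auto simp: pmap_def)
qed

lemma cmap_Pcx_data:
 assumes f: "cmap (Pcx p l) X f"
 shows "f l 1 : Cy X l" "f (l - 1) 1 : Car X (l - 1)" "cdiff X (l - 1) (f (l - 1) 1) = f l 1 ^[cgrp X l] p"
proof -
 note X = cmapD(2)[OF f]
 have "1 : Cy (Pcx p l) l" by (simp add: cocycles_iff)
 then show "f l 1 : Cy X l" by (rule cmap_cocycle[OF f])
 show "f (l - 1) 1 : Car X (l - 1)" by (rule cmap_simps(1)[OF f]) simp
 have "f l (cdiff (Pcx p l) (l - 1) 1) = cdiff X (l - 1) (f (l - 1) 1)" by (rule cmap_simps(5)[OF f]) simp_all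
 then have "f l (int p) = cdiff X (l - 1) (f (l - 1) 1)" by simp
 moreover have "f l (int p) = f l 1 ^[cgrp X l] int p" using cmap_Pcx_eq_pmap[OF f, of "int p" l] by (simp add: pmap_def)
 ultimately show "cdiff X (l - 1) (f (l - 1) 1) = f l 1 ^[cgrp X l] p" by (simp add: int_pow_int)
qed

text \<open>With \<open>f l 1\<close> the coboundary of y, the quotient of
  \<open>f (l - 1) 1\<close> by the p-th power of y is a cocycle, hence the coboundary of some v.
  The elements y and v are the values of a null homotopy on the two generators.\<close>

lemma cmap_Pcx_null:
 assumes f: "cmap (Pcx p l) X f" and a: "acyclic_at X l" "acyclic_at X (l - 1)"
 shows "htp (Pcx p l) X f (zero_map X)"
proof -
 note X = cmapD(2)[OF f]
 note d = cmap_Pcx_data[OF f]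
 note [simp] = cx_simps[OF X]
 have g: "group (cgrp X n)" for n by (rule group_cgrp[OF X])
 interpret X: comm_group "cgrp X i" for i by (rule comm_group_cgrp[OF X])
 obtain y where y: "y : Car X (l - 1)" "f l 1 = cdiff X (l - 1) y" by (rule acyclic_atE[OF X a(1) d(1)])
 let ?e = "f (l - 1) 1 *[cgrp X (l - 1)] inv[cgrp X (l - 1)] (y ^[cgrp X (l - 1)] p)"
 have "?e : Cy X (l - 1)" using d y by (simp add: cocycles_iff)
 from acyclic_atE[OF X a(2) this] obtain v where v: "v : Car X (l - 2)" "?e = cdiff X (l - 2) v" by auto
 have yp: "y ^[cgrp X (l - 1)] p : Car X (l - 1)" "cdiff X (l - 2) v : Car X (l - 1)" using y v by simp_all
 have w: "f (l - 1) 1 = cdiff X (l - 2) v *[cgrp X (l - 1)] y ^[cgrp X (l - 1)] p"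
  unfolding v(2)[symmetric] using d(2) yp by algebra
 let ?h = "%n k. if n = l then y ^[cgrp X (l - 1)] k else if n = l - 1 then v ^[cgrp X (l - 2)] k else 1[cgrp X (n - 1)]"
 show ?thesis
 proof (rule htpI[OF f cmap_zero[OF is_complex_Pcx X], of ?h])
  fix n and k :: int assume k: "k : Car (Pcx p l) n"
  consider "n = l" | "n = l - 1" | "n \<noteq> l" "n \<noteq> l - 1" by blast
  then show "f n k = zero_map X n k *[cgrp X n] (cdiff X (n - 1) (?h n k) *[cgrp X n] ?h (n + 1) (cdiff (Pcx p l) n k))"
  proof cases
   case 1
   then show ?thesis using cmap_Pcx_eq_pmap[OF f k] y by (simp add: pmap_def zero_map_def)
  next
   case 2
   have "y ^[cgrp X (l - 1)] (int p * k) = (y ^[cgrp X (l - 1)] p) ^[cgrp X (l - 1)] k"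
    using group.int_pow_pow[OF g y(1), of "int p" k] by (simp add: int_pow_int)
   then show ?thesis using 2 cmap_Pcx_eq_pmap[OF f k] y v(1) yp
    by (simp add: pmap_def zero_map_def w X.int_pow_mult_distrib X.m_comm)
  next
   case 3
   then show ?thesis using cmap_Pcx_eq_pmap[OF f k] v(1) by (auto simp: pmap_def zero_map_def int_pow_0)
  qed
 qed (use y v(1) in \<open>auto simp: group.int_pow_mult[OF g] split: if_splits\<close>)
qed

locale prime_generator = universe U for U :: "'u itself" +
 fixes p :: nat and G :: "'u cochain_complex"
 assumes p: "prime p" and G: "G : small_complexes" and conc: "concentrated_in_degree_0 G (integer_mod_group p)"
begin

lemma cG: "is_complex G" using G by (rule small_complex)

lemma G_trivial: "n \<noteq> 0 ==> Car G n = {1[cgrp G n]}"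
 using conc by (auto simp: concentrated_in_degree_0_def trivial_group_def)

lemma G_card: "card (Car G 0) = p"
proof -
 obtain \<phi> where "\<phi> : iso (cgrp G 0) (integer_mod_group p)" using conc by (auto simp: concentrated_in_degree_0_def is_iso_def)
 then have "card (Car G 0) = card (carrier (integer_mod_group p))" by (auto simp: iso_def bij_betw_same_card)
 then show ?thesis using p prime_gt_0_nat by (auto simp: carrier_integer_mod_group)
qed

lemma G_finite: "finite (Car G 0)"
proof (rule ccontr)
 assume "infinite (Car G 0)"
 then have "p = 0" using G_card card.infinite[of "Car G 0"] by simp
 then show False using p by simp
qed

lemma G_pow_p: "g : Car G 0 ==> g ^[cgrp G 0] p = 1[cgrp G 0]"
 using group.pow_order_eq_1[OF group_cgrp[OF cG], of g 0] G_card by (simp add: order_def)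

lemma G_ord:
 assumes g: "g : Car G 0" "g \<noteq> 1[cgrp G 0]" shows "group.ord (cgrp G 0) g = p"
proof -
 interpret G0: group "cgrp G 0" by (rule group_cgrp[OF cG])
 have "G0.ord g dvd p" using G0.ord_dvd_group_order[OF g(1)] G_card by (simp add: order_def)
 moreover have "G0.ord g \<noteq> 1" using G0.ord_eq_1[OF g(1)] g(2) by simp
 ultimately show ?thesis using p unfolding prime_nat_iff by blast
qed

lemma G_pow_eq_1_iff:
 assumes "g : Car G 0" "g \<noteq> 1[cgrp G 0]" shows "g ^[cgrp G 0] (k::int) = 1[cgrp G 0] \<longleftrightarrow> int p dvd k"
 using group.int_pow_eq_id[OF group_cgrp[OF cG] assms(1)] G_ord[OF assms] by simp

lemma G_generator:
 assumes g: "g : Car G 0" "g \<noteq> 1[cgrp G 0]" and x: "x : Car G 0" shows "\<exists>k::int. x = g ^[cgrp G 0] k"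
proof -
 interpret G0: group "cgrp G 0" by (rule group_cgrp[OF cG])
 have p0: "p > 0" using p prime_gt_0_nat by blast
 have "inj_on (%k::nat. g ^[cgrp G 0] k) {0 .. p - 1}" using G0.ord_inj[OF g(1)] G_ord[OF g] by simp
 then have "card ((%k::nat. g ^[cgrp G 0] k) ` {0 .. p - 1}) = card (Car G 0)" using p0 by (simp add: card_image G_card)
 moreover have "(%k::nat. g ^[cgrp G 0] k) ` {0 .. p - 1} \<subseteq> Car G 0" using g by auto
 ultimately have "(%k::nat. g ^[cgrp G 0] k) ` {0 .. p - 1} = Car G 0" by (intro card_subset_eq[OF G_finite])
 then obtain k :: nat where "x = g ^[cgrp G 0] k" using x by blast
 then show ?thesis using int_pow_int[of "cgrp G 0" g k] by (intro exI[of _ "int k"]) simp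
qed

lemma G_nontrivial: "\<exists>g\<in>Car G 0. g \<noteq> 1[cgrp G 0]"
proof (rule ccontr)
 assume "\<not> ?thesis"
 then have "Car G 0 \<subseteq> {1[cgrp G 0]}" by blast
 then have "card (Car G 0) \<le> card {1[cgrp G 0]}" by (intro card_mono) auto
 then show False using G_card prime_gt_1_nat[OF p] by simp
qed

text \<open>G moved to degree \<open>l\<close>: since \<open>Shf k\<close> lowers degrees by k, the
  shift is by -l.\<close>

abbreviation Gs :: "int => 'u cochain_complex" where "Gs l \<equiv> Shf (- l) G"

lemma Gs_Sm: "Gs l : Sm" by (rule shift_Sm[OF G])

lemma Gs_car: "Car (Gs l) n = (if n = l then Car G 0 else {1[cgrp G (n - l)]})"
proof (cases "n = l")
 case False
 then have "n - l \<noteq> 0" by simp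
 from G_trivial[OF this] show ?thesis using False by simp
qed simp

lemma Gs_coboundaries: "Bd (Gs l) n = {1[cgrp G (n - l)]}"
proof -
 have "x = 1[cgrp G (n - l)]" if xb: "x : Bd G (n - l)" for x
 proof (cases "n = l")
  case True
  then obtain z where "z : Car G (- 1)" "x = cdiff G (- 1) z" using xb by (auto simp: coboundaries_iff)
  then show ?thesis using G_trivial[of "- 1"] True cx_simps(3)[OF cG, of "- 1"] by auto
 next
  case False
  then show ?thesis using xb coboundaries_subset_cocycles[OF cG, of "n - l"] G_trivial[of "n - l"] by (auto simp: cocycles_iff)
 qed
 then have "Bd G (n - l) = {1[cgrp G (n - l)]}"
  by (intro equalityI subsetI) (simp_all add: subgroup.one_closed[OF coboundaries_subgroup[OF cG]])
 moreover have "Bd (Gs l) n = Bd G (n - l)" using coboundaries_shift[OF cG, of "- l" n] by simp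
 ultimately show ?thesis by simp
qed

lemma Gs_cocycle:
 assumes g: "g : Car G 0" shows "g : Cy (Gs l) l"
proof -
 have "cdiff G 0 g : Car G 1" using g by (intro cx_simps(1)[OF cG]) simp_all
 then have "cdiff G 0 g = 1[cgrp G 1]" unfolding G_trivial[OF one_neq_zero] by (rule singletonD)
 then have "g : Cy G 0" using g by (simp add: cocycles_iff)
 moreover have "Cy (Gs l) l = Cy G 0" using cocycles_shift[OF cG, of "- l" l] by simp
 ultimately show ?thesis by simp
qed

lemma Gs_acyclic:
 assumes "n \<noteq> l" shows "acyclic_at (Gs l) n"
 unfolding acyclic_at_iff[OF small_complex(1)[OF Gs_Sm]] Gs_coboundaries
proof
 fix x assume "x : Cy (Gs l) n"
 then have "x : Car (Gs l) n" unfolding cocycles_iff by (rule conjunct1)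
 then show "x : {1[cgrp G (n - l)]}" unfolding Gs_car if_not_P[OF assms] .
qed

lemma qis_pmap:
 assumes g: "g : Car G 0" "g \<noteq> 1[cgrp G 0]"
 shows "qis (Pcx p l) (Gs l) (pmap (Gs l) l g 1[cgrp G (- 1)])"
 unfolding qis_iff_cohom
proof (intro conjI allI ballI impI)
 note cGs = small_complex(1)[OF Gs_Sm[of l]]
 show c: "cmap (Pcx p l) (Gs l) (pmap (Gs l) l g 1[cgrp G (- 1)])"
 proof (rule cmap_pmap[OF cGs Gs_cocycle[OF g(1)]])
  show "1[cgrp G (- 1)] : Car (Gs l) (l - 1)" using cx_simps(7)[OF cG, of "- 1"] by simp
  show "cdiff (Gs l) (l - 1) 1[cgrp G (- 1)] = g ^[cgrp (Gs l) l] p"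
   using G_pow_p[OF g(1)] cx_simps(3)[OF cG, of "- 1"] cx_simps(11)[OF cG, of 0] by simp
 qed
 fix n
 { fix k assume k: "k : Cy (Pcx p l) n" "pmap (Gs l) l g 1[cgrp G (- 1)] n k : Bd (Gs l) n"
  have p0: "p \<noteq> 0" using p by auto
  consider "n = l" | "n = l - 1" | "n \<noteq> l" "n \<noteq> l - 1" by blast
  then show "k : Bd (Pcx p l) n"
  proof cases
   case 1
   then have "g ^[cgrp G 0] k = 1[cgrp G 0]" using k(2) by (simp add: pmap_def Gs_coboundaries)
   then obtain m where "k = int p * m" using G_pow_eq_1_iff[OF g] by (auto simp: dvd_def)
   then show ?thesis using 1 by (auto simp: coboundaries_iff)
  next
   case 2
   then show ?thesis using k(1) p0 by (auto simp: cocycles_iff coboundaries_iff)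
  next
   case 3
   then show ?thesis using k(1) by (auto simp: cocycles_iff coboundaries_iff)
  qed }
 { fix y assume y: "y : Cy (Gs l) n"
  show "\<exists>k\<in>Cy (Pcx p l) n. cohom (Gs l) n y (pmap (Gs l) l g 1[cgrp G (- 1)] n k)"
  proof (cases "n = l")
   case True
   then have "y : Car G 0" using y by (simp add: cocycles_iff)
   then obtain k where "y = g ^[cgrp G 0] (k::int)" using G_generator[OF g] by blast
   then have "y = pmap (Gs l) l g 1[cgrp G (- 1)] n k" "k : Cy (Pcx p l) n" using True by (auto simp: pmap_def cocycles_iff)
   then show ?thesis using cohom_refl[OF cGs, of y n] y by (auto simp: cocycles_iff)
  next
   case False
   have "y : Bd (Gs l) n" by (rule subsetD[OF Gs_acyclic[OF False, unfolded acyclic_at_iff[OF cGs]] y])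
   moreover have "0 : Cy (Pcx p l) n" by (simp add: cocycles_iff)
   moreover have "pmap (Gs l) l g 1[cgrp G (- 1)] n 0 = 1[cgrp (Gs l) n]" using cmap_simps(3)[OF c, of n] by simp
   ultimately show ?thesis using cohom_one_iff[OF cGs, of n y] by (intro bexI[of _ 0]) simp_all
  qed }
qed

lemma Pcx_transport:
 "\<exists>P \<phi>. P : Sm \<and> cmap (Pcx p l) P \<phi> \<and> (\<forall>n. bij_betw (\<phi> n) (Car (Pcx p l) n) (Car P n))"
 by (rule transport_complex[OF is_complex_Pcx]) (rule sm_countable, simp)

text \<open>A morphism from \<open>G[-l]\<close> is determined by a chain map on the resolution \<open>\<int> \<rightarrow> \<int>\<close>. The lift along
 a quasi-isomorphism \<open>s\<close> to \<open>G[-l]\<close> commutes strictly with \<open>s\<close>, because \<open>G\<close> has a single group.\<close>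

lemma hom_from_Gs:
 assumes g: "g : Car G 0" "g \<noteq> 1[cgrp G 0]" and P: "P : Sm" "cmap (Pcx p l) P \<phi>" "!!n. bij_betw (\<phi> n) (Car (Pcx p l) n) (Car P n)"
  and X: "X : Sm" and R: "R : carrier (dhom (Gs l) X)"
 shows "\<exists>f. cmap (Pcx p l) X f \<and>
  is_roof (Gs l) X P (pmap (Gs l) l g 1[cgrp G (- 1)] \<cdot> (%n. inv_into (Car (Pcx p l) n) (\<phi> n))) (f \<cdot> (%n. inv_into (Car (Pcx p l) n) (\<phi> n))) \<and>
  R = roof_class (Gs l) X (P, pmap (Gs l) l g 1[cgrp G (- 1)] \<cdot> (%n. inv_into (Car (Pcx p l) n) (\<phi> n)), f \<cdot> (%n. inv_into (Car (Pcx p l) n) (\<phi> n)))"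
proof -
 let ?i = "%n. inv_into (Car (Pcx p l) n) (\<phi> n)" and ?\<pi> = "pmap (Gs l) l g 1[cgrp G (- 1)]"
 note cGs = small_complex(1)[OF Gs_Sm[of l]]
 have i: "qis P (Pcx p l) ?i" by (rule qis_bij(2)[OF P(2,3)])
 note \<pi> = qis_pmap[OF g, of l]
 obtain W s f where 1: "is_roof (Gs l) X W s f" "R = roof_class (Gs l) X (W, s, f)" by (rule roof_classE[OF Gs_Sm X R])
 note r = is_roofD[OF 1(1)]
 note cW = small_complex(1)[OF r(1)]
 obtain w where w: "w : Cy W l" "cohom (Gs l) l g (s l w)" using qis_surj[OF r(2) Gs_cocycle[OF g(1)]] by blast
 have wc: "w : Car W l" and sw: "s l w : Car (Gs l) l" using w(1) cmap_cocycle[OF r(4) w(1)] by (auto simp: cocycles_iff)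
 have "g *[cgrp (Gs l) l] inv[cgrp (Gs l) l] s l w = 1[cgrp (Gs l) l]"
  using w(2) by (simp add: cohom_iff[OF cGs sw] Gs_coboundaries)
 then have gs: "s l w = g" using g(1) sw group.inv_solve_right'[OF group_cgrp[OF cGs, of l], of "1[cgrp (Gs l) l]" g "s l w"]
  by (simp add: cx_simps[OF cG])
 have "s l (w ^[cgrp W l] p) = 1[cgrp (Gs l) l]" using cmap_simps(6)[OF r(4) wc, of p] gs G_pow_p[OF g(1)] by simp
 then have "w ^[cgrp W l] p : Bd W l"
  by (intro qis_inj[OF r(2) cocycles_pow[OF cW w(1)]]) (simp add: Gs_coboundaries)
 then obtain v where v: "v : Car W (l - 1)" "cdiff W (l - 1) v = w ^[cgrp W l] p" by (auto simp: coboundaries_iff)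
 note u = cmap_pmap[OF cW w(1) v]
 let ?u = "pmap W l w v"
 have su: "s n (?u n k) = ?\<pi> n k" if k: "k : Car (Pcx p l) n" for n k
 proof (cases "n = l")
  case True
  then show ?thesis using cmap_simps(7)[OF r(4) wc, of k] gs by (simp add: pmap_def)
 next
  case False
  have "s n (?u n k) : Car (Gs l) n" by (rule cmap_simps(1)[OF r(4) cmap_simps(1)[OF u k]])
  moreover have "?\<pi> n k : Car (Gs l) n" by (rule cmap_simps(1)[OF qis_cmap[OF \<pi>] k])
  ultimately show ?thesis using False Gs_car[of l n] by auto
 qed
 have ui: "cmap P W (?u \<cdot> ?i)" by (rule cmap_comp[OF qis_cmap[OF i] u])
 have \<pi>i: "qis P (Gs l) (?\<pi> \<cdot> ?i)" by (rule qis_comp[OF i \<pi>])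
 have h: "htp P (Gs l) (s \<cdot> ?u \<cdot> ?i) (?\<pi> \<cdot> ?i)"
  by (rule htp_of_eq[OF cmap_comp[OF ui r(4)] qis_cmap[OF \<pi>i]]) (simp add: su cmap_simps(1)[OF qis_cmap[OF i]] del: Pcx_simps)
 note A = roof_class_refine[OF 1(1) P(1) ui qis_htp[OF htp_sym[OF h] \<pi>i]]
 note B = roof_class_htp[OF A(1) h htp_refl[OF is_roofD(3)[OF A(1)]]]
 have "cmap (Pcx p l) X (f \<cdot> ?u)" by (rule cmap_comp[OF u r(3)])
 then show ?thesis using A B 1(2) by (intro exI[of _ "f \<cdot> ?u"]) (simp add: comp_map_assoc)
qed

lemma zero_hom_Gs:
 assumes X: "X : Sm" and a: "acyclic_at X l" "acyclic_at X (l - 1)" shows "zero_hom D_Ab (Gs l) X"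
proof -
 obtain g where g: "g : Car G 0" "g \<noteq> 1[cgrp G 0]" using G_nontrivial by blast
 obtain P \<phi> where P: "P : Sm" "cmap (Pcx p l) P \<phi>" "!!n. bij_betw (\<phi> n) (Car (Pcx p l) n) (Car P n)" using Pcx_transport by blast
 have "R = 1[dhom (Gs l) X]" if R: "R : carrier (dhom (Gs l) X)" for R
 proof -
  let ?i = "%n. inv_into (Car (Pcx p l) n) (\<phi> n)"
  obtain f where f: "cmap (Pcx p l) X f" "is_roof (Gs l) X P (pmap (Gs l) l g 1[cgrp G (- 1)] \<cdot> ?i) (f \<cdot> ?i)"
   "R = roof_class (Gs l) X (P, pmap (Gs l) l g 1[cgrp G (- 1)] \<cdot> ?i, f \<cdot> ?i)" using hom_from_Gs[OF g P X R] by blast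
  have "htp P X (f \<cdot> ?i) (zero_map X)"
   using htp_comp_right[OF cmap_Pcx_null[OF f(1) a] cmap_inverse[OF P(2,3)]] by (simp add: zero_map_comp)
  then show ?thesis
   using roof_class_htp(2)[OF f(2) htp_refl[OF is_roofD(4)[OF f(2)]]] f(3) derived_zero(1)[OF Gs_Sm X P(1) is_roofD(2)[OF f(2)]] by simp
 qed
 then show ?thesis
  using comm_group_derived_hom[OF Gs_Sm X] by (auto simp: zero_hom_def monoid.one_closed comm_group_def comm_monoid_def)
qed

text \<open>A bounding element of the p-th power of x completes x to a chain map on the resolution
  of \<open>Gs l\<close>, with the resolution itself as the denominator of the roof.\<close>

lemma morphism_from_Gs:
 assumes g: "g : Car G 0" "g \<noteq> 1[cgrp G 0]" and X: "X : Sm" and x: "x : Cy X l" "x ^[cgrp X l] p : Bd X l"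
 shows "\<exists>R\<in>carrier (dhom (Gs l) X). hrel (Gs l) X R l g x"
proof -
 obtain P \<phi> where P: "P : Sm" "cmap (Pcx p l) P \<phi>" "!!n. bij_betw (\<phi> n) (Car (Pcx p l) n) (Car P n)" using Pcx_transport by blast
 let ?i = "%n. inv_into (Car (Pcx p l) n) (\<phi> n)" and ?\<pi> = "pmap (Gs l) l g 1[cgrp G (- 1)]"
 have i: "qis P (Pcx p l) ?i" by (rule qis_bij(2)[OF P(2,3)])
 note cX = small_complex(1)[OF X] and cGs = small_complex(1)[OF Gs_Sm[of l]]
 obtain w where w: "w : Car X (l - 1)" "cdiff X (l - 1) w = x ^[cgrp X l] p" using x(2) by (auto simp: coboundaries_iff)
 note f = cmap_pmap[OF cX x(1) w]
 have r: "is_roof (Gs l) X P (?\<pi> \<cdot> ?i) (pmap X l x w \<cdot> ?i)"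
  unfolding is_roof_def by (intro conjI P(1) Gs_Sm X qis_comp[OF i qis_pmap[OF g]] cmap_comp[OF qis_cmap[OF i] f])
 have one: "1 : Cy (Pcx p l) l" by (simp add: cocycles_iff)
 then have m: "\<phi> l 1 : Cy P l" by (rule cmap_cocycle[OF P(2)])
 have e: "?i l (\<phi> l 1) = 1" by (rule bij_betw_inv_into_left[OF P(3)]) simp
 have "?\<pi> l 1 = g" "pmap X l x w l 1 = x"
  using g(1) x(1) by (simp_all add: pmap_def group.int_pow_1[OF group_cgrp[OF cG]] group.int_pow_1[OF group_cgrp[OF cX]] cocycles_iff)
 then have "ceq (Gs l) l ((?\<pi> \<cdot> ?i) l (\<phi> l 1)) g" "ceq X l ((pmap X l x w \<cdot> ?i) l (\<phi> l 1)) x"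
  using e ceq_refl[OF cGs Gs_cocycle[OF g(1)]] ceq_refl[OF cX x(1)] by simp_all
 then have "hrel (Gs l) X (roof_class (Gs l) X (P, ?\<pi> \<cdot> ?i, pmap X l x w \<cdot> ?i)) l g x"
  unfolding hrel_def using mem_roof_class_self[OF r] m by blast
 then show ?thesis using roof_class_closed[OF r] by blast
qed

end

text \<open>Linear independence, over the field with p elements, of the classes of B in V modulo N.
  The coefficients are integers, and a vanishing coefficient is one divisible by p.\<close>

definition indep_mod :: "nat => 'a monoid => 'a set => 'a set => bool" where
 "indep_mod p V N B \<longleftrightarrow> (\<forall>F (c :: 'a => int). finite F \<and> F \<subseteq> B \<and> finprod V (%b. b ^[V] c b) F : N --> (\<forall>b\<in>F. int p dvd c b))"

lemma indep_modD: "\<lbrakk>indep_mod p V N B; finite F; F \<subseteq> B; finprod V (%b. b ^[V] (c b :: int)) F : N; b : F\<rbrakk> \<Longrightarrow> int p dvd c b"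
 unfolding indep_mod_def by blast

lemma ex_maximal_indep:
 fixes V :: "'a monoid"
 shows "\<exists>B\<subseteq>S. indep_mod p V N B \<and> (\<forall>B'\<subseteq>S. indep_mod p V N B' \<and> B \<subseteq> B' --> B' = B)"
proof -
 let ?A = "{B. B \<subseteq> S \<and> indep_mod p V N B}"
 have "\<exists>M\<in>?A. \<forall>X\<in>?A. M \<subseteq> X --> X = M"
 proof (rule subset_Zorn)
  fix C assume C: "subset.chain ?A C"
  show "\<exists>U\<in>?A. \<forall>X\<in>C. X \<subseteq> U"
  proof (cases "C = {}")
   case True
   have "{} : ?A" by (simp add: indep_mod_def)
   then show ?thesis using True by blast
  next
   case False
   have "indep_mod p V N (\<Union> C)"
    unfolding indep_mod_def
   proof (intro allI impI)
    fix F and c :: "'a => int" assume F: "finite F \<and> F \<subseteq> \<Union> C \<and> finprod V (%b. b ^[V] c b) F : N"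
    then obtain B where B: "B : C" "F \<subseteq> B"
     using finite_subset_Union_chain[of F C ?A] False C by blast
    then have "indep_mod p V N B" using C by (auto simp: subset.chain_def)
    then show "\<forall>b\<in>F. int p dvd c b" using F B unfolding indep_mod_def by blast
   qed
   moreover have "\<Union> C \<subseteq> S" using C by (auto simp: subset.chain_def)
   ultimately show ?thesis by blast
  qed
 qed
 then obtain M where M: "M \<subseteq> S" "indep_mod p V N M" "\<forall>X\<in>?A. M \<subseteq> X --> X = M" by auto
 then show ?thesis by (intro exI[of _ M] conjI allI impI) auto
qed

lemma (in comm_group) mult_eq_cancel_insert:
 "\<lbrakk>a : carrier G; b : carrier G; c : carrier G\<rbrakk> \<Longrightarrow> a \<otimes> b = inv c \<otimes> (a \<otimes> (b \<otimes> c))"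
 by algebra

lemma maximal_indep_spans:
 fixes V :: "'a monoid"
 assumes V: "comm_group V" and p: "prime p" and S: "subgroup S V" and N: "subgroup N V" and NS: "N \<subseteq> S"
  and el: "!!v. v : S ==> v ^[V] p : N"
  and B: "B \<subseteq> S" "indep_mod p V N B" "!!B'. \<lbrakk>B' \<subseteq> S; indep_mod p V N B'; B \<subseteq> B'\<rbrakk> \<Longrightarrow> B' = B" and v: "v : S"
 shows "\<exists>F (c :: 'a => int) m. finite F \<and> F \<subseteq> B \<and> m : N \<and> v = finprod V (%b. b ^[V] c b) F *[V] m"
proof (rule ccontr)
 assume no: "\<not> ?thesis"
 interpret V: comm_group V by fact
 have Sc: "S \<subseteq> carrier V" and Nc: "N \<subseteq> carrier V" using S N subgroup.subset by blast+
 have vB: "v \<notin> B"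
 proof
  assume "v : B"
  then have "finite {v} \<and> {v} \<subseteq> B \<and> 1[V] : N \<and> v = finprod V (%b. b ^[V] (1::int)) {v} *[V] 1[V]"
   using v Sc subgroup.one_closed[OF N] by auto
  then show False using no by (auto simp del: V.finprod_insert)
 qed
 have powN: "u ^[V] k : N" if u: "u : S" and d: "int p dvd k" for u and k :: int
 proof -
  obtain l where l: "k = int p * l" using d by (auto simp: dvd_def)
  have "u ^[V] k = (u ^[V] p) ^[V] l" using V.int_pow_pow[of u "int p" l] u Sc l by (auto simp: int_pow_int)
  then show ?thesis using V.subgroup_int_pow_closed[OF N el[OF u]] by simp
 qed
 have "indep_mod p V N (insert v B)"
  unfolding indep_mod_def
 proof (intro allI impI)
  fix F and c :: "'a => int" assume "finite F \<and> F \<subseteq> insert v B \<and> finprod V (%b. b ^[V] c b) F : N"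
  then have F: "finite F" "F \<subseteq> insert v B" "finprod V (%b. b ^[V] c b) F : N" by auto
  show "\<forall>b\<in>F. int p dvd c b"
  proof (cases "v : F")
   case False
   then have "F \<subseteq> B" using F(2) by blast
   then show ?thesis using indep_modD[OF B(2) F(1) _ F(3)] by blast
  next
   case True
   define F' where "F' = F - {v}"
   have F': "finite F'" "F' \<subseteq> B" "F = insert v F'" "v \<notin> F'" using F True by (auto simp: F'_def)
   have cl: "(%b. b ^[V] c b) : F' \<rightarrow> carrier V" using F'(2) B(1) Sc by auto
   let ?w = "finprod V (%b. b ^[V] c b) F'"
   have w: "?w : carrier V" using cl by (rule V.finprod_closed)
   have vc: "v : carrier V" using v Sc by blast
   have prod: "v ^[V] c v *[V] ?w : N" using F(3) F' cl vc by simp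
   have pv: "int p dvd c v"
   proof (rule ccontr)
    assume "\<not> int p dvd c v"
    \<comment> \<open>Bezout inverts the coefficient of v modulo p, so the relation can be solved
      for v in terms of B, contrary to \<open>no\<close>.\<close>
    then have "coprime (int p) (c v)" using p by (simp add: prime_imp_coprime)
    then obtain a b where ab: "a * int p + b * c v = 1" using bezout_int[of "int p" "c v"] by (auto simp: coprime_iff_gcd_eq_1)
    let ?n = "v ^[V] c v *[V] ?w"
    let ?m = "v ^[V] (a * int p) *[V] ?n ^[V] b"
    have m: "?m : N"
     using powN[OF v, of "a * int p"] V.subgroup_int_pow_closed[OF N prod] subgroup.m_closed[OF N] by simp
    have mc: "?m : carrier V" using m Nc by blast
    have c1: "v ^[V] (a * int p) : carrier V" "v ^[V] (b * c v) : carrier V" "?w ^[V] b : carrier V" using vc w by auto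
    have "v = v ^[V] (a * int p + b * c v)" using ab vc by simp
    also have "\<dots> = v ^[V] (a * int p) *[V] v ^[V] (b * c v)" using vc by (simp add: V.int_pow_mult)
    also have "\<dots> = inv[V] (?w ^[V] b) *[V] (v ^[V] (a * int p) *[V] (v ^[V] (b * c v) *[V] ?w ^[V] b))"
     by (rule V.mult_eq_cancel_insert[OF c1])
    also have "v ^[V] (b * c v) *[V] ?w ^[V] b = ?n ^[V] b"
     using vc w by (simp add: V.int_pow_mult_distrib[OF V.m_comm] V.int_pow_pow mult.commute)
    also have "inv[V] (?w ^[V] b) = ?w ^[V] (- b)" using w by (simp add: V.int_pow_neg)
    also have "?w ^[V] (- b) = finprod V (%x. (x ^[V] c x) ^[V] (- b)) F'"
    proof (rule finprod_hom[OF V V _ F'(1) cl])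
     show "(%x. x ^[V] (- b)) : hom V V" by (rule homI) (simp_all add: V.int_pow_mult_distrib[OF V.m_comm])
    qed
    also have "\<dots> = finprod V (%x. x ^[V] (c x * (- b))) F'"
     by (rule V.finprod_cong') (use F'(2) B(1) Sc in \<open>auto simp: V.int_pow_pow subset_iff\<close>)
    finally have "v = finprod V (%x. x ^[V] (c x * (- b))) F' *[V] ?m" .
    then show False using no F'(1,2) m by (auto dest!: spec[of _ F'] spec[of _ "%x. c x * (- b)"])
   qed
   have vN: "v ^[V] c v : N" by (rule powN[OF v pv])
   have "?w = inv[V] (v ^[V] c v) *[V] (v ^[V] c v *[V] ?w)" by (rule V.inv_cancel_left(2)[OF V.int_pow_closed[OF vc] w, symmetric])
   then have "?w : N" using subgroup.m_closed[OF N subgroup.m_inv_closed[OF N vN] prod] by simp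
   then show ?thesis using indep_modD[OF B(2) F'(1,2)] pv F'(3) by blast
  qed
 qed
 then have "insert v B = B" using B(1) v by (intro B(3)) auto
 then show False using vB by blast
qed

section \<open>Complexes killed by p\<close>

context prime_generator
begin

text \<open>G is cyclic with generator g. The exponent \<kappa> chosen for an element is unique
  modulo p, which is enough because the p-th power of v is trivial.\<close>

lemma hom_of_G:
 assumes V: "comm_group V" and g: "g : Car G 0" "g \<noteq> 1[cgrp G 0]" and v: "v : carrier V" "v ^[V] p = 1[V]"
 shows "\<exists>f\<in>hom (cgrp G 0) V. \<forall>k::int. f (g ^[cgrp G 0] k) = v ^[V] k"
proof -
 interpret V: comm_group V by fact
 interpret G0: comm_group "cgrp G 0" by (rule comm_group_cgrp[OF cG])
 define \<kappa> where "\<kappa> = (%x. SOME k::int. x = g ^[cgrp G 0] k)"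
 have \<kappa>: "x = g ^[cgrp G 0] \<kappa> x" if "x : Car G 0" for x
  unfolding \<kappa>_def by (rule someI_ex[OF G_generator[OF g that]])
 have v0: "v ^[V] (int p * l) = 1[V]" for l :: int
  using V.int_pow_pow[OF v(1), of "int p" l] v(2) by (simp add: int_pow_int)
 have eq: "v ^[V] a = v ^[V] b" if "g ^[cgrp G 0] a = g ^[cgrp G 0] b" for a b :: int
 proof -
  have "g ^[cgrp G 0] (a - b) = 1[cgrp G 0]" using that g(1) by (simp add: G0.int_pow_diff)
  then obtain l where "a = b + int p * l" using G_pow_eq_1_iff[OF g] by (auto simp: dvd_def algebra_simps)
  then show ?thesis using v0[of l] v(1) by (simp add: V.int_pow_mult)
 qed
 define f where "f = (%x. v ^[V] \<kappa> x)"
 have f: "f (g ^[cgrp G 0] k) = v ^[V] k" for k :: int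
  unfolding f_def using g(1) by (intro eq) (simp add: \<kappa>[symmetric])
 have "f : hom (cgrp G 0) V"
 proof (rule homI)
  fix x y assume xy: "x : Car G 0" "y : Car G 0"
  show "f x : carrier V" using v(1) by (simp add: f_def)
  have "x *[cgrp G 0] y = g ^[cgrp G 0] (\<kappa> x + \<kappa> y)" using \<kappa>[OF xy(1)] \<kappa>[OF xy(2)] g(1) by (simp add: G0.int_pow_mult)
  then show "f (x *[cgrp G 0] y) = f x *[V] f y" using f[of "\<kappa> x + \<kappa> y"] v(1) by (simp add: f_def V.int_pow_mult)
 qed
 then show ?thesis using f by blast
qed

text \<open>Over a field every complex is quasi-isomorphic to its cohomology: in each degree,
  cocycles representing a basis of the cohomology are chosen, and each receives its own copy of G.
  The last clause keeps the copies in degrees with cohomology, which later controls the shifts of G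
  that are used.\<close>

lemma elementary_decomposition:
 assumes K: "K : Sm" and el: "!!n x. x : Car K n ==> x ^[cgrp K n] p = 1[cgrp K n]"
 shows "\<exists>(I :: (int \<times> 'u) set) Z j q h. |I| <o |UNIV :: 'u set| \<and> Z : Sm \<and> dsum I (%i. Gs (fst i)) Z j q \<and> qis Z K h \<and>
  (\<forall>i\<in>I. \<not> acyclic_at K (fst i))"
proof -
 note cK = small_complex(1)[OF K]
 obtain g where g: "g : Car G 0" "g \<noteq> 1[cgrp G 0]" using G_nontrivial by blast
 have "\<forall>n. \<exists>B\<subseteq>Cy K n. indep_mod p (cgrp K n) (Bd K n) B \<and>
  (\<forall>B'\<subseteq>Cy K n. indep_mod p (cgrp K n) (Bd K n) B' \<and> B \<subseteq> B' --> B' = B)"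
  by (intro allI ex_maximal_indep)
 from choice[OF this] obtain B where B0: "\<forall>n. B n \<subseteq> Cy K n \<and> indep_mod p (cgrp K n) (Bd K n) (B n) \<and>
  (\<forall>B'\<subseteq>Cy K n. indep_mod p (cgrp K n) (Bd K n) B' \<and> B n \<subseteq> B' --> B' = B n)" by (elim exE)
 have B: "!!n. B n \<subseteq> Cy K n" "!!n. indep_mod p (cgrp K n) (Bd K n) (B n)"
  "!!n B'. \<lbrakk>B' \<subseteq> Cy K n; indep_mod p (cgrp K n) (Bd K n) B'; B n \<subseteq> B'\<rbrakk> \<Longrightarrow> B' = B n"
  using B0 by simp_all
 \<comment> \<open>An index is a degree together with a basis cocycle in that degree.\<close>
 define I where "I = Sigma (UNIV :: int set) B"
 have BK: "b : Car K n" "b : Cy K n" if "b : B n" for b n using B(1)[of n] that by (auto simp: cocycles_iff)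
 have "|B n| <o |UNIV :: 'u set|" for n by (rule sm_subset[OF small_complex(2)[OF K, of n]]) (use BK in auto)
 then have Ism: "|I| <o |UNIV :: 'u set|" unfolding I_def by (intro sm_Sigma[OF sm_countable]) auto
 have na: "\<not> acyclic_at K n" if b: "b : B n" for n b
 proof
  assume "acyclic_at K n"
  then have bb: "b : Bd K n" using BK(2)[OF b] by (auto simp: acyclic_at_iff[OF cK] simp del: One_nat_def)
  interpret Kn: comm_group "cgrp K n" by (rule comm_group_cgrp[OF cK])
  have "finprod (cgrp K n) (%b. b ^[cgrp K n] (1::int)) {b} = b" using BK(1)[OF b] by simp
  then have "int p dvd 1" using bb b by (intro indep_modD[OF B(2), of "{b}" n "%_. 1" b]) auto
  then show False using p by (simp add: prime_nat_iff)
 qed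
 obtain Z j q where Z: "Z : Sm" "dsum I (%i. Gs (fst i)) Z j q"
  using dsum_exists[OF Ism, of "%i. Gs (fst i)"] Gs_Sm by blast
 note D = dsumD[OF Z(2)]
 have "\<exists>f\<in>hom (cgrp G 0) (cgrp K (fst i)). \<forall>k::int. f (g ^[cgrp G 0] k) = snd i ^[cgrp K (fst i)] k" if "i : I" for i
 proof (rule hom_of_G[OF comm_group_cgrp[OF cK] g])
  show "snd i : Car K (fst i)" using that BK by (auto simp: I_def)
  then show "snd i ^[cgrp K (fst i)] p = 1[cgrp K (fst i)]" by (rule el)
 qed
 then have "\<forall>i\<in>I. \<exists>f. f : hom (cgrp G 0) (cgrp K (fst i)) \<and> (\<forall>k::int. f (g ^[cgrp G 0] k) = snd i ^[cgrp K (fst i)] k)" by blast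
 from bchoice[OF this] obtain f where f0: "\<forall>i\<in>I. f i : hom (cgrp G 0) (cgrp K (fst i)) \<and> (\<forall>k::int. f i (g ^[cgrp G 0] k) = snd i ^[cgrp K (fst i)] k)"
  by (elim exE)
 have f: "!!i. i : I ==> f i : hom (cgrp G 0) (cgrp K (fst i))"
  "!!i k. i : I ==> f i (g ^[cgrp G 0] (k::int)) = snd i ^[cgrp K (fst i)] k" using f0 by simp_all
 have fz: "f i x : Cy K (fst i)" if i: "i : I" and x: "x : Car G 0" for i x
 proof -
  obtain k :: int where k: "x = g ^[cgrp G 0] k" using G_generator[OF g x] by blast
  have "snd i : Cy K (fst i)" using i BK by (auto simp: I_def)
  then show ?thesis using f(2)[OF i, of k] k by (simp add: cocycles_iff cx_simps[OF cK])
 qed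
 let ?f = "%i n x. if n = fst i then f i x else 1[cgrp K n]"
 have fc: "cmap (Gs (fst i)) K (?f i)" if i: "i : I" for i
 proof (rule cmapI[OF small_complex(1)[OF Gs_Sm] cK])
  fix n x assume x: "x : Car (Gs (fst i)) n"
  show fxc: "?f i n x : Car K n"
   using x fz[OF i, of x] by (auto simp: cocycles_iff cx_simps[OF cK])
  show "?f i n (x *[cgrp (Gs (fst i)) n] y) = ?f i n x *[cgrp K n] ?f i n y" if y: "y : Car (Gs (fst i)) n" for y
   using x y f(1)[OF i] by (auto simp: cx_simps[OF cK] hom_def)
  have "cdiff (Gs (fst i)) n x : Car (Gs (fst i)) (n + 1)" using x by (intro cx_simps(1)[OF small_complex(1)[OF Gs_Sm]]) auto
  moreover have "f i 1[cgrp G 0] = 1[cgrp K (fst i)]" using f(2)[OF i, of 0] by simp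
  moreover have "cdiff (Gs (fst i)) n x = 1[cgrp G 0]" if n1: "n + 1 = fst i"
  proof -
   have "n \<noteq> fst i" using n1 by simp
   then have "x = 1[cgrp (Gs (fst i)) n]" using x unfolding Gs_car if_not_P[OF \<open>n \<noteq> fst i\<close>] by simp
   then have "cdiff (Gs (fst i)) n x = 1[cgrp (Gs (fst i)) (n + 1)]" using cx_simps(3)[OF small_complex(1)[OF Gs_Sm]] by simp
   then show ?thesis using n1 by simp
  qed
  ultimately show "?f i (n + 1) (cdiff (Gs (fst i)) n x) = cdiff K n (?f i n x)"
   using fz[OF i, of x] x by (auto simp: cx_simps[OF cK] cocycles_iff)
 qed
 obtain h where h: "cmap Z K h" "!!i n x. \<lbrakk>i : I; x : Car (Gs (fst i)) n\<rbrakk> \<Longrightarrow> h n (j i n x) = ?f i n x"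
  using dsum_lift[OF Z(2) cK fc] by blast
 \<comment> \<open>The image of z is the combination of basis cocycles whose coefficients are read
   off from the components of z. Injectivity on cohomology then reduces to independence of the
   basis, surjectivity to the spanning property.\<close>
 have hz: "\<exists>c :: 'u => int. \<exists>F. finite F \<and> F \<subseteq> B n \<and> h n z = finprod (cgrp K n) (%b. b ^[cgrp K n] c b) F \<and>
   (\<forall>b. (n, b) : I --> q (n, b) n z = (if b : F then g ^[cgrp G 0] c b else 1[cgrp G 0]))"
  if z: "z : Car Z n" for n z
 proof -
  interpret Kn: comm_group "cgrp K n" by (rule comm_group_cgrp[OF cK])
  let ?S = "{i\<in>I. q i n z \<noteq> 1[cgrp (Gs (fst i)) n]}"
  have S: "finite ?S" "?S \<subseteq> I" using gsumD(7)[OF D(4) z] by auto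
  have fsti: "fst i = n" if "i : ?S" for i
  proof (rule ccontr)
   assume ne: "fst i \<noteq> n"
   have "q i n z : Car (Gs (fst i)) n" using that gsumD(10)[OF D(4) _ z] by auto
   then have "q i n z = 1[cgrp (Gs (fst i)) n]" unfolding Gs_car if_not_P[OF ne[symmetric]] by simp
   then show False using that by blast
  qed
  have qc: "q i n z : Car (Gs (fst i)) n" if "i : I" for i using gsumD(10)[OF D(4) that z] .
  have qg: "q i n z : Car G 0" if "i : ?S" for i using qc[of i] that fsti[OF that] by simp
  have "\<forall>b\<in>snd ` ?S. \<exists>k::int. q (n, b) n z = g ^[cgrp G 0] k"
  proof
   fix b assume "b : snd ` ?S"
   then obtain i where i: "i : ?S" "b = snd i" by blast
   then have "i = (n, b)" using fsti[OF i(1)] by (cases i) auto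
   then show "\<exists>k::int. q (n, b) n z = g ^[cgrp G 0] k" using G_generator[OF g qg[OF i(1)]] by blast
  qed
  from bchoice[OF this] obtain c :: "'u => int" where c0: "\<forall>b\<in>snd ` ?S. q (n, b) n z = g ^[cgrp G 0] c b" by (elim exE)
  have c: "q (n, b) n z = g ^[cgrp G 0] c b" if "b : snd ` ?S" for b using c0 that by (rule bspec)
  have sB: "snd i : B n" if "i : ?S" for i using that fsti[OF that] by (cases i) (simp add: I_def)
  have sc: "snd i ^[cgrp K n] c (snd i) : Car K n" if "i : ?S" for i using BK(1)[OF sB[OF that]] by (rule Kn.int_pow_closed)
  have inj: "inj_on snd ?S"
  proof (rule inj_onI)
   fix a b assume "a : ?S" "b : ?S" "snd a = snd b"
   then show "a = b" using fsti[of a] fsti[of b] by (intro prod_eqI) simp_all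
  qed
  have Sb: "(n, b) : ?S \<longleftrightarrow> b : snd ` ?S" for b
  proof
   assume "b : snd ` ?S"
   then obtain i where i: "i : ?S" "b = snd i" by blast
   then show "(n, b) : ?S" using fsti[OF i(1)] by (cases i) auto
  next
   assume "(n, b) : ?S"
   then show "b : snd ` ?S" by (rule image_eqI[rotated]) simp
  qed
  have hm: "h n : hom (cgrp Z n) (cgrp K n)" using h(1) by (simp add: cmap_def chain_map_def)
  have jc: "(%i. j i n (q i n z)) : ?S \<rightarrow> Car Z n" using gsumD(9)[OF D(4)] qc by auto
  have fcl: "f i (q i n z) : Car K n" if "i : ?S" for i using fz[of i "q i n z"] that fsti[OF that] qg[OF that] by (auto simp: cocycles_iff)
  have "h n z = h n (finprod (cgrp Z n) (%i. j i n (q i n z)) ?S)" using gsum_decomp[OF D(4) z S] by simp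
  also have "\<dots> = finprod (cgrp K n) (%i. h n (j i n (q i n z))) ?S"
   by (rule finprod_hom[OF comm_group_cgrp[OF D(1)] comm_group_cgrp[OF cK] hm S(1) jc])
  also have "\<dots> = finprod (cgrp K n) (%i. snd i ^[cgrp K n] c (snd i)) ?S"
  proof (rule Kn.finprod_cong')
   fix i assume i: "i : ?S"
   have e: "i = (n, snd i)" using fsti[OF i] by (cases i) auto
   have hf: "h n (j i n (q i n z)) = f i (q i n z)" using h(2)[of i "q i n z" n] i qc[of i] fsti[OF i] by auto
   have "q i n z = g ^[cgrp G 0] c (snd i)" using c[OF imageI[OF i]] e by simp
   moreover have "f i (g ^[cgrp G 0] c (snd i)) = snd i ^[cgrp K n] c (snd i)" using f(2)[of i] i fsti[OF i] by auto
   ultimately show "h n (j i n (q i n z)) = snd i ^[cgrp K n] c (snd i)" using hf by simp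
  next
   show "(%i. snd i ^[cgrp K n] c (snd i)) : ?S \<rightarrow> Car K n"
    using sc by (rule Pi_I)
  qed simp
  also have "\<dots> = finprod (cgrp K n) (%b. b ^[cgrp K n] c b) (snd ` ?S)"
   by (rule Kn.finprod_reindex[symmetric, OF _ inj]) (use sc in auto)
  finally have e: "h n z = finprod (cgrp K n) (%b. b ^[cgrp K n] c b) (snd ` ?S)" .
  have "snd ` ?S \<subseteq> B n" using sB by (rule image_subsetI)
  moreover have "q (n, b) n z = (if b : snd ` ?S then g ^[cgrp G 0] c b else 1[cgrp G 0])" if "(n, b) : I" for b
   using Sb[of b] c[of b] that by auto
  ultimately show ?thesis using e S(1) by (intro exI[of _ c] exI[of _ "snd ` ?S"]) auto
 qed
 have "qis Z K h"
  unfolding qis_iff_cohom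
 proof (intro conjI allI ballI impI h(1))
  fix n
  interpret Kn: comm_group "cgrp K n" by (rule comm_group_cgrp[OF cK])
  { fix z assume z: "z : Cy Z n" "h n z : Bd K n"
   then have zc: "z : Car Z n" by (simp add: cocycles_iff)
   obtain c F where c: "finite F" "F \<subseteq> B n" "h n z = finprod (cgrp K n) (%b. b ^[cgrp K n] (c b :: int)) F"
    "\<forall>b. (n, b) : I --> q (n, b) n z = (if b : F then g ^[cgrp G 0] c b else 1[cgrp G 0])" using hz[OF zc] by blast
   have "z = 1[cgrp Z n]"
   proof (rule gsumD(8)[OF D(4) zc])
    fix i assume i: "i : I"
    show "q i n z = 1[cgrp (Gs (fst i)) n]"
    proof (cases "n = fst i")
     case True
     have dv: "int p dvd c b" if "b : F" for b using indep_modD[OF B(2) c(1,2) _ that] z(2) c(3) by simp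
     have "(n, snd i) : I" using True i by simp
     from c(4)[rule_format, OF this] have "q (n, snd i) n z = 1[cgrp G 0]"
      using dv[of "snd i"] G_pow_eq_1_iff[OF g, of "c (snd i)"] by (cases "snd i : F") simp_all
     then show ?thesis using True by simp
    next
     case False
     have "q i n z : Car (Gs (fst i)) n" using gsumD(10)[OF D(4) i zc] .
     then show ?thesis unfolding Gs_car if_not_P[OF False] by simp
    qed
   qed
   then show "z : Bd Z n" using subgroup.one_closed[OF coboundaries_subgroup[OF D(1)]] by simp }
  { fix y assume y: "y : Cy K n"
   have el': "v ^[cgrp K n] p : Bd K n" if "v : Cy K n" for v
    using el[of v n] that subgroup.one_closed[OF coboundaries_subgroup[OF cK]] by (auto simp: cocycles_iff)
   obtain F c m where c: "finite F" "F \<subseteq> B n" "m : Bd K n" "y = finprod (cgrp K n) (%b. b ^[cgrp K n] (c b :: int)) F *[cgrp K n] m"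
    using maximal_indep_spans[OF comm_group_cgrp[OF cK] p cocycles_subgroup[OF cK] coboundaries_subgroup[OF cK]
     coboundaries_subset_cocycles[OF cK] el' B y] by blast
   let ?z = "finprod (cgrp Z n) (%b. j (n, b) n (g ^[cgrp G 0] c b)) F"
   interpret Zn: comm_group "cgrp Z n" by (rule comm_group_cgrp[OF D(1)])
   have gk: "g ^[cgrp G 0] (k::int) : Car G 0" for k using cx_simps(16)[OF cG g(1)] .
   have iI: "(n, b) : I" if "b : F" for b using that c(2) by (auto simp: I_def)
   have jc: "(%b. j (n, b) n (g ^[cgrp G 0] c b)) : F \<rightarrow> Car Z n"
    using gsumD(9)[OF D(4)[of n] iI] gk by auto
   have zc: "?z : Car Z n" using jc by (rule Zn.finprod_closed)
   have hm: "h n : hom (cgrp Z n) (cgrp K n)" using h(1) by (simp add: cmap_def chain_map_def)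
   have "h n ?z = finprod (cgrp K n) (%b. h n (j (n, b) n (g ^[cgrp G 0] c b))) F"
    by (rule finprod_hom[OF comm_group_cgrp[OF D(1)] comm_group_cgrp[OF cK] hm c(1) jc])
   also have "\<dots> = finprod (cgrp K n) (%b. b ^[cgrp K n] c b) F"
   proof (rule Kn.finprod_cong')
    show "h n (j (n, b) n (g ^[cgrp G 0] c b)) = b ^[cgrp K n] c b" if b: "b : F" for b
     using h(2)[OF iI[OF b], of "g ^[cgrp G 0] c b" n] gk f(2)[OF iI[OF b], of "c b"] by simp
   qed (use c(2) BK in \<open>auto intro!: Kn.int_pow_closed\<close>)
   finally have hy: "h n ?z = finprod (cgrp K n) (%b. b ^[cgrp K n] c b) F" .
   obtain w where w: "w : Car K (n - 1)" "m = cdiff K (n - 1) w" using c(3) by (auto simp: coboundaries_iff)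
   have "cohom K n y (h n ?z)" unfolding cohom_def hy c(4) using w by blast
   moreover have "?z : Cy Z n"
    unfolding dsum_cocycles[OF Z(2)]
   proof (intro conjI zc ballI)
    fix i assume i: "i : I"
    note qc = gsumD(10)[OF D(4) i zc]
    show "q i n ?z : Cy (Gs (fst i)) n"
    proof (cases "n = fst i")
     case True
     then show ?thesis using Gs_cocycle[of "q i n ?z" n] qc by simp
    next
     case False
     have "q i n ?z = 1[cgrp (Gs (fst i)) n]" using qc unfolding Gs_car if_not_P[OF False] by simp
     then show ?thesis using subgroup.one_closed[OF cocycles_subgroup[OF small_complex(1)[OF Gs_Sm]]] by simp
    qed
   qed
   ultimately show "\<exists>z\<in>Cy Z n. cohom K n y (h n z)" by blast }
 qed
 moreover have "\<not> acyclic_at K (fst i)" if "i : I" for i using na[of "snd i" "fst i"] that by (auto simp: I_def)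
 ultimately show ?thesis using Ism Z
  by (intro exI[of _ I] exI[of _ Z] exI[of _ j] exI[of _ q] exI[of _ h]) simp
qed

lemma closedQ_elementary:
 assumes Q: "closedQ Q" and K: "K : Sm" and el: "!!n x. x : Car K n ==> x ^[cgrp K n] p = 1[cgrp K n]"
  and GQ: "!!n. \<not> acyclic_at K n ==> Gs n : Q"
 shows "K : Q"
proof -
 obtain I :: "(int \<times> 'u) set" and Z j q h where I: "|I| <o |UNIV :: 'u set|" "Z : Sm" "dsum I (%i. Gs (fst i)) Z j q" "qis Z K h"
  "\<forall>i\<in>I. \<not> acyclic_at K (fst i)" using elementary_decomposition[OF K el] by blast
 have "Z : Q" by (rule closedQ_dsum[OF Q I(3,1) _ I(2)]) (use I(5) GQ in blast)
 then show ?thesis by (rule closedQ_iso[OF Q _ K isoD_qis[OF I(2) K I(4)]])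
qed

text \<open>A class that is not zero has a nontrivial component in the decomposition into copies of
  G, and the projection to that copy detects it. The copy sits in degree n, since the others have
  only the unit there.\<close>

lemma elementary_detect:
 assumes K: "K : Sm" and el: "!!n x. x : Car K n ==> x ^[cgrp K n] p = 1[cgrp K n]"
  and b: "b : Cy K n" "b \<notin> Bd K n"
 shows "\<exists>R\<in>carrier (dhom K (Gs n)). \<exists>g\<in>Car G 0. g \<noteq> 1[cgrp G 0] \<and> hrel K (Gs n) R n b g"
proof -
 obtain I :: "(int \<times> 'u) set" and Z j q h where I: "|I| <o |UNIV :: 'u set|" "Z : Sm" "dsum I (%i. Gs (fst i)) Z j q" "qis Z K h"
  "\<forall>i\<in>I. \<not> acyclic_at K (fst i)" using elementary_decomposition[OF K el] by blast
 note D = dsumD[OF I(3)]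
 obtain z where z: "z : Cy Z n" "ceq K n b (h n z)" using ceq_qis_surj[OF I(4) b(1)] by blast
 have zc: "z : Car Z n" using z by (simp add: cocycles_iff)
 have "z \<noteq> 1[cgrp Z n]"
 proof
  assume "z = 1[cgrp Z n]"
  then have "h n z : Bd K n"
   using cmap_simps(3)[OF qis_cmap[OF I(4)]] subgroup.one_closed[OF coboundaries_subgroup[OF small_complex(1)[OF K]]] by simp
  then show False using ceq_coboundary[OF z(2)] b(2) by blast
 qed
 then obtain i where i: "i : I" "q i n z \<noteq> 1[cgrp (Gs (fst i)) n]" using gsumD(8)[OF D(4) zc] by blast
 have qc: "q i n z : Car (Gs (fst i)) n" by (rule gsumD(10)[OF D(4) i(1) zc])
 have e: "n = fst i"
 proof (rule ccontr)
  assume "n \<noteq> fst i"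
  then show False using qc i(2) unfolding Gs_car if_not_P[OF \<open>n \<noteq> fst i\<close>] by simp
 qed
 then have g: "q i n z : Car G 0" "q i n z \<noteq> 1[cgrp G 0]" using qc i(2) by simp_all
 have r: "is_roof K (Gs n) Z h (q i)" using D(3)[OF i(1)] I(2,4) K Gs_Sm e by (simp add: is_roof_def)
 have "hrel K (Gs n) (roof_class K (Gs n) (Z, h, q i)) n b (q i n z)"
  unfolding hrel_def using mem_roof_class_self[OF r] z(1) ceq_sym[OF z(2)]
   ceq_refl[OF small_complex(1)[OF Gs_Sm] Gs_cocycle[OF g(1)], of n] by blast
 then show ?thesis using roof_class_closed[OF r] g by blast
qed

end

section \<open>Short exact sequences of complexes and their cones\<close>

definition ses :: "'a cochain_complex => 'b cochain_complex => 'c cochain_complex => ('a, 'b) graded_map => ('b, 'c) graded_map => bool" where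
 "ses A B R i q \<longleftrightarrow> cmap A B i \<and> cmap B R q \<and> (\<forall>n. inj_on (i n) (Car A n)) \<and> (\<forall>n. q n ` Car B n = Car R n) \<and>
  (\<forall>n. \<forall>b\<in>Car B n. q n b = 1[cgrp R n] \<longleftrightarrow> b : i n ` Car A n)"

lemma sesD:
 assumes "ses A B R i q"
 shows "cmap A B i" "cmap B R q" "\<lbrakk>x : Car A n; y : Car A n; i n x = i n y\<rbrakk> \<Longrightarrow> x = y"
  "r : Car R n ==> \<exists>b\<in>Car B n. r = q n b" "\<lbrakk>b : Car B n; q n b = 1[cgrp R n]\<rbrakk> \<Longrightarrow> \<exists>a\<in>Car A n. b = i n a"
  "a : Car A n ==> q n (i n a) = 1[cgrp R n]"
proof -
 show "r : Car R n ==> \<exists>b\<in>Car B n. r = q n b" using assms unfolding ses_def by blast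
 show "\<lbrakk>b : Car B n; q n b = 1[cgrp R n]\<rbrakk> \<Longrightarrow> \<exists>a\<in>Car A n. b = i n a" using assms unfolding ses_def by blast
 have "cmap A B i" using assms by (simp add: ses_def)
 then show "a : Car A n ==> q n (i n a) = 1[cgrp R n]" using assms cmap_simps(1)[of A B i a n] unfolding ses_def by blast
qed (use assms in \<open>auto simp: ses_def inj_on_def\<close>)

lemma ses_cone_qis:
 assumes s: "ses A B R i q" shows "qis (cone A B i) R (%n (a, b). q n b)"
 unfolding qis_iff_cohom
proof (intro conjI allI ballI impI)
 note S = sesD[OF s]
 note A = cmapD(1)[OF S(1)] and B = cmapD(2)[OF S(1)] and R = cmapD(2)[OF S(2)]
 note [simp] = cx_simps[OF A] cx_simps[OF B] cx_simps[OF R] cmap_simps[OF S(1)] cmap_simps[OF S(2)] S(6)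
 interpret A: comm_group "cgrp A k" for k by (rule comm_group_cgrp[OF A])
 interpret B: comm_group "cgrp B k" for k by (rule comm_group_cgrp[OF B])
 show c: "cmap (cone A B i) R (%n (a, b). q n b)" by (rule cmapI) (auto simp: is_complex_cone[OF S(1)] R)
 fix n
 { fix x assume x: "x : Cy (cone A B i) n" "(case x of (a, b) => q n b) : Bd R n"
  obtain a b where e: "x = (a, b)" by (cases x) auto
  have a: "a : Car A (n + 1)" and b: "b : Car B n" and eq: "i (n + 1) a *[cgrp B (n + 1)] cdiff B n b = 1[cgrp B (n + 1)]"
   using x(1) e by (auto simp: cocycles_iff)
  obtain r where r: "r : Car R (n - 1)" "q n b = cdiff R (n - 1) r" using x(2) e by (auto simp: coboundaries_iff)
  obtain b' where b': "b' : Car B (n - 1)" "r = q (n - 1) b'" using S(4)[OF r(1)] by blast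
  have db': "cdiff B (n - 1) b' : Car B n" using b' by simp
  have "q n (b *[cgrp B n] inv[cgrp B n] (cdiff B (n - 1) b')) = 1[cgrp R n]" using b b' r db' by simp
  then obtain a' where a': "a' : Car A n" "b *[cgrp B n] inv[cgrp B n] (cdiff B (n - 1) b') = i n a'"
   using S(5)[of "b *[cgrp B n] inv[cgrp B n] (cdiff B (n - 1) b')" n] b db' by auto
  have bb: "b = i n a' *[cgrp B n] cdiff B (n - 1) b'" unfolding a'(2)[symmetric] using b db' by algebra
  have "cdiff B n b = cdiff B n (i n a')" unfolding bb using a' b' by simp
  then have "i (n + 1) a *[cgrp B (n + 1)] i (n + 1) (cdiff A n a') = 1[cgrp B (n + 1)]" using eq a'(1) by simp
  then have "i (n + 1) a = i (n + 1) (inv[cgrp A (n + 1)] (cdiff A n a'))" using B.inv_equality a a'(1) by simp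
  then have "a = inv[cgrp A (n + 1)] (cdiff A n a')" using a a'(1) by (intro S(3)[of _ "n + 1"]) simp_all
  then have "x = cdiff (cone A B i) (n - 1) (a', b')" using e bb a' b' by (simp add: add.commute)
  then show "x : Bd (cone A B i) n" unfolding coboundaries_iff using a' b' by (intro bexI[of _ "(a', b')"]) simp_all }
 { fix r assume r: "r : Cy R n"
  then obtain b where b: "b : Car B n" "r = q n b" using S(4)[of r n] by (auto simp: cocycles_iff)
  have "q (n + 1) (cdiff B n b) = 1[cgrp R (n + 1)]" using r b by (simp add: cocycles_iff)
  then obtain a where a: "a : Car A (n + 1)" "cdiff B n b = i (n + 1) a" using S(5)[of "cdiff B n b" "n + 1"] b by auto
  have "i (n + 2) (cdiff A (n + 1) a) = cdiff B (n + 1) (cdiff B n b)" using a by (simp add: add.commute)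
  then have "i (n + 2) (cdiff A (n + 1) a) = i (n + 2) 1[cgrp A (n + 2)]" using b by (simp add: add.commute)
  then have "cdiff A (n + 1) a = 1[cgrp A (n + 2)]" using a by (intro S(3)[of _ "n + 2"]) simp_all
  then have "(inv[cgrp A (n + 1)] a, b) : Cy (cone A B i) n" using a b by (simp add: cocycles_iff add.commute)
  moreover have "cohom R n r (q n b)" using b r cohom_refl[OF R, of r n] by (simp add: cocycles_iff)
  ultimately show "\<exists>x\<in>Cy (cone A B i) n. cohom R n r (case x of (a, b) => q n b)"
   by (intro bexI[of _ "(inv[cgrp A (n + 1)] a, b)"]) simp_all }
qed

text \<open>The rotated companion of \<open>ses_cone_qis\<close>: it yields the triangle B -> R ->
  A[1] directly from a cone, without a rotation of triangles.\<close>

lemma ses_shift_cone_qis: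
 assumes s: "ses A B R i q" shows "qis (Shf 1 A) (cone B R q) (%n a. (i (n + 1) a, 1[cgrp R n]))"
 unfolding qis_iff_cohom
proof (intro conjI allI ballI impI)
 note S = sesD[OF s]
 note A = cmapD(1)[OF S(1)] and B = cmapD(2)[OF S(1)] and R = cmapD(2)[OF S(2)]
 have [simp]: "2 + k = k + 2" for k :: int by simp
 note [simp] = cx_simps[OF A] cx_simps[OF B] cx_simps[OF R] cmap_simps[OF S(1)] cmap_simps[OF S(2)] S(6)
 interpret A: comm_group "cgrp A k" for k by (rule comm_group_cgrp[OF A])
 interpret B: comm_group "cgrp B k" for k by (rule comm_group_cgrp[OF B])
 interpret R: comm_group "cgrp R k" for k by (rule comm_group_cgrp[OF R])
 note cn = is_complex_cone[OF S(2)]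
 show "cmap (Shf 1 A) (cone B R q) (%n a. (i (n + 1) a, 1[cgrp R n]))"
  by (rule cmapI[OF is_complex_shift[OF A] cn]) simp_all
 fix n
 { fix a assume a: "a : Cy (Shf 1 A) n" "(i (n + 1) a, 1[cgrp R n]) : Bd (cone B R q) n"
  have ac: "a : Car A (n + 1)" using a(1) by (simp add: cocycles_iff)
  obtain b r where br: "b : Car B n" "r : Car R (n - 1)" "i (n + 1) a = inv[cgrp B (n + 1)] (cdiff B n b)"
   "1[cgrp R n] = q n b *[cgrp R n] cdiff R (n - 1) r"
   using a(2) unfolding coboundaries_iff by (force simp: add.commute)
  obtain b' where b': "b' : Car B (n - 1)" "r = q (n - 1) b'" using S(4)[OF br(2)] by blast
  have "q n (b *[cgrp B n] cdiff B (n - 1) b') = 1[cgrp R n]" using br b' by simp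
  then obtain a' where a': "a' : Car A n" "b *[cgrp B n] cdiff B (n - 1) b' = i n a'"
   using S(5)[of "b *[cgrp B n] cdiff B (n - 1) b'" n] br b' by auto
  have "cdiff B n (b *[cgrp B n] cdiff B (n - 1) b') = cdiff B n b" using br(1) b'(1) by simp
  then have "cdiff B n b = i (n + 1) (cdiff A n a')" using a' by simp
  then have "i (n + 1) a = i (n + 1) (inv[cgrp A (n + 1)] (cdiff A n a'))" using br(3) a'(1) by simp
  then have "a = inv[cgrp A (n + 1)] (cdiff A n a')" using ac a'(1) by (intro S(3)[of _ "n + 1"]) simp_all
  then show "a : Bd (Shf 1 A) n"
   unfolding coboundaries_iff using a'(1) by (intro bexI[of _ a']) simp_all }
 { fix x assume x: "x : Cy (cone B R q) n"
  obtain b r where e: "x = (b, r)" by (cases x) auto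
  have b: "b : Car B (n + 1)" and r: "r : Car R n" and eq: "q (n + 1) b *[cgrp R (n + 1)] cdiff R n r = 1[cgrp R (n + 1)]"
   and inv: "inv[cgrp B (n + 2)] (cdiff B (n + 1) b) = 1[cgrp B (n + 2)]"
   using x e by (auto simp: cocycles_iff)
  have db: "cdiff B (n + 1) b = 1[cgrp B (n + 2)]" using b inv by (simp add: B.inv_eq_1_iff)
  obtain b' where b': "b' : Car B n" "r = q n b'" using S(4)[OF r] by blast
  have "q (n + 1) (b *[cgrp B (n + 1)] cdiff B n b') = 1[cgrp R (n + 1)]" using b b' eq by simp
  then obtain a where a: "a : Car A (n + 1)" "b *[cgrp B (n + 1)] cdiff B n b' = i (n + 1) a"
   using S(5)[of "b *[cgrp B (n + 1)] cdiff B n b'" "n + 1"] b b' by auto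
  have "i (n + 2) (cdiff A (n + 1) a) = cdiff B (n + 1) (b *[cgrp B (n + 1)] cdiff B n b')" using a by simp
  also have "\<dots> = i (n + 2) 1[cgrp A (n + 2)]" using b b' db by simp
  finally have "cdiff A (n + 1) a = 1[cgrp A (n + 2)]" using a by (intro S(3)[of _ "n + 2"]) simp_all
  then have az: "a : Cy (Shf 1 A) n" using a by (simp add: cocycles_iff)
  have c: "cdiff B n b' : Car B (n + 1)" using b' by simp
  have "b = i (n + 1) a *[cgrp B (n + 1)] inv[cgrp B (n + 1)] (cdiff B n b')" unfolding a(2)[symmetric] using b c by algebra
  then have "x = (i (n + 1) a, 1[cgrp R n]) *[cgrp (cone B R q) n] cdiff (cone B R q) (n - 1) (b', 1[cgrp R (n - 1)])"
   using e b' r by (simp add: add.commute)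
  moreover have "(b', 1[cgrp R (n - 1)]) : Car (cone B R q) (n - 1)" using b' by simp
  ultimately have "cohom (cone B R q) n x (i (n + 1) a, 1[cgrp R n])" unfolding cohom_def by blast
  then show "\<exists>a\<in>Cy (Shf 1 A) n. cohom (cone B R q) n x (i (n + 1) a, 1[cgrp R n])" using az by blast }
qed

text \<open>Meant for an embedding of A into an acyclic complex: its cone represents A[1] by this
  lemma and the quotient complex by \<open>ses_cone_qis\<close>.\<close>

lemma cone_acyclic_target_qis:
 assumes f: "cmap A B f" and a: "!!n. acyclic_at B n"
 shows "qis (cone A B f) (Shf 1 A) (%n x. fst x)"
 unfolding qis_iff_cohom
proof (intro conjI allI ballI impI)
 note A = cmapD(1)[OF f] and B = cmapD(2)[OF f]
 have [simp]: "2 + k = k + 2" for k :: int by simp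
 note [simp] = cx_simps[OF A] cx_simps[OF B] cmap_simps[OF f]
 interpret A: comm_group "cgrp A k" for k by (rule comm_group_cgrp[OF A])
 interpret B: comm_group "cgrp B k" for k by (rule comm_group_cgrp[OF B])
 show "cmap (cone A B f) (Shf 1 A) (%n x. fst x)"
  by (rule cmapI[OF is_complex_cone[OF f] is_complex_shift[OF A]]) auto
 fix n
 { fix x assume x: "x : Cy (cone A B f) n" "fst x : Bd (Shf 1 A) n"
  obtain a b where e: "x = (a, b)" by (cases x) auto
  obtain a' where a': "a' : Car A n" "a = inv[cgrp A (n + 1)] (cdiff A n a')" using x(2) e by (auto simp: coboundaries_iff)
  have b: "b : Car B n" and eq: "f (n + 1) a *[cgrp B (n + 1)] cdiff B n b = 1[cgrp B (n + 1)]" using x(1) e by (auto simp: cocycles_iff)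
  have c: "cdiff B n (f n a') : Car B (n + 1)" "cdiff B n b : Car B (n + 1)" using a' b by simp_all
  have "cdiff B n (b *[cgrp B n] inv[cgrp B n] f n a') = 1[cgrp B (n + 1)]"
   using eq a' b c by (simp add: B.m_comm)
  then have "b *[cgrp B n] inv[cgrp B n] f n a' : Cy B n" using a' b by (simp add: cocycles_iff)
  from acyclic_atE[OF B a this] obtain b' where b': "b' : Car B (n - 1)" "b *[cgrp B n] inv[cgrp B n] f n a' = cdiff B (n - 1) b'" .
  have fa: "f n a' : Car B n" using a' by simp
  have "b = f n a' *[cgrp B n] cdiff B (n - 1) b'" unfolding b'(2)[symmetric] using b fa by algebra
  then have "x = cdiff (cone A B f) (n - 1) (a', b')" using e a' by (simp add: add.commute)
  then show "x : Bd (cone A B f) n" unfolding coboundaries_iff using a' b' by (intro bexI[of _ "(a', b')"]) simp_all }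
 { fix a' assume a': "a' : Cy (Shf 1 A) n"
  have ac: "a' : Car A (n + 1)" "inv[cgrp A (n + 2)] (cdiff A (n + 1) a') = 1[cgrp A (n + 2)]" using a' by (auto simp: cocycles_iff)
  then have "cdiff A (n + 1) a' = 1[cgrp A (n + 2)]" by (simp add: A.inv_eq_1_iff)
  then have az: "a' : Cy A (n + 1)" using ac by (simp add: cocycles_iff)
  from acyclic_atE[OF B a cmap_cocycle[OF f az]] obtain b where b: "b : Car B n" "f (n + 1) a' = cdiff B n b" by auto
  have "(a', inv[cgrp B n] b) : Cy (cone A B f) n" using ac b by (simp add: cocycles_iff)
  then show "\<exists>x\<in>Cy (cone A B f) n. cohom (Shf 1 A) n a' (fst x)"
   using cohom_refl[OF is_complex_shift[OF A, of 1], of a' n] ac by (intro bexI[of _ "(a', inv[cgrp B n] b)"]) simp_all }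
qed

lemma quotient_complex:
 fixes B :: "'b cochain_complex"
 assumes i: "cmap A B i" and inj: "!!n. inj_on (i n) (Car A n)"
 shows "\<exists>(R :: 'b set cochain_complex) q. ses A B R i q"
proof -
 note A = cmapD(1)[OF i] and B = cmapD(2)[OF i]
 note [simp] = cx_simps[OF A] cx_simps[OF B] cmap_simps[OF i]
 interpret B: comm_group "cgrp B k" for k by (rule comm_group_cgrp[OF B])
 define N where "N = (%n. i n ` Car A n)"
 have N: "subgroup (N n) (cgrp B n)" for n
  unfolding N_def by (rule group_hom.img_is_subgroup)
   (use i in \<open>simp add: group_hom_def group_hom_axioms_def group_cgrp[OF A] group_cgrp[OF B] cmap_def chain_map_def\<close>)
 have dN: "cdiff B n x : N (n + 1)" if xN: "x : N n" for n x
 proof -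
  obtain a where a: "a : Car A n" "x = i n a" using xN by (auto simp: N_def)
  then have "cdiff B n x = i (n + 1) (cdiff A n a)" by simp
  then show ?thesis unfolding N_def using a by (intro image_eqI[of _ _ "cdiff A n a"]) simp_all
 qed
 define q where "q = (%n b. N n #>\<^bsub>cgrp B n\<^esub> b)"
 \<comment> \<open>A representative of each coset; the fact \<open>d\<close> below shows that the
   differential is independent of it, because the image of A is a subcomplex.\<close>
 define \<sigma> where "\<sigma> = (%n C. SOME b. b : Car B n \<and> q n b = C)"
 define R where "R = \<lparr>cgrp = (%n. cgrp B n Mod N n), cdiff = (%n C. q (n + 1) (cdiff B n (\<sigma> n C)))\<rparr>"
 have car: "Car R n = q n ` Car B n" for n by (auto simp: R_def q_def FactGroup_def RCOSETS_def)
 have mult: "q n b *[cgrp R n] q n c = q n (b *[cgrp B n] c)" if "b : Car B n" "c : Car B n" for n b c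
  using normal.rcos_sum[OF B.subgroup_imp_normal[OF N]] that by (simp add: R_def q_def FactGroup_def)
 have qeq: "q n b = q n c \<longleftrightarrow> b *[cgrp B n] inv[cgrp B n] c : N n" if "b : Car B n" "c : Car B n" for n b c
  unfolding q_def by (rule B.r_coset_eq_iff[OF N that])
 have one: "1[cgrp R n] = q n 1[cgrp B n]" for n
  using B.coset_mult_one[OF subgroup.subset[OF N]] by (simp add: R_def q_def FactGroup_def)
 have \<sigma>: "\<sigma> n (q n b) : Car B n" "q n (\<sigma> n (q n b)) = q n b" if "b : Car B n" for n b
  using someI_ex[of "%c. c : Car B n \<and> q n c = q n b"] that unfolding \<sigma>_def by blast+
 have d: "cdiff R n (q n b) = q (n + 1) (cdiff B n b)" if b: "b : Car B n" for n b
 proof -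
  note s = \<sigma>[OF b]
  have "\<sigma> n (q n b) *[cgrp B n] inv[cgrp B n] b : N n" using s(2) qeq[OF s(1) b] by simp
  from dN[OF this] have "cdiff B n (\<sigma> n (q n b)) *[cgrp B (n + 1)] inv[cgrp B (n + 1)] (cdiff B n b) : N (n + 1)" using s(1) b by simp
  then show ?thesis using s(1) b by (simp add: R_def qeq)
 qed
 have R: "is_complex R"
 proof (rule is_complexI)
  show "comm_group (cgrp R n)" for n using B.abelian_FactGroup[OF N] by (simp add: R_def)
  fix n C assume "C : Car R n"
  then obtain b where b: "b : Car B n" "C = q n b" by (auto simp: car)
  show "cdiff R n C : Car R (n + 1)" using b by (simp add: d car)
  show "cdiff R (n + 1) (cdiff R n C) = 1[cgrp R (n + 2)]" using b by (simp add: d one add.commute)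
  fix E assume "E : Car R n"
  then obtain c where c: "c : Car B n" "E = q n c" by (auto simp: car)
  show "cdiff R n (C *[cgrp R n] E) = cdiff R n C *[cgrp R (n + 1)] cdiff R n E" using b c by (simp add: d mult)
 qed
 have qc: "cmap B R q" by (rule cmapI[OF B R]) (simp_all add: car mult d)
 have "q n b = 1[cgrp R n] \<longleftrightarrow> b : i n ` Car A n" if "b : Car B n" for n b
  unfolding one using qeq[OF that, of "1[cgrp B n]"] that by (simp add: N_def)
 then have "ses A B R i q" using i qc inj car by (simp add: ses_def)
 then show ?thesis by blast
qed

section \<open>Embeddings into divisible groups\<close>

lemma gsum_sum_group:
 assumes A: "!!i. i : I ==> comm_group (A i)"
 shows "gsum I A (sum_group I A) (%i x. \<lambda>k\<in>I. if k = i then x else 1[A k]) (%i z. z i)"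
proof -
 \<comment> \<open>Each group becomes a complex that is constant with trivial differential; degree 0
   of the statement for complexes is the claim.\<close>
 let ?X = "%i. \<lparr>cgrp = (%n::int. A i), cdiff = (%n x. 1[A i])\<rparr>"
 have "is_complex (?X i)" if "i : I" for i
  using A[OF that] by (intro is_complexI) (auto simp: comm_group_def comm_monoid_def monoid.one_closed monoid.l_one)
 from dsumD(4)[OF sumcx_dsum[of I ?X, OF this], of 0] show ?thesis unfolding sumcx_def cochain_complex.simps .
qed

definition rat_group :: "rat monoid" where
 "rat_group = \<lparr>carrier = UNIV, monoid.mult = (+), one = 0\<rparr>"

lemma rat_group_simps [simp]: "carrier rat_group = UNIV" "x *[rat_group] y = x + y" "1[rat_group] = 0"
 by (simp_all add: rat_group_def)

lemma comm_group_rat_group: "comm_group rat_group"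
 by (rule comm_groupI) (auto intro: exI[of _ "- x" for x])

lemma rat_group_pow: "x ^[rat_group] (n::nat) = of_nat n * x"
 by (induction n) (simp_all add: nat_pow_def algebra_simps)

context universe
begin

text \<open>A is the free group on its own elements modulo the relations \<open>?K\<close>.
  Enlarging the free group to a direct sum of copies of the rationals and dividing by the same
  relations gives a divisible group that contains A.\<close>

lemma divisible_embedding:
 fixes A :: "'u monoid"
 assumes A: "comm_group A" and sm: "|carrier A| <o |UNIV :: 'u set|" and p: "p > 0"
 shows "\<exists>(D :: ('u => rat) set monoid) e. comm_group D \<and> |carrier D| <o |UNIV :: 'u set| \<and> e : hom A D \<and> inj_on e (carrier A) \<and>
  (\<forall>x\<in>carrier D. \<exists>y\<in>carrier D. y ^[D] (p::nat) = x)"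
proof -
 interpret A: comm_group A by fact
 let ?I = "carrier A"
 let ?M = "sum_group ?I (%_. rat_group)" and ?S = "sum_group ?I (%_. integer_group)"
 have gM: "gsum ?I (%_. rat_group) ?M (%i x. \<lambda>k\<in>?I. if k = i then x else 1[rat_group]) (%i z. z i)"
  by (rule gsum_sum_group) (rule comm_group_rat_group)
 have gS: "gsum ?I (%_. integer_group) ?S (%i x. \<lambda>k\<in>?I. if k = i then x else 1[integer_group]) (%i z. z i)"
  by (rule gsum_sum_group) (rule abelian_integer_group)
 interpret M: comm_group ?M by (rule gsumD(1)[OF gM])
 interpret S: comm_group ?S by (rule gsumD(1)[OF gS])
 have carM: "carrier ?M = {z : \<Pi>\<^sub>E i\<in>?I. UNIV. finite {i\<in>?I. z i \<noteq> 0}}"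
  using comm_group.axioms(2)[OF comm_group_rat_group] by (simp add: carrier_sum_group)
 have carS: "carrier ?S = {z : \<Pi>\<^sub>E i\<in>?I. UNIV. finite {i\<in>?I. z i \<noteq> 0}}" by (simp add: carrier_sum_group)
 obtain \<epsilon> where \<epsilon>: "\<epsilon> : hom ?S A" "\<forall>a\<in>?I. \<forall>k\<in>carrier integer_group. \<epsilon> (\<lambda>c\<in>?I. if c = a then k else 1[integer_group]) = a ^[A] (k::int)"
  using gsum_lift[OF gS A, of "%a k. a ^[A] k"] A.hom_integer_group_pow by blast
 interpret \<epsilon>: group_hom ?S A \<epsilon> by unfold_locales (rule \<epsilon>(1))
 define \<delta> where "\<delta> = (%a. \<lambda>c\<in>?I. if c = a then (1::int) else 0)"
 have \<delta>: "\<delta> a : carrier ?S" if "a : ?I" for a using gsumD(9)[OF gS that, of 1] unfolding one_integer_group \<delta>_def by simp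
 have \<epsilon>\<delta>: "\<epsilon> (\<delta> a) = a" if "a : ?I" for a using \<epsilon>(2)[rule_format, OF that, of 1] that A.int_pow_1[of a] unfolding one_integer_group \<delta>_def by simp
 define \<iota> where "\<iota> = (%z. \<lambda>a\<in>?I. rat_of_int (z a))"
 have \<iota>h: "\<iota> : hom ?S ?M"
 proof (rule homI)
  fix z w assume z: "z : carrier ?S" and w: "w : carrier ?S"
  have "{i\<in>?I. \<iota> z i \<noteq> 0} = {i\<in>?I. z i \<noteq> 0}" by (auto simp: \<iota>_def)
  then show "\<iota> z : carrier ?M" using z unfolding carM carS by (auto simp: \<iota>_def)
  show "\<iota> (z *[?S] w) = \<iota> z *[?M] \<iota> w" by (auto simp: \<iota>_def intro!: restrict_ext)
 qed
 interpret \<iota>: group_hom ?S ?M \<iota> by unfold_locales (rule \<iota>h)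
 have \<iota>inj: "z = w" if z: "z : carrier ?S" and w: "w : carrier ?S" and e: "\<iota> z = \<iota> w" for z w
 proof (rule PiE_ext[of z ?I "%_. UNIV" w])
  show "z : (\<Pi>\<^sub>E i\<in>?I. UNIV)" "w : (\<Pi>\<^sub>E i\<in>?I. UNIV)" using z w by (simp_all add: carS)
  show "z i = w i" if "i : ?I" for i using fun_cong[OF e, of i] that by (simp add: \<iota>_def)
 qed
 let ?K = "kernel ?S A \<epsilon>"
 define R where "R = \<iota> ` ?K"
 have R: "subgroup R ?M" unfolding R_def by (rule \<iota>.subgroup_img_is_subgroup[OF \<epsilon>.subgroup_kernel])
 interpret Rn: normal R ?M by (rule M.subgroup_imp_normal[OF R])
 let ?D = "?M Mod R"
 have D: "comm_group ?D" by (rule M.abelian_FactGroup[OF R])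
 interpret D: comm_group ?D by (rule D)
 have carD: "carrier ?D = (%m. R #>\<^bsub>?M\<^esub> m) ` carrier ?M" by (auto simp: FactGroup_def RCOSETS_def)
 have coset: "(%m. R #>\<^bsub>?M\<^esub> m) : hom ?M ?D" by (rule Rn.r_coset_hom_Mod)
 interpret c: group_hom ?M ?D "%m. R #>\<^bsub>?M\<^esub> m" by unfold_locales (rule coset)
 have smM: "|carrier ?M| <o |UNIV :: 'u set|" unfolding carM
  by (rule sm_finite_support[OF sm]) (rule sm_countable, simp)
 have smD: "|carrier ?D| <o |UNIV :: 'u set|" unfolding carD by (rule sm_image[OF smM])
 have inR: "\<iota> s : R \<longleftrightarrow> \<epsilon> s = 1[A]" if s: "s : carrier ?S" for s
 proof
  assume "\<iota> s : R"
  then obtain k where k: "k : carrier ?S" "\<epsilon> k = 1[A]" "\<iota> s = \<iota> k" by (auto simp: R_def kernel_def)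
  then show "\<epsilon> s = 1[A]" using \<iota>inj[OF s k(1,3)] by simp
 qed (use s in \<open>auto simp: R_def kernel_def\<close>)
 have ceq: "R #>\<^bsub>?M\<^esub> \<iota> s = R #>\<^bsub>?M\<^esub> \<iota> t \<longleftrightarrow> \<epsilon> s = \<epsilon> t" if s: "s : carrier ?S" and t: "t : carrier ?S" for s t
 proof -
  have "R #>\<^bsub>?M\<^esub> \<iota> s = R #>\<^bsub>?M\<^esub> \<iota> t \<longleftrightarrow> \<iota> s *[?M] inv[?M] \<iota> t : R"
   by (rule M.r_coset_eq_iff[OF R \<iota>.hom_closed[OF s] \<iota>.hom_closed[OF t]])
  also have "\<iota> s *[?M] inv[?M] \<iota> t = \<iota> (s *[?S] inv[?S] t)"
   using \<iota>.hom_mult[OF s S.inv_closed[OF t]] \<iota>.hom_inv[OF t] by simp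
  also have "\<dots> : R \<longleftrightarrow> \<epsilon> (s *[?S] inv[?S] t) = 1[A]" by (rule inR[OF S.m_closed[OF s S.inv_closed[OF t]]])
  also have "\<epsilon> (s *[?S] inv[?S] t) = \<epsilon> s *[A] inv[A] \<epsilon> t" using \<epsilon>.hom_mult[OF s S.inv_closed[OF t]] \<epsilon>.hom_inv[OF t] by simp
  also have "\<dots> = 1[A] \<longleftrightarrow> \<epsilon> s = \<epsilon> t"
   using A.inv_solve_right'[of "1[A]" "\<epsilon> s" "\<epsilon> t"] \<epsilon>.hom_closed[OF s] \<epsilon>.hom_closed[OF t] by auto
  finally show ?thesis .
 qed
 define e where "e = (%a. R #>\<^bsub>?M\<^esub> \<iota> (\<delta> a))"
 have "e : hom A ?D"
 proof (rule homI)
  fix a b assume a: "a : ?I" and b: "b : ?I"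
  show "e a : carrier ?D" unfolding e_def by (rule c.hom_closed[OF \<iota>.hom_closed[OF \<delta>[OF a]]])
  have "e a *[?D] e b = R #>\<^bsub>?M\<^esub> \<iota> (\<delta> a *[?S] \<delta> b)"
   unfolding e_def using c.hom_mult[OF \<iota>.hom_closed[OF \<delta>[OF a]] \<iota>.hom_closed[OF \<delta>[OF b]]] \<iota>.hom_mult[OF \<delta>[OF a] \<delta>[OF b]] by simp
  also have "\<dots> = e (a *[A] b)"
   unfolding e_def ceq[OF S.m_closed[OF \<delta>[OF a] \<delta>[OF b]] \<delta>[OF A.m_closed[OF a b]]]
   using \<epsilon>.hom_mult[OF \<delta>[OF a] \<delta>[OF b]] a b by (simp add: \<epsilon>\<delta>)
  finally show "e (a *[A] b) = e a *[?D] e b" by simp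
 qed
 moreover have "inj_on e ?I"
  by (rule inj_onI) (use ceq[OF \<delta> \<delta>] \<epsilon>\<delta> in \<open>simp add: e_def\<close>)
 moreover have "\<exists>y\<in>carrier ?D. y ^[?D] p = x" if x: "x : carrier ?D" for x
 proof -
  obtain m where m: "m : carrier ?M" "x = R #>\<^bsub>?M\<^esub> m" using x unfolding carD by blast
  define m' where "m' = (\<lambda>a\<in>?I. m a / of_nat p)"
  have "{i\<in>?I. m' i \<noteq> 0} = {i\<in>?I. m i \<noteq> 0}" using p by (auto simp: m'_def)
  then have m'c: "m' : carrier ?M" using m(1) unfolding carM by (auto simp: m'_def)
  have "m' ^[?M] p = m"
  proof (rule gsum_eqI[OF gM M.nat_pow_closed[OF m'c] m(1)])
   fix a assume a: "a : ?I"
   have "(m' ^[?M] p) a = m' a ^[rat_group] p"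
    by (rule hom_nat_pow[OF gsumD(4)[OF gM a] m'c M.is_group comm_group.axioms(2)[OF comm_group_rat_group]])
   then show "(m' ^[?M] p) a = m a" using p a by (simp add: rat_group_pow m'_def)
  qed
  then have "(R #>\<^bsub>?M\<^esub> m') ^[?D] p = x" using c.hom_nat_pow[OF m'c, of p] m(2) by simp
  then show ?thesis using c.hom_closed[OF m'c] by blast
 qed
 ultimately show ?thesis using D smD by blast
qed

end

section \<open>The p^k-torsion subcomplexes of a divisible torsion complex\<close>

definition Tk :: "nat => 'a cochain_complex => nat => 'a cochain_complex" where
 "Tk p T k = subcx T (%n. {t : Car T n. t ^[cgrp T n] (p ^ k) = 1[cgrp T n]})"

lemma Tk_simps [simp]: "Car (Tk p T k) n = {t : Car T n. t ^[cgrp T n] (p ^ k) = 1[cgrp T n]}"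
 "x *[cgrp (Tk p T k) n] y = x *[cgrp T n] y" "1[cgrp (Tk p T k) n] = 1[cgrp T n]" "cdiff (Tk p T k) = cdiff T"
 by (simp_all add: Tk_def)

lemma restrict_nat_pow: "x ^[G\<lparr>carrier := H\<rparr>] (n::nat) = x ^[G] n"
 by (induction n) (simp_all add: nat_pow_def)

lemma Tk_pow [simp]: "x ^[cgrp (Tk p T k) n] (m::nat) = x ^[cgrp T n] m"
 by (simp add: Tk_def restrict_nat_pow)

lemma Tk_complex:
 assumes T: "is_complex T" shows "is_complex (Tk p T k)" "cmap (Tk p T k) T id_map" "subgroup (Car (Tk p T k) n) (cgrp T n)"
proof -
 interpret T: comm_group "cgrp T i" for i by (rule comm_group_cgrp[OF T])
 note [simp] = cx_simps[OF T]
 have s: "subgroup {t : Car T n. t ^[cgrp T n] (p ^ k) = 1[cgrp T n]} (cgrp T n)" for n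
  by (rule T.subgroupI) (auto simp: T.pow_mult_distrib_nat T.nat_pow_inv intro: exI[of _ "1[cgrp T n]"])
 have d: "cdiff T n x : {t : Car T (n + 1). t ^[cgrp T (n + 1)] (p ^ k) = 1[cgrp T (n + 1)]}"
  if x: "x : {t : Car T n. t ^[cgrp T n] (p ^ k) = 1[cgrp T n]}" for n x
 proof -
  have x': "x : Car T n" "x ^[cgrp T n] (p ^ k) = 1[cgrp T n]" using x by simp_all
  have "cdiff T n (x ^[cgrp T n] (p ^ k)) = 1[cgrp T (n + 1)]" unfolding x'(2) by simp
  then show ?thesis using x'(1) unfolding cx_simps(17)[OF T x'(1)] by simp
 qed
 show "is_complex (Tk p T k)" "cmap (Tk p T k) T id_map"
  unfolding Tk_def by (rule is_complex_subcx[OF T s d], assumption)+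
 show "subgroup (Car (Tk p T k) n) (cgrp T n)" using s by simp
qed

definition divisible_torsion :: "nat => 'a cochain_complex => bool" where
 "divisible_torsion p T \<longleftrightarrow> is_complex T \<and> (\<forall>n. \<forall>t\<in>Car T n. (\<exists>k. t ^[cgrp T n] (p ^ k) = 1[cgrp T n]) \<and> (\<exists>s\<in>Car T n. s ^[cgrp T n] p = t))"

lemma divisible_torsionD:
 assumes "divisible_torsion p T"
 shows "is_complex T" "t : Car T n ==> \<exists>k. t ^[cgrp T n] (p ^ k) = 1[cgrp T n]" "t : Car T n ==> \<exists>s\<in>Car T n. s ^[cgrp T n] p = t"
 using assms unfolding divisible_torsion_def by blast+

lemma divisible_torsion_shift: "divisible_torsion p T ==> divisible_torsion p (Shf k T)"
 unfolding divisible_torsion_def by (simp add: is_complex_shift)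

text \<open>Divisibility makes the p-th power map onto. Passing from k to \<open>Suc k\<close>
  therefore costs one extension by the elementary complex \<open>Tk p T 1\<close>, which is the
  induction step of \<open>closedQ_Tk\<close>.\<close>

lemma Tk_ses:
 assumes d: "divisible_torsion p T"
 shows "ses (Tk p T 1) (Tk p T (Suc k)) (Tk p T k) id_map (%n t. t ^[cgrp T n] p)"
proof -
 note T = divisible_torsionD(1)[OF d]
 interpret T: comm_group "cgrp T i" for i by (rule comm_group_cgrp[OF T])
 note [simp] = cx_simps[OF T]
 have pp: "(x ^[cgrp T n] p) ^[cgrp T n] (p ^ k) = x ^[cgrp T n] (p ^ Suc k)" if "x : Car T n" for x n k
  using that by (simp add: T.nat_pow_pow)
 have "x ^[cgrp T n] (p ^ Suc k) = 1[cgrp T n]" if "x : Car T n" "x ^[cgrp T n] p = 1[cgrp T n]" for x n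
  using pp[OF that(1), of k] that(2) by simp
 then have i: "cmap (Tk p T 1) (Tk p T (Suc k)) id_map"
  by (intro cmapI Tk_complex T) auto
 have q: "cmap (Tk p T (Suc k)) (Tk p T k) (%n t. t ^[cgrp T n] p)"
  by (intro cmapI Tk_complex T) (auto simp: T.pow_mult_distrib_nat pp simp del: power_Suc)
 have "(%t. t ^[cgrp T n] p) ` Car (Tk p T (Suc k)) n = Car (Tk p T k) n" for n
 proof
  show "(%t. t ^[cgrp T n] p) ` Car (Tk p T (Suc k)) n \<subseteq> Car (Tk p T k) n" using cmap_simps(1)[OF q] by blast
  show "Car (Tk p T k) n \<subseteq> (%t. t ^[cgrp T n] p) ` Car (Tk p T (Suc k)) n"
  proof
   fix t assume t: "t : Car (Tk p T k) n"
   then obtain s where s: "s : Car T n" "s ^[cgrp T n] p = t" using divisible_torsionD(3)[OF d, of t n] by auto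
   then have "s : Car (Tk p T (Suc k)) n" using t pp[OF s(1), of k] by (simp del: power_Suc)
   then show "t : (%t. t ^[cgrp T n] p) ` Car (Tk p T (Suc k)) n" using s(2) by blast
  qed
 qed
 moreover have "b ^[cgrp T n] p = 1[cgrp (Tk p T k) n] \<longleftrightarrow> b : id_map n ` Car (Tk p T 1) n" if "b : Car (Tk p T (Suc k)) n" for b n
  using that by (auto simp: image_def)
 ultimately show ?thesis using i q unfolding ses_def by (simp add: inj_on_def del: Tk_simps)
qed

text \<open>\<open>Tk p T 1\<close> is the kernel of the surjective p-th power map on T, so its
  cohomology in degree n is controlled by that of T in degrees n - 1 and n. This spread by one
  degree reappears in \<open>closedQ_divisible\<close>.\<close>

lemma Tk_acyclic:
 assumes d: "divisible_torsion p T" and a: "acyclic_at T n" "acyclic_at T (n - 1)" shows "acyclic_at (Tk p T 1) n"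
proof -
 note T = divisible_torsionD(1)[OF d]
 interpret T: comm_group "cgrp T i" for i by (rule comm_group_cgrp[OF T])
 note [simp] = cx_simps[OF T]
 show ?thesis unfolding acyclic_at_iff[OF Tk_complex(1)[OF T]]
 proof
  fix x assume x: "x : Cy (Tk p T 1) n"
  have xc: "x : Car T n" "x ^[cgrp T n] p = 1[cgrp T n]" "x : Cy T n" using x by (auto simp: cocycles_iff)
  from acyclic_atE[OF T a(1) xc(3)] obtain y where y: "y : Car T (n - 1)" "x = cdiff T (n - 1) y" .
  have "cdiff T (n - 1) (y ^[cgrp T (n - 1)] p) = 1[cgrp T n]" using y xc(2) by simp
  then have "y ^[cgrp T (n - 1)] p : Cy T (n - 1)" using y by (simp add: cocycles_iff)
  from acyclic_atE[OF T a(2) this] obtain z where z: "z : Car T (n - 2)" "y ^[cgrp T (n - 1)] p = cdiff T (n - 2) z" by auto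
  obtain s where s: "s : Car T (n - 2)" "s ^[cgrp T (n - 2)] p = z" using divisible_torsionD(3)[OF d z(1)] by blast
  let ?w = "y *[cgrp T (n - 1)] inv[cgrp T (n - 1)] cdiff T (n - 2) s"
  have ds: "cdiff T (n - 2) s : Car T (n - 1)" "cdiff T (n - 2) s ^[cgrp T (n - 1)] p = cdiff T (n - 2) z"
   using s cx_simps(17)[OF T s(1), of p] by simp_all
  have "?w ^[cgrp T (n - 1)] p = 1[cgrp T (n - 1)]"
   using y z ds by (simp add: T.pow_mult_distrib_nat T.nat_pow_inv)
  then have "?w : Car (Tk p T 1) (n - 1)" using y ds by simp
  moreover have "x = cdiff T (n - 1) ?w" using y ds s by simp
  ultimately show "x : Bd (Tk p T 1) n" unfolding coboundaries_iff by auto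
 qed
qed

context prime_generator
begin

lemma Tk_Sm: "T : Sm ==> Tk p T k : Sm"
 using Tk_complex(1)[OF small_complex(1)] unfolding small_complexes_def small_def
 by (auto intro: sm_subset)

lemma closedQ_Tk:
 assumes Q: "closedQ Q" and T: "T : Sm" and d: "divisible_torsion p T" and GQ: "!!n. \<not> acyclic_at (Tk p T 1) n ==> Gs n : Q"
 shows "Tk p T k : Q"
proof -
 note cT = small_complex(1)[OF T]
 have 1: "Tk p T 1 : Q"
  by (rule closedQ_elementary[OF Q Tk_Sm[OF T] _ GQ]) auto
 show ?thesis
 proof (induction k)
  case 0
  have "acyclic_at (Tk p T 0) n" for n
  proof -
   have "Car (Tk p T 0) n \<subseteq> {1[cgrp T n]}" by (auto simp: group.is_monoid[OF group_cgrp[OF cT]] monoid.nat_pow_Suc)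
   then show ?thesis
    unfolding acyclic_at_iff[OF Tk_complex(1)[OF cT]]
    using subgroup.one_closed[OF coboundaries_subgroup[OF Tk_complex(1)[OF cT, of p 0]], of n] by (auto simp: cocycles_iff subset_iff)
  qed
  then show ?case by (rule closedQ_zero[OF Q Tk_Sm[OF T]])
 next
  case (Suc k)
  note s = Tk_ses[OF d, of k]
  show ?case by (rule closedQ_cone[OF Q 1 Suc Tk_Sm[OF T] sesD(1)[OF s]]) (use ses_cone_qis[OF s] in blast)
 qed
qed

end

section \<open>Divisible torsion models of complexes with torsion cohomology\<close>

lemma divisible_pow:
 assumes A: "comm_group A" and d: "!!x. x : carrier A ==> \<exists>y\<in>carrier A. y ^[A] (p::nat) = x" and x: "x : carrier A"
 shows "\<exists>y\<in>carrier A. y ^[A] (p ^ k) = x"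
 using x
proof (induction k arbitrary: x)
 case 0
 interpret A: comm_group A by fact
 show ?case using 0 by auto
next
 case (Suc k)
 interpret A: comm_group A by fact
 obtain y where y: "y : carrier A" "y ^[A] (p ^ k) = x" using Suc by blast
 obtain z where z: "z : carrier A" "z ^[A] p = y" using d[OF y(1)] by blast
 have "z ^[A] (p ^ Suc k) = x" using A.nat_pow_pow[OF z(1), of p "p ^ k"] z y by simp
 then show ?case using z(1) by blast
qed

definition torsion_part :: "nat => 'a cochain_complex => 'a cochain_complex" where
 "torsion_part p R = subcx R (%n. {r : Car R n. \<exists>k. r ^[cgrp R n] (p ^ k) = 1[cgrp R n]})"

lemma torsion_part_simps [simp]:
 "Car (torsion_part p R) n = {r : Car R n. \<exists>k. r ^[cgrp R n] (p ^ k) = 1[cgrp R n]}"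
 "x *[cgrp (torsion_part p R) n] y = x *[cgrp R n] y" "1[cgrp (torsion_part p R) n] = 1[cgrp R n]"
 "cdiff (torsion_part p R) = cdiff R" "x ^[cgrp (torsion_part p R) n] (m::nat) = x ^[cgrp R n] m"
 by (simp_all add: torsion_part_def restrict_nat_pow)

text \<open>If the p^k-th power of r is the coboundary of w, divisibility gives a p^k-th root u of
  w, and r divided by the coboundary of u is torsion; this is \<open>adj\<close>. It moves cocycles,
  and also elements bounding a torsion cocycle, into the torsion part.\<close>

lemma torsion_part_qis:
 assumes R: "is_complex R" and d: "!!n r. r : Car R n ==> \<exists>s\<in>Car R n. s ^[cgrp R n] p = r"
  and t: "!!n. tors R n (range (%k. p ^ k))"
 shows "qis (torsion_part p R) R id_map" "divisible_torsion p (torsion_part p R)"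
proof -
 interpret R: comm_group "cgrp R i" for i by (rule comm_group_cgrp[OF R])
 note [simp] = cx_simps[OF R]
 have pw: "x ^[cgrp R n] (p ^ (k + l)) = 1[cgrp R n]"
  if x: "x : Car R n" and e: "x ^[cgrp R n] (p ^ k) = 1[cgrp R n]" for x n k l
  using R.nat_pow_pow[OF x, of "p ^ k" "p ^ l"] unfolding e by (simp add: power_add)
 have pw': "x ^[cgrp R n] (p ^ (l + k)) = 1[cgrp R n]"
  if x: "x : Car R n" and e: "x ^[cgrp R n] (p ^ k) = 1[cgrp R n]" for x n k l
  using pw[OF that, of l] by (simp add: add.commute)
 let ?S = "%n. {r : Car R n. \<exists>k. r ^[cgrp R n] (p ^ k) = 1[cgrp R n]}"
 have s: "subgroup (?S n) (cgrp R n)" for n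
 proof (rule R.subgroupI)
  show "?S n \<noteq> {}" using cx_simps(7)[OF R, of n] cx_simps(19)[OF R, of n] by blast
  show "inv[cgrp R n] a : ?S n" if "a : ?S n" for a using that by (auto simp: R.nat_pow_inv)
  show "a *[cgrp R n] b : ?S n" if a: "a : ?S n" and b: "b : ?S n" for a b
  proof -
   obtain k l where kl: "a ^[cgrp R n] (p ^ k) = 1[cgrp R n]" "b ^[cgrp R n] (p ^ l) = 1[cgrp R n]" using a b by blast
   have c: "a : Car R n" "b : Car R n" using a b by simp_all
   have "(a *[cgrp R n] b) ^[cgrp R n] (p ^ (k + l)) = 1[cgrp R n]"
    using pw[OF c(1) kl(1), of l] pw'[OF c(2) kl(2), of k] by (simp add: R.pow_mult_distrib_nat c)
   then show ?thesis using c by auto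
  qed
 qed auto
 have d': "cdiff R n x : ?S (n + 1)" if x: "x : ?S n" for n x
 proof -
  obtain k where k: "x ^[cgrp R n] (p ^ k) = 1[cgrp R n]" and xc: "x : Car R n" using x by blast
  have "cdiff R n (x ^[cgrp R n] (p ^ k)) = 1[cgrp R (n + 1)]" unfolding k by simp
  then show ?thesis using xc unfolding cx_simps(17)[OF R xc] by auto
 qed
 have c: "is_complex (torsion_part p R)" "cmap (torsion_part p R) R id_map"
  unfolding torsion_part_def by (rule is_complex_subcx[OF R s d'], assumption)+
 have adj: "\<exists>u\<in>Car R (n - 1). (r *[cgrp R n] inv[cgrp R n] (cdiff R (n - 1) u)) ^[cgrp R n] (p ^ k) = 1[cgrp R n]"
  if r: "r : Car R n" "r ^[cgrp R n] (p ^ k) : Bd R n" for r n k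
 proof -
  obtain w where w: "w : Car R (n - 1)" "r ^[cgrp R n] (p ^ k) = cdiff R (n - 1) w" using r(2) unfolding coboundaries_iff by blast
  obtain u where u: "u : Car R (n - 1)" "u ^[cgrp R (n - 1)] (p ^ k) = w"
   using divisible_pow[OF comm_group_cgrp[OF R] d w(1)] by blast
  have du: "cdiff R (n - 1) u : Car R n" using u by simp
  have e: "cdiff R (n - 1) u ^[cgrp R n] (p ^ k) = r ^[cgrp R n] (p ^ k)"
   using cx_simps(17)[OF R u(1), of "p ^ k"] unfolding u(2) w(2)[symmetric] by simp
  have "(r *[cgrp R n] inv[cgrp R n] (cdiff R (n - 1) u)) ^[cgrp R n] (p ^ k) = 1[cgrp R n]"
   using r(1) du by (simp add: R.pow_mult_distrib_nat R.nat_pow_inv e)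
  then show ?thesis using u(1) by blast
 qed
 show "qis (torsion_part p R) R id_map"
  unfolding qis_def
 proof (intro conjI allI ballI impI c(2))
  fix n x assume x: "x : Cy (torsion_part p R) n" and b: "id_map n x : Bd R n"
  obtain z where z: "z : Car R (n - 1)" "x = cdiff R (n - 1) z" using b unfolding coboundaries_iff by auto
  obtain k where k: "x ^[cgrp R n] (p ^ k) = 1[cgrp R n]" using x unfolding cocycles_iff by auto
  \<comment> \<open>The bounding element z need not be torsion. Its p^k-th power is a cocycle,
    however, and torsion of the cohomology in degree n - 1 makes a higher power a coboundary, so
    that \<open>adj\<close> applies to z.\<close>
  have "z ^[cgrp R (n - 1)] (p ^ k) : Cy R (n - 1)"
   using cx_simps(17)[OF R z(1), of "p ^ k"] z(1) k unfolding cocycles_iff z(2)[symmetric] by (simp add: cx_simps(15)[OF R])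
  then obtain l where "(z ^[cgrp R (n - 1)] (p ^ k)) ^[cgrp R (n - 1)] (p ^ l) : Bd R (n - 1)"
   using t[of "n - 1"] unfolding tors_def by blast
  then have "z ^[cgrp R (n - 1)] (p ^ (k + l)) : Bd R (n - 1)" by (simp add: R.nat_pow_pow z(1) power_add)
  from adj[OF z(1) this] obtain u where u: "u : Car R (n - 1 - 1)"
   "(z *[cgrp R (n - 1)] inv[cgrp R (n - 1)] (cdiff R (n - 1 - 1) u)) ^[cgrp R (n - 1)] (p ^ (k + l)) = 1[cgrp R (n - 1)]" by blast
  let ?u = "cdiff R (n - 1 - 1) u"
  have du: "?u : Car R (n - 1)" by (rule cx_simps(1)[OF R u(1)]) simp
  have ddu: "cdiff R (n - 1) ?u = 1[cgrp R n]" using cx_simps(5)[OF R u(1), of "n - 1"] by simp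
  have "cdiff R (n - 1) (z *[cgrp R (n - 1)] inv[cgrp R (n - 1)] ?u) = x"
   using cx_simps(2)[OF R z(1) cx_simps(8)[OF R du]] cx_simps(4)[OF R du] ddu z by simp
  moreover have "z *[cgrp R (n - 1)] inv[cgrp R (n - 1)] ?u : Car (torsion_part p R) (n - 1)"
   using u(2) z(1) du by auto
  ultimately show "x : Bd (torsion_part p R) n" unfolding coboundaries_iff torsion_part_simps(4) by metis
 next
  fix n y assume y: "y : Cy R n"
  then have yc: "y : Car R n" "cdiff R n y = 1[cgrp R (n + 1)]" unfolding cocycles_iff by simp_all
  obtain k where "y ^[cgrp R n] (p ^ k) : Bd R n" using t[of n] y unfolding tors_def by blast
  from adj[OF yc(1) this] obtain u where u: "u : Car R (n - 1)"
   "(y *[cgrp R n] inv[cgrp R n] (cdiff R (n - 1) u)) ^[cgrp R n] (p ^ k) = 1[cgrp R n]" by blast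
  let ?u = "cdiff R (n - 1) u" let ?x = "y *[cgrp R n] inv[cgrp R n] ?u"
  have du: "?u : Car R n" by (rule cx_simps(1)[OF R u(1)]) simp
  have ddu: "cdiff R n ?u = 1[cgrp R (n + 1)]" using cx_simps(5)[OF R u(1), of n] by simp
  have "?x : Cy (torsion_part p R) n" unfolding cocycles_iff using yc du ddu u(2) by auto
  moreover have "y = id_map n ?x *[cgrp R n] ?u" using yc du by (simp add: R.m_assoc)
  ultimately show "\<exists>x\<in>Cy (torsion_part p R) n. \<exists>z\<in>Car R (n - 1). y = id_map n x *[cgrp R n] cdiff R (n - 1) z" using u(1) by blast
 qed
 show "divisible_torsion p (torsion_part p R)" unfolding divisible_torsion_def
 proof (intro conjI allI ballI c(1))
  fix n r assume r: "r : Car (torsion_part p R) n"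
  then obtain k where k: "r : Car R n" "r ^[cgrp R n] (p ^ k) = 1[cgrp R n]" by auto
  show "\<exists>k. r ^[cgrp (torsion_part p R) n] (p ^ k) = 1[cgrp (torsion_part p R) n]" using k by auto
  obtain s where s: "s : Car R n" "s ^[cgrp R n] p = r" using d[OF k(1)] by blast
  have "s ^[cgrp R n] (p ^ Suc k) = 1[cgrp R n]" using R.nat_pow_pow[OF s(1), of p "p ^ k"] s(2) k(2) by simp
  then have "s : Car (torsion_part p R) n" using s(1) unfolding torsion_part_simps by blast
  then show "\<exists>s\<in>Car (torsion_part p R) n. s ^[cgrp (torsion_part p R) n] p = r" using s(2) by auto
 qed
qed

context prime_generator
begin

text \<open>With the n-th group embedded by e into a divisible \<open>D n\<close>, the products of
  \<open>D n\<close> and \<open>D (n + 1)\<close> with differential (a, b) to (b, 1) form a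
  contractible complex. Sending x to the pair of e x and e of its differential is a chain map,
  injective by the first component.\<close>

lemma acyclic_divisible_embedding:
 assumes X: "X : Sm"
 shows "\<exists>(E :: (('u => rat) set \<times> ('u => rat) set) cochain_complex) i. cmap X E i \<and> (\<forall>n. inj_on (i n) (Car X n)) \<and> (\<forall>n. acyclic_at E n) \<and>
  (\<forall>n. |Car E n| <o |UNIV :: 'u set| ) \<and> (\<forall>n. \<forall>x\<in>Car E n. \<exists>y\<in>Car E n. y ^[cgrp E n] p = x)"
proof -
 have cX: "is_complex X" by (rule small_complex(1)[OF X])
 have p0: "p > 0" using p by (simp add: prime_gt_0_nat)
 define P where "P n (De :: ('u => rat) set monoid \<times> ('u => ('u => rat) set)) \<longleftrightarrow> comm_group (fst De) \<and> |carrier (fst De)| <o |UNIV :: 'u set| \<and>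
  snd De : hom (cgrp X n) (fst De) \<and> inj_on (snd De) (Car X n) \<and> (\<forall>x\<in>carrier (fst De). \<exists>y\<in>carrier (fst De). y ^[fst De] p = x)" for n De
 have "\<forall>n. \<exists>De. P n De"
 proof
  fix n
  obtain D e where "comm_group (D :: ('u => rat) set monoid)" "|carrier D| <o |UNIV :: 'u set|" "e : hom (cgrp X n) D" "inj_on e (Car X n)"
   "\<forall>x\<in>carrier D. \<exists>y\<in>carrier D. y ^[D] p = x"
   using divisible_embedding[OF comm_group_cgrp[OF cX] small_complex(2)[OF X] p0, of n] by blast
  then have "P n (D, e)" by (simp add: P_def)
  then show "\<exists>De. P n De" by blast
 qed
 from choice[OF this] obtain De where De: "\<forall>n. P n (De n)" by blast
 define D where "D n = fst (De n)" for n
 define e where "e n = snd (De n)" for n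
 have D: "comm_group (D n)" "|carrier (D n)| <o |UNIV :: 'u set|" "e n : hom (cgrp X n) (D n)" "inj_on (e n) (Car X n)"
  "x : carrier (D n) ==> \<exists>y\<in>carrier (D n). y ^[D n] p = x" for n x
  using De[rule_format, of n] unfolding P_def D_def e_def by auto
 interpret D: comm_group "D i" for i by (rule D(1))
 interpret X: comm_group "cgrp X i" for i by (rule comm_group_cgrp[OF cX])
 interpret e: group_hom "cgrp X i" "D i" "e i" for i by unfold_locales (rule D(3))
 note [simp] = cx_simps[OF cX]
 define E where "E = \<lparr>cgrp = (%n. D n \<times>\<times> D (n + 1)), cdiff = (%n (a, b). (b, 1[D (n + 1 + 1)]))\<rparr>"
 have E [simp]: "cgrp E n = D n \<times>\<times> D (n + 1)" "cdiff E n (a, b) = (b, 1[D (n + 1 + 1)])" for n a b by (simp_all add: E_def)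
 have [simp]: "1 + (1 + n) = n + 2" "n + 1 + 1 = n + 2" for n :: int by simp_all
 have cE: "is_complex E"
  by (rule is_complexI) (auto simp: comm_group_DirProd D(1) one_DirProd mult_DirProd' add.assoc)
 define i where "i n x = (e n x, e (n + 1) (cdiff X n x))" for n x
 have ci: "cmap X E i"
  by (rule cmapI[OF cX cE]) (simp_all add: i_def)
 have inj: "inj_on (i n) (Car X n)" for n using D(4)[of n] by (auto simp: i_def inj_on_def)
 have ac: "acyclic_at E n" for n
  unfolding acyclic_at_iff[OF cE]
 proof
  fix x assume "x : Cy E n"
  then obtain a where a: "x = (a, 1[D (n + 1)])" "a : carrier (D n)" unfolding cocycles_iff by (cases x) (auto simp: one_DirProd)
  have "x = cdiff E (n - 1) (1[D (n - 1)], a)" "(1[D (n - 1)], a) : Car E (n - 1)" using a by simp_all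
  then show "x : Bd E n" unfolding coboundaries_iff by blast
 qed
 have sm: "|Car E n| <o |UNIV :: 'u set|" for n by (simp add: sm_Times D(2))
 have pw: "(a, b) ^[D n \<times>\<times> D m] (k::nat) = (a ^[D n] k, b ^[D m] k)" for a b n m k
  by (induction k) (simp_all add: one_DirProd)
 have dv: "\<exists>y\<in>Car E n. y ^[cgrp E n] p = x" if x: "x : Car E n" for n x
 proof -
  obtain a b where ab: "x = (a, b)" "a : carrier (D n)" "b : carrier (D (n + 1))" using x by (cases x) auto
  obtain a' b' where "a' : carrier (D n)" "a' ^[D n] p = a" "b' : carrier (D (n + 1))" "b' ^[D (n + 1)] p = b" using D(5) ab(2,3) by blast
  then show ?thesis unfolding ab(1) by (intro bexI[of _ "(a', b')"]) (simp_all add: pw)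
 qed
 show ?thesis using ci inj ac sm dv by blast
qed

text \<open>X[-1] embeds into an acyclic divisible complex, so the quotient R represents X[-1][1],
  that is, X. As a quotient R is divisible too, and its torsion part has the same
  cohomology.\<close>

lemma torsion_model:
 assumes X: "X : Sm" and t: "!!n. tors X n (range (%k. p ^ k))"
 shows "\<exists>T\<in>Sm. isoD X T \<and> divisible_torsion p T"
proof -
 let ?X = "Shf (- 1) X"
 have cX: "is_complex X" by (rule small_complex(1)[OF X])
 have X': "?X : Sm" by (rule shift_Sm[OF X])
 obtain E :: "(('u => rat) set \<times> ('u => rat) set) cochain_complex" and i where E: "cmap ?X E i" "!!n. inj_on (i n) (Car ?X n)" "!!n. acyclic_at E n"
  "!!n. |Car E n| <o |UNIV :: 'u set|" "!!n x. x : Car E n ==> \<exists>y\<in>Car E n. y ^[cgrp E n] p = x"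
  using acyclic_divisible_embedding[OF X'] by blast
 obtain R0 :: "(('u => rat) set \<times> ('u => rat) set) set cochain_complex" and q where s: "ses ?X E R0 i q" using quotient_complex[OF E(1,2)] by blast
 have cR0: "is_complex R0" by (rule cmapD(2)[OF sesD(2)[OF s]])
 have "|Car R0 n| <o |UNIV :: 'u set|" for n
  by (rule sm_subset[OF sm_image[OF E(4), of "q n" n]]) (use sesD(4)[OF s] in blast)
 from transport_complex[OF cR0 this] obtain R :: "'u cochain_complex" and \<phi> where
  R: "R : Sm" "cmap R0 R \<phi>" "!!n. bij_betw (\<phi> n) (Car R0 n) (Car R n)" by blast
 have cR: "is_complex R" by (rule small_complex(1)[OF R(1)])
 let ?C = "cone ?X E i"
 have cC: "is_complex ?C" by (rule is_complex_cone[OF E(1)])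
 have "|Car ?C n| <o |UNIV :: 'u set|" for n
  using sm_Times[OF small_complex(2)[OF X', of "n + 1"] E(4)[of n]] by simp
 from transport_complex[OF cC this] obtain V :: "'u cochain_complex" and \<psi> where
  V: "V : Sm" "cmap ?C V \<psi>" "!!n. bij_betw (\<psi> n) (Car ?C n) (Car V n)" by blast
 note iq = qis_bij(2)[OF V(2,3)]
 have 1: "isoD V R"
  by (rule isoD_qis[OF V(1) R(1) qis_comp[OF qis_comp[OF iq ses_cone_qis[OF s]] qis_bij(1)[OF R(2,3)]]])
 have 2: "isoD V (Shf 1 ?X)"
  by (rule isoD_qis[OF V(1) shift_Sm[OF X'] qis_comp[OF iq cone_acyclic_target_qis[OF E(1,3)]]])
 have 3: "isoD (Shf 1 ?X) X"
  using isoD_qis[OF shift_Sm[OF X'] X qis_comp[OF qis_shift_shift[OF cX, of 1 "-1"] ]] qis_shift_0[OF cX] by simp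
 have XR: "isoD X R"
  by (rule isoD_trans[OF X V(1) R(1) isoD_sym[OF isoD_trans[OF V(1) shift_Sm[OF X'] X 2 3]] 1])
 have tR: "tors R n (range (%k. p ^ k))" for n using tors_isoD[OF X R(1) XR] t by blast
 have dR: "\<exists>s\<in>Car R n. s ^[cgrp R n] p = r" if r: "r : Car R n" for n r
 proof -
  obtain r0 where r0: "r0 : Car R0 n" "r = \<phi> n r0" using R(3)[of n] r unfolding bij_betw_def by blast
  obtain x where x: "x : Car E n" "r0 = q n x" using sesD(4)[OF s r0(1)] by blast
  obtain y where y: "y : Car E n" "y ^[cgrp E n] p = x" using E(5)[OF x(1)] by blast
  have qy: "q n y : Car R0 n" by (rule cmap_simps(1)[OF sesD(2)[OF s] y(1)])
  have "\<phi> n (q n y) ^[cgrp R n] p = r"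
   using cmap_simps(6)[OF R(2) qy, of p] cmap_simps(6)[OF sesD(2)[OF s] y(1), of p] y(2) x(2) r0(2) by simp
  then show ?thesis using cmap_simps(1)[OF R(2) qy] by blast
 qed
 note T = torsion_part_qis[OF cR dR tR]
 have TS: "torsion_part p R : Sm"
  unfolding small_complexes_def small_def
  using cmapD(1)[OF qis_cmap[OF T(1)]] by (auto intro!: sm_subset[OF small_complex(2)[OF R(1)]])
 show ?thesis
  by (intro bexI[OF _ TS] conjI T(2) isoD_trans[OF X R(1) TS XR isoD_sym[OF isoD_qis[OF TS R(1) T(1)]]])
qed

text \<open>The identity on elements works in both directions. Because of the sign in the shift,
  inverses in the torsion subgroup have to be matched with inverses in the ambient group.\<close>

lemma Tk_shift_iso:
 assumes T: "T : Sm" shows "isoD (Tk p (Shf 1 T) k) (Shf 1 (Tk p T k))"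
proof -
 have cT: "is_complex T" by (rule small_complex(1)[OF T])
 have c1: "is_complex (Tk p (Shf 1 T) k)" by (rule Tk_complex(1)[OF is_complex_shift[OF cT]])
 have c2: "is_complex (Shf 1 (Tk p T k))" by (rule is_complex_shift[OF Tk_complex(1)[OF cT]])
 have iv: "inv[cgrp (Tk p T k) n] x = inv[cgrp T n] x" if "x : Car (Tk p T k) n" for n x
  using group.m_inv_consistent[OF group_cgrp[OF cT] Tk_complex(3)[OF cT] that] by (simp add: Tk_def)
 have dT: "cdiff T n x : Car (Tk p T k) (n + 1)" if "x : Car (Tk p T k) n" for n x
  using cx_simps(1)[OF Tk_complex(1)[OF cT, of p k] that] by simp
 have dd: "cdiff (Tk p (Shf 1 T) k) n x = cdiff (Shf 1 (Tk p T k)) n x" if "x : Car (Tk p T k) (n + 1)" for n x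
  using iv[OF dT[OF that]] by simp
 have m1: "cmap (Tk p (Shf 1 T) k) (Shf 1 (Tk p T k)) id_map"
  by (rule cmapI[OF c1 c2]) (use dd in \<open>simp_all\<close>)
 have m2: "cmap (Shf 1 (Tk p T k)) (Tk p (Shf 1 T) k) id_map"
  by (rule cmapI[OF c2 c1]) (use dd in \<open>simp_all\<close>)
 show ?thesis by (rule isoD_qis[OF Tk_Sm[OF shift_Sm[OF T]] shift_Sm[OF Tk_Sm[OF T]] qis_of_inverse[OF m1 m2]]) simp_all
qed

text \<open>T is the union of the \<open>Tk p T k\<close>. The map \<theta> is the identity minus
  the inclusion into the next stage, and f adds up the components. Injectivity of \<theta> is seen
  one component after the other; exactness in the middle uses partial sums.\<close>

lemma telescope_ses:
 assumes T: "divisible_torsion p T" and d: "dsum (UNIV :: nat set) (Tk p T) Z j q"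
 shows "\<exists>\<theta> f. ses Z Z T \<theta> f"
proof -
 have cT: "is_complex T" by (rule divisible_torsionD(1)[OF T])
 have cZ: "is_complex Z" by (rule dsumD(1)[OF d])
 interpret T: comm_group "cgrp T i" for i by (rule comm_group_cgrp[OF cT])
 interpret Z: comm_group "cgrp Z i" for i by (rule comm_group_cgrp[OF cZ])
 note [simp] = cx_simps[OF cT] cx_simps[OF cZ]
 have j: "cmap (Tk p T k) Z (j k)" and q: "cmap Z (Tk p T k) (q k)" for k using dsumD(2,3)[OF d] by blast+
 note g = dsumD(4)[OF d]
 have up: "x : Car (Tk p T (Suc k)) n" if "x : Car (Tk p T k) n" for x k n
  using that T.nat_pow_pow[of x n "p ^ k" p] by (simp add: mult.commute)
 have jc: "j k n x : Car Z n" if "x : Car (Tk p T k) n" for k n x by (rule cmap_simps(1)[OF j that])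
 have qc: "q k n z : Car (Tk p T k) n" if "z : Car Z n" for k n z by (rule cmap_simps(1)[OF q that])
 have qT: "q k n z : Car T n" if "z : Car Z n" for k n z using qc[OF that, of k] by simp
 obtain f where f: "cmap Z T f" "!!k n x. x : Car (Tk p T k) n ==> f n (j k n x) = x"
  using dsum_lift[OF d cT Tk_complex(2)[OF cT]] by auto
 define t where "t k n x = j k n x *[cgrp Z n] inv[cgrp Z n] (j (Suc k) n x)" for k n x
 have tm: "cmap (Tk p T k) Z (t k)" for k
 proof (rule cmapI[OF Tk_complex(1)[OF cT] cZ])
  fix n x assume x: "x : Car (Tk p T k) n"
  note xs = jc[OF x] jc[OF up[OF x]]
  show "t k n x : Car Z n" using xs by (simp add: t_def)
  show "t k (n + 1) (cdiff (Tk p T k) n x) = cdiff Z n (t k n x)"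
   using cmap_simps(5)[OF j x, of "n + 1"] cmap_simps(5)[OF j up[OF x], of "n + 1"] xs by (simp add: t_def)
  fix y assume y: "y : Car (Tk p T k) n"
  note ys = jc[OF y] jc[OF up[OF y]]
  show "t k n (x *[cgrp (Tk p T k) n] y) = t k n x *[cgrp Z n] t k n y"
   using cmap_simps(2)[OF j x y] cmap_simps(2)[OF j up[OF x] up[OF y]] xs ys
   by (simp add: t_def Z.inv_mult Z.m_ac)
 qed
 obtain \<theta> where \<theta>: "cmap Z Z \<theta>" "!!k n x. x : Car (Tk p T k) n ==> \<theta> n (j k n x) = t k n x"
  using dsum_lift[OF d cZ tm] by auto
 have \<theta>c: "\<theta> n z : Car Z n" if "z : Car Z n" for n z by (rule cmap_simps(1)[OF \<theta>(1) that])
 have qTm: "cmap Z T (q k)" for k using cmap_comp[OF q Tk_complex(2)[OF cT]] by simp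
 have qj: "q l n (j k n x) = (if l = k then x else 1[cgrp T n])" if "x : Car (Tk p T k) n" for l k n x
  using gsumD(5)[OF dsumD(4)[OF d, of n], of k x] gsumD(6)[OF dsumD(4)[OF d, of n], of k x l] that by auto
 have qt: "q l n (t k n x) = q l n (j k n x) *[cgrp T n] inv[cgrp T n] (q l n (j (Suc k) n x))" if "x : Car (Tk p T k) n" for l k n x
  unfolding t_def using cmap_simps(2)[OF qTm jc[OF that] cx_simps(8)[OF cZ jc[OF up[OF that]]]] cmap_simps(4)[OF qTm jc[OF up[OF that]]] by simp
 have q0: "q 0 n (\<theta> n z) = q 0 n z" if z: "z : Car Z n" for n z
 proof -
  have "(q 0 \<cdot> \<theta>) n z = q 0 n z"
  proof (rule dsum_ext[OF d cmap_comp[OF \<theta>(1) qTm] qTm _ z])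
   fix k n x assume x: "x : Car (Tk p T k) n"
   then show "(q 0 \<cdot> \<theta>) n (j k n x) = q 0 n (j k n x)" using qj[OF x, of 0] qj[OF up[OF x], of 0] by (simp add: \<theta>(2)[OF x] qt[OF x])
  qed
  then show ?thesis by simp
 qed
 define m where "m k n z = q (Suc k) n z *[cgrp T n] inv[cgrp T n] (q k n z)" for k n z
 have mm: "cmap Z T (m k)" for k
  by (rule cmapI[OF cZ cT]) (use qT cmap_simps(5)[OF qTm] in \<open>simp_all add: m_def cmap_simps(2)[OF qTm] T.inv_mult T.m_ac\<close>)
 have qS: "q (Suc l) n (\<theta> n z) = q (Suc l) n z *[cgrp T n] inv[cgrp T n] (q l n z)" if z: "z : Car Z n" for n z l
 proof -
  have "(q (Suc l) \<cdot> \<theta>) n z = m l n z"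
  proof (rule dsum_ext[OF d cmap_comp[OF \<theta>(1) qTm] mm _ z])
   fix k n x assume x: "x : Car (Tk p T k) n"
   then have "x : Car T n" by simp
   then show "(q (Suc l) \<cdot> \<theta>) n (j k n x) = m l n (j k n x)"
    using qj[OF x, of "Suc l"] qj[OF up[OF x], of "Suc l"] qj[OF x, of l] by (simp add: \<theta>(2)[OF x] qt[OF x] m_def)
  qed
  then show ?thesis by (simp add: m_def)
 qed
 have f\<theta>: "f n (\<theta> n z) = 1[cgrp T n]" if z: "z : Car Z n" for n z
 proof -
  have "(f \<cdot> \<theta>) n z = zero_map T n z"
  proof (rule dsum_ext[OF d cmap_comp[OF \<theta>(1) f(1)] cmap_zero[OF cZ cT] _ z])
   fix k n x assume x: "x : Car (Tk p T k) n"
   then have "x : Car T n" by simp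
   then show "(f \<cdot> \<theta>) n (j k n x) = zero_map T n (j k n x)"
    using cmap_simps(2)[OF f(1) jc[OF x] cx_simps(8)[OF cZ jc[OF up[OF x]]]] cmap_simps(4)[OF f(1) jc[OF up[OF x]]] f(2)[OF x] f(2)[OF up[OF x]]
    by (simp add: \<theta>(2)[OF x] t_def zero_map_def)
  qed
  then show ?thesis by (simp add: zero_map_def)
 qed
 have ker: "z = 1[cgrp Z n]" if z: "z : Car Z n" and e: "\<theta> n z = 1[cgrp Z n]" for n z
 proof (rule gsumD(8)[OF g z])
  fix k :: nat
  have "q k n z = 1[cgrp T n]"
  proof (induction k)
   case 0 show ?case using q0[OF z] cmap_simps(3)[OF qTm, of 0 n] unfolding e by simp
  next
   case (Suc k) show ?case using qS[OF z, of k] cmap_simps(3)[OF qTm, of "Suc k" n] qT[OF z] unfolding e Suc by simp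
  qed
  then show "q k n z = 1[cgrp (Tk p T k) n]" by simp
 qed
 have "ses Z Z T \<theta> f" unfolding ses_def
 proof (intro conjI allI ballI \<theta>(1) f(1) iffI)
  fix n
  interpret h: group_hom "cgrp Z n" "cgrp Z n" "\<theta> n"
   by unfold_locales (use \<theta>c cmap_simps(2)[OF \<theta>(1)] in \<open>auto simp: hom_def\<close>)
  show "inj_on (\<theta> n) (Car Z n)" using ker[of _ n] by (simp add: h.inj_on_one_iff)
  show "f n ` Car Z n = Car T n"
  proof (intro equalityI subsetI)
   fix x assume "x : Car T n"
   then obtain k where x: "x : Car (Tk p T k) n" using divisible_torsionD(2)[OF T, of x n] by auto
   show "x : f n ` Car Z n" using f(2)[OF x] jc[OF x] by force
  qed (use cmap_simps(1)[OF f(1)] in auto)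
  fix z assume z: "z : Car Z n"
  { assume "z : \<theta> n ` Car Z n" then show "f n z = 1[cgrp T n]" using f\<theta> by auto }
  assume fz: "f n z = 1[cgrp T n]"
  \<comment> \<open>The partial sums of the components of z form its preimage under \<theta>. They
    are trivial from \<open>N\<close> on, because the total sum is \<open>f n z\<close>, and the
    k-th of them lies in \<open>Tk p T k\<close> as the stages increase.\<close>
  define s where "s k = finprod (cgrp T n) (%i. q i n z) {..k}" for k
  have s0: "s 0 = q 0 n z" using qT[OF z] by (simp add: s_def)
  have sS: "s (Suc k) = q (Suc k) n z *[cgrp T n] s k" for k
   unfolding s_def by (rule T.finprod_Suc) (use qT[OF z] in auto)
  have sc: "s k : Car (Tk p T k) n" for k
  proof (induction k)
   case 0 show ?case unfolding s0 by (rule qc[OF z])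
  next
   case (Suc k)
   show ?case unfolding sS using cx_simps(6)[OF Tk_complex(1)[OF cT] qc[OF z] up[OF Suc]] by simp
  qed
  have fin: "finite {i : UNIV. q i n z \<noteq> 1[cgrp (Tk p T i) n]}" by (rule gsumD(7)[OF g z])
  obtain N where N: "{i : UNIV. q i n z \<noteq> 1[cgrp (Tk p T i) n]} \<subseteq> {..N}" using finite_nat_iff_bounded_le[of "{i : UNIV. q i n z \<noteq> 1[cgrp (Tk p T i) n]}"] fin by auto
  have sN: "s k = 1[cgrp T n]" if "N \<le> k" for k
  proof -
   have "finprod (cgrp Z n) (%i. j i n (q i n z)) {..k} = z"
    by (rule gsum_decomp[OF g z]) (use N that in auto)
   then have "f n z = finprod (cgrp T n) (%i. f n (j i n (q i n z))) {..k}"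
    using finprod_hom[OF comm_group_cgrp[OF cZ, of n] comm_group_cgrp[OF cT, of n], of "f n" "{..k}" "%i. j i n (q i n z)"]
     cmap_simps(1,2)[OF f(1)] jc[OF qc[OF z]] by (auto simp: hom_def)
   also have "\<dots> = s k" unfolding s_def by (rule T.finprod_cong') (use f(2)[OF qc[OF z]] qT[OF z] in auto)
   finally show ?thesis using fz by simp
  qed
  have "{i : UNIV. s i \<noteq> 1[cgrp (Tk p T i) n]} \<subseteq> {..<N}" using sN by (auto simp: not_le[symmetric])
  then have "finite {i : UNIV. s i \<noteq> 1[cgrp (Tk p T i) n]}" by (rule finite_subset) simp
  then obtain w where w: "w : Car Z n" "!!k. q k n w = s k" using gsum_build[OF g sc] by auto
  have "\<theta> n w = z"
  proof (rule gsum_eqI[OF g \<theta>c[OF w(1)] z])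
   fix k
   show "q k n (\<theta> n w) = q k n z"
   proof (cases k)
    case 0 then show ?thesis using q0[OF w(1)] w(2) s0 by simp
   next
    case (Suc l)
    have "s l : Car T n" using sc[of l] by simp
    then show ?thesis unfolding Suc qS[OF w(1)] w(2) sS using qT[OF z, of "Suc l"] by (simp add: T.m_assoc)
   qed
  qed
  then show "z : \<theta> n ` Car Z n" using w(1) by blast
 qed
 then show ?thesis by blast
qed

text \<open>The telescope gives a triangle Z -> T -> Z[1] with Z the direct sum of the
  \<open>Tk p T k\<close>. By \<open>Tk_acyclic\<close>, cohomology of T in degree n calls for
  copies of G in degrees n and n + 1 to build Z, and in degrees n - 1 and n to build Z[1].\<close>

lemma closedQ_divisible:
 assumes Q: "closedQ Q" and T: "T : Sm" "divisible_torsion p T"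
  and GQ: "!!n. \<not> acyclic_at T n ==> Gs (n - 1) : Q \<and> Gs n : Q \<and> Gs (n + 1) : Q"
 shows "T : Q"
proof -
 have cT: "is_complex T" by (rule small_complex(1)[OF T(1)])
 obtain Z j q where Z: "Z : Sm" "dsum (UNIV :: nat set) (Tk p T) Z j q" using dsum_exists[OF sm_nat, of "Tk p T"] Tk_Sm[OF T(1)] by blast
 obtain \<theta> f where s: "ses Z Z T \<theta> f" using telescope_ses[OF T(2) Z(2)] by blast
 have "Gs n : Q" if "\<not> acyclic_at (Tk p T 1) n" for n
  using Tk_acyclic[OF T(2), of n] that GQ[of n] GQ[of "n - 1"] by auto
 then have 1: "Tk p T k : Q" for k by (rule closedQ_Tk[OF Q T])
 then have ZQ: "Z : Q" by (rule closedQ_dsum[OF Q Z(2) sm_nat _ Z(1)])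
 have "Gs n : Q" if a: "\<not> acyclic_at (Tk p (Shf 1 T) 1) n" for n
  using Tk_acyclic[OF divisible_torsion_shift[OF T(2)], of 1 n] that GQ[of n] GQ[of "n + 1"] unfolding tors_shift[OF cT] by auto
 then have "Tk p (Shf 1 T) k : Q" for k by (rule closedQ_Tk[OF Q shift_Sm[OF T(1)] divisible_torsion_shift[OF T(2)]])
 then have 2: "Shf 1 (Tk p T k) : Q" for k
  by (rule closedQ_iso[OF Q _ shift_Sm[OF Tk_Sm[OF T(1)]] Tk_shift_iso[OF T(1)]])
 have "Shf 1 Z : Q"
  by (rule closedQ_dsum[OF Q dsum_shift[OF Z(2), of 1] sm_nat 2 shift_Sm[OF Z(1)]])
 from closedQ_cone[OF Q ZQ this T(1) sesD(2)[OF s]] ses_shift_cone_qis[OF s] show ?thesis by blast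
qed

lemma closedQ_torsion:
 assumes Q: "closedQ Q" and X: "X : Sm" "!!n. tors X n (range (%k. p ^ k))"
  and GQ: "!!n. \<not> acyclic_at X n ==> Gs (n - 1) : Q \<and> Gs n : Q \<and> Gs (n + 1) : Q"
 shows "X : Q"
proof -
 obtain T where T: "T : Sm" "isoD X T" "divisible_torsion p T" using torsion_model[OF X] by blast
 have "T : Q" by (rule closedQ_divisible[OF Q T(1,3)]) (use tors_isoD[OF X(1) T(1,2)] GQ in blast)
 then show ?thesis by (rule closedQ_iso[OF Q _ X(1) isoD_sym[OF T(2)]])
qed

end

section \<open>Full subcategories, torsion classes and a criterion for compactness\<close>

lemma shift_complex_0 [simp]: "Shf 0 X = X"
 by (cases X) (simp add: shift_complex_def)

context universe
begin

lemma isomorphic_full_subcategory: "isomorphic (full_subcategory D_Ab P) X Y \<longleftrightarrow> isomorphic D_Ab X Y"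
 by (simp add: isomorphic_def isomorphism_def)

lemma zero_hom_full_subcategory: "zero_hom (full_subcategory D_Ab P) X Y \<longleftrightarrow> zero_hom D_Ab X Y"
 by (simp add: zero_hom_def)

lemma is_coproduct_subcategory:
 assumes c: "is_coproduct D_Ab I X Z \<iota>" and P: "P \<subseteq> Sm" and X: "\<forall>i\<in>I. X i : P" and Z: "Z : P"
 shows "is_coproduct (full_subcategory D_Ab P) I X Z \<iota>"
proof -
 have 1: "\<forall>i\<in>I. \<iota> i : carrier (dhom (X i) Z)" using c by (simp add: is_coproduct_def)
 have 2: "\<forall>g. (\<forall>i\<in>I. g i : carrier (dhom (X i) Y)) -->
   (\<exists>!h. h : carrier (dhom Z Y) \<and> (\<forall>i\<in>I. dcomp (X i) Z Y h (\<iota> i) = g i))" if "Y : P" for Y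
  using c subsetD[OF P that] unfolding is_coproduct_def D_Ab_simps by (elim conjE) (erule (1) bspec)
 show ?thesis unfolding is_coproduct_def full_subcategory_simps
 proof (intro conjI X Z 1)
  show "\<forall>Y\<in>P. \<forall>g. (\<forall>i\<in>I. g i : carrier (dhom (X i) Y)) -->
   (\<exists>!h. h : carrier (dhom Z Y) \<and> (\<forall>i\<in>I. dcomp (X i) Z Y h (\<iota> i) = g i))" by (rule ballI) (rule 2)
 qed
qed

lemma zero_homI:
 assumes X: "X : Sm" "Y : Sm" and z: "!!R. R : carrier (dhom X Y) ==> R = 1[dhom X Y]"
 shows "zero_hom D_Ab X Y"
 unfolding zero_hom_def D_Ab_simps
proof (intro equalityI subsetI)
 interpret comm_group "dhom X Y" by (rule comm_group_derived_hom[OF X])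
 show "R : {1[dhom X Y]}" if "R : carrier (dhom X Y)" for R using z[OF that] by (simp only: singleton_iff)
 show "R : carrier (dhom X Y)" if "R : {1[dhom X Y]}" for R using that by (simp only: singleton_iff one_closed)
qed

lemma derived_dist_Sm:
 assumes "(X, Y, Z, f, g, h) : derived_dist" shows "X : Sm" "Y : Sm" "Z : Sm"
 using assms unfolding derived_dist_def by blast+

text \<open>Extensions multiply exponents, which the multiplicative sets \<open>S n\<close> absorb.
  A coproduct is a retract of a direct sum, where \<open>dsum_tors\<close> applies because a product
  is a common multiple. The statement serves both acyclicity and p-primary torsion.\<close>

lemma tors_class_closed:
 assumes P: "P \<subseteq> Sm" and Pd: "!!(I :: 'u set) X Z j q. \<lbrakk>dsum I X Z j q; |I| <o |UNIV :: 'u set|; \<forall>i\<in>I. X i : P; Z : Sm\<rbrakk> \<Longrightarrow> Z : P"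
  and S: "!!n. 1 : S n" "!!n a b. \<lbrakk>a : S n; b : S n\<rbrakk> \<Longrightarrow> a * b : S n"
 shows "extension_closed (full_subcategory D_Ab P) {X : P. \<forall>n. tors X n (S n)}"
  "coproduct_closed U (full_subcategory D_Ab P) {X : P. \<forall>n. tors X n (S n)}"
proof -
 show "extension_closed (full_subcategory D_Ab P) {X : P. \<forall>n. tors X n (S n)}"
  unfolding extension_closed_def
 proof (intro conjI allI impI)
  fix X assume "zero_object (full_subcategory D_Ab P) X"
  then have X: "X : P" "zero_hom D_Ab X X" unfolding zero_object_def zero_hom_full_subcategory by simp_all
  have "tors X n (S n)" for n by (rule tors_mono[OF acyclic_of_zero_hom[OF subsetD[OF P X(1)] X(2)]]) (use S(1) in simp)
  then show "X : {X : P. \<forall>n. tors X n (S n)}" using X(1) by simp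
 next
  fix X Z Y f g h
  assume a: "(X, Z, Y, f, g, h) : Dist (full_subcategory D_Ab P) \<and> X : {X : P. \<forall>n. tors X n (S n)} \<and> Y : {X : P. \<forall>n. tors X n (S n)}"
  then have d: "(X, Z, Y, f, g, h) : derived_dist" "Z : P" and t: "!!n. tors X n (S n)" "!!n. tors Y n (S n)" by simp_all
  have "tors Z n (S n)" for n by (rule tors_mono[OF tors_extension[OF d(1) t]]) (use S(2) in blast)
  then show "Z : {X : P. \<forall>n. tors X n (S n)}" using d(2) by simp
 qed
 show "coproduct_closed U (full_subcategory D_Ab P) {X : P. \<forall>n. tors X n (S n)}"
  unfolding coproduct_closed_def
 proof (intro allI impI)
  fix I :: "'u set" and X Z \<iota>
  assume a: "small I \<and> is_coproduct (full_subcategory D_Ab P) I X Z \<iota> \<and> (\<forall>i\<in>I. X i : {X : P. \<forall>n. tors X n (S n)})"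
  then have I: "|I| <o |UNIV :: 'u set|" and c: "is_coproduct (full_subcategory D_Ab P) I X Z \<iota>"
   and X: "!!i. i : I ==> X i : P" "!!i n. i : I ==> tors (X i) n (S n)" by (simp_all add: small_def)
  have Z: "Z : P" using c unfolding is_coproduct_def by simp
  obtain Z' j q where Z': "Z' : Sm" "dsum I X Z' j q" using dsum_exists[OF I, of X] X(1) P by blast
  have Z'P: "Z' : P" using Pd[OF Z'(2) I] X(1) Z'(1) by blast
  obtain h k where hk: "h : carrier (dhom Z Z')" "k : carrier (dhom Z' Z)" "dcomp Z Z' Z k h = dmor Z Z id_map"
   using coproduct_retract[OF P c I Z'(2) Z'P] by blast
  have "tors Z' n (S n)" for n
  proof (rule dsum_tors[OF Z'(2) X(2)])
   show "S n \<noteq> {}" using S(1) by blast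
   show "\<exists>c\<in>S n. a dvd c \<and> b dvd c" if "a : S n" "b : S n" for a b using S(2)[OF that] by (intro bexI[of _ "a * b"]) auto
  qed
  then have "tors Z n (S n)" for n using tors_retract[OF subsetD[OF P Z] Z'(1) hk] by blast
  then show "Z : {X : P. \<forall>n. tors X n (S n)}" using Z by simp
 qed
qed

lemma closedQ_tors:
 assumes S: "!!n. 1 : S n" "!!n a b. \<lbrakk>a : S n; b : S n\<rbrakk> \<Longrightarrow> a * b : S n"
 shows "closedQ {X : Sm. \<forall>n. tors X n (S n)}"
proof -
 let ?Q = "{X : Sm. \<forall>n. tors X n (S n)}"
 have "extension_closed (full_subcategory D_Ab Sm) ?Q" "coproduct_closed U (full_subcategory D_Ab Sm) ?Q"
  using tors_class_closed[of Sm S] S by simp_all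
 moreover have "extension_closed D_Ab ?Q \<longleftrightarrow> extension_closed (full_subcategory D_Ab Sm) ?Q"
 proof -
  have 1: "zero_object D_Ab X \<longleftrightarrow> zero_object (full_subcategory D_Ab Sm) X" for X by (simp add: zero_object_def zero_hom_def)
  have 2: "Dist (full_subcategory D_Ab Sm) = Dist D_Ab" using derived_dist_Sm by (auto 0 3)
  show ?thesis unfolding extension_closed_def 1 2 ..
 qed
 moreover have "coproduct_closed U D_Ab ?Q \<longleftrightarrow> coproduct_closed U (full_subcategory D_Ab Sm) ?Q"
  unfolding coproduct_closed_def is_coproduct_def by simp
 ultimately show ?thesis unfolding closedQ_def by blast
qed

lemma zero_comp_left:
 assumes X: "X : Sm" "Y : Sm" "Z : Sm" and R: "R : carrier (dhom X Y)"
 shows "dcomp X Y Z 1[dhom Y Z] R = 1[dhom X Z]"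
proof -
 obtain W s f where r: "is_roof X Y W s f" "R = roof_class X Y (W, s, f)" by (rule roof_classE[OF X(1,2) R])
 have c: "cmap Y Z (zero_map Z)" by (rule cmap_zero[OF small_complex(1)[OF X(2)] small_complex(1)[OF X(3)]])
 show ?thesis
  using comp_of_chain_map[OF r(1) X(3) c] derived_zero(1)[OF X(1,3) is_roofD(1,2)[OF r(1)]]
  unfolding r(2) zero_map_comp by (simp add: derived_hom_def)
qed

text \<open>Over one common denominator, finite sums of morphisms are computed on the numerators;
  the pointwise formula makes the result comparable with \<open>gsum_decomp\<close>.\<close>

lemma finprod_roof_class:
 assumes F: "finite F" and X: "X : Sm" "Y : Sm" "W : Sm" "qis W X s" and a: "!!i. i : F ==> cmap W Y (a i)"
  and r: "!!i. i : F ==> is_roof X Y W s (a i)"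
 shows "\<exists>b. is_roof X Y W s b \<and> finprod (dhom X Y) (%i. roof_class X Y (W, s, a i)) F = roof_class X Y (W, s, b) \<and>
  (\<forall>n. \<forall>x\<in>Car W n. b n x = finprod (cgrp Y n) (%i. a i n x) F)"
 using F a r
proof (induction F)
 case empty
 interpret H: comm_group "dhom X Y" by (rule comm_group_derived_hom[OF X(1,2)])
 interpret Y: comm_group "cgrp Y n" for n by (rule comm_group_cgrp[OF small_complex(1)[OF X(2)]])
 show ?case using derived_zero[OF X(1,2,3,4)] by (intro exI[of _ "zero_map Y"]) (simp add: zero_map_def)
next
 case (insert i F)
 interpret H: comm_group "dhom X Y" by (rule comm_group_derived_hom[OF X(1,2)])
 interpret Y: comm_group "cgrp Y n" for n by (rule comm_group_cgrp[OF small_complex(1)[OF X(2)]])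
 have "\<exists>b. is_roof X Y W s b \<and> finprod (dhom X Y) (%i. roof_class X Y (W, s, a i)) F = roof_class X Y (W, s, b) \<and>
  (\<forall>n. \<forall>x\<in>Car W n. b n x = finprod (cgrp Y n) (%i. a i n x) F)"
  by (rule insert.IH) (rule insert.prems, erule insertI2)+
 then obtain b where b: "is_roof X Y W s b" "finprod (dhom X Y) (%i. roof_class X Y (W, s, a i)) F = roof_class X Y (W, s, b)"
  "\<forall>n. \<forall>x\<in>Car W n. b n x = finprod (cgrp Y n) (%i. a i n x) F" by (elim exE conjE) (rule that)
 have ri: "is_roof X Y W s (a i)" using insert.prems by blast
 have rc: "(%i. roof_class X Y (W, s, a i)) : F \<rightarrow> carrier (dhom X Y)" using insert.prems(2) roof_class_closed by blast
 have 1: "finprod (dhom X Y) (%i. roof_class X Y (W, s, a i)) (insert i F) = roof_class X Y (W, s, add_map Y (a i) b)"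
  using H.finprod_insert[OF insert.hyps(1,2) rc roof_class_closed[OF ri]] b(2) derived_add[OF ri b(1)] by simp
 have 2: "add_map Y (a i) b n x = finprod (cgrp Y n) (%i. a i n x) (insert i F)" if x: "x : Car W n" for n x
 proof -
  have "(%i. a i n x) : F \<rightarrow> Car Y n" by (rule funcsetI) (rule cmap_simps(1)[OF insert.prems(1)[OF insertI2] x])
  from Y.finprod_insert[OF insert.hyps(1,2) this] cmap_simps(1)[OF insert.prems(1)[of i] x]
  show ?thesis using b(3)[rule_format, OF x] by (simp add: add_map_def)
 qed
 show ?case using 1 2 is_roof_add[OF ri b(1)] by blast
qed

text \<open>The projections from a direct sum make the canonical map injective for every \<open>M\<close>, so compactness
 only asks that maps into direct sums have finite support.\<close>

lemma compact_object_full_subcategory: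
 assumes P: "P \<subseteq> Sm" and Pd: "!!(I :: 'u set) X Z j q. \<lbrakk>dsum I X Z j q; |I| <o |UNIV :: 'u set|; \<forall>i\<in>I. X i : P; Z : Sm\<rbrakk> \<Longrightarrow> Z : P"
  and M: "M : P"
  and fs: "!!(I :: 'u set) X Z j q R. \<lbrakk>dsum I X Z j q; \<forall>i\<in>I. X i : Sm; Z : Sm; R : carrier (dhom M Z)\<rbrakk> \<Longrightarrow>
   \<exists>F y. finite F \<and> F \<subseteq> I \<and> (\<forall>i\<in>I. y i : carrier (dhom M (X i))) \<and>
    R = finprod (dhom M Z) (%i. dcomp M (X i) Z (dmor (X i) Z (j i)) (y i)) F"
 shows "compact_object U (full_subcategory D_Ab P) M"
 unfolding compact_object_def full_subcategory_simps
proof (intro conjI M allI impI)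
 fix I :: "'u set" and X Z \<iota>
 assume a: "small I \<and> is_coproduct (full_subcategory D_Ab P) I X Z \<iota>"
 then have I: "|I| <o |UNIV :: 'u set|" and c: "is_coproduct (full_subcategory D_Ab P) I X Z \<iota>" by (simp_all add: small_def)
 have ZP: "Z : P" and XP: "i : I ==> X i : P" and \<iota>: "i : I ==> \<iota> i : carrier (dhom (X i) Z)" for i
  using c unfolding is_coproduct_def by simp_all
 have Z: "Z : Sm" and X: "i : I ==> X i : Sm" and MS: "M : Sm" for i using ZP XP M P by blast+
 obtain Z' j q where Z': "Z' : Sm" and d: "dsum I X Z' j q" using dsum_exists[OF I, of X] X by blast
 have Z'P: "Z' : P" using Pd[OF d I] XP Z' by blast
 obtain h k where h: "h : carrier (dhom Z Z')" and k: "k : carrier (dhom Z' Z)"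
  and kh: "dcomp Z Z' Z k h = dmor Z Z id_map"
  and h\<iota>: "\<forall>i\<in>I. dcomp (X i) Z Z' h (\<iota> i) = dmor (X i) Z' (j i)"
  and kj: "\<forall>i\<in>I. dcomp (X i) Z' Z k (dmor (X i) Z' (j i)) = \<iota> i"
  using coproduct_retract[OF P c I d Z'P] by blast
 let ?H = "dhom M Z" and ?A = "%i. dhom M (X i)"
 let ?S = "sum_group I ?A" and ?e = "%i x. \<lambda>k\<in>I. if k = i then x else 1[?A k]"
 have A: "comm_group (?A i)" if "i : I" for i by (rule comm_group_derived_hom[OF MS X[OF that]])
 have g: "gsum I ?A ?S ?e (%i z. z i)" by (rule gsum_sum_group[OF A])
 have HC: "comm_group ?H" by (rule comm_group_derived_hom[OF MS Z])
 interpret H: comm_group ?H by (rule HC)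
 interpret S: comm_group ?S by (rule gsumD(1)[OF g])
 have \<iota>hom: "dcomp M (X i) Z (\<iota> i) : hom (?A i) ?H" if "i : I" for i by (rule derived_comp_hom[OF MS X[OF that] Z \<iota>[OF that]])
 have "\<exists>h. h : hom ?S ?H \<and> (\<forall>i\<in>I. \<forall>x\<in>carrier (?A i). h (?e i x) = dcomp M (X i) Z (\<iota> i) x)"
  by (rule gsum_lift[OF g HC, of "%i. dcomp M (X i) Z (\<iota> i)"]) (rule \<iota>hom)
 then obtain \<Phi> where \<Phi>: "\<Phi> : hom ?S ?H" "\<forall>i\<in>I. \<forall>x\<in>carrier (?A i). \<Phi> (?e i x) = dcomp M (X i) Z (\<iota> i) x"
  by (elim exE conjE) (rule that)
 interpret \<Phi>: group_hom ?S ?H \<Phi> by unfold_locales (rule \<Phi>(1))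
 let ?\<phi> = "%x. finprod ?H (%i. dcomp M (X i) Z (\<iota> i) (x i)) {i : I. x i \<noteq> 1[?A i]}"
 have \<Phi>fin: "\<Phi> (finprod ?S (%i. ?e i (y i)) F) = finprod ?H (%i. dcomp M (X i) Z (\<iota> i) (y i)) F"
  if F: "finite F" "F \<subseteq> I" and y: "!!i. i : F ==> y i : carrier (?A i)" for F y
 proof -
  have ec: "(%i. ?e i (y i)) : F \<rightarrow> carrier ?S" using gsumD(9)[OF g] F(2) y by blast
  have "\<Phi> (finprod ?S (%i. ?e i (y i)) F) = finprod ?H (%i. \<Phi> (?e i (y i))) F"
   by (rule finprod_hom[OF gsumD(1)[OF g] HC \<Phi>(1) F(1) ec])
  also have "\<dots> = finprod ?H (%i. dcomp M (X i) Z (\<iota> i) (y i)) F"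
  proof (rule H.finprod_cong'[OF refl])
   show "(%i. dcomp M (X i) Z (\<iota> i) (y i)) : F \<rightarrow> carrier ?H"
    using derived_comp_closed[OF MS X Z _ \<iota>] F(2) y by blast
   show "\<Phi> (?e i (y i)) = dcomp M (X i) Z (\<iota> i) (y i)" if "i : F" for i using \<Phi>(2) F(2) y that by blast
  qed
  finally show ?thesis .
 qed
 \<comment> \<open>The map in the definition of compactness takes a product over a support that
   varies with x. \<Phi> comes from the universal property of the direct sum of groups, hence is a
   homomorphism from the outset, and agrees with it.\<close>
 have \<phi>\<Phi>: "?\<phi> x = \<Phi> x" if x: "x : carrier ?S" for x
 proof -
  let ?F = "{i : I. x i \<noteq> 1[?A i]}"
  have F: "finite ?F" "?F \<subseteq> I" using gsumD(7)[OF g x] by auto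
  have "finprod ?S (%i. ?e i (x i)) ?F = x" by (rule gsum_decomp[OF g x F]) simp
  moreover have "\<Phi> (finprod ?S (%i. ?e i (x i)) ?F) = ?\<phi> x"
   by (rule \<Phi>fin[OF F]) (use gsumD(10)[OF g _ x] in blast)
  ultimately show ?thesis by simp
 qed
 have ker: "x = 1[?S]" if x: "x : carrier ?S" and e: "\<Phi> x = 1[?H]" for x
 proof (rule gsumD(8)[OF g x])
  fix l assume l: "l : I"
  \<comment> \<open>The projection of the coproduct to its l-th member, taken through the direct sum
    Z'. After \<Phi> it returns the l-th coordinate, and so the kernel of \<Phi> is trivial.\<close>
  let ?\<pi> = "dcomp Z Z' (X l) (dmor Z' (X l) (q l)) h"
  have qc: "dmor Z' (X l) (q l) : carrier (dhom Z' (X l))" by (rule of_chain_map_closed[OF Z' X[OF l] dsumD(3)[OF d l]])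
  have \<pi>c: "?\<pi> : carrier (dhom Z (X l))" by (rule derived_comp_closed[OF Z Z' X[OF l] h qc])
  have \<pi>\<iota>: "dcomp (X i) Z (X l) ?\<pi> (\<iota> i) = dmor (X i) (X l) (q l \<cdot> j i)" if i: "i : I" for i
   using derived_comp_assoc[OF X[OF i] Z Z' X[OF l] \<iota>[OF i] h qc] h\<iota> of_chain_map_comp[OF X[OF i] Z' X[OF l] dsumD(2)[OF d i] dsumD(3)[OF d l]] i by simp
  have h\<pi>: "dcomp M Z (X l) ?\<pi> : hom ?H (?A l)" by (rule derived_comp_hom[OF MS Z X[OF l] \<pi>c])
  interpret Al: comm_group "?A l" by (rule A[OF l])
  interpret \<pi>: group_hom ?H "?A l" "dcomp M Z (X l) ?\<pi>" by unfold_locales (rule h\<pi>)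
  have "(dcomp M Z (X l) ?\<pi> \<circ> \<Phi>) x = (%z. z l) x"
  proof (rule gsum_hom_ext[OF g A[OF l] _ gsumD(4)[OF g l] _ x])
   show "dcomp M Z (X l) ?\<pi> \<circ> \<Phi> : hom ?S (?A l)" by (rule hom_compose[OF \<Phi>(1) h\<pi>])
   fix i y assume i: "i : I" and y: "y : carrier (?A i)"
   have cij: "cmap (X i) (X l) (q l \<cdot> j i)" by (rule cmap_comp[OF dsumD(2)[OF d i] dsumD(3)[OF d l]])
   have "(dcomp M Z (X l) ?\<pi> \<circ> \<Phi>) (?e i y) = dcomp M (X i) (X l) (dmor (X i) (X l) (q l \<cdot> j i)) y"
    using \<Phi>(2) i y derived_comp_assoc[OF MS X[OF i] Z X[OF l] y \<iota>[OF i] \<pi>c] \<pi>\<iota>[OF i] by simp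
   also have "\<dots> = ?e i y l"
   proof (cases "i = l")
    case True
    have "dmor (X i) (X l) (q l \<cdot> j i) = dmor (X l) (X l) id_map"
     using of_chain_map_cong[OF X[OF l] X[OF l] htp_of_eq[OF cij[unfolded True] cmap_id[OF dsumD(5)[OF d l]]]]
      gsumD(5)[OF dsumD(4)[OF d] l] unfolding True by simp
    then show ?thesis using True l derived_comp_id_left[OF MS X[OF l], of y] y by simp
   next
    case False
    have "dmor (X i) (X l) (q l \<cdot> j i) = dmor (X i) (X l) (zero_map (X l))"
     using of_chain_map_cong[OF X[OF i] X[OF l] htp_of_eq[OF cij cmap_zero[OF dsumD(5)[OF d i] dsumD(5)[OF d l]]]]
      gsumD(6)[OF dsumD(4)[OF d] i _ l] False by (simp add: zero_map_def)
    also have "\<dots> = 1[dhom (X i) (X l)]" by (simp add: derived_hom_def)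
    finally show ?thesis using False l zero_comp_left[OF MS X[OF i] X[OF l] y] by simp
   qed
   finally show "(dcomp M Z (X l) ?\<pi> \<circ> \<Phi>) (?e i y) = (%z. z l) (?e i y)" .
  qed
  then show "x l = 1[?A l]" using e by simp
 qed
 have surj: "\<exists>x\<in>carrier ?S. \<Phi> x = R" if R: "R : carrier ?H" for R
 proof -
  \<comment> \<open>Finite support is assumed for maps into concrete direct sums, so R is pushed to
    Z' by h and brought back by the left inverse k.\<close>
  have hR: "dcomp M Z Z' h R : carrier (dhom M Z')" by (rule derived_comp_closed[OF MS Z Z' R h])
  obtain F y where F: "finite F" "F \<subseteq> I" and y: "\<forall>i\<in>I. y i : carrier (?A i)"
   and e: "dcomp M Z Z' h R = finprod (dhom M Z') (%i. dcomp M (X i) Z' (dmor (X i) Z' (j i)) (y i)) F"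
   using fs[OF d _ Z' hR] X by blast
  have yF: "y i : carrier (?A i)" if "i : F" for i using y F(2) that by blast
  have jc: "dmor (X i) Z' (j i) : carrier (dhom (X i) Z')" if "i : I" for i
   by (rule of_chain_map_closed[OF X[OF that] Z' dsumD(2)[OF d that]])
  have jy: "(%i. dcomp M (X i) Z' (dmor (X i) Z' (j i)) (y i)) : F \<rightarrow> carrier (dhom M Z')"
   using derived_comp_closed[OF MS X Z' _ jc] y F(2) by blast
  have "R = dcomp M Z' Z k (dcomp M Z Z' h R)"
   using derived_comp_assoc[OF MS Z Z' Z R h k] kh derived_comp_id_left[OF MS Z R] by simp
  also have "\<dots> = finprod ?H (%i. dcomp M Z' Z k (dcomp M (X i) Z' (dmor (X i) Z' (j i)) (y i))) F"
   unfolding e by (rule finprod_hom[OF comm_group_derived_hom[OF MS Z'] HC derived_comp_hom[OF MS Z' Z k] F(1) jy])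
  also have "\<dots> = finprod ?H (%i. dcomp M (X i) Z (\<iota> i) (y i)) F"
  proof (rule H.finprod_cong'[OF refl])
   show "(%i. dcomp M (X i) Z (\<iota> i) (y i)) : F \<rightarrow> carrier ?H"
    using derived_comp_closed[OF MS X Z _ \<iota>] F(2) y by blast
   fix i assume "i : F"
   then have i: "i : I" using F(2) by blast
   show "dcomp M Z' Z k (dcomp M (X i) Z' (dmor (X i) Z' (j i)) (y i)) = dcomp M (X i) Z (\<iota> i) (y i)"
    using derived_comp_assoc[OF MS X[OF i] Z' Z y[rule_format, OF i] jc[OF i] k] kj i by simp
  qed
  also have "\<dots> = \<Phi> (finprod ?S (%i. ?e i (y i)) F)" by (rule \<Phi>fin[OF F yF, symmetric])
  finally have "\<Phi> (finprod ?S (%i. ?e i (y i)) F) = R" by simp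
  moreover have "finprod ?S (%i. ?e i (y i)) F : carrier ?S"
   by (rule S.finprod_closed) (use gsumD(9)[OF g] F(2) yF in blast)
  ultimately show ?thesis by blast
 qed
 have "\<Phi> : iso ?S ?H"
  unfolding iso_def bij_betw_def using \<Phi>(1) ker surj \<Phi>.hom_closed by (auto simp: \<Phi>.inj_on_one_iff image_iff)
 then have b\<Phi>: "bij_betw \<Phi> (carrier ?S) (carrier ?H)" by (simp add: iso_def)
 have "bij_betw ?\<phi> (carrier ?S) (carrier ?H) = bij_betw \<Phi> (carrier ?S) (carrier ?H)" by (rule bij_betw_cong) (rule \<phi>\<Phi>)
 then have b: "bij_betw ?\<phi> (carrier ?S) (carrier ?H)" using b\<Phi> by (simp only:)
 have h: "?\<phi> : hom ?S ?H"
 proof (rule homI)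
  fix x y assume x: "x : carrier ?S" and y: "y : carrier ?S"
  show "?\<phi> x : carrier ?H" using \<Phi>.hom_closed[OF x] \<phi>\<Phi>[OF x] by (simp only:)
  show "?\<phi> (x *[?S] y) = ?\<phi> x *[?H] ?\<phi> y"
   by (rule trans[OF \<phi>\<Phi>[OF S.m_closed[OF x y]] trans[OF \<Phi>.hom_mult[OF x y]
    arg_cong2[where f = "monoid.mult ?H", OF \<phi>\<Phi>[OF x, symmetric] \<phi>\<Phi>[OF y, symmetric]]]])
 qed
 show "?\<phi> : iso ?S ?H" unfolding iso_def by (intro CollectI conjI h b)
qed

end

section \<open>The category generated by G\<close>

context prime_generator
begin

definition Tor :: "'u cochain_complex set" where "Tor = {X : Sm. \<forall>n. tors X n (range (%k. p ^ k))}"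

abbreviation TorC where "TorC \<equiv> full_subcategory D_Ab Tor"

lemma Tor_Sm: "Tor \<subseteq> Sm" by (auto simp: Tor_def)

lemma powers_mult: "1 : range (%k. p ^ k)" "\<lbrakk>a : range (%k. p ^ k); b : range (%k. p ^ k)\<rbrakk> \<Longrightarrow> a * b : range (%k. p ^ k)"
proof -
 show "1 : range (%k. p ^ k)" by (rule range_eqI[of _ _ 0]) simp
 show "a * b : range (%k. p ^ k)" if "a : range (%k. p ^ k)" "b : range (%k. p ^ k)" using that by (auto simp: power_add[symmetric])
qed

lemma closedQ_Tor: "closedQ Tor"
 unfolding Tor_def by (rule closedQ_tors) (use powers_mult in auto)

lemma Tor_dsum:
 assumes d: "dsum I X Z j q" and I: "|I| <o |UNIV :: 'u set|" and X: "\<forall>i\<in>I. X i : Tor" and Z: "Z : Sm" shows "Z : Tor"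
 by (rule closedQ_dsum[OF closedQ_Tor d I _ Z]) (use X in blast)

lemma Tor_shift: "X : Tor ==> Shf k X : Tor"
 unfolding Tor_def using shift_Sm tors_shift[OF small_complex(1)] by blast

lemma Tor_iso: "\<lbrakk>X : Tor; Y : Sm; isoD X Y\<rbrakk> \<Longrightarrow> Y : Tor"
 by (rule closedQ_iso[OF closedQ_Tor])

lemma G_Tor: "G : Tor"
proof -
 have "tors G n (range (%k. p ^ k))" for n
  unfolding tors_def
 proof
  fix x assume x: "x : Cy G n"
  have 1: "1[cgrp G n] : Bd G n" by (rule subgroup.one_closed[OF coboundaries_subgroup[OF cG]])
  have xc: "x : Car G n" using x unfolding cocycles_iff by blast
  have "x ^[cgrp G n] (p ^ 1) = 1[cgrp G n]"
  proof (cases "n = 0")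
   case True then show ?thesis using G_pow_p[of x] xc by simp
  next
   case False then show ?thesis using G_trivial[OF False] xc cx_simps(19)[OF cG, of n p] by simp
  qed
  with 1 show "\<exists>k\<in>range (%k. p ^ k). x ^[cgrp G n] k : Bd G n" by (metis rangeI)
 qed
 then show ?thesis using G by (simp add: Tor_def)
qed

text \<open>One inclusion holds because \<open>Tor\<close> is closed and contains the shifts of G;
  the other is \<open>closedQ_torsion\<close>, whose requirement on degrees is met since all shifts
  of G are at hand.\<close>

lemma generated_subcategory_G: "generated_subcategory U D_Ab {G} = TorC"
proof -
 have "closure_cl U D_Ab (\<Union>i. shift_class D_Ab {G} i) = Tor"
 proof (intro equalityI subsetI)
  fix X assume X: "X : closure_cl U D_Ab (\<Union>i. shift_class D_Ab {G} i)"
  have "(\<Union>i. shift_class D_Ab {G} i) \<subseteq> Tor" using Tor_iso[OF Tor_shift[OF G_Tor]] by (auto simp: shift_class_def)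
  with X closedQ_Tor show "X : Tor" unfolding closure_cl_def closedQ_def by auto
 next
  fix X assume X: "X : Tor"
  show "X : closure_cl U D_Ab (\<Union>i. shift_class D_Ab {G} i)"
   unfolding closure_cl_def
  proof (rule InterI, clarify)
   fix Q assume Q: "Q \<subseteq> Obj D_Ab" "(\<Union>i. shift_class D_Ab {G} i) \<subseteq> Q" "extension_closed D_Ab Q" "coproduct_closed U D_Ab Q"
   then have cQ: "closedQ Q" by (simp add: closedQ_def)
   have "Gs l : shift_class D_Ab {G} (- l)" for l using Gs_Sm isoD_refl by (simp add: shift_class_def)
   then have GQ: "Gs l : Q" for l using Q(2) by blast
   have "X : Sm" "!!n. tors X n (range (%k. p ^ k))" using X by (simp_all add: Tor_def)
   then show "X : Q" by (rule closedQ_torsion[OF cQ]) (intro conjI GQ)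
  qed
 qed
 then show ?thesis by (simp add: generated_subcategory_def)
qed

text \<open>Closures inside \<open>TorC\<close> refer to its own triangles and coproducts. As
  \<open>Tor\<close> is closed, a triangle or coproduct of the derived category built from Q has all
  its objects in \<open>Tor\<close>, hence belongs to \<open>TorC\<close>, and the criteria for
  \<open>closedQ\<close> become available.\<close>

lemma closedQ_of_TorC:
 assumes Q: "Q \<subseteq> Tor" "extension_closed TorC Q" "coproduct_closed U TorC Q" shows "closedQ Q"
 unfolding closedQ_def
proof (intro conjI)
 show "Q \<subseteq> Sm" using Q(1) Tor_Sm by blast
 have TE: "extension_closed D_Ab Tor" "coproduct_closed U D_Ab Tor" using closedQ_Tor unfolding closedQ_def by blast+
 show "extension_closed D_Ab Q" unfolding extension_closed_def
 proof (intro conjI allI impI)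
  fix X :: "'u cochain_complex" assume z: "zero_object D_Ab X"
  then have "X : Tor" using TE(1) unfolding extension_closed_def by blast
  then have "zero_object TorC X" using z Tor_Sm unfolding zero_object_def zero_hom_full_subcategory by auto
  then show "X : Q" using Q(2) unfolding extension_closed_def by blast
 next
  fix X Z Y f g h assume a: "(X, Z, Y, f, g, h) : Dist D_Ab \<and> X : Q \<and> Y : Q"
  then have "Z : Tor" using closedQ_dist[OF closedQ_Tor, of X Z Y f g h] Q(1) by auto
  then have "(X, Z, Y, f, g, h) : Dist TorC" using a Q(1) by auto
  then show "Z : Q" using Q(2) a unfolding extension_closed_def by blast
 qed
 show "coproduct_closed U D_Ab Q" unfolding coproduct_closed_def
 proof (intro allI impI)
  fix I :: "'u set" and X Z \<iota> assume a: "small I \<and> is_coproduct D_Ab I X Z \<iota> \<and> (\<forall>i\<in>I. X i : Q)"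
  then have "Z : Tor" using TE(2) Q(1) unfolding coproduct_closed_def by blast
  then have "is_coproduct TorC I X Z \<iota>" using a Q(1) is_coproduct_subcategory[OF _ Tor_Sm, of I X Z \<iota>] by blast
  then show "Z : Q" using a Q(3) unfolding coproduct_closed_def by blast
 qed
qed

lemma Gs_0: "Gs 0 = G" by simp

text \<open>A morphism out of G is given by a chain map on the two-term resolution, hence by two
  elements of the direct sum. F collects the finitely many indices at which one of them has a
  nontrivial component.\<close>

lemma compact_G: "compact_object U TorC G"
proof (rule compact_object_full_subcategory[OF Tor_Sm Tor_dsum G_Tor])
 fix I :: "'u set" and X Z j q R
 assume d: "dsum I X Z j q" and X: "\<forall>i\<in>I. X i : Sm" and Z: "Z : Sm" and R: "R : carrier (dhom G Z)"
 obtain g where g: "g : Car G 0" "g \<noteq> 1[cgrp G 0]" using G_nontrivial by blast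
 obtain P \<phi> where P: "P : Sm" "cmap (Pcx p 0) P \<phi>" "!!n. bij_betw (\<phi> n) (Car (Pcx p 0) n) (Car P n)"
  using Pcx_transport[of 0] by blast
 define i where "i = (%n. inv_into (Car (Pcx p 0) n) (\<phi> n))"
 define s where "s = pmap (Gs 0) 0 g 1[cgrp G (- 1)] \<cdot> i"
 obtain f where f: "cmap (Pcx p 0) Z f" "is_roof G Z P s (f \<cdot> i)" "R = roof_class G Z (P, s, f \<cdot> i)"
  using hom_from_Gs[of g P 0 \<phi> Z R, OF g P Z] R unfolding s_def i_def Gs_0 by blast
 have im: "cmap P (Pcx p 0) i" unfolding i_def by (rule cmap_inverse[OF P(2,3)])
 have sq: "qis P G s" by (rule is_roofD(2)[OF f(2)])
 note c = cmap_Pcx_data[OF f(1)]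
 have f0: "f 0 1 : Car Z 0" "f (- 1) 1 : Car Z (- 1)" using c(1,2) unfolding cocycles_iff by simp_all
 define F where "F = {l\<in>I. q l 0 (f 0 1) \<noteq> 1[cgrp (X l) 0]} \<union> {l\<in>I. q l (- 1) (f (- 1) 1) \<noteq> 1[cgrp (X l) (- 1)]}"
 have F: "finite F" "F \<subseteq> I" unfolding F_def using gsumD(7)[OF dsumD(4)[OF d] f0(1)] gsumD(7)[OF dsumD(4)[OF d] f0(2)] by auto
 have out: "q l n (f n k) = 1[cgrp (X l) n]" if l: "l : I" "l \<notin> F" and k: "k : Car (Pcx p 0) n" for l n k
 proof -
  have "(q l \<cdot> f) n k = pmap (X l) 0 ((q l \<cdot> f) 0 1) ((q l \<cdot> f) (0 - 1) 1) n k"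
   by (rule cmap_Pcx_eq_pmap[OF cmap_comp[OF f(1) dsumD(3)[OF d l(1)]] k])
  moreover have "(q l \<cdot> f) 0 1 = 1[cgrp (X l) 0]" "(q l \<cdot> f) (0 - 1) 1 = 1[cgrp (X l) (- 1)]" using l unfolding F_def by auto
  ultimately show ?thesis by (simp add: pmap_def cx_simps(20)[OF dsumD(5)[OF d l(1)]])
 qed
 define y where "y l = roof_class G (X l) (P, s, q l \<cdot> f \<cdot> i)" for l
 have ry: "is_roof G (X l) P s (q l \<cdot> f \<cdot> i)" if l: "l : I" for l
  unfolding is_roof_def using P(1) sq G X l cmap_comp[OF cmap_comp[OF im f(1)] dsumD(3)[OF d l]] by simp
 have yc: "y l : carrier (dhom G (X l))" if "l : I" for l unfolding y_def by (rule roof_class_closed[OF ry[OF that]])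
 define a where "a l = j l \<cdot> q l \<cdot> f \<cdot> i" for l
 have am: "cmap P Z (a l)" if "l : I" for l
  unfolding a_def using cmap_comp[OF cmap_comp[OF cmap_comp[OF im f(1)] dsumD(3)[OF d that]] dsumD(2)[OF d that]] by simp
 have ar: "is_roof G Z P s (a l)" if "l : I" for l
  unfolding is_roof_def using P(1) sq G Z am[OF that] by simp
 have jy: "dcomp G (X l) Z (dmor (X l) Z (j l)) (y l) = roof_class G Z (P, s, a l)" if "l : I" for l
  unfolding y_def a_def by (rule comp_of_chain_map[OF ry[OF that] Z dsumD(2)[OF d that]])
 obtain b where b: "is_roof G Z P s b" "finprod (dhom G Z) (%i. roof_class G Z (P, s, a i)) F = roof_class G Z (P, s, b)"
  "!!n x. x : Car P n ==> b n x = finprod (cgrp Z n) (%i. a i n x) F"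
  using finprod_roof_class[OF F(1) G Z P(1) sq, of a] am ar F(2) by blast
 have "b n x = (f \<cdot> i) n x" if x: "x : Car P n" for n x
 proof -
  have ix: "i n x : Car (Pcx p 0) n" by (rule cmap_simps(1)[OF im x])
  have "finprod (cgrp Z n) (%l. j l n (q l n (f n (i n x)))) F = f n (i n x)"
   by (rule gsum_decomp[OF dsumD(4)[OF d] cmap_simps(1)[OF f(1) ix] F]) (use out[OF _ _ ix] in blast)
  then show ?thesis unfolding b(3)[OF x] a_def by simp
 qed
 then have "htp P Z b (f \<cdot> i)" by (intro htp_of_eq is_roofD(3)[OF b(1)] is_roofD(3)[OF f(2)])
 then have "roof_class G Z (P, s, b) = R" unfolding f(3) by (rule roof_class_htp(2)[OF b(1) htp_refl[OF qis_cmap[OF sq]]])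
 moreover have "finprod (dhom G Z) (%i. roof_class G Z (P, s, a i)) F =
   finprod (dhom G Z) (%l. dcomp G (X l) Z (dmor (X l) Z (j l)) (y l)) F"
 proof -
  interpret H: comm_group "dhom G Z" by (rule comm_group_derived_hom[OF G Z])
  show ?thesis
  proof (rule H.finprod_cong'[OF refl])
   show "(%l. dcomp G (X l) Z (dmor (X l) Z (j l)) (y l)) : F \<rightarrow> carrier (dhom G Z)"
    using roof_class_closed[OF ar] jy F(2) by auto
   show "roof_class G Z (P, s, a i) = dcomp G (X i) Z (dmor (X i) Z (j i)) (y i)" if "i : F" for i
    using jy[of i] F(2) that by auto
  qed
 qed
 ultimately show "\<exists>F y. finite F \<and> F \<subseteq> I \<and> (\<forall>i\<in>I. y i : carrier (dhom G (X i))) \<and>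
    R = finprod (dhom G Z) (%i. dcomp G (X i) Z (dmor (X i) Z (j i)) (y i)) F"
  using F yc b(2) by (intro exI[of _ F] exI[of _ y]) simp
qed

lemma compactly_generates_G: "compactly_generates U TorC {G}"
 unfolding compactly_generates_def
proof (intro conjI ballI)
 show "compact_object U TorC M" if "M : {G}" for M using compact_G that by simp
 show "closure_cl U TorC (\<Union>i. shift_class TorC {G} i) = Obj TorC"
 proof (intro equalityI subsetI)
  fix X assume X: "X : closure_cl U TorC (\<Union>i. shift_class TorC {G} i)"
  have "extension_closed TorC Tor" "coproduct_closed U TorC Tor"
   unfolding extension_closed_def coproduct_closed_def zero_object_def is_coproduct_def by auto
  with X show "X : Obj TorC" unfolding closure_cl_def shift_class_def by auto
 next
  fix X assume X: "X : Obj TorC"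
  show "X : closure_cl U TorC (\<Union>i. shift_class TorC {G} i)"
   unfolding closure_cl_def
  proof (rule InterI, clarify)
   fix Q assume Q: "Q \<subseteq> Obj TorC" "(\<Union>i. shift_class TorC {G} i) \<subseteq> Q" "extension_closed TorC Q" "coproduct_closed U TorC Q"
   then have cQ: "closedQ Q" by (intro closedQ_of_TorC) simp_all
   have "Gs l : shift_class TorC {G} (- l)" for l
    using Gs_Sm isoD_refl Tor_shift[OF G_Tor] by (simp add: shift_class_def isomorphic_full_subcategory)
   then have GQ: "Gs l : Q" for l using Q(2) by blast
   have "X : Sm" "!!n. tors X n (range (%k. p ^ k))" using X by (simp_all add: Tor_def)
   then show "X : Q" by (rule closedQ_torsion[OF cQ]) (intro conjI GQ)
  qed
 qed
qed

text \<open>The resolution of G sees only the degrees 0 and -1, whereas G[i] lives in degree -i,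
  which is below -1 for i > 1.\<close>

lemma weakly_negative_G: "weakly_negative TorC {G}"
proof -
 have "zero_hom D_Ab G (Shf i G)" if i: "i > 1" for i
 proof -
  have "acyclic_at (Shf i G) 0" "acyclic_at (Shf i G) (0 - 1)"
   using Gs_acyclic[of i 0] Gs_acyclic[of "i - 1" 0] i unfolding tors_shift[OF cG] Gs_0 by (simp_all add: add.commute)
  from zero_hom_Gs[OF shift_Sm[OF G] this] show ?thesis unfolding Gs_0 .
 qed
 then show ?thesis unfolding weakly_negative_def zero_hom_full_subcategory by simp
qed

end

section \<open>Truncations, the standard t-structure and weak approximability\<close>

lemma tors_cone:
 assumes f: "cmap X Y f" and tX: "tors X (n + 1) S" and tY: "tors Y n S'"
 shows "tors (cone X Y f) n {k * l | k l. k : S \<and> l : S'}"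
 unfolding tors_def
proof
 have cX: "is_complex X" and cY: "is_complex Y" by (rule cmapD[OF f])+
 let ?C = "cone X Y f"
 have cC: "is_complex ?C" by (rule is_complex_cone[OF f])
 interpret C: comm_group "cgrp ?C i" for i by (rule comm_group_cgrp[OF cC])
 interpret X: comm_group "cgrp X i" for i by (rule comm_group_cgrp[OF cX])
 interpret Y: comm_group "cgrp Y i" for i by (rule comm_group_cgrp[OF cY])
 interpret B: subgroup "Bd ?C n" "cgrp ?C n" by (rule coboundaries_subgroup[OF cC])
 fix z assume z: "z : Cy ?C n"
 obtain x y where xy: "z = (x, y)" "x : Car X (n + 1)" "y : Car Y n" "inv[cgrp X (n + 2)] (cdiff X (n + 1) x) = 1[cgrp X (n + 2)]"
  using z unfolding cocycles_iff by (cases z) (auto simp: one_DirProd add.assoc)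
 have "cdiff X (n + 1) x = 1[cgrp X (n + 1 + 1)]"
  using xy(4) cx_simps(1)[OF cX xy(2), of "n + 2"] by (simp add: add.assoc)
 then have "x : Cy X (n + 1)" using xy(2) unfolding cocycles_iff by simp
 then obtain k w where k: "k : S" "w : Car X n" "x ^[cgrp X (n + 1)] k = cdiff X n w"
  using tX unfolding tors_def coboundaries_iff by fastforce
 have pw: "(a, b) ^[cgrp ?C n] (m::nat) = (a ^[cgrp X (n + 1)] m, b ^[cgrp Y n] m)" for a b m
  by (induction m) (simp_all add: one_DirProd)
 \<comment> \<open>Since \<open>w\<close> bounds the k-th power of x, this coboundary cancels the
   first component of the k-th power of z. What remains is a cocycle of Y, and l takes care of
   it.\<close>
 let ?b = "cdiff ?C (n - 1) (w, 1[cgrp Y (n - 1)])"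
 have wc: "(w, 1[cgrp Y (n - 1)]) : Car ?C (n - 1)" using k(2) by simp
 have b: "?b : Bd ?C n" unfolding coboundaries_iff using wc by blast
 have fw: "f n w : Car Y n" by (rule cmap_simps(1)[OF f k(2)])
 have dw: "cdiff X n w : Car X (n + 1)" by (rule cx_simps(1)[OF cX k(2)]) simp
 have be: "?b = (inv[cgrp X (n + 1)] (cdiff X n w), f n w)"
  using fw cx_simps(3)[OF cY, of "n - 1"] by (simp add: add.commute)
 let ?y = "y ^[cgrp Y n] k *[cgrp Y n] f n w"
 have yk: "?y : Car Y n" using xy(3) fw by simp
 have e1: "z ^[cgrp ?C n] k *[cgrp ?C n] ?b = (1[cgrp X (n + 1)], ?y)"
  unfolding xy(1) pw be k(3) using dw by simp
 have "z ^[cgrp ?C n] k *[cgrp ?C n] ?b : Cy ?C n"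
  by (rule subgroup.m_closed[OF cocycles_subgroup[OF cC] cocycles_pow[OF cC z] subsetD[OF coboundaries_subset_cocycles[OF cC] b]])
 then have "?y : Cy Y n"
  unfolding e1 using yk cx_simps(1)[OF cY yk, of "n + 1"] cmap_simps(3)[OF f, of "n + 1"] unfolding cocycles_iff by (simp add: one_DirProd)
 then obtain l v where l: "l : S'" "v : Car Y (n - 1)" "?y ^[cgrp Y n] l = cdiff Y (n - 1) v"
  using tY unfolding tors_def coboundaries_iff by fastforce
 have zc: "z : Car ?C n" using z unfolding cocycles_iff by blast
 have bc: "?b : Car ?C n" using b B.subset by blast
 have "(z ^[cgrp ?C n] k *[cgrp ?C n] ?b) ^[cgrp ?C n] l = cdiff ?C (n - 1) (1[cgrp X n], v)"
  unfolding e1 pw l(3) using l(2) cx_simps(1)[OF cY l(2), of n] cx_simps(3)[OF cX, of n] cx_simps(11)[OF cX, of "n + 1"] cmap_simps(3)[OF f, of n] by (simp add: add.commute)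
 moreover have "(1[cgrp X n], v) : Car ?C (n - 1)" using l(2) by simp
 ultimately have c: "(z ^[cgrp ?C n] k *[cgrp ?C n] ?b) ^[cgrp ?C n] l : Bd ?C n" unfolding coboundaries_iff by blast
 have zk: "z ^[cgrp ?C n] k : Car ?C n" by (rule C.nat_pow_closed[OF zc])
 have zkl: "z ^[cgrp ?C n] (k * l) = (z ^[cgrp ?C n] k) ^[cgrp ?C n] l" by (rule C.nat_pow_pow[OF zc, symmetric])
 have zklc: "z ^[cgrp ?C n] (k * l) : Car ?C n" by (rule C.nat_pow_closed[OF zc])
 have bl: "?b ^[cgrp ?C n] l : Bd ?C n" by (rule coboundaries_pow[OF cC b])
 have "z ^[cgrp ?C n] (k * l) *[cgrp ?C n] ?b ^[cgrp ?C n] l : Bd ?C n"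
  using c unfolding C.pow_mult_distrib_nat[OF zk bc] zkl .
 from B.m_closed[OF this B.m_inv_closed[OF bl]]
 have "z ^[cgrp ?C n] (k * l) : Bd ?C n"
  unfolding C.m_assoc[OF zklc subsetD[OF B.subset bl] C.inv_closed[OF subsetD[OF B.subset bl]]] C.r_inv[OF subsetD[OF B.subset bl]] C.r_one[OF zklc] .
 then show "\<exists>k\<in>{k * l |k l. k : S \<and> l : S'}. z ^[cgrp ?C n] k : Bd ?C n" using k(1) l(1) by blast
qed

text \<open>A cocycle (l, y) of the cone with y in L is the coboundary of (y, 1); the hypothesis
  \<open>h\<close> provides exactly this membership.\<close>

lemma cone_inclusion_acyclic:
 assumes i: "cmap L X id_map"
  and h: "!!l y. \<lbrakk>l : Car L (n + 1); y : Car X n; l *[cgrp X (n + 1)] cdiff X n y = 1[cgrp X (n + 1)]\<rbrakk> \<Longrightarrow> y : Car L n"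
 shows "acyclic_at (cone L X id_map) n"
 unfolding acyclic_at_iff[OF is_complex_cone[OF i]]
proof
 have cL: "is_complex L" and cX: "is_complex X" by (rule cmapD[OF i])+
 interpret L: comm_group "cgrp L i" for i by (rule comm_group_cgrp[OF cL])
 fix z assume "z : Cy (cone L X id_map) n"
 then obtain l y where ly: "z = (l, y)" "l : Car L (n + 1)" "y : Car X n" "l *[cgrp X (n + 1)] cdiff X n y = 1[cgrp X (n + 1)]"
  unfolding cocycles_iff by (cases z) (auto simp: one_DirProd)
 have yL: "y : Car L n" by (rule h[OF ly(2-4)])
 have dy: "cdiff L n y = cdiff X n y" using cmap_simps(5)[OF i yL, of "n + 1"] by simp
 have dyL: "cdiff L n y : Car L (n + 1)" by (rule cx_simps(1)[OF cL yL]) simp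
 have "l *[cgrp L (n + 1)] cdiff L n y = 1[cgrp L (n + 1)]"
  using cmap_simps(2)[OF i ly(2) dyL] cmap_simps(3)[OF i, of "n + 1"] ly(4) dy by simp
 then have "inv[cgrp L (n + 1)] (cdiff L n y) = l" by (rule L.inv_equality[OF _ dyL ly(2)])
 then have "z = cdiff (cone L X id_map) (n - 1) (y, 1[cgrp X (n - 1)])"
  using ly cx_simps(3)[OF cX, of "n - 1"] cx_simps(10)[OF cX ly(3)] by (simp add: add.commute)
 moreover have "(y, 1[cgrp X (n - 1)]) : Car (cone L X id_map) (n - 1)" using yL cx_simps(7)[OF cX] by simp
 ultimately show "z : Bd (cone L X id_map) n" unfolding coboundaries_iff by blast
qed

text \<open>The canonical truncation: taking cocycles in degree \<open>m\<close> preserves the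
  cohomology in all degrees up to \<open>m\<close>.\<close>

definition trle :: "'a cochain_complex => int => 'a cochain_complex" where
 "trle X m = subcx X (%n. if n < m then Car X n else if n = m then Cy X m else {1[cgrp X n]})"

lemma trle_simps [simp]: "Car (trle X m) n = (if n < m then Car X n else if n = m then Cy X m else {1[cgrp X n]})"
 "1[cgrp (trle X m) n] = 1[cgrp X n]" "cdiff (trle X m) = cdiff X" "x *[cgrp (trle X m) n] y = x *[cgrp X n] y"
 "x ^[cgrp (trle X m) n] (k::nat) = x ^[cgrp X n] k"
 by (simp_all add: trle_def restrict_nat_pow)

lemma trle_complex:
 assumes X: "is_complex X" shows "is_complex (trle X m)" "cmap (trle X m) X id_map"
proof -
 interpret X: comm_group "cgrp X i" for i by (rule comm_group_cgrp[OF X])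
 let ?S = "%n. if n < m then Car X n else if n = m then Cy X m else {1[cgrp X n]}"
 have s: "subgroup (?S n) (cgrp X n)" for n
  using cocycles_subgroup[OF X, of m] X.subgroup_self[of n] X.triv_subgroup[of n] by simp
 have d: "cdiff X n x : ?S (n + 1)" if x: "x : ?S n" for n x
 proof -
  have 1: "cdiff X n x : Cy X (n + 1)" if "x : Car X n"
   unfolding cocycles_iff using that cx_simps(1,5)[OF X that, of "n + 1"] by simp
  consider "n + 1 < m" | "n + 1 = m" | "n = m" | "n > m" by linarith
  then show ?thesis using x 1 cx_simps(3)[OF X, of n] by cases (auto simp: cocycles_iff)
 qed
 show "is_complex (trle X m)" "cmap (trle X m) X id_map" unfolding trle_def by (rule is_complex_subcx[OF X s d], assumption)+
qed

lemma trle_cohomology: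
 assumes X: "is_complex X" and n: "n \<le> m"
 shows "Cy (trle X m) n = Cy X n" "Bd (trle X m) n = Bd X n"
proof -
 show "Cy (trle X m) n = Cy X n" using n by (intro equalityI subsetI) (auto simp: cocycles_iff split: if_splits)
 show "Bd (trle X m) n = Bd X n" using n by (intro equalityI subsetI) (auto simp: coboundaries_iff)
qed

lemma tors_trle:
 assumes X: "is_complex X" and n: "n \<le> m" shows "tors (trle X m) n S \<longleftrightarrow> tors X n S"
 unfolding tors_def trle_cohomology[OF X n] by simp

lemma acyclic_at_trivial:
 assumes X: "is_complex X" and t: "Car X n \<subseteq> {1[cgrp X n]}" shows "acyclic_at X n"
 unfolding acyclic_at_iff[OF X]
proof
 fix x assume "x : Cy X n"
 then have "x = 1[cgrp X n]" using t unfolding cocycles_iff by blast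
 then show "x : Bd X n" using subgroup.one_closed[OF coboundaries_subgroup[OF X]] by simp
qed

lemma acyclic_trle: "is_complex X ==> n > m ==> acyclic_at (trle X m) n"
 by (rule acyclic_at_trivial[OF trle_complex(1)]) auto

lemma qis_trle:
 assumes X: "is_complex X" and a: "!!n. n > m ==> acyclic_at X n"
 shows "qis (trle X m) X id_map"
 unfolding qis_iff_cohom
proof (intro conjI allI ballI impI trle_complex(2)[OF X])
 fix n x assume x: "x : Cy (trle X m) n" "id_map n x : Bd X n"
 show "x : Bd (trle X m) n"
 proof (cases "n \<le> m")
  case True then show ?thesis using x(2) trle_cohomology(2)[OF X True] by simp
 next
  case False
  then have "acyclic_at (trle X m) n" using acyclic_trle[OF X] by simp
  then show ?thesis using x(1) unfolding acyclic_at_iff[OF trle_complex(1)[OF X]] by blast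
 qed
next
 fix n y assume y: "y : Cy X n"
 have yc: "y : Car X n" using y unfolding cocycles_iff by blast
 show "\<exists>x\<in>Cy (trle X m) n. cohom X n y (id_map n x)"
 proof (cases "n \<le> m")
  case True then show ?thesis using y trle_cohomology(1)[OF X True] cohom_refl[OF X yc] by (intro bexI[of _ y]) simp_all
 next
  case False
  then have "y : Bd X n" using a[of n] y unfolding acyclic_at_iff[OF X] by auto
  then have "cohom X n y 1[cgrp X n]" unfolding cohom_one_iff[OF X] .
  moreover have "1[cgrp X n] : Cy (trle X m) n"
   using subgroup.one_closed[OF cocycles_subgroup[OF trle_complex(1)[OF X, of m], of n]] by simp
  ultimately show ?thesis by (intro bexI[of _ "1[cgrp X n]"]) simp_all
 qed
qed

context universe
begin

lemma subcomplex_Sm: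
 assumes X: "X : Sm" and i: "cmap L X id_map" shows "L : Sm"
proof -
 have "Car L n \<subseteq> Car X n" for n using cmap_simps(1)[OF i, of _ n] by auto
 then have "|Car L n| <o |UNIV :: 'u set|" for n by (rule sm_subset[OF small_complex(2)[OF X]])
 then show ?thesis unfolding small_complexes_def small_def using cmapD(1)[OF i] by blast
qed

text \<open>The denominator of a roof has the cohomology of X, so it may be replaced by its
  truncation at m. The numerator then lands in the truncation of Y, which is acyclic, and
  \<open>factor_acyclic\<close> applies.\<close>

lemma zero_hom_separated:
 assumes X: "X : Sm" and Y: "Y : Sm" and aX: "!!n. n > m ==> acyclic_at X n" and aY: "!!n. n \<le> m ==> acyclic_at Y n"
 shows "zero_hom D_Ab X Y"
proof -
 have cY: "is_complex Y" by (rule small_complex(1)[OF Y])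
 have z: "R = 1[dhom X Y]" if R: "R : carrier (dhom X Y)" for R
 proof -
  obtain W s f where r: "is_roof X Y W s f" "R = roof_class X Y (W, s, f)" by (rule roof_classE[OF X Y R])
  have W: "W : Sm" and sq: "qis W X s" and f: "cmap W Y f" using is_roofD[OF r(1)] by blast+
  have cW: "is_complex W" by (rule small_complex(1)[OF W])
  have aW: "acyclic_at W n" if "n > m" for n using tors_qis[OF sq] aX[OF that] by blast
  let ?W = "trle W m" and ?Y = "trle Y m"
  note iW = trle_complex[OF cW, of m] and iY = trle_complex[OF cY, of m]
  have W': "?W : Sm" by (rule subcomplex_Sm[OF W iW(2)])
  have Y': "?Y : Sm" by (rule subcomplex_Sm[OF Y iY(2)])
  note ref = roof_class_refine[OF r(1) W' iW(2) qis_comp[OF qis_trle[OF cW aW] sq]]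
  have fc: "f n x : Car ?Y n" if x: "x : Car ?W n" for n x
  proof -
   consider "n < m" | "n = m" | "n > m" by linarith
   then show ?thesis using x cmap_simps(1,3)[OF f] cmap_cocycle[OF f, of x m] by cases auto
  qed
  have xW: "x : Car W n" if "x : Car ?W n" for x n using cmap_simps(1)[OF iW(2) that] by simp
  have g: "cmap ?W ?Y f"
  proof (rule cmapI[OF iW(1) iY(1)])
   fix n x y assume x: "x : Car ?W n"
   show "f n x : Car ?Y n" by (rule fc[OF x])
   show "f (n + 1) (cdiff ?W n x) = cdiff ?Y n (f n x)" using cmap_simps(5)[OF f xW[OF x], of "n + 1"] by simp
   assume y: "y : Car ?W n"
   show "f n (x *[cgrp ?W n] y) = f n x *[cgrp ?Y n] f n y" using cmap_simps(2)[OF f xW[OF x] xW[OF y]] by simp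
  qed
  have aY': "acyclic_at ?Y n" for n
  proof (cases "n \<le> m")
   case True then show ?thesis using tors_trle[OF cY True] aY[OF True] by blast
  next
   case False then show ?thesis using acyclic_trle[OF cY] by simp
  qed
  have "htp ?W Y (f \<cdot> id_map) (id_map \<cdot> f)" using htp_refl[OF cmap_comp[OF iW(2) f]] by simp
  from trans[OF ref(2) factor_acyclic[OF ref(1) Y' aY' g iY(2) this]] show ?thesis unfolding r(2) .
 qed
 show ?thesis by (rule zero_homI[OF X Y]) (rule z)
qed

end

context prime_generator
begin

lemma shift_classI:
 assumes "Y : Tor" "Shf (- i) Y : P" shows "Y : shift_class TorC P i"
proof -
 have Y: "Y : Sm" using assms(1) Tor_Sm by blast
 have "qis (Shf i (Shf (- i) Y)) Y id_map"
  using qis_shift_shift[OF small_complex(1)[OF Y], of i "- i"] by simp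
 then have "isoD (Shf i (Shf (- i) Y)) Y" by (rule isoD_qis[OF shift_Sm[OF shift_Sm[OF Y]] Y])
 then show ?thesis using assms by (auto simp: shift_class_def isomorphic_full_subcategory)
qed

lemma shift_classD:
 assumes "Y : shift_class TorC P i" "P \<subseteq> Tor"
 shows "Y : Tor" "\<exists>X\<in>P. \<forall>n S. tors Y n S \<longleftrightarrow> tors X (n + i) S"
proof -
 obtain X where X: "X : P" "isoD (Shf i X) Y" and Y: "Y : Tor"
  using assms(1) by (auto simp: shift_class_def isomorphic_full_subcategory)
 have XS: "X : Sm" using X(1) assms(2) Tor_Sm by blast
 show "Y : Tor" by (rule Y)
 have "tors Y n S \<longleftrightarrow> tors X (n + i) S" for n S
  using tors_isoD[OF shift_Sm[OF XS] subsetD[OF Tor_Sm Y] X(2)] tors_shift[OF small_complex(1)[OF XS]] by blast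
 then show "\<exists>X\<in>P. \<forall>n S. tors Y n S \<longleftrightarrow> tors X (n + i) S" using X(1) by blast
qed

lemma Tor_cone:
 assumes X: "X : Tor" and Y: "Y : Tor" and V: "V : Sm" and f: "cmap X Y f" and \<phi>: "qis (cone X Y f) V \<phi>"
 shows "V : Tor"
proof -
 have "tors V n (range (%k. p ^ k))" for n
 proof -
  have "tors (cone X Y f) n {k * l | k l. k : range (%k. p ^ k) \<and> l : range (%k. p ^ k)}"
   by (rule tors_cone[OF f]) (use X Y in \<open>auto simp: Tor_def\<close>)
  then have "tors (cone X Y f) n (range (%k. p ^ k))" by (rule tors_mono) (use powers_mult(2) in blast)
  then show ?thesis using tors_qis[OF \<phi>] by blast
 qed
 then show ?thesis using V by (simp add: Tor_def)
qed

definition Cle :: "'u cochain_complex set" where "Cle = {X : Tor. \<forall>n>0. acyclic_at X n}"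
definition Cge :: "'u cochain_complex set" where "Cge = {X : Tor. \<forall>n<0. acyclic_at X n}"

lemma Cle_Tor: "Cle \<subseteq> Tor" and Cge_Tor: "Cge \<subseteq> Tor" unfolding Cle_def Cge_def by blast+

lemma acyclic_shift: "X : Tor ==> acyclic_at (Shf k X) n \<longleftrightarrow> acyclic_at X (n + k)"
 using tors_shift[OF small_complex(1)] Tor_Sm by blast

lemma standard_t_structure: "t_structure TorC Cge Cle"
 unfolding t_structure_def full_subcategory_simps
proof (intro conjI Cle_Tor Cge_Tor ballI subsetI)
 have iso: "acyclic_at Y n" if "X : Tor" "Y : Tor" "isoD X Y" "acyclic_at X n" for X Y n
  using tors_isoD[of X Y n "{1}"] that Tor_Sm by blast
 show "iso_closed TorC Cge" unfolding iso_closed_def isomorphic_full_subcategory full_subcategory_simps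
 proof (intro ballI impI)
  fix X Y assume "X : Cge" "Y : Tor" "isoD X Y"
  then show "Y : Cge" using iso[of X Y] unfolding Cge_def by blast
 qed
 show "iso_closed TorC Cle" unfolding iso_closed_def isomorphic_full_subcategory full_subcategory_simps
 proof (intro ballI impI)
  fix X Y assume "X : Cle" "Y : Tor" "isoD X Y"
  then show "Y : Cle" using iso[of X Y] unfolding Cle_def by blast
 qed
 show "Y : shift_class TorC Cge 1" if "Y : Cge" for Y
 proof (rule shift_classI)
  show "Y : Tor" using that Cge_Tor by blast
  then show "Shf (- 1) Y : Cge" using that Tor_shift[of Y "- 1"] acyclic_shift[of Y "- 1"] unfolding Cge_def by auto
 qed
 show "Y : Cle" if Y: "Y : shift_class TorC Cle 1" for Y
 proof -
  obtain X where X: "X : Cle" "\<forall>n S. tors Y n S \<longleftrightarrow> tors X (n + 1) S" using shift_classD(2)[OF Y Cle_Tor] by blast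
  show ?thesis unfolding Cle_def
  proof (intro CollectI conjI allI impI shift_classD(1)[OF Y Cle_Tor])
   fix n :: int assume "n > 0"
   then have "acyclic_at X (n + 1)" using X(1) unfolding Cle_def by auto
   then show "acyclic_at Y n" using X(2) by blast
  qed
 qed
 show "zero_hom TorC Y Z" if Y: "Y : shift_class TorC Cle 1" and Z: "Z : Cge" for Y Z
 proof -
  obtain X where X: "X : Cle" "\<forall>n S. tors Y n S \<longleftrightarrow> tors X (n + 1) S" using shift_classD(2)[OF Y Cle_Tor] by blast
  have YS: "Y : Sm" and ZS: "Z : Sm" using shift_classD(1)[OF Y Cle_Tor] Z Cge_Tor Tor_Sm by blast+
  have "acyclic_at Y n" if "n > - 1" for n
  proof -
   have "acyclic_at X (n + 1)" using X(1) that unfolding Cle_def by auto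
   then show ?thesis using X(2) by blast
  qed
  moreover have "acyclic_at Z n" if "n \<le> - 1" for n using Z that unfolding Cge_def by auto
  ultimately show ?thesis unfolding zero_hom_full_subcategory by (rule zero_hom_separated[OF YS ZS])
 qed
 fix M assume M: "M : Tor"
 have MS: "M : Sm" using M Tor_Sm by blast
 have cM: "is_complex M" by (rule small_complex(1)[OF MS])
 \<comment> \<open>The truncation triangle: its third vertex is the cone of the inclusion,
   transported into the universe as \<open>V\<close> below.\<close>
 let ?L = "trle M 0"
 note i = trle_complex[OF cM, of 0]
 have LS: "?L : Sm" by (rule subcomplex_Sm[OF MS i(2)])
 have "tors ?L n (range (%k. p ^ k))" for n
 proof (cases "n \<le> 0")
  case True then show ?thesis using tors_trle[OF cM True] M unfolding Tor_def by blast
 next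
  case False
  then have "acyclic_at ?L n" using acyclic_trle[OF cM] by simp
  then show ?thesis by (rule tors_mono) (use powers_mult(1) in blast)
 qed
 then have LT: "?L : Tor" using LS by (simp add: Tor_def)
 have L: "?L : Cle" unfolding Cle_def using LT acyclic_trle[OF cM] by blast
 obtain V \<phi> where V: "V : Sm" "cmap (cone ?L M id_map) V \<phi>" "!!n. bij_betw (\<phi> n) (Car (cone ?L M id_map) n) (Car V n)"
  using transport_cone[OF LS MS i(2)] by blast
 have q: "qis (cone ?L M id_map) V \<phi>" by (rule qis_bij(1)[OF V(2,3)])
 have VT: "V : Tor" by (rule Tor_cone[OF LT M V(1) i(2) q])
 have aV: "acyclic_at V n" if n: "n \<le> 0" for n
 proof -
  have "acyclic_at (cone ?L M id_map) n"
  proof (rule cone_inclusion_acyclic[OF i(2)])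
   fix l y assume a: "l : Car ?L (n + 1)" "y : Car M n" "l *[cgrp M (n + 1)] cdiff M n y = 1[cgrp M (n + 1)]"
   show "y : Car ?L n"
   proof (cases "n < 0")
    case True then show ?thesis using a(2) by simp
   next
    case False
    then have n0: "n = 0" using n by simp
    have "cdiff M 0 y = 1[cgrp M 1]" using a cx_simps(1)[OF cM a(2), of "n + 1"] cx_simps(9)[OF cM] unfolding n0 by simp
    then show ?thesis using a(2) unfolding n0 by (simp add: cocycles_iff)
   qed
  qed
  then show ?thesis using tors_qis[OF q] by blast
 qed
 have R: "V : shift_class TorC Cge (- 1)"
 proof (rule shift_classI[OF VT])
  have "acyclic_at (Shf 1 V) n" if "n < 0" for n unfolding acyclic_shift[OF VT] by (rule aV) (use that in simp)
  then show "Shf (- (- 1)) V : Cge" using Tor_shift[OF VT, of 1] unfolding Cge_def by simp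
 qed
 obtain a b c where "(?L, M, V, a, b, c) : derived_dist" using derived_dist_cone_qis[OF LS MS V(1) i(2)] q by blast
 then have dd: "(?L, M, V, a, b, c) : {(X, Y, Z, f, g, h). (X, Y, Z, f, g, h) : derived_dist \<and> X : Tor \<and> Y : Tor \<and> Z : Tor}" using LT M VT by simp
 then show "\<exists>L\<in>Cle. \<exists>R\<in>shift_class TorC Cge (- 1). \<exists>f g h. (L, M, R, f, g, h) : {(X, Y, Z, f, g, h). (X, Y, Z, f, g, h) : derived_dist \<and> X : Tor \<and> Y : Tor \<and> Z : Tor}"
  by (intro bexI[OF _ L] bexI[OF _ R] exI dd)
qed

text \<open>F is replaced by a divisible torsion model T because in T every element is torsion, not
  only every class; thus a truncation of T that creates new cohomology still lies in
  \<open>Tor\<close>. The cohomology of E in degrees -1 and 0 calls for copies of G in degrees -2 to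
  1, which the bound 2 accommodates.\<close>

lemma approximation_triangle:
 assumes F: "F : Cle"
 shows "\<exists>E\<in>unbounded_gen U TorC G 2. \<exists>D\<in>t_le TorC Cle (- 1). \<exists>f g h. (E, F, D, f, g, h) : Dist TorC"
proof -
 have FT: "F : Tor" using F Cle_Tor by blast
 have FS: "F : Sm" using FT Tor_Sm by blast
 obtain T where T: "T : Sm" "isoD F T" "divisible_torsion p T" using torsion_model[OF FS] FT unfolding Tor_def by blast
 have TT: "T : Tor" by (rule Tor_iso[OF FT T(1,2)])
 have cT: "is_complex T" by (rule small_complex(1)[OF T(1)])
 interpret T: comm_group "cgrp T i" for i by (rule comm_group_cgrp[OF cT])
 have aT: "acyclic_at T n" if "n > 0" for n
 proof -
  have "acyclic_at F n" using F that unfolding Cle_def by blast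
  then show ?thesis using tors_isoD[OF FS T(1,2)] by blast
 qed
 \<comment> \<open>Brutal truncation below -1 and canonical truncation above 0. Degree 0 keeps the
   cohomology of T; the change in degree -1 is harmless, since D may have cohomology there.\<close>
 let ?S = "%n. if n = - 1 then Car T (- 1) else if n = 0 then Cy T 0 else {1[cgrp T n]}"
 define E where "E = subcx T ?S"
 have s: "subgroup (?S n) (cgrp T n)" for n
  using cocycles_subgroup[OF cT, of 0] T.subgroup_self[of "- 1"] T.triv_subgroup[of n] by simp
 have d: "cdiff T n x : ?S (n + 1)" if x: "x : ?S n" for n x
 proof -
  consider "n = - 1" | "n = 0" | "n \<noteq> - 1" "n \<noteq> 0" by blast
  then show ?thesis
  proof cases
   case 1 then show ?thesis using x cx_simps(1)[OF cT, of x "- 1" 0] cx_simps(5)[OF cT, of x "- 1" 0] by (simp add: cocycles_iff)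
  next
   case 2 then show ?thesis using x by (simp add: cocycles_iff)
  next
   case 3 then show ?thesis using x cx_simps(3)[OF cT, of n] subgroup.one_closed[OF s[of "n + 1"]] by simp
  qed
 qed
 have cE: "is_complex E" and i: "cmap E T id_map" unfolding E_def by (rule is_complex_subcx[OF cT s d], assumption)+
 have E [simp]: "Car E n = ?S n" "1[cgrp E n] = 1[cgrp T n]" "x ^[cgrp E n] (k::nat) = x ^[cgrp T n] k" for n x k
  by (simp_all add: E_def restrict_nat_pow)
 have ES: "E : Sm" by (rule subcomplex_Sm[OF T(1) i])
 have tE: "tors E n (range (%k. p ^ k))" for n
  unfolding tors_def
 proof
  fix x assume "x : Cy E n"
  then have "x : Car T n" using cmap_simps(1)[OF i, of x n] unfolding cocycles_iff by simp
  then obtain k where "x ^[cgrp T n] (p ^ k) = 1[cgrp T n]" using divisible_torsionD(2)[OF T(3)] by blast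
  then have "x ^[cgrp E n] (p ^ k) : Bd E n" using subgroup.one_closed[OF coboundaries_subgroup[OF cE, of n]] by simp
  then show "\<exists>k\<in>range (%k. p ^ k). x ^[cgrp E n] k : Bd E n" by blast
 qed
 have ET: "E : Tor" using ES tE by (simp add: Tor_def)
 have aE: "acyclic_at E n" if "n \<noteq> - 1" "n \<noteq> 0" for n by (rule acyclic_at_trivial[OF cE]) (use that in simp)
 have "E : closure_cl U TorC {Shift TorC s G | s. - int 2 \<le> s \<and> s \<le> int 2}"
  unfolding closure_cl_def
 proof (rule InterI, clarify)
  fix Q assume Q: "Q \<subseteq> Obj TorC" "{Shift TorC s G | s. - int 2 \<le> s \<and> s \<le> int 2} \<subseteq> Q" "extension_closed TorC Q" "coproduct_closed U TorC Q"
  then have cQ: "closedQ Q" by (intro closedQ_of_TorC) simp_all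
  have GQ: "Gs l : Q" if "- 2 \<le> l" "l \<le> 2" for l
  proof -
   have "Gs l : {Shift TorC s G | s. - int 2 \<le> s \<and> s \<le> int 2}" using that by auto
   then show ?thesis using Q(2) by blast
  qed
  show "E : Q"
  proof (rule closedQ_torsion[OF cQ ES tE])
   fix n assume "\<not> acyclic_at E n"
   then have "n = - 1 \<or> n = 0" using aE by blast
   then show "Gs (n - 1) : Q \<and> Gs n : Q \<and> Gs (n + 1) : Q" using GQ[of "n - 1"] GQ[of n] GQ[of "n + 1"] by auto
  qed
 qed
 moreover have "dmor E E id_map : carrier (dhom E E)" by (rule of_chain_map_closed[OF ES ES cmap_id[OF cE]])
 ultimately have EU: "E : unbounded_gen U TorC G 2"
  unfolding unbounded_gen_def retracts_def using ET derived_comp_id_left[OF ES ES, of "dmor E E id_map"] by auto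
 obtain V \<phi> where V: "V : Sm" "cmap (cone E T id_map) V \<phi>" "!!n. bij_betw (\<phi> n) (Car (cone E T id_map) n) (Car V n)"
  using transport_cone[OF ES T(1) i] by blast
 have q: "qis (cone E T id_map) V \<phi>" by (rule qis_bij(1)[OF V(2,3)])
 have VT: "V : Tor" by (rule Tor_cone[OF ET TT V(1) i q])
 have aV: "acyclic_at V n" if n: "n \<ge> 0" for n
 proof -
  have "acyclic_at (cone E T id_map) n"
  proof (cases "n = 0")
   case True
   show ?thesis
   proof (rule cone_inclusion_acyclic[OF i])
    fix l y assume a: "l : Car E (n + 1)" "y : Car T n" "l *[cgrp T (n + 1)] cdiff T n y = 1[cgrp T (n + 1)]"
    have "cdiff T 0 y = 1[cgrp T 1]" using a cx_simps(1)[OF cT a(2), of "n + 1"] cx_simps(9)[OF cT] unfolding True by simp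
    then show "y : Car E n" using a(2) unfolding True by (simp add: cocycles_iff)
   qed
  next
   case False
   have "tors (cone E T id_map) n {k * l | k l. k : {1} \<and> l : {1}}"
    by (rule tors_cone[OF i aE aT]) (use False n in simp_all)
   then show ?thesis by (rule tors_mono) auto
  qed
  then show ?thesis using tors_qis[OF q] by blast
 qed
 have "acyclic_at (Shf (- 1) V) n" if "n > 0" for n unfolding acyclic_shift[OF VT] by (rule aV) (use that in simp)
 then have "Shf (- 1) V : Cle" using Tor_shift[OF VT, of "- 1"] unfolding Cle_def by blast
 then have "V : shift_class TorC Cle 1" by (rule shift_classI[OF VT])
 then have D: "V : t_le TorC Cle (- 1)" by (simp add: t_le_def)
 obtain a b c where "(E, F, V, a, b, c) : derived_dist"
  using derived_dist_cone[OF ES FS T(1) V(1) V(1) i V(2,3) T(2) isoD_refl[OF V(1)]] by blast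
 then have "(E, F, V, a, b, c) : Dist TorC" using ET FT VT by simp
 then show ?thesis using EU D by blast
qed

lemma weakly_approximable_TorC: "weakly_approximable U TorC"
proof -
 have "acyclic_at (Shf 2 G) n" if "n > 0" for n
  unfolding acyclic_shift[OF G_Tor] using Gs_acyclic[of "n + 2" 0] that unfolding Gs_0 by auto
 then have "Shf 2 G : Cle" using Tor_shift[OF G_Tor, of 2] unfolding Cle_def by blast
 then have 1: "Shift TorC (int 2) G : Cle" by simp
 have 2: "\<forall>X\<in>Cle. zero_hom TorC (Shift TorC (- int 2) G) X"
 proof
  fix X assume X: "X : Cle"
  then have XS: "X : Sm" using Cle_Tor Tor_Sm by blast
  have "acyclic_at X 2" "acyclic_at X (2 - 1)" using X unfolding Cle_def by auto
  then have "zero_hom D_Ab (Gs 2) X" by (rule zero_hom_Gs[OF XS])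
  then show "zero_hom TorC (Shift TorC (- int 2) G) X" unfolding zero_hom_full_subcategory by simp
 qed
 have 3: "\<forall>F\<in>Cle. \<exists>E\<in>unbounded_gen U TorC G 2. \<exists>D\<in>t_le TorC Cle (- 1). \<exists>f g h. (E, F, D, f, g, h) : Dist TorC"
  by (rule ballI) (rule approximation_triangle)
 have ac: "approximation_conditions TorC G Cle 2 (unbounded_gen U TorC G 2)"
  unfolding approximation_conditions_def by (intro conjI 1 2 3)
 show ?thesis unfolding weakly_approximable_def
  by (intro bexI[of _ G] exI[of _ Cge] exI[of _ Cle] exI[of _ "2::nat"] conjI compactly_generates_G standard_t_structure ac)
   (simp_all add: G_Tor)
qed

end

section \<open>Compact generators and the failure of approximability\<close>

lemma cmap_cone_fst:
 assumes f: "cmap A B f" shows "cmap (cone A B f) (Shf 1 A) (%n x. fst x)"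
proof (rule cmapI[OF is_complex_cone[OF f] is_complex_shift[OF cmapD(1)[OF f]]])
 fix n x assume "x : Car (cone A B f) n"
 then show "fst x : Car (Shf 1 A) n" "fst (cdiff (cone A B f) n x) = cdiff (Shf 1 A) n (fst x)"
  by (cases x; simp add: add.assoc)+
qed (auto simp: mult_DirProd')

lemma divisible_ses:
 assumes d: "divisible_torsion p T" shows "ses (Tk p T 1) T T id_map (%n t. t ^[cgrp T n] p)"
proof -
 have cT: "is_complex T" by (rule divisible_torsionD(1)[OF d])
 interpret T: comm_group "cgrp T i" for i by (rule comm_group_cgrp[OF cT])
 have c: "cmap T T (%n t. t ^[cgrp T n] p)"
  by (rule cmapI[OF cT cT]) (simp_all add: T.pow_mult_distrib_nat cx_simps(17)[OF cT])
 have im: "(%t. t ^[cgrp T n] p) ` Car T n = Car T n" for n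
  using divisible_torsionD(3)[OF d, of _ n] by force
 show ?thesis unfolding ses_def using Tk_complex(2)[OF cT, of p 1] c im by (auto simp: inj_on_def)
qed

context universe
begin

lemma zero_hom_isoD_source:
 assumes H: "H : Sm" "T : Sm" "X : Sm" and i: "isoD H T" and z: "zero_hom D_Ab H X" shows "zero_hom D_Ab T X"
proof -
 obtain \<alpha> \<beta> where \<alpha>: "\<alpha> : carrier (dhom H T)" and \<beta>: "\<beta> : carrier (dhom T H)" and \<alpha>\<beta>: "dcomp T H T \<alpha> \<beta> = dmor T T id_map"
  using i unfolding isomorphic_def isomorphism_def by auto
 show ?thesis
 proof (rule zero_homI[OF H(2,3)])
  fix R assume R: "R : carrier (dhom T X)"
  have "dcomp H T X R \<alpha> : carrier (dhom H X)" by (rule derived_comp_closed[OF H \<alpha> R])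
  then have "dcomp H T X R \<alpha> = 1[dhom H X]" using z by (simp add: zero_hom_def)
  then have "dcomp T H X (dcomp H T X R \<alpha>) \<beta> = 1[dhom T X]" using zero_comp_left[OF H(2,1,3) \<beta>] by simp
  then show "R = 1[dhom T X]" using derived_comp_assoc[OF H(2,1,2,3) \<beta> \<alpha> R] \<alpha>\<beta> derived_comp_id_right[OF H(2,3) R] by simp
 qed
qed

lemma tors_coproduct:
 assumes P: "P \<subseteq> Sm" and Pd: "!!(I :: 'u set) X Z j q. \<lbrakk>dsum I X Z j q; |I| <o |UNIV :: 'u set|; \<forall>i\<in>I. X i : P; Z : Sm\<rbrakk> \<Longrightarrow> Z : P"
  and I: "|I :: 'u set| <o |UNIV :: 'u set|" and c: "is_coproduct (full_subcategory D_Ab P) I X Z \<iota>"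
  and t: "!!i. i : I ==> tors (X i) n {a}"
 shows "tors Z n {a}"
proof -
 have Z: "Z : P" and X: "!!i. i : I ==> X i : P" using c unfolding is_coproduct_def by simp_all
 obtain Z' j q where Z': "Z' : Sm" "dsum I X Z' j q" using dsum_exists[OF I, of X] X P by blast
 have Z'P: "Z' : P" using Pd[OF Z'(2) I] X Z'(1) by blast
 obtain h k where hk: "h : carrier (dhom Z Z')" "k : carrier (dhom Z' Z)" "dcomp Z Z' Z k h = dmor Z Z id_map"
  using coproduct_retract[OF P c I Z'(2) Z'P] by blast
 have "tors Z' n {a}" by (rule dsum_tors[OF Z'(2) t]) auto
 then show ?thesis using tors_retract[OF subsetD[OF P Z] Z'(1) hk] by blast
qed

end

context prime_generator
begin

text \<open>The connecting morphism of the sequence 0 -> T[p] -> T -> T -> 0 whose last map is the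
  p-th power. It kills only classes of p-th powers of cocycles, and x avoids these by
  \<open>np\<close>.\<close>

lemma connecting_morphism:
 assumes T: "T : Sm" and d: "divisible_torsion p T" and x: "x : Cy T l"
  and np: "!!y. y : Cy T l ==> y ^[cgrp T l] p \<noteq> x"
 shows "\<exists>R\<in>carrier (dhom T (Shf 1 (Tk p T 1))). \<exists>b\<in>Cy (Shf 1 (Tk p T 1)) l.
  b \<notin> Bd (Shf 1 (Tk p T 1)) l \<and> hrel T (Shf 1 (Tk p T 1)) R l x b"
proof -
 let ?A = "Tk p T 1" and ?K = "Shf 1 (Tk p T 1)"
 have cT: "is_complex T" by (rule small_complex(1)[OF T])
 interpret T: comm_group "cgrp T i" for i by (rule comm_group_cgrp[OF cT])
 have A: "?A : Sm" by (rule Tk_Sm[OF T])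
 have cA: "is_complex ?A" by (rule small_complex(1)[OF A])
 have K: "?K : Sm" by (rule shift_Sm[OF A])
 have cK: "is_complex ?K" by (rule small_complex(1)[OF K])
 note s = divisible_ses[OF d]
 note inc = sesD(1)[OF s]
 let ?C = "cone ?A T id_map"
 obtain V \<phi> where V: "V : Sm" "cmap ?C V \<phi>" "!!n. bij_betw (\<phi> n) (Car ?C n) (Car V n)"
  using transport_cone[OF A T inc] by blast
 define i where "i = (%n. inv_into (Car ?C n) (\<phi> n))"
 have im: "cmap V ?C i" unfolding i_def by (rule cmap_inverse[OF V(2,3)])
 have iq: "qis V ?C i" unfolding i_def by (rule qis_bij(2)[OF V(2,3)])
 define S where "S = (%n (a, b). b ^[cgrp T n] p) \<cdot> i"
 define Ff where "Ff = (%n x. fst x) \<cdot> i"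
 have Sq: "qis V T S" unfolding S_def by (rule qis_comp[OF iq ses_cone_qis[OF s]])
 have fm: "cmap ?C ?K (%n x. fst x)" by (rule cmap_cone_fst[OF inc])
 have Fm: "cmap V ?K Ff" unfolding Ff_def by (rule cmap_comp[OF im fm])
 have r: "is_roof T ?K V S Ff" unfolding is_roof_def using V(1) Sq Fm T K by simp
 let ?R = "roof_class T ?K (V, S, Ff)"
 have xc: "x : Car T l" "cdiff T l x = 1[cgrp T (l + 1)]" using x unfolding cocycles_iff by simp_all
 obtain y where y: "y : Car T l" "y ^[cgrp T l] p = x" using divisible_torsionD(3)[OF d xc(1)] by blast
 let ?d = "cdiff T l y"
 have dT: "?d : Car T (l + 1)" by (rule cx_simps(1)[OF cT y(1)]) simp
 have "?d ^[cgrp T (l + 1)] p = 1[cgrp T (l + 1)]" using cx_simps(17)[OF cT y(1), of p] y(2) xc(2) by simp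
 then have dA: "?d : Car ?A (l + 1)" using dT by simp
 define a where "a = inv[cgrp ?A (l + 1)] ?d"
 have aA: "a : Car ?A (l + 1)" unfolding a_def by (rule cx_simps(8)[OF cA dA])
 have aT: "a = inv[cgrp T (l + 1)] ?d" unfolding a_def using cmap_simps(4)[OF inc dA] by simp
 have ddy: "cdiff ?A (l + 1) ?d = 1[cgrp ?A (l + 1 + 1)]" using cx_simps(5)[OF cT y(1), of "l + 1"] by simp
 have da: "cdiff ?A (l + 1) a = 1[cgrp ?A (l + 1 + 1)]"
  unfolding a_def cx_simps(4)[OF cA dA] ddy by (rule cx_simps(11)[OF cA])
 \<comment> \<open>With y a p-th root of x and a the inverse of its coboundary, the pair is a
   cocycle of the cone lying over x; its first component represents the image of x.\<close>
 have w0: "(a, y) : Cy ?C l"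
  unfolding cocycles_iff
 proof
  show "(a, y) : Car ?C l" using aA y(1) by simp
  have "inv[cgrp ?A (l + 2)] (cdiff ?A (l + 1) a) = 1[cgrp ?A (l + 2)]" unfolding da using cx_simps(11)[OF cA, of "l + 2"] by (simp add: add.assoc)
  moreover have "a *[cgrp T (l + 1)] ?d = 1[cgrp T (l + 1)]" unfolding aT by (rule T.l_inv[OF dT])
  ultimately show "cdiff ?C l (a, y) = 1[cgrp ?C (l + 1)]" by (simp add: one_DirProd add.assoc)
 qed
 let ?w = "\<phi> l (a, y)"
 have w: "?w : Cy V l" by (rule cmap_cocycle[OF V(2) w0])
 have iw: "i l ?w = (a, y)" unfolding i_def using V(3)[of l] w0 unfolding cocycles_iff by (auto simp: bij_betw_def inv_into_f_f)
 have bc: "a : Cy ?K l" using cmap_cocycle[OF fm w0] by simp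
 have "ceq T l (S l ?w) x" unfolding S_def using iw y(2) ceq_refl[OF cT x] by simp
 moreover have "ceq ?K l (Ff l ?w) a" unfolding Ff_def using iw ceq_refl[OF cK bc] by simp
 ultimately have h: "hrel T ?K ?R l x a" unfolding hrel_def using w mem_roof_class_self[OF r] by blast
 \<comment> \<open>If some t in T[p] bounded \<open>a\<close> up to sign, a correction of y by t
   would be a cocycle with the same p-th power x.\<close>
 have nb: "a \<notin> Bd ?K l"
 proof
  assume "a : Bd ?K l"
  then obtain t where t: "t : Car ?A l" "a = cdiff T l t" unfolding coboundaries_shift[OF cA] coboundaries_iff by auto
  have tT: "t : Car T l" "t ^[cgrp T l] p = 1[cgrp T l]" using t(1) by simp_all
  have "cdiff T l (y *[cgrp T l] t) = ?d *[cgrp T (l + 1)] a" using cx_simps(2)[OF cT y(1) tT(1)] t(2) by simp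
  also have "\<dots> = 1[cgrp T (l + 1)]" unfolding aT by (rule T.r_inv[OF dT])
  finally have "y *[cgrp T l] t : Cy T l" unfolding cocycles_iff using y(1) tT(1) by simp
  moreover have "(y *[cgrp T l] t) ^[cgrp T l] p = x" using y tT xc(1) by (simp add: T.pow_mult_distrib_nat)
  ultimately show False using np by blast
 qed
 show ?thesis using roof_class_closed[OF r] bc nb h by blast
qed

text \<open>The morphism is T -> T[p][1] -> G[-l] -> X, for a divisible model T of H. The connecting
  morphism keeps alive a cocycle that is not a p-th power, a projection to a copy of G detects its
  image, and G[-l] maps onto a class of order p in X. A single cocycle is followed through all three
  by \<open>hrel_comp\<close>.\<close>

lemma nonzero_hom:
 assumes H: "H : Tor" "\<not> acyclic_at H l" "tors H l {p ^ N}" and X: "X : Tor" "\<not> acyclic_at X l"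
 shows "\<not> zero_hom D_Ab H X"
proof
 assume z: "zero_hom D_Ab H X"
 have HS: "H : Sm" and XS: "X : Sm" using H(1) X(1) Tor_Sm by blast+
 have cX: "is_complex X" by (rule small_complex(1)[OF XS])
 obtain T where T: "T : Sm" "isoD H T" "divisible_torsion p T" using torsion_model[OF HS] H(1) unfolding Tor_def by blast
 have cT: "is_complex T" by (rule small_complex(1)[OF T(1)])
 interpret T: comm_group "cgrp T i" for i by (rule comm_group_cgrp[OF cT])
 interpret X: comm_group "cgrp X i" for i by (rule comm_group_cgrp[OF cX])
 have zT: "zero_hom D_Ab T X" by (rule zero_hom_isoD_source[OF HS T(1) XS T(2) z])
 have nT: "\<not> acyclic_at T l" and tT: "tors T l {p ^ N}" using tors_isoD[OF HS T(1,2)] H(2,3) by blast+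
 have "\<exists>x\<in>Cy T l. \<forall>y\<in>Cy T l. y ^[cgrp T l] p \<noteq> x"
 proof (rule ccontr)
  \<comment> \<open>If every cocycle had a p-th root among the cocycles, it would also have a p^N-th
    root there, and the exponent bound would make it a coboundary.\<close>
  assume "\<not> ?thesis"
  then have dv: "\<exists>y\<in>Cy T l. y ^[cgrp T l] p = x" if "x : Cy T l" for x using that by blast
  let ?Z = "cgrp T l\<lparr>carrier := Cy T l\<rparr>"
  have "x : Bd T l" if x: "x : Cy T l" for x
  proof -
   have "\<exists>y\<in>carrier ?Z. y ^[?Z] (p ^ N) = x"
    by (rule divisible_pow[OF T.comm_group_restrict[OF cocycles_subgroup[OF cT]]]) (use dv x in \<open>simp_all add: restrict_nat_pow\<close>)
   then obtain y where "y : Cy T l" "y ^[cgrp T l] (p ^ N) = x" by (auto simp: restrict_nat_pow)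
   then show ?thesis using tT unfolding tors_def by auto
  qed
  then show False using nT unfolding acyclic_at_iff[OF cT] by blast
 qed
 then obtain x where x: "x : Cy T l" "!!y. y : Cy T l ==> y ^[cgrp T l] p \<noteq> x" by blast
 let ?K = "Shf 1 (Tk p T 1)"
 have K: "?K : Sm" by (rule shift_Sm[OF Tk_Sm[OF T(1)]])
 obtain R0 b where R0: "R0 : carrier (dhom T ?K)" "b : Cy ?K l" "b \<notin> Bd ?K l" "hrel T ?K R0 l x b"
  using connecting_morphism[OF T(1,3) x] by blast
 have el: "c ^[cgrp ?K n] p = 1[cgrp ?K n]" if "c : Car ?K n" for n c using that by simp
 obtain R1 g where R1: "R1 : carrier (dhom ?K (Gs l))" "g : Car G 0" "g \<noteq> 1[cgrp G 0]" "hrel ?K (Gs l) R1 l b g"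
  using elementary_detect[OF K el R0(2,3)] by blast
 obtain x' where x': "x' : Cy X l" "x' \<notin> Bd X l" using X(2) unfolding acyclic_at_iff[OF cX] by blast
 have x'c: "x' : Car X l" using x'(1) unfolding cocycles_iff by blast
 \<comment> \<open>The last power of \<open>x'\<close> before a coboundary is reached has order p in
   cohomology.\<close>
 define k where "k = (LEAST k. x' ^[cgrp X l] (p ^ k) : Bd X l)"
 have "\<exists>k. x' ^[cgrp X l] (p ^ k) : Bd X l" using X(1) x'(1) unfolding Tor_def tors_def by blast
 then have k: "x' ^[cgrp X l] (p ^ k) : Bd X l" unfolding k_def by (rule LeastI_ex)
 have "k \<noteq> 0" using k x'(2) X.nat_pow_eone[OF x'c] by (cases k) auto
 then obtain k' where k': "k = Suc k'" using not0_implies_Suc by blast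
 let ?x = "x' ^[cgrp X l] (p ^ k')"
 have nx: "?x \<notin> Bd X l" using not_less_Least[of k' "%k. x' ^[cgrp X l] (p ^ k) : Bd X l"] k' unfolding k_def[symmetric] by simp
 have xp: "?x ^[cgrp X l] p : Bd X l" using k X.nat_pow_pow[OF x'c, of "p ^ k'" p] unfolding k' by (simp add: mult.commute)
 obtain R2 where R2: "R2 : carrier (dhom (Gs l) X)" "hrel (Gs l) X R2 l g ?x"
  using morphism_from_Gs[OF R1(2,3) XS cocycles_pow[OF cX x'(1)] xp] by blast
 let ?S = "dcomp T ?K (Gs l) R1 R0" let ?R = "dcomp T (Gs l) X R2 ?S"
 have Sc: "?S : carrier (dhom T (Gs l))" by (rule derived_comp_closed[OF T(1) K Gs_Sm R0(1) R1(1)])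
 have Rc: "?R : carrier (dhom T X)" by (rule derived_comp_closed[OF T(1) Gs_Sm XS Sc R2(1)])
 have h: "hrel T X ?R l x ?x"
  by (rule hrel_comp[OF T(1) Gs_Sm XS Sc R2(1) hrel_comp[OF T(1) K Gs_Sm R0(1) R1(1) R0(4) R1(4)] R2(2)])
 have R: "?R = dmor T X (zero_map X)" using Rc zT by (simp add: zero_hom_def derived_hom_def)
 have "hrel T X ?R l x (zero_map X l x)" unfolding R by (rule hrel_of_chain_map[OF T(1) XS cmap_zero[OF cT cX] x(1)])
 then have "ceq X l ?x (zero_map X l x)" by (rule hrel_uniq[OF T(1) XS Rc h _ ceq_refl[OF cT x(1)]])
 then show False using nx unfolding zero_map_def ceq_one_iff[OF cX] by blast
qed

text \<open>On the direct sum of countably many copies of a torsion complex, the identity minus the shift by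
 multiplication with \<open>p\<close> is a quasi-isomorphism; its inverse sends \<open>x\<close> in the first summand to
 \<open>(x, p x, p\<^sup>2 x, \<dots>)\<close>.\<close>

lemma shift_minus_identity:
 assumes H: "H : Tor" and d: "dsum (UNIV :: nat set) (%_. H) Z j q"
 shows "\<exists>\<theta>. qis Z Z \<theta> \<and> (\<forall>n. \<forall>z\<in>Car Z n. q 0 n (\<theta> n z) = q 0 n z) \<and>
  (\<forall>k n. \<forall>z\<in>Car Z n. q (Suc k) n (\<theta> n z) = q (Suc k) n z *[cgrp H n] inv[cgrp H n] (q k n z ^[cgrp H n] p))"
proof -
 have cH: "is_complex H" by (rule small_complex(1)[OF subsetD[OF Tor_Sm H]])
 have cZ: "is_complex Z" by (rule dsumD(1)[OF d])
 interpret H: comm_group "cgrp H i" for i by (rule comm_group_cgrp[OF cH])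
 interpret Z: comm_group "cgrp Z i" for i by (rule comm_group_cgrp[OF cZ])
 note [simp] = cx_simps[OF cH] cx_simps[OF cZ]
 have j: "cmap H Z (j k)" and q: "cmap Z H (q k)" for k using dsumD(2,3)[OF d] by blast+
 note g = dsumD(4)[OF d]
 have jc: "j k n x : Car Z n" if "x : Car H n" for k n x by (rule cmap_simps(1)[OF j that])
 have qc: "q k n z : Car H n" if "z : Car Z n" for k n z by (rule cmap_simps(1)[OF q that])
 \<comment> \<open>The element stays in its own copy, and its p-th power is divided out in the next
   one.\<close>
 define t where "t k n x = j k n x *[cgrp Z n] inv[cgrp Z n] (j (Suc k) n (x ^[cgrp H n] p))" for k n x
 have tm: "cmap H Z (t k)" for k
 proof (rule cmapI[OF cH cZ])
  fix n x assume x: "x : Car H n"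
  have xp: "x ^[cgrp H n] p : Car H n" using x by simp
  note xs = jc[OF x] jc[OF xp]
  show "t k n x : Car Z n" using xs by (simp add: t_def)
  show "t k (n + 1) (cdiff H n x) = cdiff Z n (t k n x)"
   using cmap_simps(5)[OF j x, of "n + 1"] cmap_simps(5)[OF j xp, of "n + 1"] xs x by (simp add: t_def)
  fix y assume y: "y : Car H n"
  have yp: "y ^[cgrp H n] p : Car H n" using y by simp
  note ys = jc[OF y] jc[OF yp]
  show "t k n (x *[cgrp H n] y) = t k n x *[cgrp Z n] t k n y"
   using cmap_simps(2)[OF j x y] cmap_simps(2)[OF j xp yp] xs ys x y
   by (simp add: t_def H.pow_mult_distrib_nat Z.inv_mult Z.m_ac)
 qed
 have "\<exists>h. cmap Z Z h \<and> (\<forall>i\<in>UNIV. \<forall>n. \<forall>x\<in>Car H n. h n (j i n x) = t i n x)" by (rule dsum_lift[OF d cZ]) (rule tm)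
 then obtain \<theta> where \<theta>: "cmap Z Z \<theta>" "!!k n x. x : Car H n ==> \<theta> n (j k n x) = t k n x" by auto
 have \<theta>c: "\<theta> n z : Car Z n" if "z : Car Z n" for n z by (rule cmap_simps(1)[OF \<theta>(1) that])
 have qj: "q l n (j k n x) = (if l = k then x else 1[cgrp H n])" if "x : Car H n" for l k n x
  using gsumD(5)[OF dsumD(4)[OF d, of n], of k x] gsumD(6)[OF dsumD(4)[OF d, of n], of k x l] that by auto
 have qt: "q l n (t k n x) = q l n (j k n x) *[cgrp H n] inv[cgrp H n] (q l n (j (Suc k) n (x ^[cgrp H n] p)))" if x: "x : Car H n" for l k n x
 proof -
  have xp: "x ^[cgrp H n] p : Car H n" using x by simp
  show ?thesis unfolding t_def using cmap_simps(2)[OF q jc[OF x] cx_simps(8)[OF cZ jc[OF xp]]] cmap_simps(4)[OF q jc[OF xp]] by simp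
 qed
 have q0: "q 0 n (\<theta> n z) = q 0 n z" if z: "z : Car Z n" for n z
 proof -
  have "(q 0 \<cdot> \<theta>) n z = q 0 n z"
  proof (rule dsum_ext[OF d cmap_comp[OF \<theta>(1) q] q _ z])
   fix k n x assume x: "x : Car H n"
   have xp: "x ^[cgrp H n] p : Car H n" using x by simp
   show "(q 0 \<cdot> \<theta>) n (j k n x) = q 0 n (j k n x)" using qj[OF x, of 0] qj[OF xp, of 0] x by (simp add: \<theta>(2)[OF x] qt[OF x])
  qed
  then show ?thesis by simp
 qed
 define m where "m k n z = q (Suc k) n z *[cgrp H n] inv[cgrp H n] (q k n z ^[cgrp H n] p)" for k n z
 have mm: "cmap Z H (m k)" for k
  by (rule cmapI[OF cZ cH])
   (use qc cmap_simps(5)[OF q] in \<open>simp_all add: m_def cmap_simps(2)[OF q] H.pow_mult_distrib_nat H.inv_mult H.m_ac\<close>)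
 have qS: "q (Suc l) n (\<theta> n z) = q (Suc l) n z *[cgrp H n] inv[cgrp H n] (q l n z ^[cgrp H n] p)" if z: "z : Car Z n" for n z l
 proof -
  have "(q (Suc l) \<cdot> \<theta>) n z = m l n z"
  proof (rule dsum_ext[OF d cmap_comp[OF \<theta>(1) q] mm _ z])
   fix k n x assume x: "x : Car H n"
   have xp: "x ^[cgrp H n] p : Car H n" using x by simp
   show "(q (Suc l) \<cdot> \<theta>) n (j k n x) = m l n (j k n x)"
    using qj[OF x, of "Suc l"] qj[OF xp, of "Suc l"] qj[OF x, of l] x by (simp add: \<theta>(2)[OF x] qt[OF x] m_def)
  qed
  then show ?thesis by (simp add: m_def)
 qed
 have "qis Z Z \<theta>" unfolding qis_iff_cohom
 proof (intro conjI allI ballI impI \<theta>(1))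
  fix n z assume z: "z : Cy Z n" and b: "\<theta> n z : Bd Z n"
  have zc: "z : Car Z n" using z unfolding cocycles_iff by blast
  have qz: "q k n z : Cy H n" for k by (rule cmap_cocycle[OF q z])
  have "q k n z : Bd H n" for k
  proof (induction k)
   case 0 show ?case using cmap_coboundary[OF q b, of 0] q0[OF zc] by simp
  next
   case (Suc k)
   have "q (Suc k) n z *[cgrp H n] inv[cgrp H n] (q k n z ^[cgrp H n] p) : Bd H n"
    using cmap_coboundary[OF q b, of "Suc k"] qS[OF zc, of k] by simp
   then have "ceq H n (q (Suc k) n z) (q k n z ^[cgrp H n] p)" unfolding ceq_iff[OF cH qz cocycles_pow[OF cH qz]] .
   then show ?case by (rule ceq_coboundary[OF _ coboundaries_pow[OF cH Suc]])
  qed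
  then show "z : Bd Z n" by (intro dsum_coboundaries[OF d zc])
 next
  fix n y assume y: "y : Cy Z n"
  have yc: "y : Car Z n" using y unfolding cocycles_iff by blast
  have qy: "q k n y : Cy H n" for k by (rule cmap_cocycle[OF q y])
  \<comment> \<open>The formal inverse of \<theta> applied to y. It can have infinitely many
    components, but past the support of y each is just the p-th power of its predecessor, so some
    \<open>u M\<close> is a coboundary.\<close>
  define u where "u = rec_nat (q 0 n y) (%k r. q (Suc k) n y *[cgrp H n] r ^[cgrp H n] p)"
  have u0: "u 0 = q 0 n y" and uS: "u (Suc k) = q (Suc k) n y *[cgrp H n] u k ^[cgrp H n] p" for k by (simp_all add: u_def)
  have uz: "u k : Cy H n" for k
  proof (induction k)
   case 0 show ?case unfolding u0 by (rule qy)
  next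
   case (Suc k) show ?case unfolding uS by (rule subgroup.m_closed[OF cocycles_subgroup[OF cH] qy cocycles_pow[OF cH Suc]])
  qed
  have uc: "u k : Car H n" for k using uz unfolding cocycles_iff by blast
  have "finite {k : UNIV. q k n y \<noteq> 1[cgrp H n]}" by (rule gsumD(7)[OF g yc])
  then obtain K where K: "\<forall>k\<in>{k : UNIV. q k n y \<noteq> 1[cgrp H n]}. k \<le> K" using finite_nat_set_iff_bounded_le by blast
  have qK: "q k n y = 1[cgrp H n]" if "K < k" for k using K that by (metis (mono_tags, lifting) UNIV_I mem_Collect_eq not_le)
  have uK: "u (K + l) = u K ^[cgrp H n] (p ^ l)" for l
  proof (induction l)
   case 0 show ?case using uc by simp
  next
   case (Suc l)
   have "u (K + Suc l) = u (K + l) ^[cgrp H n] p" using uS[of "K + l"] qK[of "Suc (K + l)"] uc[of "K + l"] by simp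
   then show ?case unfolding Suc using H.nat_pow_pow[OF uc, of K "p ^ l" p] by (simp add: mult.commute)
  qed
  obtain l where "u K ^[cgrp H n] (p ^ l) : Bd H n" using H uz[of K] unfolding Tor_def tors_def by blast
  then obtain M where M: "K \<le> M" "u M : Bd H n" using uK[of l] by (metis le_add1)
  \<comment> \<open>Cutting \<open>u\<close> off at M gives finite support. The image under \<theta>
    of the resulting w differs from y in component M only, and there by the coboundary
    \<open>u M\<close>.\<close>
  define v where "v k = (if k < M then u k else 1[cgrp H n])" for k
  have vz: "v k : Cy H n" for k unfolding v_def using uz subgroup.one_closed[OF cocycles_subgroup[OF cH]] by simp
  have vc: "v k : Car H n" for k using vz unfolding cocycles_iff by blast
  have "{k : UNIV. v k \<noteq> 1[cgrp H n]} \<subseteq> {..<M}" by (auto simp: v_def split: if_splits)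
  then have fin: "finite {k : UNIV. v k \<noteq> 1[cgrp H n]}" by (rule finite_subset) simp
  have "\<exists>z\<in>Car Z n. \<forall>i\<in>UNIV. q i n z = v i"
   by (rule gsum_build[OF dsumD(4)[OF d, of n], where y = v]) (use vc fin in simp_all)
  then obtain w where w: "w : Car Z n" "!!k. q k n w = v k" by auto
  have wz: "w : Cy Z n" unfolding dsum_cocycles[OF d] using w vz by simp
  have B: "subgroup (Bd H n) (cgrp H n)" by (rule coboundaries_subgroup[OF cH])
  have one: "1[cgrp H n] : Bd H n" by (rule subgroup.one_closed[OF B])
  have diff: "q k n y *[cgrp H n] inv[cgrp H n] (q k n (\<theta> n w)) : Bd H n" for k
  proof (cases k)
   case 0
   show ?thesis unfolding 0 q0[OF w(1)] w(2) v_def using one M(2) u0 qc[OF yc, of 0] by auto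
  next
   case (Suc i)
   have qi: "q (Suc i) n y : Car H n" by (rule qc[OF yc])
   have up: "u i ^[cgrp H n] p : Car H n" using uc by simp
   consider "Suc i < M" | "Suc i = M" | "M < Suc i" "M \<le> i" by linarith
   then show ?thesis
   proof cases
    case 1
    have "q (Suc i) n (\<theta> n w) = q (Suc i) n y" unfolding qS[OF w(1)] w(2) v_def using 1 qi up by (simp add: uS H.m_assoc)
    then show ?thesis unfolding Suc using one qi by simp
   next
    case 2
    then have "q (Suc i) n (\<theta> n w) = inv[cgrp H n] (u i ^[cgrp H n] p)" unfolding qS[OF w(1)] w(2) v_def using up by auto
    then have "q (Suc i) n y *[cgrp H n] inv[cgrp H n] (q (Suc i) n (\<theta> n w)) = u M" unfolding 2[symmetric] uS using up by simp
    then show ?thesis unfolding Suc using M(2) by simp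
   next
    case 3
    have "q (Suc i) n (\<theta> n w) = 1[cgrp H n]" unfolding qS[OF w(1)] w(2) v_def using 3 by simp
    moreover have "q (Suc i) n y = 1[cgrp H n]" using qK 3 M(1) by simp
    ultimately show ?thesis unfolding Suc using one by simp
   qed
  qed
  have "y *[cgrp Z n] inv[cgrp Z n] (\<theta> n w) : Bd Z n"
  proof (rule dsum_coboundaries[OF d])
   show "y *[cgrp Z n] inv[cgrp Z n] (\<theta> n w) : Car Z n" using yc \<theta>c[OF w(1)] by simp
   show "q k n (y *[cgrp Z n] inv[cgrp Z n] (\<theta> n w)) : Bd H n" for k
    using diff[of k] cmap_simps(2)[OF q yc cx_simps(8)[OF cZ \<theta>c[OF w(1)]], of k] cmap_simps(4)[OF q \<theta>c[OF w(1)], of k] by simp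
  qed
  then have "cohom Z n y (\<theta> n w)" unfolding cohom_iff[OF cZ \<theta>c[OF w(1)]] using yc by simp
  then show "\<exists>x\<in>Cy Z n. cohom Z n y (\<theta> n x)" using wz by blast
 qed
 then show ?thesis using q0 qS by blast
qed

text \<open>Applying the inverse of \<open>?\<theta>\<close> to the inclusion of the first copy
  gives y from H to the sum, whose k-th component acts on cohomology as multiplication by p^k. By
  compactness y involves finitely many copies, so some component K is zero, and p^K kills the
  cohomology of H in every degree at once.\<close>

lemma compact_bounded_torsion:
 assumes H: "H : Tor" and co: "compact_object U TorC H"
 shows "\<exists>N. \<forall>n. tors H n {p ^ N}"
proof -
 have HS: "H : Sm" using H Tor_Sm by blast
 have cH: "is_complex H" by (rule small_complex(1)[OF HS])
 obtain e :: "nat => 'u" where e: "inj e" using infinite_countable_subset[OF infinite_univ] by blast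
 obtain Z j q where Z: "Z : Sm" and d: "dsum (UNIV :: nat set) (%_. H) Z j q" using dsum_exists[OF sm_nat, of "%_. H"] HS by blast
 have cZ: "is_complex Z" by (rule small_complex(1)[OF Z])
 have ZT: "Z : Tor" by (rule Tor_dsum[OF d sm_nat _ Z]) (use H in simp)
 let ?I = "range e" and ?i = "inv_into UNIV e"
 have I: "|?I| <o |UNIV :: 'u set|" by (rule sm_image[OF sm_nat])
 have j: "cmap H Z (j k)" and q: "cmap Z H (q k)" for k using dsumD(2,3)[OF d] by blast+
 define \<iota> where "\<iota> i = dmor H Z (j (?i i))" for i
 have \<iota>c: "\<iota> i : carrier (dhom H Z)" for i unfolding \<iota>_def by (rule of_chain_map_closed[OF HS Z j])
 have "is_coproduct D_Ab ?I (%i. H) Z \<iota>"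
  unfolding \<iota>_def using dsum_coproduct[OF dsum_reindex[OF d e] I _ Z] HS by simp
 then have "is_coproduct TorC ?I (%i. H) Z \<iota>" by (rule is_coproduct_subcategory[OF _ Tor_Sm]) (use H ZT in simp_all)
 then have iso: "(%x. finprod (dhom H Z) (%i. dcomp H H Z (\<iota> i) (x i)) {i : ?I. x i \<noteq> 1[dhom H H]})
   : iso (sum_group ?I (%i. dhom H H)) (dhom H Z)"
  using co I unfolding compact_object_def small_def full_subcategory_simps by blast
 obtain \<theta> where \<theta>: "qis Z Z \<theta>" "!!n z. z : Car Z n ==> q 0 n (\<theta> n z) = q 0 n z"
  "!!k n z. z : Car Z n ==> q (Suc k) n (\<theta> n z) = q (Suc k) n z *[cgrp H n] inv[cgrp H n] (q k n z ^[cgrp H n] p)"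
  using shift_minus_identity[OF H d] by auto
 have \<theta>m: "cmap Z Z \<theta>" by (rule qis_cmap[OF \<theta>(1)])
 let ?\<theta> = "dmor Z Z \<theta>"
 have \<theta>h: "?\<theta> : carrier (dhom Z Z)" by (rule of_chain_map_closed[OF Z Z \<theta>m])
 obtain S where S: "S : carrier (dhom Z Z)" "dcomp Z Z Z ?\<theta> S = dmor Z Z id_map"
  using isomorphism_qis[OF Z Z \<theta>(1)] unfolding isomorphism_def by auto
 let ?j = "dmor H Z (j 0)"
 have jh: "?j : carrier (dhom H Z)" by (rule of_chain_map_closed[OF HS Z j])
 define y where "y = dcomp H Z Z S ?j"
 have yc: "y : carrier (dhom H Z)" unfolding y_def by (rule derived_comp_closed[OF HS Z Z jh S(1)])
 have \<theta>y: "dcomp H Z Z ?\<theta> y = ?j"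
  unfolding y_def using derived_comp_assoc[OF HS Z Z Z jh S(1) \<theta>h] S(2) derived_comp_id_left[OF HS Z jh] by simp
 have HH: "comm_group (dhom H H)" by (rule comm_group_derived_hom[OF HS HS])
 have gs: "gsum ?I (%i. dhom H H) (sum_group ?I (%i. dhom H H)) (%i x. \<lambda>k\<in>?I. if k = i then x else 1[dhom H H]) (%i z. z i)"
  by (rule gsum_sum_group) (rule HH)
 obtain x where x: "x : carrier (sum_group ?I (%i. dhom H H))"
  "y = finprod (dhom H Z) (%i. dcomp H H Z (\<iota> i) (x i)) {i : ?I. x i \<noteq> 1[dhom H H]}"
  using iso yc unfolding iso_def bij_betw_def by blast
 define F where "F = {i : ?I. x i \<noteq> 1[dhom H H]}"
 have F: "finite F" "F \<subseteq> ?I" unfolding F_def using gsumD(7)[OF gs x(1)] by auto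
 have xc: "x i : carrier (dhom H H)" if "i : F" for i using gsumD(10)[OF gs _ x(1)] F(2) that by blast
 \<comment> \<open>An index beyond the finite support of y, so that the projection to copy K
   annihilates y.\<close>
 obtain K where K: "\<forall>k\<in>?i ` F. k < K" using finite_nat_set_iff_bounded finite_imageI[OF F(1)] by blast
 let ?q = "dmor Z H (q K)"
 have qh: "?q : carrier (dhom Z H)" by (rule of_chain_map_closed[OF Z HS q])
 interpret HH: comm_group "dhom H H" by (rule HH)
 have qy: "dcomp H Z H ?q y = 1[dhom H H]"
 proof -
  have ic: "(%i. dcomp H H Z (\<iota> i) (x i)) : F \<rightarrow> carrier (dhom H Z)"
   using derived_comp_closed[OF HS HS Z xc \<iota>c] by blast
  have "dcomp H Z H ?q y = finprod (dhom H H) (%i. dcomp H Z H ?q (dcomp H H Z (\<iota> i) (x i))) F"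
   unfolding x(2) F_def[symmetric] by (rule finprod_hom[OF comm_group_derived_hom[OF HS Z] HH derived_comp_hom[OF HS Z HS qh] F(1) ic])
  also have "\<dots> = 1[dhom H H]"
  proof (rule HH.finprod_one_eqI)
   fix i assume i: "i : F"
   have ne: "K \<noteq> ?i i" using K i by blast
   have "cmap H H (q K \<cdot> j (?i i))" by (rule cmap_comp[OF j q])
   then have "htp H H (q K \<cdot> j (?i i)) (zero_map H)"
    by (rule htp_of_eq[OF _ cmap_zero[OF cH cH]]) (use gsumD(6)[OF dsumD(4)[OF d] UNIV_I _ UNIV_I ne] in \<open>simp add: zero_map_def\<close>)
   then have "dcomp H Z H ?q (\<iota> i) = dmor H H (zero_map H)"
    unfolding \<iota>_def of_chain_map_comp[OF HS Z HS j q] by (rule of_chain_map_cong[OF HS HS])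
   then have "dcomp H Z H ?q (\<iota> i) = 1[dhom H H]" by (simp add: derived_hom_def)
   then show "dcomp H Z H ?q (dcomp H H Z (\<iota> i) (x i)) = 1[dhom H H]"
    using derived_comp_assoc[OF HS HS Z HS xc[OF i] \<iota>c[of i] qh] zero_comp_left[OF HS HS HS xc[OF i]] by simp
  qed
  finally show ?thesis .
 qed
 have "tors H n {p ^ K}" for n
  unfolding tors_def
 proof
  interpret H: comm_group "cgrp H n" by (rule comm_group_cgrp[OF cH])
  fix h assume h: "h : Cy H n"
  have hc: "h : Car H n" using h unfolding cocycles_iff by blast
  obtain z where z: "hrel H Z y n h z" using hrel_ex[OF HS Z yc h] by blast
  have zz: "z : Cy Z n" by (rule hrelD(2)[OF z])
  have zc: "z : Car Z n" using zz unfolding cocycles_iff by blast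
  have "hrel H Z ?j n h (\<theta> n z)"
   using hrel_comp[OF HS Z Z yc \<theta>h z hrel_of_chain_map[OF Z Z \<theta>m zz]] unfolding \<theta>y .
  then have c: "ceq Z n (\<theta> n z) (j 0 n h)"
   by (rule hrel_uniq[OF HS Z jh _ hrel_of_chain_map[OF HS Z j h] ceq_refl[OF cH h]])
  have qz: "q k n z : Cy H n" for k by (rule cmap_cocycle[OF q zz])
  have pow: "ceq H n (q k n z) (h ^[cgrp H n] (p ^ k))" for k
  proof (induction k)
   case 0
   have "q 0 n (j 0 n h) = h" by (rule gsumD(5)[OF dsumD(4)[OF d] UNIV_I hc])
   then show ?case using ceq_cmap[OF q c, of 0] \<theta>(2)[OF zc] H.nat_pow_eone[OF hc] by simp
  next
   case (Suc k)
   have "q (Suc k) n (j 0 n h) = 1[cgrp H n]" by (rule gsumD(6)[OF dsumD(4)[OF d] UNIV_I hc UNIV_I]) simp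
   then have "ceq H n (q (Suc k) n z *[cgrp H n] inv[cgrp H n] (q k n z ^[cgrp H n] p)) 1[cgrp H n]"
    using ceq_cmap[OF q c, of "Suc k"] \<theta>(3)[OF zc, of k] by simp
   then have "ceq H n (q (Suc k) n z) (q k n z ^[cgrp H n] p)"
    unfolding ceq_one_iff[OF cH] ceq_iff[OF cH qz cocycles_pow[OF cH qz]] .
   then have "ceq H n (q (Suc k) n z) ((h ^[cgrp H n] (p ^ k)) ^[cgrp H n] p)" by (rule ceq_trans[OF _ ceq_pow[OF Suc]])
   then show ?case using H.nat_pow_pow[OF hc, of "p ^ k" p] by (simp add: mult.commute)
  qed
  have 1: "hrel H H 1[dhom H H] n h (q K n z)"
   using hrel_comp[OF HS Z HS yc qh z hrel_of_chain_map[OF Z HS q zz]] unfolding qy .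
  have 2: "hrel H H 1[dhom H H] n h (zero_map H n h)"
   using hrel_of_chain_map[OF HS HS cmap_zero[OF cH cH] h] by (simp add: derived_hom_def)
  have "ceq H n (q K n z) (zero_map H n h)" by (rule hrel_uniq[OF HS HS HH.one_closed 1 2 ceq_refl[OF cH h]])
  then have "q K n z : Bd H n" unfolding zero_map_def ceq_one_iff[OF cH] .
  then have "h ^[cgrp H n] (p ^ K) : Bd H n" by (rule ceq_coboundary[OF ceq_sym[OF pow]])
  then show "\<exists>k\<in>{p ^ K}. h ^[cgrp H n] k : Bd H n" by simp
 qed
 then show ?thesis by blast
qed

lemma G_not_acyclic: "\<not> acyclic_at G 0"
proof
 assume a: "acyclic_at G 0"
 obtain g where g: "g : Car G 0" "g \<noteq> 1[cgrp G 0]" using G_nontrivial by blast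
 have "g : Cy G 0" using Gs_cocycle[OF g(1), of 0] by simp
 then have "g : Bd G 0" using a unfolding acyclic_at_iff[OF cG] by blast
 then show False using Gs_coboundaries[of 0 0] g(2) by simp
qed

text \<open>Otherwise the acyclic objects of \<open>TorC\<close> would form a closed class
  containing the shifts of H, hence every object of \<open>TorC\<close>, among them G.\<close>

lemma generator_not_acyclic:
 assumes H: "H : Tor" and g: "compactly_generates U TorC {H}" shows "\<exists>l. \<not> acyclic_at H l"
proof (rule ccontr)
 assume "\<not> ?thesis"
 then have a: "acyclic_at H l" for l by blast
 let ?Q = "{X : Tor. \<forall>n. tors X n {1}}"
 have Td: "Z : Tor" if "dsum I X Z j q" "|I| <o |UNIV :: 'u set|" "\<forall>i\<in>I. X i : Tor" "Z : Sm" for I :: "'u set" and X Z j q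
  by (rule Tor_dsum[OF that])
 have Q: "extension_closed TorC ?Q" "coproduct_closed U TorC ?Q"
  by (rule tors_class_closed[OF Tor_Sm, where S = "%_. {1}"], erule (3) Td, simp, simp)+
 have sub: "(\<Union>i. shift_class TorC {H} i) \<subseteq> ?Q"
 proof
  fix Y assume "Y : (\<Union>i. shift_class TorC {H} i)"
  then obtain i where Y: "Y : shift_class TorC {H} i" by blast
  have HT: "{H} \<subseteq> Tor" using H by simp
  obtain X where X: "X : {H}" "\<forall>n S. tors Y n S \<longleftrightarrow> tors X (n + i) S" using shift_classD(2)[OF Y HT] by blast
  then have "acyclic_at Y n" for n using a[of "n + i"] by blast
  then show "Y : ?Q" using shift_classD(1)[OF Y HT] by blast
 qed
 have "?Q \<subseteq> Obj TorC" by auto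
 then have "closure_cl U TorC (\<Union>i. shift_class TorC {H} i) \<subseteq> ?Q"
  unfolding closure_cl_def by (intro Inter_lower CollectI conjI Q sub)
 moreover have "closure_cl U TorC (\<Union>i. shift_class TorC {H} i) = Tor" using g unfolding compactly_generates_def by simp
 ultimately have "acyclic_at G 0" using G_Tor by blast
 then show False using G_not_acyclic by blast
qed

text \<open>Shifts and coproducts of H keep the exponent p^N, each factor of the star power
  multiplies the bound by p^N, and retracts inherit it.\<close>

lemma bounded_gen_torsion:
 assumes H: "H : Tor" and t: "!!n. tors H n {p ^ N}" and m: "m > 0" and E: "E : bounded_gen U TorC H m m"
 shows "tors E n {p ^ (N * m)}"
proof -
 let ?P = "coproducts_of_shifts U TorC H m"
 have P: "Z : Tor \<and> (\<forall>n. tors Z n {p ^ N})" if ZP: "Z : ?P" for Z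
 proof -
  obtain I :: "'u set" and X \<iota> where c: "small I" "is_coproduct TorC I X Z \<iota>"
   "\<forall>i\<in>I. \<exists>s. - int m \<le> s \<and> s \<le> int m \<and> X i = Shift TorC s H"
   using ZP unfolding coproducts_of_shifts_def by blast
  have tX: "tors (X i) n {p ^ N}" if i: "i : I" for i n
  proof -
   obtain s where "X i = Shf s H" using c(3) i by auto
   then show ?thesis using tors_shift[OF small_complex(1)[OF subsetD[OF Tor_Sm H]]] t by simp
  qed
  have Td: "Z : Tor" if "dsum I X Z j q" "|I| <o |UNIV :: 'u set|" "\<forall>i\<in>I. X i : Tor" "Z : Sm" for I :: "'u set" and X Z j q
   by (rule Tor_dsum[OF that])
  have I: "|I| <o |UNIV :: 'u set|" using c(1) by (simp add: small_def)
  have "tors Z n {p ^ N}" for n by (rule tors_coproduct[OF Tor_Sm _ I c(2)], erule (3) Td, erule tX)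
  then show ?thesis using c(2) unfolding is_coproduct_def by simp
 qed
 \<comment> \<open>Applying star r times to the class gives r + 1 factors; this matches the
   iteration count m - 1 in \<open>star_power\<close>.\<close>
 have st: "Z : Tor \<and> (\<forall>n. tors Z n {p ^ (N * Suc r)})" if "Z : (star TorC ?P ^^ r) ?P" for Z r
  using that
 proof (induction r arbitrary: Z)
  case 0 then show ?case using P by simp
 next
  case (Suc r)
  then obtain X Y f g h where XY: "X : ?P" "Y : (star TorC ?P ^^ r) ?P" "(X, Z, Y, f, g, h) : Dist TorC"
   unfolding funpow.simps comp_def star_def by blast
  have d: "(X, Z, Y, f, g, h) : derived_dist" "Z : Tor" using XY(3) by simp_all
  have "tors Z n {p ^ (N * Suc (Suc r))}" for n
  proof (rule tors_mono[OF tors_extension[OF d(1)]])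
   show "tors X n {p ^ N}" using P[OF XY(1)] by blast
   show "tors Y n {p ^ (N * Suc r)}" using Suc.IH[OF XY(2)] by blast
   show "{k * l |k l. k : {p ^ N} \<and> l : {p ^ (N * Suc r)}} \<subseteq> {p ^ (N * Suc (Suc r))}" by (auto simp: power_add)
  qed
  then show ?case using d(2) by blast
 qed
 obtain Y i r where Y: "E : Tor" "Y : star_power TorC ?P m" "i : carrier (dhom E Y)" "r : carrier (dhom Y E)"
  "dcomp E Y E r i = dmor E E id_map"
  using E unfolding bounded_gen_def retracts_def by auto
 have "Suc (m - 1) = m" using m by simp
 then have "Y : Tor" "tors Y n {p ^ (N * m)}" using st[of Y "m - 1"] Y(2) unfolding star_power_def by simp_all
 then show ?thesis using tors_retract[OF subsetD[OF Tor_Sm Y(1)] _ Y(3-5)] Tor_Sm by blast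
qed

text \<open>Degree 0 of the divisible model of G, placed alone in degree d. The group is divisible,
  so an exponent p^N for it would make it trivial, and then G would be acyclic.\<close>

lemma unbounded_object: "\<exists>F\<in>Tor. \<forall>N. \<not> tors F d {p ^ N}"
proof -
 obtain T where T: "T : Sm" "isoD G T" "divisible_torsion p T" using torsion_model[OF G] G_Tor unfolding Tor_def by blast
 have cT: "is_complex T" by (rule small_complex(1)[OF T(1)])
 interpret T: comm_group "cgrp T 0" by (rule comm_group_cgrp[OF cT])
 define F where "F = \<lparr>cgrp = (%n. if n = d then cgrp T 0 else cgrp T 0\<lparr>carrier := {1[cgrp T 0]}\<rparr>), cdiff = (%n (x::'u). 1[cgrp T 0])\<rparr>"
 have F [simp]: "Car F n = (if n = d then Car T 0 else {1[cgrp T 0]})" "1[cgrp F n] = 1[cgrp T 0]" "x *[cgrp F n] y = x *[cgrp T 0] y"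
  "cdiff F n x = 1[cgrp T 0]" "x ^[cgrp F n] (k::nat) = x ^[cgrp T 0] k" for n x y k
  by (simp_all add: F_def restrict_nat_pow)
 have cF: "is_complex F"
 proof (rule is_complexI)
  show "comm_group (cgrp F n)" for n using T.comm_group_axioms T.comm_group_restrict[OF T.triv_subgroup] by (simp add: F_def)
 qed auto
 have FS: "F : Sm" unfolding small_complexes_def small_def
  using cF small_complex(2)[OF T(1), of 0] sm_subset[OF small_complex(2)[OF T(1), of 0], of "{1[cgrp T 0]}"] by simp
 have B: "Bd F n = {1[cgrp T 0]}" for n by (auto simp: coboundaries_def)
 have "tors F n (range (%k. p ^ k))" for n
  unfolding tors_def
 proof
  fix x assume "x : Cy F n"
  then have "x : Car T 0" unfolding cocycles_iff by (auto split: if_splits)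
  then obtain k where "x ^[cgrp T 0] (p ^ k) = 1[cgrp T 0]" using divisible_torsionD(2)[OF T(3)] by blast
  then have "x ^[cgrp F n] (p ^ k) : Bd F n" unfolding B by simp
  then show "\<exists>k\<in>range (%k. p ^ k). x ^[cgrp F n] k : Bd F n" by blast
 qed
 then have FT: "F : Tor" using FS by (simp add: Tor_def)
 have "\<not> tors F d {p ^ N}" for N
 proof
  assume t: "tors F d {p ^ N}"
  have "x = 1[cgrp T 0]" if x: "x : Car T 0" for x
  proof -
   obtain y where y: "y : Car T 0" "y ^[cgrp T 0] (p ^ N) = x"
    using divisible_pow[OF comm_group_cgrp[OF cT] divisible_torsionD(3)[OF T(3)] x] by blast
   have "y : Cy F d" using y(1) by (simp add: cocycles_iff)
   then show ?thesis using t y(2) unfolding tors_def B by simp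
  qed
  then have "acyclic_at T 0" by (intro acyclic_at_trivial[OF cT]) blast
  then show False using tors_isoD[OF G T(1,2), of 0 "{1}"] G_not_acyclic by blast
 qed
 then show ?thesis using FT by blast
qed

lemma not_approximable_TorC: "\<not> approximable U TorC"
proof
 assume "approximable U TorC"
 then obtain H A B m where H: "H : Tor" and m: "m > 0" and gen: "compactly_generates U TorC {H}" and ts: "t_structure TorC A B"
  and ap: "approximation_conditions TorC H B m (bounded_gen U TorC H m m)"
  unfolding approximable_def full_subcategory_simps by blast
 have HS: "H : Sm" using H Tor_Sm by blast
 have cH: "is_complex H" by (rule small_complex(1)[OF HS])
 have "compact_object U TorC H" using gen unfolding compactly_generates_def by blast
 then obtain N where N: "!!n. tors H n {p ^ N}" using compact_bounded_torsion[OF H] by blast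
 obtain l where l: "\<not> acyclic_at H l" using generator_not_acyclic[OF H gen] by blast
 have A: "A \<subseteq> Tor" and B: "B \<subseteq> Tor" and sB: "shift_class TorC B 1 \<subseteq> B"
  and zAB: "!!X Y. \<lbrakk>X : shift_class TorC B 1; Y : A\<rbrakk> \<Longrightarrow> zero_hom D_Ab X Y"
  and tr: "!!M. M : Tor ==> \<exists>L\<in>B. \<exists>R\<in>shift_class TorC A (- 1). \<exists>f g h. (L, M, R, f, g, h) : Dist TorC"
  using ts unfolding t_structure_def zero_hom_full_subcategory full_subcategory_simps(1) by blast+
 have HB: "Shf (int m) H : B" and zH: "!!X. X : B ==> zero_hom D_Ab (Shf (- int m) H) X"
  and tri: "!!F. F : B ==> \<exists>E\<in>bounded_gen U TorC H m m. \<exists>D\<in>t_le TorC B (- 1). \<exists>f g h. (E, F, D, f, g, h) : Dist TorC"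
  using ap unfolding approximation_conditions_def zero_hom_full_subcategory full_subcategory_simps(5) by blast+
 have s1: "Shf 1 X : shift_class TorC B 1" if X: "X : B" for X
  using X B Tor_shift[of X 1] Tor_Sm isoD_refl by (auto simp: shift_class_def isomorphic_full_subcategory)
 have sk: "\<exists>Y\<in>B. \<forall>n S. tors Y n S \<longleftrightarrow> tors X (n + int k) S" if X: "X : B" for X k
 proof (induction k)
  case 0 show ?case using X by auto
 next
  case (Suc k)
  then obtain Y where Y: "Y : B" "\<forall>n S. tors Y n S \<longleftrightarrow> tors X (n + int k) S" by blast
  have "tors (Shf 1 Y) n S \<longleftrightarrow> tors X (n + int (Suc k)) S" for n S
   using Y tors_shift[OF small_complex(1), of Y 1 n S] B Tor_Sm by (auto simp: add.assoc)
  then show ?case using s1[OF Y(1)] sB by blast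
 qed
 \<comment> \<open>There are no nonzero morphisms from H[-m], which has cohomology in degree l + m,
   to the aisle B. By \<open>nonzero_hom\<close> no object of B has cohomology there, and since B is
   closed under positive shifts, none has it above.\<close>
 have up: "acyclic_at X i" if X: "X : B" and i: "i \<ge> l + int m" for X i
 proof (rule ccontr)
  assume n: "\<not> acyclic_at X i"
  obtain Y where Y: "Y : B" "\<forall>n S. tors Y n S \<longleftrightarrow> tors X (n + int (nat (i - (l + int m)))) S" using sk[OF X] by blast
  have nY: "\<not> acyclic_at Y (l + int m)" using Y(2) n i by simp
  have YT: "Y : Tor" using Y(1) B by blast
  have "\<not> acyclic_at (Shf (- int m) H) (l + int m)" "tors (Shf (- int m) H) (l + int m) {p ^ N}"
   unfolding tors_shift[OF cH] using l N by simp_all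
  then have "\<not> zero_hom D_Ab (Shf (- int m) H) Y" by (rule nonzero_hom[OF Tor_shift[OF H] _ _ YT nY])
  then show False using zH[OF Y(1)] by blast
 qed
 \<comment> \<open>H[m] lies in B and has cohomology in degree l - m. One more shift puts this into
   degree l - m - 1 and makes the object orthogonal to A; further shifts reach all lower
   degrees.\<close>
 have low: "acyclic_at Y i" if Y: "Y : A" and i: "i \<le> l - int m - 1" for Y i
 proof (rule ccontr)
  assume n: "\<not> acyclic_at Y i"
  obtain X where X: "X : B" "\<forall>n S. tors X n S \<longleftrightarrow> tors (Shf (int m) H) (n + int (nat (l - int m - 1 - i))) S"
   using sk[OF HB] by blast
  have XT: "X : Tor" using X(1) B by blast
  have e: "tors (Shf 1 X) i S \<longleftrightarrow> tors H l S" for S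
   using X(2) i unfolding tors_shift[OF small_complex(1)[OF subsetD[OF Tor_Sm XT]]] tors_shift[OF cH] by simp
  have "\<not> zero_hom D_Ab (Shf 1 X) Y"
   by (rule nonzero_hom[OF Tor_shift[OF XT] _ _ subsetD[OF A Y] n]) (use e l N in blast)+
  then show False using zAB[OF s1[OF X(1)] Y] by blast
 qed
 \<comment> \<open>Descending induction from degree l + m. D lies in the shifted aisle, so its
   degree i is degree i + 1 of an object of B and is already bounded, while E contributes the fixed
   exponent \<open>p ^ (N * m)\<close>.\<close>
 have bnd: "\<exists>K. \<forall>F\<in>B. \<forall>i\<ge>l + int m - int j. tors F i {p ^ K}" for j
 proof (induction j)
  case 0 show ?case using up by (intro exI[of _ 0]) auto
 next
  case (Suc j)
  then obtain K where K: "\<forall>F\<in>B. \<forall>i\<ge>l + int m - int j. tors F i {p ^ K}" by blast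
  have "tors F i {p ^ (N * m + K)}" if F: "F : B" and i: "i \<ge> l + int m - int (Suc j)" for F i
  proof -
   obtain E D f g h where E: "E : bounded_gen U TorC H m m" and D: "D : t_le TorC B (- 1)" and d: "(E, F, D, f, g, h) : Dist TorC"
    using tri[OF F] by blast
   have D': "D : shift_class TorC B 1" using D by (simp add: t_le_def)
   obtain X where X: "X : B" "\<forall>n S. tors D n S \<longleftrightarrow> tors X (n + 1) S" using shift_classD(2)[OF D' B] by blast
   have "tors X (i + 1) {p ^ K}" using K X(1) i by auto
   then have tD: "tors D i {p ^ K}" using X(2) by blast
   have tE: "tors E i {p ^ (N * m)}" by (rule bounded_gen_torsion[OF H N m E])
   have d': "(E, F, D, f, g, h) : derived_dist" using d by simp
   show ?thesis by (rule tors_mono[OF tors_extension[OF d' tE tD]]) (auto simp: power_add)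
  qed
  then show ?case by blast
 qed
 \<comment> \<open>The highest degree in which \<open>low\<close> makes R acyclic, as degree d of R
   is degree d - 1 of an object of A. It lies 2 m degrees below l + m, so \<open>bnd\<close> bounds
   L there, and with R acyclic the bound passes to F.\<close>
 define d where "d = l - int m"
 obtain F where F: "F : Tor" "!!N. \<not> tors F d {p ^ N}" using unbounded_object[of d] by blast
 obtain L R f g h where L: "L : B" and R: "R : shift_class TorC A (- 1)" and LFR: "(L, F, R, f, g, h) : Dist TorC" using tr[OF F(1)] by blast
 obtain Y where Y: "Y : A" "\<forall>n S. tors R n S \<longleftrightarrow> tors Y (n + - 1) S" using shift_classD(2)[OF R A] by blast
 have "acyclic_at Y (d + - 1)" by (rule low[OF Y(1)]) (simp add: d_def)
 then have aR: "acyclic_at R d" using Y(2) by blast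
 obtain K where K: "\<forall>F\<in>B. \<forall>i\<ge>l + int m - int (2 * m). tors F i {p ^ K}" using bnd by blast
 have tL: "tors L d {p ^ K}" using K L by (simp add: d_def)
 have "(L, F, R, f, g, h) : derived_dist" using LFR by simp
 from tors_mono[OF tors_extension[OF this tL aR], of "{p ^ K}"] have "tors F d {p ^ K}" by auto
 then show False using F(2) by blast
qed

end

theorem mainTheorem3:
 fixes p :: nat and G :: "'u cochain_complex"
 assumes "regularCard |UNIV :: 'u set|"
  and "natLeq <o |UNIV :: 'u set|"
  and "prime p"
  and "G \<in> Obj D_Ab"
  and "concentrated_in_degree_0 G (integer_mod_group p)"
 shows "weakly_negative (generated_subcategory TYPE('u) D_Ab {G}) {G} \<and>
  compactly_generates TYPE('u) (generated_subcategory TYPE('u) D_Ab {G}) {G} \<and>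
  weakly_approximable TYPE('u) (generated_subcategory TYPE('u) D_Ab {G}) \<and>
  \<not> approximable TYPE('u) (generated_subcategory TYPE('u) D_Ab {G})"
proof -
 have G: "G : small_complexes" using assms(4) by (simp add: D_Ab_def derived_preadditive_def preadditive_category.defs)
 interpret prime_generator "TYPE('u)" p G
  using assms G by unfold_locales
 show ?thesis unfolding generated_subcategory_G
  using weakly_negative_G compactly_generates_G weakly_approximable_TorC not_approximable_TorC by blast
qed

end
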